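(* Let $\Bbbk$ be any commutative ring. Let $G$ be an orientable Poincaré duality group of dimension $d$. Then its group ring $\Bbbk[G]$ is a Calabi-Yau algebra of dimension $d$.
   Context: Orientable Poincaré duality group of dimension $d$ (standard, as in Brown's "Cohomology of groups", VIII.10): a group $G$ of type $FP$ with $H^i(G,\mathbb Z G)=0$ for $i\ne d$ and $H^d(G,\mathbb ZG)\cong\mathbb Z$ with trivial $G$-action; equivalently, of type $FP$ with a fundamental class in $H_d(G,\mathbb Z)$ cap product with which gives isomorphisms $H^p(G,N)\cong H_{d-p}(G,N)$ for all $G$-modules $N$. An (ungraded, unital associative) $\Bbbk$-algebra $A$ is Calabi-Yau of dimension $d$ if: (i) viewed as an $A$-bimodule over itself, $A$ admits a finite resolution $0\to P_i\to\dots\to P_0\to A\to0$ by finite type (finitely generated) projective $A$-bimodules, i.e. projective modules over $A^e=A\otimes A^{op}$; (ii) for all $k\ne d$, $HH^k(A,A\otimes A)=0$; (iii) $HH^d(A,A\otimes A)$ is isomorphic to $A$ as an $(A,A)$-bimodule. Here $HH^*(A,N)=H(\mathrm{Hom}_{A^e}(B(A;A;A),N))$, with $B(A;A;A)$ the bar resolution, is computed using the outer bimodule structure $a\cdot(x\otimes y)\cdot b=ax\otimes yb$ on $N=A\otimes A$, and the bimodule structure (right $A^e$-module structure) on $HH^*(A,A\otimes A)$ is induced by the inner structure $(x\otimes y)\cdot(a\otimes b)=xa\otimes by$. *)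

theory Defs
  imports "HOL-Algebra.Algebra"
begin

section \<open>Modules over a not necessarily commutative ring\<close>

text \<open>The library locale \<^locale>\<open>module\<close> requires the ring of scalars to be commutative, so left
  modules are set up here on the same record type. The fields \<open>mult\<close> and \<open>one\<close> that a module
  record inherits from rings carry no information for a module and are left undefined.\<close>

locale left_module = R?: ring R + M?: abelian_group M
  for R :: "('r, 's) ring_scheme" (structure) and M :: "('r, 'm) module" (structure) +
  assumes smult_closed: "\<lbrakk>a \<in> carrier R; x \<in> carrier M\<rbrakk> \<Longrightarrow> a \<odot>\<^bsub>M\<^esub> x \<in> carrier M"
    and smult_l_distr: "\<lbrakk>a \<in> carrier R; b \<in> carrier R; x \<in> carrier M\<rbrakk> \<Longrightarrow>
      (a \<oplus>\<^bsub>R\<^esub> b) \<odot>\<^bsub>M\<^esub> x = a \<odot>\<^bsub>M\<^esub> x \<oplus>\<^bsub>M\<^esub> b \<odot>\<^bsub>M\<^esub> x"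
    and smult_r_distr: "\<lbrakk>a \<in> carrier R; x \<in> carrier M; y \<in> carrier M\<rbrakk> \<Longrightarrow>
      a \<odot>\<^bsub>M\<^esub> (x \<oplus>\<^bsub>M\<^esub> y) = a \<odot>\<^bsub>M\<^esub> x \<oplus>\<^bsub>M\<^esub> a \<odot>\<^bsub>M\<^esub> y"
    and smult_assoc: "\<lbrakk>a \<in> carrier R; b \<in> carrier R; x \<in> carrier M\<rbrakk> \<Longrightarrow>
      (a \<otimes>\<^bsub>R\<^esub> b) \<odot>\<^bsub>M\<^esub> x = a \<odot>\<^bsub>M\<^esub> (b \<odot>\<^bsub>M\<^esub> x)"
    and smult_one: "x \<in> carrier M \<Longrightarrow> \<one>\<^bsub>R\<^esub> \<odot>\<^bsub>M\<^esub> x = x"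

text \<open>Homomorphisms are extensional on the carrier of the domain, so that they can be compared by
  equality when they are used as cochains.\<close>

definition lmod_hom ::
  "('r, 's) ring_scheme \<Rightarrow> ('r, 'm) module \<Rightarrow> ('r, 'n) module \<Rightarrow> ('m \<Rightarrow> 'n) set" where
  "lmod_hom R M N = {f \<in> carrier M \<rightarrow>\<^sub>E carrier N.
     (\<forall>x\<in>carrier M. \<forall>y\<in>carrier M. f (x \<oplus>\<^bsub>M\<^esub> y) = f x \<oplus>\<^bsub>N\<^esub> f y) \<and>
     (\<forall>r\<in>carrier R. \<forall>x\<in>carrier M. f (r \<odot>\<^bsub>M\<^esub> x) = r \<odot>\<^bsub>N\<^esub> f x)}"

definition regular_module :: "('r, 's) ring_scheme \<Rightarrow> ('r, 'r) module" where
  "regular_module R = \<lparr>carrier = carrier R, monoid.mult = undefined, one = undefined,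
     ring.zero = \<zero>\<^bsub>R\<^esub>, ring.add = ring.add R, module.smult = monoid.mult R\<rparr>"

definition fin_supp :: "('r, 's) ring_scheme \<Rightarrow> 'i set \<Rightarrow> ('i \<Rightarrow> 'r) set" where
  "fin_supp R I = {f. (\<forall>i\<in>I. f i \<in> carrier R) \<and> (\<forall>i. i \<notin> I \<longrightarrow> f i = \<zero>\<^bsub>R\<^esub>) \<and>
     finite {i \<in> I. f i \<noteq> \<zero>\<^bsub>R\<^esub>}}"

definition free_module :: "('r, 's) ring_scheme \<Rightarrow> 'i set \<Rightarrow> ('r, 'i \<Rightarrow> 'r) module" where
  "free_module R I = \<lparr>carrier = fin_supp R I, monoid.mult = undefined, one = undefined,
     ring.zero = (\<lambda>i. \<zero>\<^bsub>R\<^esub>), ring.add = (\<lambda>f g i. f i \<oplus>\<^bsub>R\<^esub> g i), module.smult = (\<lambda>r f i. r \<otimes>\<^bsub>R\<^esub> f i)\<rparr>"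

definition finitely_generated_module :: "('r, 's) ring_scheme \<Rightarrow> ('r, 'm) module \<Rightarrow> bool" where
  "finitely_generated_module R M \<longleftrightarrow> left_module R M \<and>
     (\<exists>S \<subseteq> carrier M. finite S \<and>
       (\<forall>x\<in>carrier M. \<exists>c \<in> S \<rightarrow> carrier R. x = (\<Oplus>\<^bsub>M\<^esub>s\<in>S. c s \<odot>\<^bsub>M\<^esub> s)))"

text \<open>A module is projective if it is a direct summand of a free module; the summand is given by its
  inclusion \<open>i\<close> and the projection \<open>p\<close>. Taking the basis \<open>I\<close> in the type of the elements of the
  module is no restriction, since the free module on all elements of \<open>P\<close> can be used.\<close>

definition projective_module :: "('r, 's) ring_scheme \<Rightarrow> ('r, 'm) module \<Rightarrow> bool" where
  "projective_module R P \<longleftrightarrow> left_module R P \<and>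
     (\<exists>(I :: 'm set) i p. i \<in> lmod_hom R P (free_module R I) \<and> p \<in> lmod_hom R (free_module R I) P \<and>
        (\<forall>x\<in>carrier P. p (i x) = x))"

text \<open>Existence of a finite resolution \<open>0 \<rightarrow> P l \<rightarrow> \<dots> \<rightarrow> P 0 \<rightarrow> M \<rightarrow> 0\<close> by finitely generated
  projectives. A finitely generated projective module is isomorphic to a submodule of some \<open>R\<^sup>n\<close>,
  hence to one with elements of type \<open>nat \<Rightarrow> 'r\<close>; fixing this type is therefore no restriction.\<close>

definition module_type_FP :: "('r, 's) ring_scheme \<Rightarrow> ('r, 'm) module \<Rightarrow> bool" where
  "module_type_FP R M \<longleftrightarrow> left_module R M \<and>
     (\<exists>(P :: nat \<Rightarrow> ('r, nat \<Rightarrow> 'r) module) \<delta> \<epsilon> l.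
        (\<forall>n. finitely_generated_module R (P n) \<and> projective_module R (P n)) \<and>
        (\<forall>n>l. carrier (P n) = {\<zero>\<^bsub>P n\<^esub>}) \<and>
        (\<forall>n. \<delta> n \<in> lmod_hom R (P (Suc n)) (P n)) \<and>
        \<epsilon> \<in> lmod_hom R (P 0) M \<and>
        \<epsilon> ` carrier (P 0) = carrier M \<and>
        {x \<in> carrier (P 0). \<epsilon> x = \<zero>\<^bsub>M\<^esub>} = \<delta> 0 ` carrier (P (Suc 0)) \<and>
        (\<forall>n. {x \<in> carrier (P (Suc n)). \<delta> n x = \<zero>\<^bsub>P n\<^esub>} = \<delta> (Suc n) ` carrier (P (Suc (Suc n)))))"

section \<open>Cohomology of a complex of homomorphisms\<close>

text \<open>For a chain complex \<open>C\<close> of left \<open>R\<close>-modules with differentials \<open>d n : C (n + 1) \<rightarrow> C n\<close> these are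
  the groups \<open>H\<^sup>n(Hom\<^sub>R(C, N))\<close>.\<close>

definition cocycles :: "('r, 's) ring_scheme \<Rightarrow> (nat \<Rightarrow> ('r, 'c) module) \<Rightarrow> (nat \<Rightarrow> 'c \<Rightarrow> 'c) \<Rightarrow>
    ('r, 'n) module \<Rightarrow> nat \<Rightarrow> ('c \<Rightarrow> 'n) monoid" where
  "cocycles R C d N n =
     \<lparr>carrier = {f \<in> lmod_hom R (C n) N. \<forall>x\<in>carrier (C (Suc n)). f (d n x) = \<zero>\<^bsub>N\<^esub>},
      monoid.mult = (\<lambda>f g. \<lambda>x\<in>carrier (C n). f x \<oplus>\<^bsub>N\<^esub> g x),
      one = (\<lambda>x\<in>carrier (C n). \<zero>\<^bsub>N\<^esub>)\<rparr>"

definition coboundaries :: "('r, 's) ring_scheme \<Rightarrow> (nat \<Rightarrow> ('r, 'c) module) \<Rightarrow> (nat \<Rightarrow> 'c \<Rightarrow> 'c) \<Rightarrow>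
    ('r, 'n) module \<Rightarrow> nat \<Rightarrow> ('c \<Rightarrow> 'n) set" where
  "coboundaries R C d N n = (case n of
       0 \<Rightarrow> {\<lambda>x\<in>carrier (C 0). \<zero>\<^bsub>N\<^esub>}
     | Suc m \<Rightarrow> (\<lambda>f. compose (carrier (C n)) f (d m)) ` lmod_hom R (C m) N)"

definition hom_cohomology :: "('r, 's) ring_scheme \<Rightarrow> (nat \<Rightarrow> ('r, 'c) module) \<Rightarrow>
    (nat \<Rightarrow> 'c \<Rightarrow> 'c) \<Rightarrow> ('r, 'n) module \<Rightarrow> nat \<Rightarrow> ('c \<Rightarrow> 'n) set monoid" where
  "hom_cohomology R C d N n = cocycles R C d N n Mod coboundaries R C d N n"

text \<open>The endomorphism of \<open>H\<^sup>n(Hom\<^sub>R(C, N))\<close> induced by an \<open>R\<close>-linear endomorphism \<open>\<phi>\<close> of \<open>N\<close>.\<close>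

definition hom_cohomology_map :: "('r, 's) ring_scheme \<Rightarrow> (nat \<Rightarrow> ('r, 'c) module) \<Rightarrow>
    (nat \<Rightarrow> 'c \<Rightarrow> 'c) \<Rightarrow> ('r, 'n) module \<Rightarrow> nat \<Rightarrow> ('n \<Rightarrow> 'n) \<Rightarrow> ('c \<Rightarrow> 'n) set \<Rightarrow> ('c \<Rightarrow> 'n) set" where
  "hom_cohomology_map R C d N n \<phi> U =
     (\<Union>f\<in>U. coboundaries R C d N n #>\<^bsub>cocycles R C d N n\<^esub> compose (carrier (C n)) \<phi> f)"

section \<open>Group algebras\<close>

locale assoc_algebra = module k A + A?: ring A
  for k :: "('k, 's) ring_scheme" and A :: "('k, 'a) module" +
  assumes smult_mult_left: "\<lbrakk>c \<in> carrier k; x \<in> carrier A; y \<in> carrier A\<rbrakk> \<Longrightarrow>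
      (c \<odot>\<^bsub>A\<^esub> x) \<otimes>\<^bsub>A\<^esub> y = c \<odot>\<^bsub>A\<^esub> (x \<otimes>\<^bsub>A\<^esub> y)"
    and smult_mult_right: "\<lbrakk>c \<in> carrier k; x \<in> carrier A; y \<in> carrier A\<rbrakk> \<Longrightarrow>
      x \<otimes>\<^bsub>A\<^esub> (c \<odot>\<^bsub>A\<^esub> y) = c \<odot>\<^bsub>A\<^esub> (x \<otimes>\<^bsub>A\<^esub> y)"

definition group_basis :: "('k, 's) ring_scheme \<Rightarrow> 'g \<Rightarrow> 'g \<Rightarrow> 'k" where
  "group_basis k g = (\<lambda>x. if x = g then \<one>\<^bsub>k\<^esub> else \<zero>\<^bsub>k\<^esub>)"

definition group_algebra ::
  "('k, 's) ring_scheme \<Rightarrow> ('g, 't) monoid_scheme \<Rightarrow> ('k, 'g \<Rightarrow> 'k) module" where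
  "group_algebra k G = \<lparr>carrier = fin_supp k (carrier G),
     monoid.mult = (\<lambda>a b x. if x \<in> carrier G
       then \<Oplus>\<^bsub>k\<^esub>y\<in>{y \<in> carrier G. a y \<noteq> \<zero>\<^bsub>k\<^esub>}. a y \<otimes>\<^bsub>k\<^esub> b (inv\<^bsub>G\<^esub> y \<otimes>\<^bsub>G\<^esub> x) else \<zero>\<^bsub>k\<^esub>),
     one = group_basis k \<one>\<^bsub>G\<^esub>, ring.zero = (\<lambda>x. \<zero>\<^bsub>k\<^esub>),
     ring.add = (\<lambda>a b x. a x \<oplus>\<^bsub>k\<^esub> b x), module.smult = (\<lambda>c a x. c \<otimes>\<^bsub>k\<^esub> a x)\<rparr>"

section \<open>Group cohomology and Poincare duality groups\<close>

abbreviation integral_group_ring :: "('g, 't) monoid_scheme \<Rightarrow> (int, 'g \<Rightarrow> int) module" where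
  "integral_group_ring G \<equiv> group_algebra \<Z> G"

definition trivial_int_module :: "('g, 't) monoid_scheme \<Rightarrow> ('g \<Rightarrow> int, int) module" where
  "trivial_int_module G = \<lparr>carrier = UNIV, monoid.mult = undefined, one = undefined, ring.zero = 0, ring.add = (+),
     module.smult = (\<lambda>r m. (\<Sum>g | g \<in> carrier G \<and> r g \<noteq> 0. r g) * m)\<rparr>"

text \<open>The standard resolution of the trivial module \<open>\<int>\<close>: in degree \<open>n\<close> the free abelian group on
  \<open>G\<^sup>n\<^sup>+\<^sup>1\<close>, with the diagonal action of \<open>G\<close> and the alternating sum of the face maps.\<close>

definition standard_resolution ::
  "('g, 't) monoid_scheme \<Rightarrow> nat \<Rightarrow> ('g \<Rightarrow> int, 'g list \<Rightarrow>\<^sub>0 int) module" where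
  "standard_resolution G n =
     \<lparr>carrier = carrier (free_Abelian_group {xs. length xs = Suc n \<and> set xs \<subseteq> carrier G}),
      monoid.mult = undefined, one = undefined, ring.zero = 0, ring.add = (+),
      module.smult = (\<lambda>r u. \<Sum>g | g \<in> carrier G \<and> r g \<noteq> 0.
        frag_cmul (r g) (frag_extend (\<lambda>xs. frag_of (map (monoid.mult G g) xs)) u))\<rparr>"

definition standard_differential :: "nat \<Rightarrow> ('g list \<Rightarrow>\<^sub>0 int) \<Rightarrow> 'g list \<Rightarrow>\<^sub>0 int" where
  "standard_differential n = frag_extend (\<lambda>xs.
     \<Sum>i<length xs. frag_cmul ((- 1) ^ i) (frag_of (take i xs @ drop (Suc i) xs)))"

definition group_cohomology :: "('g, 't) monoid_scheme \<Rightarrow> ('g \<Rightarrow> int, 'n) module \<Rightarrow> nat \<Rightarrow>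
    (('g list \<Rightarrow>\<^sub>0 int) \<Rightarrow> 'n) set monoid" where
  "group_cohomology G N =
     hom_cohomology (integral_group_ring G) (standard_resolution G) standard_differential N"

text \<open>The action of \<open>g\<close> on \<open>H\<^sup>n(G, \<int>G)\<close>, induced by right multiplication on the coefficients.\<close>

definition group_cohomology_action :: "('g, 't) monoid_scheme \<Rightarrow> nat \<Rightarrow> 'g \<Rightarrow>
    (('g list \<Rightarrow>\<^sub>0 int) \<Rightarrow> 'g \<Rightarrow> int) set \<Rightarrow> (('g list \<Rightarrow>\<^sub>0 int) \<Rightarrow> 'g \<Rightarrow> int) set" where
  "group_cohomology_action G n g =
     hom_cohomology_map (integral_group_ring G) (standard_resolution G) standard_differential
       (regular_module (integral_group_ring G)) n
       (\<lambda>x. x \<otimes>\<^bsub>integral_group_ring G\<^esub> group_basis \<Z> g)"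

definition group_type_FP :: "('g, 't) monoid_scheme \<Rightarrow> bool" where
  "group_type_FP G \<longleftrightarrow> module_type_FP (integral_group_ring G) (trivial_int_module G)"

definition orientable_PD_group :: "('g, 't) monoid_scheme \<Rightarrow> nat \<Rightarrow> bool" where
  "orientable_PD_group G d \<longleftrightarrow> group G \<and> group_type_FP G \<and>
     (let H = group_cohomology G (regular_module (integral_group_ring G)) in
       (\<forall>i. i \<noteq> d \<longrightarrow> trivial_group (H i)) \<and>
       H d \<cong> integer_group \<and>
       (\<forall>g\<in>carrier G. \<forall>U\<in>carrier (H d). group_cohomology_action G d g U = U))"

section \<open>Tensor powers and the enveloping algebra\<close>

text \<open>\<open>A\<^sup>\<otimes>\<^sup>n\<close> over \<open>k\<close>, for \<open>n \<ge> 1\<close>, is the free abelian group on \<open>n\<close>-tuples modulo the relations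
  making a tuple additive in each entry and allowing scalars to move between entries.\<close>

definition tuples :: "('k, 'a) module \<Rightarrow> nat \<Rightarrow> 'a list set" where
  "tuples A n = {xs. length xs = n \<and> set xs \<subseteq> carrier A}"

definition tensor_relations ::
  "('k, 's) ring_scheme \<Rightarrow> ('k, 'a) module \<Rightarrow> nat \<Rightarrow> ('a list \<Rightarrow>\<^sub>0 int) set" where
  "tensor_relations k A n = generate (free_Abelian_group (tuples A n))
     ({frag_of (xs[i := x \<oplus>\<^bsub>A\<^esub> y]) - frag_of (xs[i := x]) - frag_of (xs[i := y]) | xs i x y.
         xs \<in> tuples A n \<and> i < n \<and> x \<in> carrier A \<and> y \<in> carrier A} \<union>
      {frag_of (xs[i := c \<odot>\<^bsub>A\<^esub> xs ! i]) - frag_of (xs[j := c \<odot>\<^bsub>A\<^esub> xs ! j]) | xs i j c.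
         xs \<in> tuples A n \<and> i < n \<and> j < n \<and> c \<in> carrier k})"

definition tensor_power ::
  "('k, 's) ring_scheme \<Rightarrow> ('k, 'a) module \<Rightarrow> nat \<Rightarrow> ('a list \<Rightarrow>\<^sub>0 int) set monoid" where
  "tensor_power k A n = free_Abelian_group (tuples A n) Mod tensor_relations k A n"

definition tensor_class :: "('k, 's) ring_scheme \<Rightarrow> ('k, 'a) module \<Rightarrow> nat \<Rightarrow>
    ('a list \<Rightarrow>\<^sub>0 int) \<Rightarrow> ('a list \<Rightarrow>\<^sub>0 int) set" where
  "tensor_class k A n u = tensor_relations k A n #>\<^bsub>free_Abelian_group (tuples A n)\<^esub> u"

text \<open>The additive maps into \<open>A\<^sup>\<otimes>\<^sup>n\<close> induced by a map \<open>\<phi>\<close> given on pure tensors, and by a map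
  \<open>\<beta>\<close> given on pairs of pure tensors.\<close>

definition tensor_extend :: "('k, 's) ring_scheme \<Rightarrow> ('k, 'a) module \<Rightarrow> nat \<Rightarrow>
    ('a list \<Rightarrow> 'a list \<Rightarrow>\<^sub>0 int) \<Rightarrow> ('a list \<Rightarrow>\<^sub>0 int) set \<Rightarrow> ('a list \<Rightarrow>\<^sub>0 int) set" where
  "tensor_extend k A n \<phi> U = (\<Union>u\<in>U. tensor_class k A n (frag_extend \<phi> u))"

definition tensor_extend2 :: "('k, 's) ring_scheme \<Rightarrow> ('k, 'a) module \<Rightarrow> nat \<Rightarrow>
    ('a list \<Rightarrow> 'a list \<Rightarrow> 'a list \<Rightarrow>\<^sub>0 int) \<Rightarrow>
    ('a list \<Rightarrow>\<^sub>0 int) set \<Rightarrow> ('a list \<Rightarrow>\<^sub>0 int) set \<Rightarrow> ('a list \<Rightarrow>\<^sub>0 int) set" where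
  "tensor_extend2 k A n \<beta> U V =
     (\<Union>u\<in>U. \<Union>v\<in>V. tensor_class k A n (frag_extend (\<lambda>r. frag_extend (\<beta> r) v) u))"

text \<open>\<open>A\<^sup>e = A \<otimes> A\<^sup>o\<^sup>p\<close>, with product \<open>(a \<otimes> b) (x \<otimes> y) = a x \<otimes> y b\<close>, where \<open>y b\<close> is a product in \<open>A\<close>.
  An \<open>A\<close>-bimodule is a left \<open>A\<^sup>e\<close>-module by \<open>(a \<otimes> b) m = a m b\<close>.\<close>

definition enveloping_algebra ::
  "('k, 's) ring_scheme \<Rightarrow> ('k, 'a) module \<Rightarrow> ('a list \<Rightarrow>\<^sub>0 int) set ring" where
  "enveloping_algebra k A =
     \<lparr>carrier = carrier (tensor_power k A 2),
      monoid.mult = tensor_extend2 k A 2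
        (\<lambda>r s. frag_of [r ! 0 \<otimes>\<^bsub>A\<^esub> s ! 0, s ! 1 \<otimes>\<^bsub>A\<^esub> r ! 1]),
      one = tensor_class k A 2 (frag_of [\<one>\<^bsub>A\<^esub>, \<one>\<^bsub>A\<^esub>]),
      ring.zero = \<one>\<^bsub>tensor_power k A 2\<^esub>,
      ring.add = monoid.mult (tensor_power k A 2)\<rparr>"

definition algebra_bimodule ::
  "('k, 's) ring_scheme \<Rightarrow> ('k, 'a) module \<Rightarrow> (('a list \<Rightarrow>\<^sub>0 int) set, 'a) module" where
  "algebra_bimodule k A =
     \<lparr>carrier = carrier A, monoid.mult = undefined, one = undefined, ring.zero = \<zero>\<^bsub>A\<^esub>, ring.add = ring.add A,
      module.smult = (\<lambda>U m. the_elem ((\<lambda>u. \<Oplus>\<^bsub>A\<^esub>r\<in>Poly_Mapping.keys u.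
        [Poly_Mapping.lookup u r] \<cdot>\<^bsub>A\<^esub> (r ! 0 \<otimes>\<^bsub>A\<^esub> m \<otimes>\<^bsub>A\<^esub> r ! 1)) ` U))\<rparr>"

section \<open>Hochschild cohomology and Calabi-Yau algebras\<close>

text \<open>The bar resolution \<open>B(A; A; A)\<close>, which is \<open>A \<otimes> A\<^sup>\<otimes>\<^sup>n \<otimes> A\<close> in degree \<open>n\<close>. In degree \<open>0\<close> it is
  \<open>A \<otimes> A\<close> with the outer bimodule structure \<open>a (x \<otimes> y) b = a x \<otimes> y b\<close>.\<close>

definition bar_resolution :: "('k, 's) ring_scheme \<Rightarrow> ('k, 'a) module \<Rightarrow> nat \<Rightarrow>
    (('a list \<Rightarrow>\<^sub>0 int) set, ('a list \<Rightarrow>\<^sub>0 int) set) module" where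
  "bar_resolution k A n =
     \<lparr>carrier = carrier (tensor_power k A (n + 2)), monoid.mult = undefined, one = undefined,
      ring.zero = \<one>\<^bsub>tensor_power k A (n + 2)\<^esub>, ring.add = monoid.mult (tensor_power k A (n + 2)),
      module.smult = tensor_extend2 k A (n + 2)
        (\<lambda>r xs. frag_of (xs[0 := r ! 0 \<otimes>\<^bsub>A\<^esub> xs ! 0, n + 1 := xs ! (n + 1) \<otimes>\<^bsub>A\<^esub> r ! 1]))\<rparr>"

definition bar_differential :: "('k, 's) ring_scheme \<Rightarrow> ('k, 'a) module \<Rightarrow> nat \<Rightarrow>
    ('a list \<Rightarrow>\<^sub>0 int) set \<Rightarrow> ('a list \<Rightarrow>\<^sub>0 int) set" where
  "bar_differential k A n = tensor_extend k A (n + 2) (\<lambda>xs.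
     \<Sum>i<n + 2. frag_cmul ((- 1) ^ i)
       (frag_of (take i xs @ (xs ! i \<otimes>\<^bsub>A\<^esub> xs ! Suc i) # drop (i + 2) xs)))"

definition hochschild_cohomology :: "('k, 's) ring_scheme \<Rightarrow> ('k, 'a) module \<Rightarrow>
    (('a list \<Rightarrow>\<^sub>0 int) set, 'n) module \<Rightarrow> nat \<Rightarrow> (('a list \<Rightarrow>\<^sub>0 int) set \<Rightarrow> 'n) set monoid" where
  "hochschild_cohomology k A N =
     hom_cohomology (enveloping_algebra k A) (bar_resolution k A) (bar_differential k A) N"

abbreviation outer_bimodule :: "('k, 's) ring_scheme \<Rightarrow> ('k, 'a) module \<Rightarrow>
    (('a list \<Rightarrow>\<^sub>0 int) set, ('a list \<Rightarrow>\<^sub>0 int) set) module" where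
  "outer_bimodule k A \<equiv> bar_resolution k A 0"

text \<open>The action of \<open>a \<otimes> b\<close> on \<open>HH\<^sup>n(A, A \<otimes> A)\<close> from the right, induced by the inner structure
  \<open>(x \<otimes> y) (a \<otimes> b) = x a \<otimes> b y\<close>.\<close>

definition inner_action :: "('k, 's) ring_scheme \<Rightarrow> ('k, 'a) module \<Rightarrow> nat \<Rightarrow> 'a \<Rightarrow> 'a \<Rightarrow>
    (('a list \<Rightarrow>\<^sub>0 int) set \<Rightarrow> ('a list \<Rightarrow>\<^sub>0 int) set) set \<Rightarrow>
    (('a list \<Rightarrow>\<^sub>0 int) set \<Rightarrow> ('a list \<Rightarrow>\<^sub>0 int) set) set" where
  "inner_action k A n a b =
     hom_cohomology_map (enveloping_algebra k A) (bar_resolution k A) (bar_differential k A)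
       (outer_bimodule k A) n
       (tensor_extend k A 2 (\<lambda>xs. frag_of [xs ! 0 \<otimes>\<^bsub>A\<^esub> a, b \<otimes>\<^bsub>A\<^esub> xs ! 1]))"

text \<open>A right \<open>A\<^sup>e\<close>-module is an \<open>(A, A)\<close>-bimodule by \<open>b m a = m (a \<otimes> b)\<close>; this explains the form of
  the linearity condition on \<open>h\<close>. Since \<open>A\<^sup>e\<close> is additively generated by the \<open>a \<otimes> b\<close>, the condition
  is that \<open>h\<close> is linear over \<open>A\<^sup>e\<close>.\<close>

definition calabi_yau_algebra ::
  "('k, 's) ring_scheme \<Rightarrow> ('k, 'a) module \<Rightarrow> nat \<Rightarrow> bool" where
  "calabi_yau_algebra k A d \<longleftrightarrow> assoc_algebra k A \<and>
     module_type_FP (enveloping_algebra k A) (algebra_bimodule k A) \<and>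
     (let HH = hochschild_cohomology k A (outer_bimodule k A) in
       (\<forall>n. n \<noteq> d \<longrightarrow> trivial_group (HH n)) \<and>
       (\<exists>h \<in> iso (HH d) (add_monoid A).
          \<forall>a\<in>carrier A. \<forall>b\<in>carrier A. \<forall>U\<in>carrier (HH d).
            h (inner_action k A d a b U) = b \<otimes>\<^bsub>A\<^esub> h U \<otimes>\<^bsub>A\<^esub> a))"

end

theory Submission
  imports Defs
begin

text \<open>For an abelian group \<open>M\<close>, a homomorphism from the standard resolution to \<open>M[G]\<close> is determined
  by its coefficient at \<open>\<one>\<close>, an \<open>M\<close>-valued cochain that is nonzero on only finitely many translates of
  each tuple. For \<open>M = \<int>\<close> these cochains compute \<open>H\<^sup>*(G, \<int>G)\<close>. As \<open>G\<close> is of type FP, the identity of the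
  standard resolution is homotopic to a map \<open>T\<close> that factors through a finite complex of finitely
  generated modules. So \<open>\<phi> \<circ> T\<close> lifts along a surjection of a free abelian group onto a finitely
  generated subgroup of \<open>M\<close>, and descending induction on the degree along the kernel of that
  surjection turns duality for \<open>\<int>\<close> into duality for every \<open>M\<close>: the cohomology is \<open>M\<close>, concentrated in
  degree \<open>d\<close>, and its classes are those of \<open>c \<cdot> m\<close>, where \<open>c\<close> generates the cohomology for \<open>\<int>\<close>.

  Let \<open>A = k[G]\<close>. Along \<open>g \<mapsto> g \<otimes> g\<^sup>-\<^sup>1\<close> the bar resolution of \<open>A\<close> is induced from the standard
  resolution of \<open>G\<close>, and \<open>A \<otimes> A\<close> with its outer structure is \<open>M[G]\<close> for \<open>M = A\<close>. Hence
  \<open>HH\<^sup>*(A, A \<otimes> A)\<close> is \<open>A\<close> in degree \<open>d\<close>, and the inner action is the regular one because \<open>G\<close> acts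
  trivially on the class of \<open>c\<close>. Finally, a finite projective resolution of \<open>\<int>\<close> is given by idempotents
  on finitely generated free modules together with an additive contraction; inducing these
  matrices to \<open>A\<^sup>e\<close> yields the resolution of \<open>A\<close>.\<close>

text \<open>The coefficient group that finally matters is \<open>A\<close>, which may have torsion
  and need not be finitely generated, so duality for \<int> cannot be applied to it coordinate by
  coordinate. This is why the cochain argument is run for arbitrary abelian groups. The kernel of a
  surjection from a free abelian group is a subgroup of a free abelian group, so the descending
  induction can stay within such subgroups; it starts because \<open>T\<close> vanishes above the
  length of the finite resolution, and the multiple of \<open>c\<close> produced by the connecting
  map dies by injectivity over the free group. On the side of resolutions the identity x \<otimes> y
  = (1 \<otimes> xy)(x \<otimes> inv x) is decisive. It shows that inducing a free module of rank m
  from the integral group ring to the enveloping algebra amounts, additively, to tensoring it with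
  \<open>A\<close> over \<int>. Hence merely additive maps can be induced as well as linear ones, a
  contraction that is not equivariant survives, and exactness over the enveloping algebra follows
  for every commutative ring \<open>k\<close>.\<close>

abbreviation "keys \<equiv> Poly_Mapping.keys"

section \<open>Additive maps\<close>

text \<open>Unlike members of \<open>lmod_hom\<close>, these maps are not extensional, so they can
  be composed and added as plain functions; extensionality is restored by \<open>restrict\<close> at
  the end.\<close>

definition add_hom :: "('a, 'm) ring_scheme \<Rightarrow> ('b, 'n) ring_scheme \<Rightarrow> ('a \<Rightarrow> 'b) set" where
  "add_hom M N = {f \<in> carrier M \<rightarrow> carrier N.
     \<forall>x\<in>carrier M. \<forall>y\<in>carrier M. f (x \<oplus>\<^bsub>M\<^esub> y) = f x \<oplus>\<^bsub>N\<^esub> f y}"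

lemma add_homI:
  assumes "\<And>x. x \<in> carrier M ==> f x \<in> carrier N"
    and "\<And>x y. x \<in> carrier M ==> y \<in> carrier M ==> f (x \<oplus>\<^bsub>M\<^esub> y) = f x \<oplus>\<^bsub>N\<^esub> f y"
  shows "f \<in> add_hom M N"
  using assms by (auto simp: add_hom_def)

lemma add_hom_iff_hom: "f \<in> add_hom M N \<longleftrightarrow> f \<in> hom (add_monoid M) (add_monoid N)"
  by (auto simp: add_hom_def hom_def)

lemma add_hom_closed: "f \<in> add_hom M N ==> x \<in> carrier M ==> f x \<in> carrier N"
  by (auto simp: add_hom_def)

lemma add_hom_add:
  "f \<in> add_hom M N ==> x \<in> carrier M ==> y \<in> carrier M ==> f (x \<oplus>\<^bsub>M\<^esub> y) = f x \<oplus>\<^bsub>N\<^esub> f y"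
  by (auto simp: add_hom_def)

lemma add_hom_group_hom:
  assumes "abelian_group M" "abelian_group N" "f \<in> add_hom M N"
  shows "group_hom (add_monoid M) (add_monoid N) f"
  using assms by (intro group_hom.intro group_hom_axioms.intro)
    (auto simp: add_hom_iff_hom abelian_group.a_group)

lemma add_hom_zero:
  assumes "abelian_group M" "abelian_group N" "f \<in> add_hom M N"
  shows "f \<zero>\<^bsub>M\<^esub> = \<zero>\<^bsub>N\<^esub>"
  using group_hom.hom_one[OF add_hom_group_hom[OF assms]] by simp

lemma add_hom_neg:
  assumes "abelian_group M" "abelian_group N" "f \<in> add_hom M N" "x \<in> carrier M"
  shows "f (\<ominus>\<^bsub>M\<^esub> x) = \<ominus>\<^bsub>N\<^esub> f x"
  using group_hom.hom_inv[OF add_hom_group_hom[OF assms(1-3)], of x] assms(4)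
  by (simp add: a_inv_def)

lemma add_hom_minus:
  assumes "abelian_group M" "abelian_group N" "f \<in> add_hom M N" "x \<in> carrier M" "y \<in> carrier M"
  shows "f (x \<ominus>\<^bsub>M\<^esub> y) = f x \<ominus>\<^bsub>N\<^esub> f y"
  using assms
  by (simp add: a_minus_def add_hom_add[OF assms(3)] add_hom_neg[OF assms(1-3)]
      abelian_group.a_inv_closed)

lemma add_hom_int_pow:
  assumes "abelian_group M" "abelian_group N" "f \<in> add_hom M N" "x \<in> carrier M"
  shows "f ([(n::int)] \<cdot>\<^bsub>M\<^esub> x) = [n] \<cdot>\<^bsub>N\<^esub> f x"
  using group_hom.hom_int_pow[OF add_hom_group_hom[OF assms(1-3)], of x n] assms(4)
  by (simp add: add_pow_def)

lemma add_hom_finsum: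
  assumes "abelian_group M" "abelian_group N" "f \<in> add_hom M N"
    and "\<And>i. i \<in> I ==> v i \<in> carrier M"
  shows "f (\<Oplus>\<^bsub>M\<^esub>i\<in>I. v i) = (\<Oplus>\<^bsub>N\<^esub>i\<in>I. f (v i))"
proof -
  interpret M: abelian_group M by fact
  interpret N: abelian_group N by fact
  show ?thesis
    using assms(4)
  proof (induction I rule: infinite_finite_induct)
    case (infinite A)
    then show ?case by (simp add: add_hom_zero[OF assms(1-3)])
  next
    case empty
    then show ?case by (simp add: add_hom_zero[OF assms(1-3)])
  next
    case (insert x F)
    then show ?case
      by (simp add: Pi_iff add_hom_add[OF assms(3)] add_hom_closed[OF assms(3)])
  qed
qed

lemma add_hom_comp:
  "f \<in> add_hom M N ==> g \<in> add_hom N L ==> (\<lambda>x. g (f x)) \<in> add_hom M L"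
  by (auto simp: add_hom_def Pi_iff)

lemma add_hom_id: "(\<lambda>x. x) \<in> add_hom M M"
  by (auto simp: add_hom_def)

lemma add_hom_plus:
  assumes "abelian_group N" "f \<in> add_hom M N" "g \<in> add_hom M N"
  shows "(\<lambda>x. f x \<oplus>\<^bsub>N\<^esub> g x) \<in> add_hom M N"
proof -
  interpret N: abelian_group N by fact
  show ?thesis
    using assms(2,3) by (auto simp: add_hom_def Pi_iff N.a_ac)
qed

lemma add_hom_uminus:
  assumes "abelian_group N" "f \<in> add_hom M N"
  shows "(\<lambda>x. \<ominus>\<^bsub>N\<^esub> f x) \<in> add_hom M N"
proof -
  interpret N: abelian_group N by fact
  show ?thesis
    using assms(2) by (auto simp: add_hom_def Pi_iff N.minus_add)
qed

lemma add_hom_diff: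
  assumes "abelian_group N" "f \<in> add_hom M N" "g \<in> add_hom M N"
  shows "(\<lambda>x. f x \<ominus>\<^bsub>N\<^esub> g x) \<in> add_hom M N"
  using add_hom_plus[OF assms(1,2) add_hom_uminus[OF assms(1,3)]] by (simp add: a_minus_def)

lemma add_hom_const_zero:
  assumes "abelian_group N" shows "(\<lambda>x. \<zero>\<^bsub>N\<^esub>) \<in> add_hom M N"
proof -
  interpret N: abelian_group N by fact
  show ?thesis by (auto simp: add_hom_def)
qed

lemma add_hom_sum:
  assumes "abelian_group M" "abelian_group N" "\<And>i. i \<in> I ==> f i \<in> add_hom M N"
  shows "(\<lambda>x. \<Oplus>\<^bsub>N\<^esub>i\<in>I. f i x) \<in> add_hom M N"
proof -
  interpret M: abelian_group M by fact
  interpret N: abelian_group N by fact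
  note cl = add_hom_closed[OF assms(3)]
  show ?thesis
  proof (rule add_homI)
    fix x y assume xy: "x \<in> carrier M" "y \<in> carrier M"
    have "(\<Oplus>\<^bsub>N\<^esub>i\<in>I. f i (x \<oplus>\<^bsub>M\<^esub> y)) = (\<Oplus>\<^bsub>N\<^esub>i\<in>I. f i x \<oplus>\<^bsub>N\<^esub> f i y)"
      using xy by (intro N.finsum_cong') (auto simp: add_hom_add[OF assms(3)] cl)
    also have "\<dots> = (\<Oplus>\<^bsub>N\<^esub>i\<in>I. f i x) \<oplus>\<^bsub>N\<^esub> (\<Oplus>\<^bsub>N\<^esub>i\<in>I. f i y)"
      using xy by (intro N.finsum_addf) (auto simp: cl)
    finally show "(\<Oplus>\<^bsub>N\<^esub>i\<in>I. f i (x \<oplus>\<^bsub>M\<^esub> y)) = (\<Oplus>\<^bsub>N\<^esub>i\<in>I. f i x) \<oplus>\<^bsub>N\<^esub> (\<Oplus>\<^bsub>N\<^esub>i\<in>I. f i y)" .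
  qed (auto intro!: N.finsum_closed simp: cl)
qed

lemma add_hom_cong:
  assumes "carrier M = carrier M'" "ring.add M = ring.add M'" "carrier N = carrier N'" "ring.add N = ring.add N'"
  shows "add_hom M N = add_hom M' N'"
  using assms by (simp add: add_hom_def)

lemma abelian_group_of_comm_group:
  assumes "comm_group T" "carrier M = carrier T" "ring.add M = monoid.mult T" "\<zero>\<^bsub>M\<^esub> = \<one>\<^bsub>T\<^esub>"
  shows "abelian_group M"
proof -
  interpret T: comm_group T by fact
  show ?thesis
    by (rule abelian_groupI) (auto simp: assms(2-4) T.m_assoc intro: T.m_comm T.l_inv_ex)
qed

text \<open>Generation as an abelian group, phrased through subgroups containing \<open>B\<close> so
  that it can be used directly as an induction principle.\<close>

definition spans :: "('a, 'm) ring_scheme \<Rightarrow> 'a set \<Rightarrow> bool" where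
  "spans M B \<longleftrightarrow> B \<subseteq> carrier M \<and>
     (\<forall>H\<subseteq>carrier M. \<zero>\<^bsub>M\<^esub> \<in> H \<longrightarrow> B \<subseteq> H \<longrightarrow> (\<forall>x\<in>H. \<ominus>\<^bsub>M\<^esub> x \<in> H) \<longrightarrow> (\<forall>x\<in>H. \<forall>y\<in>H. x \<oplus>\<^bsub>M\<^esub> y \<in> H) \<longrightarrow>
        carrier M \<subseteq> H)"

lemma spans_subset: "spans M B ==> b \<in> B ==> b \<in> carrier M"
  by (auto simp: spans_def)

lemma spans_induct [consumes 3, case_names zero base neg add]:
  assumes "spans M B" "abelian_group M" "x \<in> carrier M"
    and "P \<zero>\<^bsub>M\<^esub>" "\<And>b. b \<in> B ==> P b" "\<And>x. x \<in> carrier M ==> P x ==> P (\<ominus>\<^bsub>M\<^esub> x)"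
    and "\<And>x y. x \<in> carrier M ==> y \<in> carrier M ==> P x ==> P y ==> P (x \<oplus>\<^bsub>M\<^esub> y)"
  shows "P x"
proof -
  interpret M: abelian_group M by fact
  have "carrier M \<subseteq> {x \<in> carrier M. P x}"
    using assms(1)[unfolded spans_def, THEN conjunct2, rule_format, of "{x \<in> carrier M. P x}"] assms
    by (auto dest: spans_subset)
  with assms(3) show ?thesis by auto
qed

lemma spansI:
  assumes "B \<subseteq> carrier M"
    and "\<And>P x. x \<in> carrier M ==> P \<zero>\<^bsub>M\<^esub> ==> (\<And>b. b \<in> B ==> P b) ==>
      (\<And>x. x \<in> carrier M ==> P x ==> P (\<ominus>\<^bsub>M\<^esub> x)) ==>
      (\<And>x y. x \<in> carrier M ==> y \<in> carrier M ==> P x ==> P y ==> P (x \<oplus>\<^bsub>M\<^esub> y)) ==> P x"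
  shows "spans M B"
  unfolding spans_def
proof (intro conjI allI impI subsetI)
  fix H x assume *: "H \<subseteq> carrier M" "\<zero>\<^bsub>M\<^esub> \<in> H" "B \<subseteq> H" "\<forall>x\<in>H. \<ominus>\<^bsub>M\<^esub> x \<in> H"
    "\<forall>x\<in>H. \<forall>y\<in>H. x \<oplus>\<^bsub>M\<^esub> y \<in> H" "x \<in> carrier M"
  show "x \<in> H"
    by (rule assms(2)[of x "\<lambda>x. x \<in> H"]) (use * in auto)
qed (use assms(1) in auto)

text \<open>Identities between maps out of group rings, chain groups and tensor powers are reduced
  by this to a check on basis elements.\<close>

lemma add_hom_eqI:
  assumes "spans M B" "abelian_group M" "abelian_group N" "f \<in> add_hom M N" "g \<in> add_hom M N"
    and "\<And>b. b \<in> B ==> f b = g b" and "x \<in> carrier M"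
  shows "f x = g x"
  using assms(1,2,7)
  by (induction x rule: spans_induct)
    (use assms(6) in \<open>simp_all add: add_hom_zero[OF assms(2,3,4)] add_hom_neg[OF assms(2,3,4)] add_hom_add[OF assms(4)]
      add_hom_zero[OF assms(2,3,5)] add_hom_neg[OF assms(2,3,5)] add_hom_add[OF assms(5)]\<close>)

text \<open>The last premise expresses, in terms of predicates, that every element of
  \<open>B\<close> lies in the subgroup generated by \<open>B'\<close>.\<close>

lemma spans_trans:
  assumes "abelian_group M" "spans M B" "B' \<subseteq> carrier M"
    and "\<And>P b. b \<in> B ==> P \<zero>\<^bsub>M\<^esub> ==> (\<And>b. b \<in> B' ==> P b) ==>
      (\<And>x. x \<in> carrier M ==> P x ==> P (\<ominus>\<^bsub>M\<^esub> x)) ==>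
      (\<And>x y. x \<in> carrier M ==> y \<in> carrier M ==> P x ==> P y ==> P (x \<oplus>\<^bsub>M\<^esub> y)) ==> P b"
  shows "spans M B'"
proof (rule spansI[OF assms(3)])
  fix P x
  assume x: "x \<in> carrier M" and P: "P \<zero>\<^bsub>M\<^esub>" "\<And>b. b \<in> B' ==> P b"
    "\<And>x. x \<in> carrier M ==> P x ==> P (\<ominus>\<^bsub>M\<^esub> x)"
    "\<And>x y. x \<in> carrier M ==> y \<in> carrier M ==> P x ==> P y ==> P (x \<oplus>\<^bsub>M\<^esub> y)"
  show "P x"
    using assms(2,1) x
  proof (induction x rule: spans_induct)
    case (base b)
    show ?case by (rule assms(4)[OF base]) (use P in auto)
  qed (use P in auto)
qed

lemma spans_image:
  assumes "spans M B" "abelian_group M" "abelian_group N" "f \<in> add_hom M N" "f ` carrier M = carrier N"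
  shows "spans N (f ` B)"
proof (rule spansI)
  show "f ` B \<subseteq> carrier N"
    using add_hom_closed[OF assms(4)] spans_subset[OF assms(1)] by auto
  fix P y
  assume y: "y \<in> carrier N" and P: "P \<zero>\<^bsub>N\<^esub>" "\<And>b. b \<in> f ` B ==> P b"
    "\<And>x. x \<in> carrier N ==> P x ==> P (\<ominus>\<^bsub>N\<^esub> x)"
    "\<And>x y. x \<in> carrier N ==> y \<in> carrier N ==> P x ==> P y ==> P (x \<oplus>\<^bsub>N\<^esub> y)"
  note f = add_hom_zero[OF assms(2-4)] add_hom_neg[OF assms(2-4)] add_hom_add[OF assms(4)]
    add_hom_closed[OF assms(4)]
  have "P (f x)" if "x \<in> carrier M" for x
    using assms(1,2) that
  proof (induction x rule: spans_induct)
    case zero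
    show ?case unfolding f(1) by (rule P(1))
  next
    case (base b)
    show ?case by (rule P(2)) (use base in blast)
  next
    case (neg x)
    show ?case unfolding f(2)[OF neg(1)] by (rule P(3)) (use neg f(4) in blast)+
  next
    case (add x y)
    show ?case unfolding f(3)[OF add(1,2)] by (rule P(4)) (use add f(4) in blast)+
  qed
  with y show "P y" unfolding assms(5)[symmetric] by (elim imageE) simp
qed

section \<open>Finitely supported functions\<close>

definition sing :: "('r, 's) ring_scheme \<Rightarrow> 'i \<Rightarrow> 'r \<Rightarrow> 'i \<Rightarrow> 'r" where
  "sing R i r = (\<lambda>j. if j = i then r else \<zero>\<^bsub>R\<^esub>)"

lemma fin_suppD:
  assumes "f \<in> fin_supp R I"
  shows "i \<in> I ==> f i \<in> carrier R" "i \<notin> I ==> f i = \<zero>\<^bsub>R\<^esub>" "finite {i \<in> I. f i \<noteq> \<zero>\<^bsub>R\<^esub>}"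
  using assms by (auto simp: fin_supp_def)

lemma fin_supp_closed:
  assumes "abelian_group R" "f \<in> fin_supp R I" shows "f i \<in> carrier R"
proof -
  interpret R: abelian_group R by fact
  show ?thesis using assms(2) by (cases "i \<in> I") (auto simp: fin_supp_def)
qed

lemma fin_supp_sing:
  assumes "abelian_group R" "i \<in> I" "r \<in> carrier R"
  shows "sing R i r \<in> fin_supp R I"
proof -
  interpret R: abelian_group R by fact
  have "{j \<in> I. sing R i r j \<noteq> \<zero>\<^bsub>R\<^esub>} \<subseteq> {i}" by (auto simp: sing_def)
  from finite_subset[OF this] show ?thesis using assms
    by (auto simp: fin_supp_def sing_def)
qed

lemma fin_supp_zero: "abelian_group R ==> (\<lambda>i. \<zero>\<^bsub>R\<^esub>) \<in> fin_supp R I"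
  by (auto simp: fin_supp_def abelian_monoid.zero_closed abelian_group.axioms)

lemma fin_supp_add:
  assumes "abelian_group R" "f \<in> fin_supp R I" "g \<in> fin_supp R I"
  shows "(\<lambda>i. f i \<oplus>\<^bsub>R\<^esub> g i) \<in> fin_supp R I"
proof -
  interpret R: abelian_group R by fact
  have "{i \<in> I. f i \<oplus>\<^bsub>R\<^esub> g i \<noteq> \<zero>\<^bsub>R\<^esub>} \<subseteq> {i \<in> I. f i \<noteq> \<zero>\<^bsub>R\<^esub>} \<union> {i \<in> I. g i \<noteq> \<zero>\<^bsub>R\<^esub>}"
    by auto
  from finite_subset[OF this] show ?thesis
    using assms(2,3) unfolding fin_supp_def by auto
qed

lemma fin_supp_uminus:
  assumes "abelian_group R" "f \<in> fin_supp R I"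
  shows "(\<lambda>i. \<ominus>\<^bsub>R\<^esub> f i) \<in> fin_supp R I"
proof -
  interpret R: abelian_group R by fact
  have "{i \<in> I. \<ominus>\<^bsub>R\<^esub> f i \<noteq> \<zero>\<^bsub>R\<^esub>} \<subseteq> {i \<in> I. f i \<noteq> \<zero>\<^bsub>R\<^esub>}"
    by auto
  from finite_subset[OF this] show ?thesis
    using assms(2) unfolding fin_supp_def by auto
qed

lemma fin_supp_induct [consumes 2, case_names zero add]:
  assumes "abelian_group R" "f \<in> fin_supp R I"
    and zero: "P (\<lambda>i. \<zero>\<^bsub>R\<^esub>)"
    and add: "\<And>f i r. f \<in> fin_supp R I ==> i \<in> I ==> r \<in> carrier R ==> f i = \<zero>\<^bsub>R\<^esub> ==> P f ==>
      P (\<lambda>j. sing R i r j \<oplus>\<^bsub>R\<^esub> f j)"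
  shows "P f"
proof -
  interpret R: abelian_group R by fact
  \<comment> \<open>Induction runs over a finite superset of the support, because clearing one entry
    changes the support itself.\<close>
  have "\<forall>f \<in> fin_supp R I. {i \<in> I. f i \<noteq> \<zero>\<^bsub>R\<^esub>} \<subseteq> J \<longrightarrow> P f" if "finite J" for J
    using that
  proof (induction J rule: finite_induct)
    case empty
    show ?case
    proof (intro ballI impI)
      fix f assume "f \<in> fin_supp R I" "{i \<in> I. f i \<noteq> \<zero>\<^bsub>R\<^esub>} \<subseteq> {}"
      then have "f = (\<lambda>i. \<zero>\<^bsub>R\<^esub>)" by (auto simp: fin_supp_def)
      then show "P f" using zero by simp
    qed
  next
    case (insert i J)
    show ?case
    proof (intro ballI impI)
      fix f assume f: "f \<in> fin_supp R I" and sub: "{i \<in> I. f i \<noteq> \<zero>\<^bsub>R\<^esub>} \<subseteq> insert i J"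
      show "P f"
      proof (cases "i \<in> I")
        case True
        let ?f = "f(i := \<zero>\<^bsub>R\<^esub>)"
        have "finite {j \<in> I. ?f j \<noteq> \<zero>\<^bsub>R\<^esub>}"
          by (rule finite_subset[OF _ fin_suppD(3)[OF f]]) auto
        then have f': "?f \<in> fin_supp R I" using f by (auto simp: fin_supp_def)
        have "{j \<in> I. ?f j \<noteq> \<zero>\<^bsub>R\<^esub>} \<subseteq> J" using sub by auto
        then have "P ?f" using insert.IH f' by blast
        then have "P (\<lambda>j. sing R i (f i) j \<oplus>\<^bsub>R\<^esub> ?f j)"
          using add[OF f' True] fin_suppD(1)[OF f True] by simp
        also have "(\<lambda>j. sing R i (f i) j \<oplus>\<^bsub>R\<^esub> ?f j) = f"
          using fin_supp_closed[OF assms(1) f] by (auto simp: sing_def)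
        finally show ?thesis .
      next
        case False
        then have "{i \<in> I. f i \<noteq> \<zero>\<^bsub>R\<^esub>} \<subseteq> J" using sub by auto
        then show ?thesis using insert.IH f by auto
      qed
    qed
  qed
  then show ?thesis using assms(2) fin_suppD(3)[OF assms(2)] by blast
qed

lemma free_module_simps [simp]:
  "carrier (free_module R I) = fin_supp R I"
  "\<zero>\<^bsub>free_module R I\<^esub> = (\<lambda>i. \<zero>\<^bsub>R\<^esub>)"
  "f \<oplus>\<^bsub>free_module R I\<^esub> g = (\<lambda>i. f i \<oplus>\<^bsub>R\<^esub> g i)"
  "r \<odot>\<^bsub>free_module R I\<^esub> f = (\<lambda>i. r \<otimes>\<^bsub>R\<^esub> f i)"
  by (auto simp: free_module_def)

lemma free_module_abelian_group:
  assumes "abelian_group R" shows "abelian_group (free_module R I)"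
proof -
  interpret R: abelian_group R by fact
  show ?thesis
  proof (rule abelian_groupI)
    fix f g h assume "f \<in> carrier (free_module R I)" "g \<in> carrier (free_module R I)" "h \<in> carrier (free_module R I)"
    then have "f i \<in> carrier R" "g i \<in> carrier R" "h i \<in> carrier R" for i
      by (auto intro: fin_supp_closed[OF assms])
    then show "(f \<oplus>\<^bsub>free_module R I\<^esub> g) \<oplus>\<^bsub>free_module R I\<^esub> h = f \<oplus>\<^bsub>free_module R I\<^esub> (g \<oplus>\<^bsub>free_module R I\<^esub> h)"
      by (auto simp: R.a_assoc)
  next
    fix f g assume "f \<in> carrier (free_module R I)" "g \<in> carrier (free_module R I)"
    then have "f i \<in> carrier R" "g i \<in> carrier R" for i
      by (auto intro: fin_supp_closed[OF assms])
    then show "f \<oplus>\<^bsub>free_module R I\<^esub> g = g \<oplus>\<^bsub>free_module R I\<^esub> f"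
      by (auto simp: R.a_comm)
  next
    fix f assume f: "f \<in> carrier (free_module R I)"
    then have "f i \<in> carrier R" for i
      by (auto intro: fin_supp_closed[OF assms])
    then show "\<zero>\<^bsub>free_module R I\<^esub> \<oplus>\<^bsub>free_module R I\<^esub> f = f" by auto
    show "\<exists>g\<in>carrier (free_module R I). g \<oplus>\<^bsub>free_module R I\<^esub> f = \<zero>\<^bsub>free_module R I\<^esub>"
      using f \<open>\<And>i. f i \<in> carrier R\<close> by (intro bexI[of _ "\<lambda>i. \<ominus>\<^bsub>R\<^esub> f i"])
        (auto simp: fin_supp_uminus[OF assms] R.l_neg)
  qed (auto simp: fin_supp_add[OF assms] fin_supp_zero[OF assms])
qed

lemma free_module_spans:
  assumes "abelian_group R"
  shows "spans (free_module R I) {sing R i r | i r. i \<in> I \<and> r \<in> carrier R}"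
proof (rule spansI)
  fix P x
  assume x: "x \<in> carrier (free_module R I)" and P: "P \<zero>\<^bsub>free_module R I\<^esub>"
    "\<And>b. b \<in> {sing R i r | i r. i \<in> I \<and> r \<in> carrier R} ==> P b"
    "\<And>x y. x \<in> carrier (free_module R I) ==> y \<in> carrier (free_module R I) ==> P x ==> P y ==>
      P (x \<oplus>\<^bsub>free_module R I\<^esub> y)"
  have "x \<in> fin_supp R I" using x by simp
  with assms show "P x"
  proof (induction x rule: fin_supp_induct)
    case (add f i r)
    then show ?case using P(3)[of "sing R i r" f] P(2)[of "sing R i r"]
      by (auto simp: fin_supp_sing[OF assms])
  qed (use P in auto)
qed (auto simp: fin_supp_sing[OF assms])

lemma sing_add_hom:
  assumes "abelian_group R" "i \<in> I"
  shows "sing R i \<in> add_hom R (free_module R I)"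
proof -
  interpret R: abelian_group R by fact
  show ?thesis using assms
    by (intro add_homI) (auto simp: fin_supp_sing, auto simp: sing_def fun_eq_iff)
qed

lemma free_module_lookup_add_hom:
  assumes "abelian_group R"
  shows "(\<lambda>v. v i) \<in> add_hom (free_module R I) R"
  by (rule add_homI) (auto intro: fin_supp_closed[OF assms])

text \<open>Only the additive group of \<open>R\<close> enters: a free module is a direct sum of
  copies of it, and each summand may be mapped by any additive map. The same lemma therefore serves
  \<int>, \<open>k\<close>, \<open>A\<close> and the enveloping algebra.\<close>

lemma free_module_universal:
  assumes "abelian_group R" "abelian_group B" "\<And>i. i \<in> I ==> b i \<in> add_hom R B"
  obtains h where "h \<in> add_hom (free_module R I) B"
    "\<And>i r. i \<in> I ==> r \<in> carrier R ==> h (sing R i r) = b i r"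
proof -
  interpret R: abelian_group R by fact
  interpret B: abelian_group B by fact
  define h where "h v = (\<Oplus>\<^bsub>B\<^esub>i\<in>{i \<in> I. v i \<noteq> \<zero>\<^bsub>R\<^esub>}. b i (v i))" for v
  have bcl: "b i (v i) \<in> carrier B" if "i \<in> I" "v \<in> fin_supp R I" for i v
    using add_hom_closed[OF assms(3)[OF that(1)]] fin_suppD(1)[OF that(2,1)] by auto
  have b0: "b i \<zero>\<^bsub>R\<^esub> = \<zero>\<^bsub>B\<^esub>" if "i \<in> I" for i
    using add_hom_zero[OF assms(1,2) assms(3)[OF that]] .
  \<comment> \<open>The support of a sum can shrink, so the defining sums must be compared over a
    common larger index set.\<close>
  have h_eq: "h v = (\<Oplus>\<^bsub>B\<^esub>i\<in>J. b i (v i))"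
    if "v \<in> fin_supp R I" "finite J" "J \<subseteq> I" "{i \<in> I. v i \<noteq> \<zero>\<^bsub>R\<^esub>} \<subseteq> J" for v J
    unfolding h_def
    by (rule B.add.finprod_mono_neutral_cong_left) (use that bcl b0 in auto)
  have "h \<in> add_hom (free_module R I) B"
  proof (rule add_homI)
    fix v assume "v \<in> carrier (free_module R I)"
    then show "h v \<in> carrier B" unfolding h_def by (intro B.finsum_closed) (auto intro: bcl)
  next
    fix v w assume "v \<in> carrier (free_module R I)" "w \<in> carrier (free_module R I)"
    then have vw: "v \<in> fin_supp R I" "w \<in> fin_supp R I" "(\<lambda>i. v i \<oplus>\<^bsub>R\<^esub> w i) \<in> fin_supp R I"
      by (auto simp: fin_supp_add[OF assms(1)])
    let ?J = "{i \<in> I. v i \<noteq> \<zero>\<^bsub>R\<^esub>} \<union> {i \<in> I. w i \<noteq> \<zero>\<^bsub>R\<^esub>}"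
    have "finite ?J" using vw by (auto simp: fin_supp_def)
    then have "h v = (\<Oplus>\<^bsub>B\<^esub>i\<in>?J. b i (v i))" "h w = (\<Oplus>\<^bsub>B\<^esub>i\<in>?J. b i (w i))"
      "h (\<lambda>i. v i \<oplus>\<^bsub>R\<^esub> w i) = (\<Oplus>\<^bsub>B\<^esub>i\<in>?J. b i (v i \<oplus>\<^bsub>R\<^esub> w i))"
      using vw by (intro h_eq; auto)+
    moreover have "(\<Oplus>\<^bsub>B\<^esub>i\<in>?J. b i (v i \<oplus>\<^bsub>R\<^esub> w i)) = (\<Oplus>\<^bsub>B\<^esub>i\<in>?J. b i (v i) \<oplus>\<^bsub>B\<^esub> b i (w i))"
      using bcl vw fin_suppD(1)[OF vw(1)] fin_suppD(1)[OF vw(2)]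
      by (intro B.finsum_cong') (auto simp: add_hom_add[OF assms(3)])
    moreover have "\<dots> = (\<Oplus>\<^bsub>B\<^esub>i\<in>?J. b i (v i)) \<oplus>\<^bsub>B\<^esub> (\<Oplus>\<^bsub>B\<^esub>i\<in>?J. b i (w i))"
      using bcl vw by (intro B.finsum_addf) auto
    ultimately show "h (v \<oplus>\<^bsub>free_module R I\<^esub> w) = h v \<oplus>\<^bsub>B\<^esub> h w" by simp
  qed
  moreover have "h (sing R i r) = b i r" if "i \<in> I" "r \<in> carrier R" for i r
  proof -
    have "h (sing R i r) = (\<Oplus>\<^bsub>B\<^esub>j\<in>{i}. b j (sing R i r j))"
      using that by (intro h_eq fin_supp_sing[OF assms(1)]) (auto simp: sing_def)
    also have "\<dots> = b i r"
      using that add_hom_closed[OF assms(3)] by (simp add: sing_def)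
    finally show ?thesis .
  qed
  ultimately show ?thesis by (rule that)
qed

section \<open>Left modules\<close>

lemma left_module_smult_add_hom:
  assumes "left_module R M" "r \<in> carrier R"
  shows "(\<lambda>x. r \<odot>\<^bsub>M\<^esub> x) \<in> add_hom M M"
  using assms by (intro add_homI) (auto simp: left_module.smult_closed left_module.smult_r_distr)

lemma left_module_scalar_add_hom:
  assumes "left_module R M" "x \<in> carrier M"
  shows "(\<lambda>r. r \<odot>\<^bsub>M\<^esub> x) \<in> add_hom R M"
  using assms by (intro add_homI) (auto simp: left_module.smult_closed left_module.smult_l_distr)

lemma lmod_abelian: "left_module R M ==> abelian_group M"
  and left_module_ring: "left_module R M ==> ring R"
  by (auto simp: left_module_def)

lemma lmod_homI:
  assumes "left_module R M" "f \<in> add_hom M N"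
    and "\<And>r x. r \<in> carrier R ==> x \<in> carrier M ==> f (r \<odot>\<^bsub>M\<^esub> x) = r \<odot>\<^bsub>N\<^esub> f x"
  shows "restrict f (carrier M) \<in> lmod_hom R M N"
proof -
  interpret M: abelian_group M using assms(1) by (rule lmod_abelian)
  show ?thesis
    using assms by (auto simp: lmod_hom_def add_hom_closed add_hom_add left_module.smult_closed)
qed

lemma lmod_hom_add_hom: "f \<in> lmod_hom R M N ==> f \<in> add_hom M N"
  by (auto simp: lmod_hom_def add_hom_def PiE_def)

lemma lmod_hom_smult:
  "f \<in> lmod_hom R M N ==> r \<in> carrier R ==> x \<in> carrier M ==> f (r \<odot>\<^bsub>M\<^esub> x) = r \<odot>\<^bsub>N\<^esub> f x"
  by (auto simp: lmod_hom_def)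

lemma lmod_hom_closed: "f \<in> lmod_hom R M N ==> x \<in> carrier M ==> f x \<in> carrier N"
  by (auto simp: lmod_hom_def PiE_def)

lemma lmod_hom_eqI:
  assumes "f \<in> lmod_hom R M N" "g \<in> lmod_hom R M N" "\<And>x. x \<in> carrier M ==> f x = g x"
  shows "f = g"
  using assms by (intro PiE_ext[of f "carrier M" "\<lambda>_. carrier N" g]) (auto simp: lmod_hom_def)

text \<open>Both sides are additive in the scalar and in the vector, so generators of the ring and
  of the module suffice.\<close>

lemma linear_on_spans:
  assumes "left_module R M" "left_module R N" "f \<in> add_hom M N" "spans R C" "spans M B"
    and eq: "\<And>c b. c \<in> C ==> b \<in> B ==> f (c \<odot>\<^bsub>M\<^esub> b) = c \<odot>\<^bsub>N\<^esub> f b"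
    and "r \<in> carrier R" "x \<in> carrier M"
  shows "f (r \<odot>\<^bsub>M\<^esub> x) = r \<odot>\<^bsub>N\<^esub> f x"
proof -
  interpret R: ring R using assms(1) by (rule left_module_ring)
  note ab = R.is_abelian_group lmod_abelian[OF assms(1)] lmod_abelian[OF assms(2)]
  have 1: "f (c \<odot>\<^bsub>M\<^esub> y) = c \<odot>\<^bsub>N\<^esub> f y" if c: "c \<in> C" and y: "y \<in> carrier M" for c y
    by (rule add_hom_eqI[OF assms(5) ab(2,3) add_hom_comp[OF left_module_smult_add_hom assms(3)]
          add_hom_comp[OF assms(3) left_module_smult_add_hom]])
      (use assms(1,2) spans_subset[OF assms(4) c] eq[OF c] y in auto)
  show ?thesis
    by (rule add_hom_eqI[OF assms(4) ab(1,3) add_hom_comp[OF left_module_scalar_add_hom assms(3)]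
          left_module_scalar_add_hom])
      (use assms(1,2,7,8) 1 add_hom_closed[OF assms(3)] in auto)
qed

lemma lmod_hom_comp:
  assumes "left_module R M" "f \<in> lmod_hom R M N" "g \<in> lmod_hom R N L"
  shows "restrict (\<lambda>x. g (f x)) (carrier M) \<in> lmod_hom R M L"
  using assms by (intro lmod_homI add_hom_comp[OF lmod_hom_add_hom lmod_hom_add_hom])
    (auto simp: lmod_hom_smult lmod_hom_closed)

lemma lmod_hom_id:
  assumes "left_module R M"
  shows "restrict (\<lambda>x. x) (carrier M) \<in> lmod_hom R M M"
  using assms by (intro lmod_homI add_hom_id) auto

lemma left_module_smult_neg:
  assumes "left_module R M" "r \<in> carrier R" "x \<in> carrier M"
  shows "r \<odot>\<^bsub>M\<^esub> (\<ominus>\<^bsub>M\<^esub> x) = \<ominus>\<^bsub>M\<^esub> (r \<odot>\<^bsub>M\<^esub> x)"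
  using add_hom_neg[OF lmod_abelian[OF assms(1)] lmod_abelian[OF assms(1)]
    left_module_smult_add_hom[OF assms(1,2)] assms(3)] .

lemma left_module_smult_minus:
  assumes "left_module R M" "r \<in> carrier R" "x \<in> carrier M" "y \<in> carrier M"
  shows "r \<odot>\<^bsub>M\<^esub> (x \<ominus>\<^bsub>M\<^esub> y) = r \<odot>\<^bsub>M\<^esub> x \<ominus>\<^bsub>M\<^esub> r \<odot>\<^bsub>M\<^esub> y"
  using add_hom_minus[OF lmod_abelian[OF assms(1)] lmod_abelian[OF assms(1)]
    left_module_smult_add_hom[OF assms(1,2)] assms(3,4)] .

lemma lmod_hom_diff:
  assumes "left_module R M" "left_module R N" "f \<in> lmod_hom R M N" "g \<in> lmod_hom R M N"
  shows "restrict (\<lambda>x. f x \<ominus>\<^bsub>N\<^esub> g x) (carrier M) \<in> lmod_hom R M N"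
  using assms
  by (intro lmod_homI add_hom_diff lmod_abelian[OF assms(2)] lmod_hom_add_hom)
    (auto simp: lmod_hom_smult lmod_hom_closed left_module_smult_minus)

lemma fin_supp_smult:
  assumes "ring R" "f \<in> fin_supp R I" "r \<in> carrier R"
  shows "(\<lambda>i. r \<otimes>\<^bsub>R\<^esub> f i) \<in> fin_supp R I"
proof -
  interpret R: ring R by fact
  have "{i \<in> I. r \<otimes>\<^bsub>R\<^esub> f i \<noteq> \<zero>\<^bsub>R\<^esub>} \<subseteq> {i \<in> I. f i \<noteq> \<zero>\<^bsub>R\<^esub>}"
    using assms(3) by auto
  from finite_subset[OF this] show ?thesis
    using assms(2,3) unfolding fin_supp_def by auto
qed

lemma free_module_left_module:
  assumes "ring R" shows "left_module R (free_module R I)"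
proof -
  interpret R: ring R by fact
  interpret F: abelian_group "free_module R I"
    by (rule free_module_abelian_group[OF R.is_abelian_group])
  note cl = fin_supp_closed[OF R.is_abelian_group]
  show ?thesis
  proof (intro left_module.intro left_module_axioms.intro)
    show "ring R" "abelian_group (free_module R I)" by unfold_locales
  next
    fix a x assume "a \<in> carrier R" "x \<in> carrier (free_module R I)"
    then show "a \<odot>\<^bsub>free_module R I\<^esub> x \<in> carrier (free_module R I)"
      by (simp add: fin_supp_smult[OF assms])
  next
    fix a b x assume "a \<in> carrier R" "b \<in> carrier R" "x \<in> carrier (free_module R I)"
    then show "(a \<oplus>\<^bsub>R\<^esub> b) \<odot>\<^bsub>free_module R I\<^esub> x = a \<odot>\<^bsub>free_module R I\<^esub> x \<oplus>\<^bsub>free_module R I\<^esub> b \<odot>\<^bsub>free_module R I\<^esub> x"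
      by (simp add: cl R.l_distr)
  next
    fix a x y assume "a \<in> carrier R" "x \<in> carrier (free_module R I)" "y \<in> carrier (free_module R I)"
    then show "a \<odot>\<^bsub>free_module R I\<^esub> (x \<oplus>\<^bsub>free_module R I\<^esub> y) = a \<odot>\<^bsub>free_module R I\<^esub> x \<oplus>\<^bsub>free_module R I\<^esub> a \<odot>\<^bsub>free_module R I\<^esub> y"
      by (simp add: cl R.r_distr)
  next
    fix a b x assume "a \<in> carrier R" "b \<in> carrier R" "x \<in> carrier (free_module R I)"
    then show "(a \<otimes>\<^bsub>R\<^esub> b) \<odot>\<^bsub>free_module R I\<^esub> x = a \<odot>\<^bsub>free_module R I\<^esub> (b \<odot>\<^bsub>free_module R I\<^esub> x)"
      by (simp add: cl R.m_assoc)
  next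
    fix x assume "x \<in> carrier (free_module R I)"
    then show "\<one>\<^bsub>R\<^esub> \<odot>\<^bsub>free_module R I\<^esub> x = x"
      by (simp add: cl)
  qed
qed

lemma regular_module_simps [simp]:
  "carrier (regular_module R) = carrier R" "\<zero>\<^bsub>regular_module R\<^esub> = \<zero>\<^bsub>R\<^esub>"
  "x \<oplus>\<^bsub>regular_module R\<^esub> y = x \<oplus>\<^bsub>R\<^esub> y" "x \<odot>\<^bsub>regular_module R\<^esub> y = x \<otimes>\<^bsub>R\<^esub> y"
  by (auto simp: regular_module_def)

lemma regular_module_left_module:
  assumes "ring R" shows "left_module R (regular_module R)"
proof -
  interpret R: ring R by fact
  have "abelian_group (regular_module R)"
    by (rule abelian_group_of_comm_group[OF R.a_comm_group]) (auto simp: regular_module_def)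
  then show ?thesis
    by (intro left_module.intro left_module_axioms.intro)
      (auto simp: assms R.l_distr R.r_distr R.m_assoc)
qed

lemma free_module_lift:
  assumes "left_module R B" "\<And>i. i \<in> I ==> b i \<in> carrier B"
  obtains h where "h \<in> lmod_hom R (free_module R I) B"
    "\<And>i r. i \<in> I ==> r \<in> carrier R ==> h (sing R i r) = r \<odot>\<^bsub>B\<^esub> b i"
proof -
  interpret R: ring R using assms(1) by (rule left_module_ring)
  note lF = free_module_left_module[OF R.ring_axioms]
  obtain h where h: "h \<in> add_hom (free_module R I) B"
    "\<And>i r. i \<in> I ==> r \<in> carrier R ==> h (sing R i r) = r \<odot>\<^bsub>B\<^esub> b i"
    using free_module_universal[OF R.is_abelian_group lmod_abelian[OF assms(1)],
        of I "\<lambda>i r. r \<odot>\<^bsub>B\<^esub> b i"] left_module_scalar_add_hom[OF assms(1)] assms(2) by metis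
  have "spans R (carrier R)" by (auto simp: spans_def)
  have lin: "h (r \<odot>\<^bsub>free_module R I\<^esub> x) = r \<odot>\<^bsub>B\<^esub> h x" if "r \<in> carrier R" "x \<in> carrier (free_module R I)" for r x
  proof (rule linear_on_spans[OF lF assms(1) h(1) \<open>spans R (carrier R)\<close> free_module_spans[OF R.is_abelian_group] _ that])
    fix c x assume c: "c \<in> carrier R" and "x \<in> {sing R i r | i r. i \<in> I \<and> r \<in> carrier R}"
    then obtain i r where x: "x = sing R i r" "i \<in> I" "r \<in> carrier R" by auto
    have "(\<lambda>j. c \<otimes>\<^bsub>R\<^esub> sing R i r j) = sing R i (c \<otimes>\<^bsub>R\<^esub> r)" using c by (auto simp: sing_def)
    then show "h (c \<odot>\<^bsub>free_module R I\<^esub> x) = c \<odot>\<^bsub>B\<^esub> h x"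
      using x c assms(2) by (simp add: h(2) left_module.smult_assoc[OF assms(1)])
  qed
  show ?thesis
  proof (rule that)
    show "restrict h (carrier (free_module R I)) \<in> lmod_hom R (free_module R I) B"
      by (rule lmod_homI[OF lF h(1)]) (rule lin)
    show "restrict h (carrier (free_module R I)) (sing R i r) = r \<odot>\<^bsub>B\<^esub> b i" if "i \<in> I" "r \<in> carrier R" for i r
      using that h(2) fin_supp_sing[OF R.is_abelian_group that] by simp
  qed
qed

text \<open>The map is extended to the free module by \<open>p\<close>, lifted there on basis
  vectors, and the lift is restricted along \<open>i\<close>.\<close>

lemma projective_lift:
  assumes "projective_module R P" "left_module R B" "left_module R B'"
    and "d \<in> lmod_hom R B' B" "q \<in> lmod_hom R P B" "q ` carrier P \<subseteq> d ` carrier B'"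
  obtains h where "h \<in> lmod_hom R P B'" "\<And>x. x \<in> carrier P ==> d (h x) = q x"
proof -
  have lP: "left_module R P" using assms(1) by (simp add: projective_module_def)
  interpret R: ring R using lP by (rule left_module_ring)
  note lF = free_module_left_module[OF R.ring_axioms]
  obtain I :: "'c set" and i p where ip: "i \<in> lmod_hom R P (free_module R I)"
    "p \<in> lmod_hom R (free_module R I) P" "\<And>x. x \<in> carrier P ==> p (i x) = x"
    using assms(1) unfolding projective_module_def by metis
  have sing1: "sing R j \<one>\<^bsub>R\<^esub> \<in> carrier (free_module R I)" if "j \<in> I" for j
    using that by (simp add: fin_supp_sing[OF R.is_abelian_group])
  have "\<exists>b. b \<in> carrier B' \<and> d b = q (p (sing R j \<one>\<^bsub>R\<^esub>))" if "j \<in> I" for j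
    using assms(6) lmod_hom_closed[OF ip(2) sing1[OF that]] by force
  then obtain b where b: "\<And>j. j \<in> I ==> b j \<in> carrier B'"
    "\<And>j. j \<in> I ==> d (b j) = q (p (sing R j \<one>\<^bsub>R\<^esub>))" by metis
  obtain h where h: "h \<in> lmod_hom R (free_module R I) B'"
    "\<And>i r. i \<in> I ==> r \<in> carrier R ==> h (sing R i r) = r \<odot>\<^bsub>B'\<^esub> b i"
    using free_module_lift[where R=R and b=b and I=I, OF assms(3)] b(1) by metis
  note hom = lmod_hom_add_hom[OF h(1)] lmod_hom_add_hom[OF assms(4)] lmod_hom_add_hom[OF assms(5)]
    lmod_hom_add_hom[OF ip(1)] lmod_hom_add_hom[OF ip(2)]
  have eq: "d (h v) = q (p v)" if "v \<in> carrier (free_module R I)" for v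
  proof (rule add_hom_eqI[OF free_module_spans[OF R.is_abelian_group] _ _ add_hom_comp[OF hom(1,2)]
        add_hom_comp[OF hom(5,3)] _ that])
    fix x assume "x \<in> {sing R i r | i r. i \<in> I \<and> r \<in> carrier R}"
    then obtain i r where x: "x = sing R i r" "i \<in> I" "r \<in> carrier R" by auto
    have "sing R i r = r \<odot>\<^bsub>free_module R I\<^esub> sing R i \<one>\<^bsub>R\<^esub>" using x by (auto simp: sing_def)
    then show "d (h x) = q (p x)"
      using x sing1[OF x(2)] b h(2)[of i r] lmod_hom_closed[OF ip(2) sing1[OF x(2)]]
        lmod_hom_smult[OF assms(4) x(3) b(1)[OF x(2)]]
      by (simp only: lmod_hom_smult[OF ip(2)] lmod_hom_smult[OF assms(5)])
  qed (use lmod_abelian[OF assms(2)] lmod_abelian[OF lF] in auto)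
  show ?thesis
  proof (rule that)
    show "restrict (\<lambda>x. h (i x)) (carrier P) \<in> lmod_hom R P B'"
      by (rule lmod_hom_comp[OF lP ip(1) h(1)])
    show "d (restrict (\<lambda>x. h (i x)) (carrier P) x) = q x" if "x \<in> carrier P" for x
      using that eq[OF lmod_hom_closed[OF ip(1) that]] ip(3) by simp
  qed
qed

section \<open>Resolutions\<close>

text \<open>Kept apart from \<open>resolution\<close> because a comparison map needs exactness only
  of its target.\<close>

locale augmented_complex =
  fixes R :: "('r, 's) ring_scheme" and C :: "nat \<Rightarrow> ('r, 'c) module" and d :: "nat \<Rightarrow> 'c \<Rightarrow> 'c"
    and e :: "'c \<Rightarrow> 'e" and M :: "('r, 'e) module"
  assumes lmod: "\<And>n. left_module R (C n)" and lmod_aug: "left_module R M"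
    and d_hom: "\<And>n. d n \<in> lmod_hom R (C (Suc n)) (C n)"
    and e_hom: "e \<in> lmod_hom R (C 0) M"
    and d_d: "\<And>n x. x \<in> carrier (C (Suc (Suc n))) ==> d n (d (Suc n) x) = \<zero>\<^bsub>C n\<^esub>"
    and e_d: "\<And>x. x \<in> carrier (C (Suc 0)) ==> e (d 0 x) = \<zero>\<^bsub>M\<^esub>"

locale resolution = augmented_complex +
  assumes e_onto: "e ` carrier (C 0) = carrier M"
    and exact0: "\<And>x. x \<in> carrier (C 0) ==> e x = \<zero>\<^bsub>M\<^esub> ==> x \<in> d 0 ` carrier (C (Suc 0))"
    and exact: "\<And>n x. x \<in> carrier (C (Suc n)) ==> d n x = \<zero>\<^bsub>C n\<^esub> ==> x \<in> d (Suc n) ` carrier (C (Suc (Suc n)))"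

lemma chain_map_exists:
  assumes "augmented_complex R C dC eC M" "resolution R D dD eD M" "\<And>n. projective_module R (C n)"
  obtains f where "\<And>n. f n \<in> lmod_hom R (C n) (D n)"
    "\<And>x. x \<in> carrier (C 0) ==> eD (f 0 x) = eC x"
    "\<And>n x. x \<in> carrier (C (Suc n)) ==> dD n (f (Suc n) x) = f n (dC n x)"
proof -
  interpret C: augmented_complex R C dC eC M by fact
  interpret D: resolution R D dD eD M by fact
  \<comment> \<open>Besides linearity the invariant records that \<open>f\<close> sends boundaries
    to boundaries, which is the hypothesis for lifting in the next degree.\<close>
  define P where "P n f \<longleftrightarrow> f \<in> lmod_hom R (C n) (D n) \<and>
    (\<forall>x\<in>carrier (C (Suc n)). f (dC n x) \<in> dD n ` carrier (D (Suc n))) \<and>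
    (n = 0 \<longrightarrow> (\<forall>x\<in>carrier (C 0). eD (f x) = eC x))" for n f
  have "\<exists>f. P 0 f"
  proof -
    obtain f where f: "f \<in> lmod_hom R (C 0) (D 0)" "\<And>x. x \<in> carrier (C 0) ==> eD (f x) = eC x"
      using projective_lift[OF assms(3) C.lmod_aug D.lmod D.e_hom C.e_hom] D.e_onto
        lmod_hom_closed[OF C.e_hom] by (metis image_subsetI)
    have "f (dC 0 x) \<in> dD 0 ` carrier (D (Suc 0))" if "x \<in> carrier (C (Suc 0))" for x
      using that lmod_hom_closed[OF C.d_hom that] f
      by (intro D.exact0) (auto simp: lmod_hom_closed C.e_d)
    with f show ?thesis by (auto simp: P_def)
  qed
  moreover have "\<exists>g. P (Suc n) g \<and> (\<forall>x\<in>carrier (C (Suc n)). dD n (g x) = f (dC n x))" if "P n f" for n f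
  proof -
    have f: "f \<in> lmod_hom R (C n) (D n)" "\<And>x. x\<in>carrier (C (Suc n)) ==> f (dC n x) \<in> dD n ` carrier (D (Suc n))"
      using that by (auto simp: P_def)
    obtain g where g: "g \<in> lmod_hom R (C (Suc n)) (D (Suc n))"
      "\<And>x. x \<in> carrier (C (Suc n)) ==> dD n (g x) = restrict (\<lambda>x. f (dC n x)) (carrier (C (Suc n))) x"
      by (rule projective_lift[OF assms(3) D.lmod D.lmod D.d_hom lmod_hom_comp[OF C.lmod C.d_hom f(1)]])
        (use f(2) in auto)
    have "g (dC (Suc n) x) \<in> dD (Suc n) ` carrier (D (Suc (Suc n)))" if x: "x \<in> carrier (C (Suc (Suc n)))" for x
    proof (rule D.exact)
      show "g (dC (Suc n) x) \<in> carrier (D (Suc n))"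
        by (rule lmod_hom_closed[OF g(1) lmod_hom_closed[OF C.d_hom x]])
      show "dD n (g (dC (Suc n) x)) = \<zero>\<^bsub>D n\<^esub>"
        using g(2)[OF lmod_hom_closed[OF C.d_hom x]] lmod_hom_closed[OF C.d_hom x]
          add_hom_zero[OF lmod_abelian[OF C.lmod] lmod_abelian[OF D.lmod] lmod_hom_add_hom[OF f(1)]]
        by (simp add: C.d_d[OF x])
    qed
    with g show ?thesis by (auto simp: P_def)
  qed
  ultimately obtain f where "\<And>n. P n (f n)" "\<And>n. \<forall>x\<in>carrier (C (Suc n)). dD n (f (Suc n) x) = f n (dC n x)"
    using dependent_nat_choice[of P "\<lambda>n f g. \<forall>x\<in>carrier (C (Suc n)). dD n (g x) = f (dC n x)"] by metis
  then show ?thesis by (intro that[of f]) (auto simp: P_def)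
qed

lemma null_homotopy_exists:
  assumes "augmented_complex R C dC eC M" "resolution R D dD eD M" "\<And>n. projective_module R (C n)"
    and f: "\<And>n. f n \<in> lmod_hom R (C n) (D n)"
    and f_e: "\<And>x. x \<in> carrier (C 0) ==> eD (f 0 x) = \<zero>\<^bsub>M\<^esub>"
    and f_d: "\<And>n x. x \<in> carrier (C (Suc n)) ==> dD n (f (Suc n) x) = f n (dC n x)"
  obtains h where "\<And>n. h n \<in> lmod_hom R (C n) (D (Suc n))"
    "\<And>x. x \<in> carrier (C 0) ==> dD 0 (h 0 x) = f 0 x"
    "\<And>n x. x \<in> carrier (C (Suc n)) ==> dD (Suc n) (h (Suc n) x) = f (Suc n) x \<ominus>\<^bsub>D (Suc n)\<^esub> h n (dC n x)"
proof -
  interpret C: augmented_complex R C dC eC M by fact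
  interpret D: resolution R D dD eD M by fact
  note abD = lmod_abelian[OF D.lmod] and abC = lmod_abelian[OF C.lmod]
  \<comment> \<open>The second clause makes \<open>f (Suc n) x\<close> minus
    \<open>h (dC n x)\<close> a cycle, so that exactness supplies the next homotopy.\<close>
  define P where "P n h \<longleftrightarrow> h \<in> lmod_hom R (C n) (D (Suc n)) \<and>
    (\<forall>x\<in>carrier (C (Suc n)). dD n (h (dC n x)) = f n (dC n x)) \<and>
    (n = 0 \<longrightarrow> (\<forall>x\<in>carrier (C 0). dD 0 (h x) = f 0 x))" for n h
  have "\<exists>h. P 0 h"
  proof -
    have "f 0 ` carrier (C 0) \<subseteq> dD 0 ` carrier (D (Suc 0))"
      using f_e lmod_hom_closed[OF f] by (auto intro!: D.exact0)
    then obtain h where h: "h \<in> lmod_hom R (C 0) (D (Suc 0))" "\<And>x. x \<in> carrier (C 0) ==> dD 0 (h x) = f 0 x"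
      using projective_lift[OF assms(3) D.lmod D.lmod D.d_hom f] by metis
    then show ?thesis using lmod_hom_closed[OF C.d_hom] by (auto simp: P_def)
  qed
  moreover have "\<exists>g. P (Suc n) g \<and>
      (\<forall>x\<in>carrier (C (Suc n)). dD (Suc n) (g x) = f (Suc n) x \<ominus>\<^bsub>D (Suc n)\<^esub> h (dC n x))"
    if "P n h" for n h
  proof -
    interpret D1: abelian_group "D (Suc n)" by (rule abD)
    interpret D0: abelian_group "D n" by (rule abD)
    have h: "h \<in> lmod_hom R (C n) (D (Suc n))" "\<And>x. x\<in>carrier (C (Suc n)) ==> dD n (h (dC n x)) = f n (dC n x)"
      using that by (auto simp: P_def)
    let ?q = "restrict (\<lambda>x. f (Suc n) x \<ominus>\<^bsub>D (Suc n)\<^esub> restrict (\<lambda>x. h (dC n x)) (carrier (C (Suc n))) x) (carrier (C (Suc n)))"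
    have q: "?q \<in> lmod_hom R (C (Suc n)) (D (Suc n))"
      by (intro lmod_hom_diff C.lmod D.lmod f lmod_hom_comp[OF C.lmod C.d_hom h(1)])
    have sub: "?q ` carrier (C (Suc n)) \<subseteq> dD (Suc n) ` carrier (D (Suc (Suc n)))"
    proof clarify
      fix x assume x: "x \<in> carrier (C (Suc n))"
      have dx: "dC n x \<in> carrier (C n)" by (rule lmod_hom_closed[OF C.d_hom x])
      have hx: "h (dC n x) \<in> carrier (D (Suc n))" "f (Suc n) x \<in> carrier (D (Suc n))" "f n (dC n x) \<in> carrier (D n)"
        by (rule lmod_hom_closed[OF h(1) dx] lmod_hom_closed[OF f x] lmod_hom_closed[OF f dx])+
      have "dD n (f (Suc n) x \<ominus>\<^bsub>D (Suc n)\<^esub> h (dC n x)) = \<zero>\<^bsub>D n\<^esub>"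
        unfolding add_hom_minus[OF abD abD lmod_hom_add_hom[OF D.d_hom] hx(2,1)] f_d[OF x] h(2)[OF x]
        using hx(3) by (simp add: D0.minus_eq D0.r_neg)
      then show "?q x \<in> dD (Suc n) ` carrier (D (Suc (Suc n)))"
        using x hx by (intro D.exact) simp_all
    qed
    obtain g where g: "g \<in> lmod_hom R (C (Suc n)) (D (Suc (Suc n)))"
      "\<And>x. x \<in> carrier (C (Suc n)) ==> dD (Suc n) (g x) = ?q x"
      by (rule projective_lift[OF assms(3) D.lmod D.lmod D.d_hom q sub]) (rule that)
    have "dD (Suc n) (g (dC (Suc n) x)) = f (Suc n) (dC (Suc n) x)" if x: "x \<in> carrier (C (Suc (Suc n)))" for x
    proof -
      have dx: "dC (Suc n) x \<in> carrier (C (Suc n))" by (rule lmod_hom_closed[OF C.d_hom x])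
      have "h (dC n (dC (Suc n) x)) = \<zero>\<^bsub>D (Suc n)\<^esub>"
        using add_hom_zero[OF abC abD lmod_hom_add_hom[OF h(1)]] by (simp add: C.d_d[OF x])
      then show ?thesis using g(2)[OF dx] dx lmod_hom_closed[OF f dx] by (simp add: D1.minus_eq)
    qed
    with g show ?thesis by (auto simp: P_def)
  qed
  ultimately obtain h where "\<And>n. P n (h n)"
    "\<And>n. \<forall>x\<in>carrier (C (Suc n)). dD (Suc n) (h (Suc n) x) = f (Suc n) x \<ominus>\<^bsub>D (Suc n)\<^esub> h n (dC n x)"
    using dependent_nat_choice[of P "\<lambda>n h g. \<forall>x\<in>carrier (C (Suc n)). dD (Suc n) (g x) = f (Suc n) x \<ominus>\<^bsub>D (Suc n)\<^esub> h (dC n x)"] by metis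
  then show ?thesis by (intro that[of h]) (auto simp: P_def)
qed

lemma biadd_eqI:
  assumes "spans M B" "spans N C" "abelian_group M" "abelian_group N" "abelian_group L"
    and F1: "\<And>y. y \<in> carrier N ==> (\<lambda>x. F x y) \<in> add_hom M L"
    and G1: "\<And>y. y \<in> carrier N ==> (\<lambda>x. H x y) \<in> add_hom M L"
    and F2: "\<And>x. x \<in> carrier M ==> (\<lambda>y. F x y) \<in> add_hom N L"
    and G2: "\<And>x. x \<in> carrier M ==> (\<lambda>y. H x y) \<in> add_hom N L"
    and eq: "\<And>b c. b \<in> B ==> c \<in> C ==> F b c = H b c"
    and xy: "x \<in> carrier M" "y \<in> carrier N"
  shows "F x y = H x y"
proof -
  have "F b y = H b y" if "b \<in> B" for b
    using add_hom_eqI[OF assms(2,4,5) F2 G2 eq xy(2)] spans_subset[OF assms(1) that] that by blast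
  then show ?thesis
    using add_hom_eqI[OF assms(1,3,5) F1 G1 _ xy(1)] xy(2) by blast
qed

section \<open>Group algebras\<close>

lemma galg_simps [simp]:
  "carrier (group_algebra k G) = fin_supp k (carrier G)"
  "\<zero>\<^bsub>group_algebra k G\<^esub> = (\<lambda>i. \<zero>\<^bsub>k\<^esub>)"
  "\<one>\<^bsub>group_algebra k G\<^esub> = group_basis k \<one>\<^bsub>G\<^esub>"
  "f \<oplus>\<^bsub>group_algebra k G\<^esub> g = (\<lambda>i. f i \<oplus>\<^bsub>k\<^esub> g i)"
  "c \<odot>\<^bsub>group_algebra k G\<^esub> f = (\<lambda>i. c \<otimes>\<^bsub>k\<^esub> f i)"
  by (auto simp: group_algebra_def)

lemma group_basis_sing: "group_basis k g = sing k g \<one>\<^bsub>k\<^esub>"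
  by (simp add: group_basis_def sing_def)

locale group_alg = k: cring k + G: group G
  for k :: "('k, 's) ring_scheme" and G :: "('g, 't) monoid_scheme" (structure)
begin

abbreviation "A \<equiv> group_algebra k G"

lemmas k_ab = k.is_abelian_group
lemmas cl = fin_supp_closed[OF k_ab]

lemma A_add_hom: "add_hom A M = add_hom (free_module k (carrier G)) M"
  "add_hom M A = add_hom M (free_module k (carrier G))"
  by (rule add_hom_cong; simp add: free_module_def group_algebra_def)+

lemma A_abelian: "abelian_group A"
  by (rule abelian_group_of_comm_group[OF
      abelian_group.a_comm_group[OF free_module_abelian_group[OF k_ab, of "carrier G"]]])
    (auto simp: free_module_def group_algebra_def)

sublocale A_ab: abelian_group A by (rule A_abelian)

lemma A_spans: "spans A {sing k g c | g c. g \<in> carrier G \<and> c \<in> carrier k}"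
proof (rule spansI)
  fix P x
  assume x: "x \<in> carrier A" and P: "P \<zero>\<^bsub>A\<^esub>"
    "\<And>b. b \<in> {sing k g c | g c. g \<in> carrier G \<and> c \<in> carrier k} ==> P b"
    "\<And>x y. x \<in> carrier A ==> y \<in> carrier A ==> P x ==> P y ==> P (x \<oplus>\<^bsub>A\<^esub> y)"
  have "x \<in> fin_supp k (carrier G)" using x by simp
  with k_ab show "P x"
  proof (induction x rule: fin_supp_induct)
    case (add f i r)
    then show ?case using P(3)[of "sing k i r" f] P(2)[of "sing k i r"]
      by (auto simp: fin_supp_sing[OF k_ab])
  qed (use P in auto)
qed (auto simp: fin_supp_sing[OF k_ab])

lemma sing_A: "g \<in> carrier G ==> c \<in> carrier k ==> sing k g c \<in> carrier A"
  by (simp add: fin_supp_sing[OF k_ab])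

text \<open>The convolution may be summed over any finite set containing the support of the left
  factor; products with different supports can then be added.\<close>

lemma A_mult_eq:
  assumes "a \<in> carrier A" "b \<in> carrier A" "x \<in> carrier G"
    and "finite Y" "Y \<subseteq> carrier G" "{y \<in> carrier G. a y \<noteq> \<zero>\<^bsub>k\<^esub>} \<subseteq> Y"
  shows "(a \<otimes>\<^bsub>A\<^esub> b) x = (\<Oplus>\<^bsub>k\<^esub>y\<in>Y. a y \<otimes>\<^bsub>k\<^esub> b (inv y \<otimes> x))"
proof -
  have "(a \<otimes>\<^bsub>A\<^esub> b) x = (\<Oplus>\<^bsub>k\<^esub>y\<in>{y \<in> carrier G. a y \<noteq> \<zero>\<^bsub>k\<^esub>}. a y \<otimes>\<^bsub>k\<^esub> b (inv y \<otimes> x))"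
    using assms(3) by (simp add: group_algebra_def)
  also have "\<dots> = (\<Oplus>\<^bsub>k\<^esub>y\<in>Y. a y \<otimes>\<^bsub>k\<^esub> b (inv y \<otimes> x))"
    by (rule k.add.finprod_mono_neutral_cong_left) (use assms(3-) cl[OF assms(1)[simplified]] cl[OF assms(2)[simplified]] in auto)
  finally show ?thesis .
qed

lemma A_mult_outside: "x \<notin> carrier G ==> (a \<otimes>\<^bsub>A\<^esub> b) x = \<zero>\<^bsub>k\<^esub>"
  by (simp add: group_algebra_def)

lemma A_mult_l_distr:
  assumes "a \<in> carrier A" "a' \<in> carrier A" "b \<in> carrier A"
  shows "(a \<oplus>\<^bsub>A\<^esub> a') \<otimes>\<^bsub>A\<^esub> b = a \<otimes>\<^bsub>A\<^esub> b \<oplus>\<^bsub>A\<^esub> a' \<otimes>\<^bsub>A\<^esub> b"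
proof
  fix x
  show "((a \<oplus>\<^bsub>A\<^esub> a') \<otimes>\<^bsub>A\<^esub> b) x = (a \<otimes>\<^bsub>A\<^esub> b \<oplus>\<^bsub>A\<^esub> a' \<otimes>\<^bsub>A\<^esub> b) x"
  proof (cases "x \<in> carrier G")
    case True
    let ?Y = "{y \<in> carrier G. a y \<noteq> \<zero>\<^bsub>k\<^esub>} \<union> {y \<in> carrier G. a' y \<noteq> \<zero>\<^bsub>k\<^esub>}"
    have fin: "finite ?Y" using assms by (auto simp: fin_supp_def)
    have c: "a y \<in> carrier k" "a' y \<in> carrier k" "b y \<in> carrier k" for y using assms cl by auto
    have aa: "a \<oplus>\<^bsub>A\<^esub> a' \<in> carrier A" using assms by (simp add: fin_supp_add[OF k_ab])
    have "((a \<oplus>\<^bsub>A\<^esub> a') \<otimes>\<^bsub>A\<^esub> b) x = (\<Oplus>\<^bsub>k\<^esub>y\<in>?Y. (a \<oplus>\<^bsub>A\<^esub> a') y \<otimes>\<^bsub>k\<^esub> b (inv y \<otimes> x))"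
      by (rule A_mult_eq[OF aa assms(3) True fin]) (use c in auto)
    also have "\<dots> = (\<Oplus>\<^bsub>k\<^esub>y\<in>?Y. a y \<otimes>\<^bsub>k\<^esub> b (inv y \<otimes> x) \<oplus>\<^bsub>k\<^esub> a' y \<otimes>\<^bsub>k\<^esub> b (inv y \<otimes> x))"
      using c by (intro k.finsum_cong') (auto simp: k.l_distr)
    also have "\<dots> = (\<Oplus>\<^bsub>k\<^esub>y\<in>?Y. a y \<otimes>\<^bsub>k\<^esub> b (inv y \<otimes> x)) \<oplus>\<^bsub>k\<^esub> (\<Oplus>\<^bsub>k\<^esub>y\<in>?Y. a' y \<otimes>\<^bsub>k\<^esub> b (inv y \<otimes> x))"
      using c by (intro k.finsum_addf) auto
    also have "\<dots> = (a \<otimes>\<^bsub>A\<^esub> b) x \<oplus>\<^bsub>k\<^esub> (a' \<otimes>\<^bsub>A\<^esub> b) x"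
      using A_mult_eq[OF assms(1,3) True fin] A_mult_eq[OF assms(2,3) True fin] by auto
    finally show ?thesis by simp
  qed (simp add: A_mult_outside)
qed

lemma A_mult_r_distr:
  assumes "a \<in> carrier A" "b \<in> carrier A" "b' \<in> carrier A"
  shows "a \<otimes>\<^bsub>A\<^esub> (b \<oplus>\<^bsub>A\<^esub> b') = a \<otimes>\<^bsub>A\<^esub> b \<oplus>\<^bsub>A\<^esub> a \<otimes>\<^bsub>A\<^esub> b'"
proof
  fix x
  show "(a \<otimes>\<^bsub>A\<^esub> (b \<oplus>\<^bsub>A\<^esub> b')) x = (a \<otimes>\<^bsub>A\<^esub> b \<oplus>\<^bsub>A\<^esub> a \<otimes>\<^bsub>A\<^esub> b') x"
  proof (cases "x \<in> carrier G")
    case True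
    let ?Y = "{y \<in> carrier G. a y \<noteq> \<zero>\<^bsub>k\<^esub>}"
    have c: "a y \<in> carrier k" "b y \<in> carrier k" "b' y \<in> carrier k" for y using assms cl by auto
    have "(a \<otimes>\<^bsub>A\<^esub> (b \<oplus>\<^bsub>A\<^esub> b')) x = (\<Oplus>\<^bsub>k\<^esub>y\<in>?Y. a y \<otimes>\<^bsub>k\<^esub> (b \<oplus>\<^bsub>A\<^esub> b') (inv y \<otimes> x))"
      using True by (simp add: group_algebra_def)
    also have "\<dots> = (\<Oplus>\<^bsub>k\<^esub>y\<in>?Y. a y \<otimes>\<^bsub>k\<^esub> b (inv y \<otimes> x) \<oplus>\<^bsub>k\<^esub> a y \<otimes>\<^bsub>k\<^esub> b' (inv y \<otimes> x))"
      using c by (intro k.finsum_cong') (auto simp: k.r_distr)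
    also have "\<dots> = (\<Oplus>\<^bsub>k\<^esub>y\<in>?Y. a y \<otimes>\<^bsub>k\<^esub> b (inv y \<otimes> x)) \<oplus>\<^bsub>k\<^esub> (\<Oplus>\<^bsub>k\<^esub>y\<in>?Y. a y \<otimes>\<^bsub>k\<^esub> b' (inv y \<otimes> x))"
      using c by (intro k.finsum_addf) auto
    also have "\<dots> = (a \<otimes>\<^bsub>A\<^esub> b) x \<oplus>\<^bsub>k\<^esub> (a \<otimes>\<^bsub>A\<^esub> b') x"
      using True by (simp add: group_algebra_def)
    finally show ?thesis by simp
  qed (simp add: A_mult_outside)
qed

lemma A_mult_sing:
  assumes "g \<in> carrier G" "h \<in> carrier G" "c \<in> carrier k" "c' \<in> carrier k"
  shows "sing k g c \<otimes>\<^bsub>A\<^esub> sing k h c' = sing k (g \<otimes> h) (c \<otimes>\<^bsub>k\<^esub> c')"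
proof
  fix x
  show "(sing k g c \<otimes>\<^bsub>A\<^esub> sing k h c') x = sing k (g \<otimes> h) (c \<otimes>\<^bsub>k\<^esub> c') x"
  proof (cases "x \<in> carrier G")
    case True
    have "(sing k g c \<otimes>\<^bsub>A\<^esub> sing k h c') x = (\<Oplus>\<^bsub>k\<^esub>y\<in>{g}. sing k g c y \<otimes>\<^bsub>k\<^esub> sing k h c' (inv y \<otimes> x))"
      using assms by (intro A_mult_eq sing_A True) (auto simp: sing_def)
    also have "\<dots> = c \<otimes>\<^bsub>k\<^esub> sing k h c' (inv g \<otimes> x)"
      using assms by (simp add: sing_def)
    also have "inv g \<otimes> x = h \<longleftrightarrow> x = g \<otimes> h"
      using assms True by (metis G.inv_solve_left)
    then have "c \<otimes>\<^bsub>k\<^esub> sing k h c' (inv g \<otimes> x) = sing k (g \<otimes> h) (c \<otimes>\<^bsub>k\<^esub> c') x"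
      using assms by (simp add: sing_def)
    finally show ?thesis .
  qed (use assms in \<open>auto simp: A_mult_outside sing_def\<close>)
qed

lemma A_mult_closed:
  assumes "a \<in> carrier A" "b \<in> carrier A" shows "a \<otimes>\<^bsub>A\<^esub> b \<in> carrier A"
proof -
  have "\<forall>b \<in> carrier A. a \<otimes>\<^bsub>A\<^esub> b \<in> carrier A" if "a \<in> fin_supp k (carrier G)" for a
    using k_ab that
  proof (induction a rule: fin_supp_induct)
    case zero
    show ?case
    proof
      fix b assume "b \<in> carrier A"
      have "(\<lambda>i. \<zero>\<^bsub>k\<^esub>) \<otimes>\<^bsub>A\<^esub> b = (\<lambda>i. \<zero>\<^bsub>k\<^esub>)" by (auto simp: group_algebra_def)
      then show "(\<lambda>i. \<zero>\<^bsub>k\<^esub>) \<otimes>\<^bsub>A\<^esub> b \<in> carrier A" by (simp add: fin_supp_zero[OF k_ab])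
    qed
  next
    case (add f i r)
    show ?case
    proof
      fix b assume b: "b \<in> carrier A"
      have s: "sing k i r \<otimes>\<^bsub>A\<^esub> b \<in> carrier A"
        using k_ab b[simplified]
      proof (induction b rule: fin_supp_induct)
        case zero
        have "sing k i r \<otimes>\<^bsub>A\<^esub> sing k i \<zero>\<^bsub>k\<^esub> \<in> carrier A"
          using add by (subst A_mult_sing) (auto simp: fin_supp_sing[OF k_ab])
        then show ?case by (simp add: sing_def)
      next
        case (add f' i' r')
        have *: "sing k i r \<otimes>\<^bsub>A\<^esub> sing k i' r' \<in> carrier A"
          using \<open>i \<in> carrier G\<close> \<open>r \<in> carrier k\<close> add by (subst A_mult_sing) (auto simp: fin_supp_sing[OF k_ab])
        show ?case
          using A_mult_r_distr[OF sing_A[OF \<open>i \<in> carrier G\<close> \<open>r \<in> carrier k\<close>] sing_A[OF add(2,3)], of f'] add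
            A_ab.a_closed[OF * add(5)] by simp
      qed
      show "(\<lambda>j. sing k i r j \<oplus>\<^bsub>k\<^esub> f j) \<otimes>\<^bsub>A\<^esub> b \<in> carrier A"
        using A_mult_l_distr[OF sing_A[OF add(2,3)], of f b] add b A_ab.a_closed[OF s, of "f \<otimes>\<^bsub>A\<^esub> b"] by simp
    qed
  qed
  then show ?thesis using assms by simp
qed

lemma A_mult_add_hom:
  "a \<in> carrier A ==> (\<lambda>b. a \<otimes>\<^bsub>A\<^esub> b) \<in> add_hom A A"
  "b \<in> carrier A ==> (\<lambda>a. a \<otimes>\<^bsub>A\<^esub> b) \<in> add_hom A A"
  by (intro add_homI A_mult_closed A_mult_l_distr A_mult_r_distr; simp)+

lemma A_mult_assoc:
  assumes "a \<in> carrier A" "b \<in> carrier A" "c \<in> carrier A"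
  shows "(a \<otimes>\<^bsub>A\<^esub> b) \<otimes>\<^bsub>A\<^esub> c = a \<otimes>\<^bsub>A\<^esub> (b \<otimes>\<^bsub>A\<^esub> c)"
proof -
  have 1: "(a \<otimes>\<^bsub>A\<^esub> b) \<otimes>\<^bsub>A\<^esub> sing k g r = a \<otimes>\<^bsub>A\<^esub> (b \<otimes>\<^bsub>A\<^esub> sing k g r)"
    if g: "g \<in> carrier G" "r \<in> carrier k" for g r
    by (rule biadd_eqI[OF A_spans A_spans A_abelian A_abelian A_abelian])
      (use assms g sing_A[OF g] in \<open>auto intro!: add_hom_comp[OF A_mult_add_hom(2) A_mult_add_hom(2)]
        add_hom_comp[OF A_mult_add_hom(1) A_mult_add_hom(2)] add_hom_comp[OF A_mult_add_hom(2) A_mult_add_hom(1)]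
        A_mult_add_hom A_mult_closed[simplified] simp: A_mult_sing G.m_assoc k.m_assoc\<close>)
  show ?thesis
    by (rule add_hom_eqI[OF A_spans A_abelian A_abelian A_mult_add_hom(1)[OF A_mult_closed]
          add_hom_comp[OF A_mult_add_hom(1) A_mult_add_hom(1)]]) (use 1 assms in auto)
qed

lemma A_one: "\<one>\<^bsub>A\<^esub> = sing k \<one> \<one>\<^bsub>k\<^esub>"
  by (simp add: group_basis_sing)

lemma A_ring: "ring A"
proof (rule ringI)
  have one: "\<one>\<^bsub>A\<^esub> \<in> carrier A" unfolding A_one by (rule sing_A) auto
  show "monoid A"
  proof (rule monoidI)
    fix x assume x: "x \<in> carrier A"
    show "\<one>\<^bsub>A\<^esub> \<otimes>\<^bsub>A\<^esub> x = x"
      by (rule add_hom_eqI[OF A_spans A_abelian A_abelian A_mult_add_hom(1)[OF one] add_hom_id _ x])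
        (auto simp: A_mult_sing group_basis_sing)
    show "x \<otimes>\<^bsub>A\<^esub> \<one>\<^bsub>A\<^esub> = x"
      by (rule add_hom_eqI[OF A_spans A_abelian A_abelian A_mult_add_hom(2)[OF one] add_hom_id _ x])
        (auto simp: A_mult_sing group_basis_sing)
  qed (use A_mult_closed A_mult_assoc one in auto)
qed (auto simp only: A_abelian A_mult_l_distr A_mult_r_distr)

sublocale A: ring A by (rule A_ring)

lemma A_smult_closed: "c \<in> carrier k ==> a \<in> carrier A ==> c \<odot>\<^bsub>A\<^esub> a \<in> carrier A"
  by (simp add: fin_supp_smult[OF k.ring_axioms])

lemma A_smult_add_hom: "c \<in> carrier k ==> (\<lambda>a. c \<odot>\<^bsub>A\<^esub> a) \<in> add_hom A A"
  by (rule add_homI) (auto simp: fin_supp_smult[OF k.ring_axioms] cl k.r_distr)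

lemma smult_sing: "c \<in> carrier k ==> c \<odot>\<^bsub>A\<^esub> sing k g r = sing k g (c \<otimes>\<^bsub>k\<^esub> r)"
  by (auto simp: sing_def)

lemma A_algebra: "assoc_algebra k A"
proof (intro assoc_algebra.intro assoc_algebra_axioms.intro)
  show "module k A"
    by (rule moduleI) (auto simp: k.cring_axioms A_abelian fin_supp_smult[OF k.ring_axioms] cl k.l_distr k.r_distr k.m_assoc)
  show "ring A" by (rule A_ring)
next
  fix c x y assume c: "c \<in> carrier k" and xy: "x \<in> carrier A" "y \<in> carrier A"
  note * = add_hom_comp[OF A_smult_add_hom A_mult_add_hom(2)] add_hom_comp[OF A_smult_add_hom A_mult_add_hom(1)]
    add_hom_comp[OF A_mult_add_hom(2) A_smult_add_hom] add_hom_comp[OF A_mult_add_hom(1) A_smult_add_hom]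
    A_mult_add_hom A_smult_closed
  show "(c \<odot>\<^bsub>A\<^esub> x) \<otimes>\<^bsub>A\<^esub> y = c \<odot>\<^bsub>A\<^esub> (x \<otimes>\<^bsub>A\<^esub> y)"
    by (rule biadd_eqI[OF A_spans A_spans A_abelian A_abelian A_abelian _ _ _ _ _ xy])
      (use c * in \<open>auto simp only: smult_sing A_mult_sing k.m_assoc k.m_closed mem_Collect_eq\<close>)
  show "x \<otimes>\<^bsub>A\<^esub> (c \<odot>\<^bsub>A\<^esub> y) = c \<odot>\<^bsub>A\<^esub> (x \<otimes>\<^bsub>A\<^esub> y)"
    by (rule biadd_eqI[OF A_spans A_spans A_abelian A_abelian A_abelian _ _ _ _ _ xy])
      (use c * in \<open>auto simp only: smult_sing A_mult_sing k.m_lcomm k.m_closed mem_Collect_eq\<close>)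
qed

end

section \<open>Free abelian groups\<close>

text \<open>The free abelian group in additive notation, so that it can be domain or codomain of an
  \<open>add_hom\<close>.\<close>

definition frag_group :: "'a set \<Rightarrow> ('a \<Rightarrow>\<^sub>0 int) ring" where
  "frag_group Gs = \<lparr>carrier = carrier (free_Abelian_group Gs), monoid.mult = undefined, one = undefined,
     ring.zero = 0, ring.add = (+)\<rparr>"

lemma frag_group_simps [simp]:
  "carrier (frag_group Gs) = {u. keys u \<subseteq> Gs}" "\<zero>\<^bsub>frag_group Gs\<^esub> = 0"
  "u \<oplus>\<^bsub>frag_group Gs\<^esub> v = u + v"
  by (auto simp: frag_group_def)

lemma frag_abelian: "abelian_group (frag_group Gs)"
  by (rule abelian_group_of_comm_group[OF abelian_free_Abelian_group[of Gs]])
    (auto simp: frag_group_def free_Abelian_group_def)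

lemma frag_group_neg: "keys u \<subseteq> Gs ==> \<ominus>\<^bsub>frag_group Gs\<^esub> u = - u"
  by (rule abelian_group.minus_equality[OF frag_abelian]) auto

lemma frag_group_minus:
  "keys u \<subseteq> Gs ==> keys v \<subseteq> Gs ==> u \<ominus>\<^bsub>frag_group Gs\<^esub> v = u - v"
  by (simp add: a_minus_def frag_group_neg)

lemma frag_group_spans: "spans (frag_group Gs) (frag_of ` Gs)"
proof (rule spansI)
  fix P x
  assume x: "x \<in> carrier (frag_group Gs)" and P: "P \<zero>\<^bsub>frag_group Gs\<^esub>" "\<And>b. b \<in> frag_of ` Gs ==> P b"
    "\<And>x. x \<in> carrier (frag_group Gs) ==> P x ==> P (\<ominus>\<^bsub>frag_group Gs\<^esub> x)"
    "\<And>x y. x \<in> carrier (frag_group Gs) ==> y \<in> carrier (frag_group Gs) ==> P x ==> P y ==> P (x \<oplus>\<^bsub>frag_group Gs\<^esub> y)"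
  have "keys x \<subseteq> Gs" using x by simp
  then show "P x"
  proof (rule free_Abelian_group_induct)
    fix u v assume "keys u \<subseteq> Gs" "keys v \<subseteq> Gs" "P u" "P v"
    then show "P (u - v)" using P(3)[of v] P(4)[of u "- v"] by (simp add: frag_group_neg)
  qed (use P in auto)
qed auto

lemma frag_group_universal:
  assumes "abelian_group B" "\<And>x. x \<in> Gs ==> f x \<in> carrier B"
  obtains h where "h \<in> add_hom (frag_group Gs) B" "\<And>x. x \<in> Gs ==> h (frag_of x) = f x"
proof -
  have "comm_group (add_monoid B)" using abelian_group.a_comm_group[OF assms(1)] .
  moreover have "f ` Gs \<subseteq> carrier (add_monoid B)" using assms(2) by auto
  ultimately obtain h where h: "h \<in> hom (free_Abelian_group Gs) (add_monoid B)" "\<And>x. x \<in> Gs ==> h (frag_of x) = f x"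
    using comm_group.free_Abelian_group_universal by metis
  have "h \<in> add_hom (frag_group Gs) B"
    using h(1) by (auto simp: hom_def add_hom_def)
  with h(2) show ?thesis by (intro that)
qed

lemma keys_sum_subset:
  assumes "\<And>i. i \<in> I ==> keys (f i) \<subseteq> Y" shows "keys (sum f I) \<subseteq> Y"
  using order_trans[OF keys_sum[of f I] UN_least] assms by blast

lemma frag_extend_add_hom:
  assumes "\<And>x. x \<in> Gs ==> keys (f x) \<subseteq> Y"
  shows "frag_extend f \<in> add_hom (frag_group Gs) (frag_group Y)"
  using assms by (intro add_homI) (auto simp: frag_extend_add dest!: subsetD[OF keys_frag_extend])

lemma frag_extend_frag_group:
  "(\<And>x. x \<in> Gs ==> keys (f x) \<subseteq> Y) ==> keys u \<subseteq> Gs ==> keys (frag_extend f u) \<subseteq> Y"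
  using keys_frag_extend[of f u] by blast

section \<open>The standard resolution\<close>

lemma map_take_drop_nth:
  "map f (take i xs @ drop (Suc i) xs) = take i (map f xs) @ drop (Suc i) (map f xs)"
  by (simp add: take_map drop_map)

locale grp = G: group G for G :: "('g, 't) monoid_scheme" (structure)
begin

sublocale ZG: group_alg "\<Z>" G
  by (intro group_alg.intro int_is_cring G.is_group)

abbreviation "R \<equiv> integral_group_ring G"
abbreviation "\<G> \<equiv> carrier G"
abbreviation "gmap g \<equiv> map (monoid.mult G g)"

definition del :: "'g \<Rightarrow> 'g \<Rightarrow> int" where "del g = group_basis \<Z> g"

lemma del_sing: "del g = sing \<Z> g 1"
  by (simp add: del_def group_basis_sing)

lemma del_closed [simp]: "g \<in> \<G> ==> del g \<in> carrier R"
  unfolding del_sing by (rule ZG.sing_A) auto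

lemma del_fin_supp [simp]: "g \<in> \<G> ==> del g \<in> fin_supp \<Z> (\<G>)"
  using del_closed by simp

lemma del_mult [simp]: "g \<in> \<G> ==> h \<in> \<G> ==> del g \<otimes>\<^bsub>R\<^esub> del h = del (g \<otimes> h)"
  unfolding del_sing by (simp add: ZG.A_mult_sing)

lemma del_one: "\<one>\<^bsub>R\<^esub> = del \<one>"
  by (simp add: del_def)

lemma Z_sing_add:
  "sing \<Z> g (c + c') = sing \<Z> g c \<oplus>\<^bsub>R\<^esub> sing \<Z> g c'"
  by (auto simp: sing_def)

text \<open>Over \<int> the group elements alone generate additively, the coefficients being
  iterated sums. In \<open>A_spans\<close> the scalars of \<open>k\<close> have to be kept.\<close>

lemma R_spans: "spans R (del ` \<G>)"
proof (rule spans_trans[OF ZG.A_abelian ZG.A_spans])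
  fix P b
  assume b: "b \<in> {sing \<Z> g c | g c. g \<in> \<G> \<and> c \<in> UNIV}"
    and P: "P \<zero>\<^bsub>R\<^esub>" "\<And>b. b \<in> del ` \<G> ==> P b" "\<And>x. x \<in> carrier R ==> P x ==> P (\<ominus>\<^bsub>R\<^esub> x)"
    "\<And>x y. x \<in> carrier R ==> y \<in> carrier R ==> P x ==> P y ==> P (x \<oplus>\<^bsub>R\<^esub> y)"
  from b obtain g c where gc: "b = sing \<Z> g c" "g \<in> \<G>" by auto
  have s: "sing \<Z> g c \<in> carrier R" for c using gc by (intro ZG.sing_A) auto
  have p: "P (sing \<Z> g (int n))" for n
  proof (induction n)
    case 0
    have "sing \<Z> g 0 = \<zero>\<^bsub>R\<^esub>" by (auto simp: sing_def)
    then show ?case using P(1) by simp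
  next
    case (Suc n)
    have "P (sing \<Z> g (1::int))" using P(2) gc by (auto simp: del_sing)
    then show ?case using P(4)[OF s s, of 1 "int n"] Suc by (simp only: Z_sing_add of_nat_Suc)
  qed
  have "P (sing \<Z> g c)"
  proof (cases "c \<ge> 0")
    case True
    then show ?thesis using p[of "nat c"] by simp
  next
    case False
    have "\<ominus>\<^bsub>R\<^esub> sing \<Z> g (int (nat (- c))) = sing \<Z> g c"
      by (rule ZG.A_ab.minus_equality) (use False s in \<open>auto simp: sing_def fun_eq_iff\<close>)
    then show ?thesis using P(3)[OF s p[of "nat (- c)"]] by simp
  qed
  then show "P b" using gc by simp
qed auto

definition Gs :: "nat \<Rightarrow> 'g list set" where
  "Gs N = {xs. length xs = N \<and> set xs \<subseteq> \<G>}"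

definition gact :: "'g \<Rightarrow> ('g list \<Rightarrow>\<^sub>0 int) \<Rightarrow> 'g list \<Rightarrow>\<^sub>0 int" where
  "gact g = frag_extend (\<lambda>xs. frag_of (map (monoid.mult G g) xs))"

text \<open>One formula for all lengths: on tuples with a single entry it yields the empty tuple, so
  the augmentation appears as the lowest differential.\<close>

definition bd :: "('g list \<Rightarrow>\<^sub>0 int) \<Rightarrow> 'g list \<Rightarrow>\<^sub>0 int" where
  "bd = standard_differential 0"

text \<open>Coning with vertex \<open>g\<close>: a contraction of the augmented complex that is
  additive but not equivariant.\<close>

definition cone :: "'g \<Rightarrow> ('g list \<Rightarrow>\<^sub>0 int) \<Rightarrow> 'g list \<Rightarrow>\<^sub>0 int" where
  "cone g = frag_extend (\<lambda>xs. frag_of (g # xs))"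

abbreviation "Sg N \<equiv> frag_group (Gs N)"
abbreviation "ch N \<equiv> carrier (Sg N)"

lemma standard_differential_bd: "standard_differential n = bd"
  by (simp add: bd_def standard_differential_def fun_eq_iff)

lemma bd_frag_of: "bd (frag_of xs) = (\<Sum>i<length xs. frag_cmul ((- 1) ^ i) (frag_of (take i xs @ drop (Suc i) xs)))"
  by (simp add: bd_def standard_differential_def)

lemma bd_add: "bd (u + v) = bd u + bd v" and bd_diff: "bd (u - v) = bd u - bd v" and bd_0 [simp]: "bd 0 = 0"
  by (simp_all add: bd_def standard_differential_def frag_extend_add frag_extend_diff)

text \<open>Deleting the first entry leaves \<open>xs\<close>; every other deletion keeps
  \<open>x\<close> and occurs one place later, hence with the opposite sign.\<close>

lemma bd_Cons: "bd (frag_of (x # xs)) = frag_of xs - cone x (bd (frag_of xs))"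
proof -
  have "cone x (bd (frag_of xs)) = (\<Sum>i<length xs. frag_cmul ((- 1) ^ i) (frag_of (x # take i xs @ drop (Suc i) xs)))"
    unfolding bd_frag_of cone_def by (subst frag_extend_sum) (auto simp: frag_extend_cmul)
  then show ?thesis
    unfolding bd_frag_of
    by (simp add: sum.lessThan_Suc_shift sum_negf[symmetric] del: sum.lessThan_Suc)
qed

lemma cone_diff: "cone g (u - v) = cone g u - cone g v" and cone_add: "cone g (u + v) = cone g u + cone g v"
  by (simp_all add: cone_def frag_extend_diff frag_extend_add)

lemma bd_cone: "bd (cone g u) = u - cone g (bd u)"
  using subset_UNIV[of "keys u"]
proof (induction u rule: frag_induction)
  case (one xs)
  show ?case using bd_Cons[of g xs] by (simp add: cone_def)
next
  case (diff a b)
  then show ?case by (simp add: cone_diff bd_diff)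
qed (simp add: cone_def)

lemma cone_0 [simp]: "cone g 0 = 0"
  by (simp add: cone_def)

text \<open>Induction on the tuple replaces the cancellation in a double sum: by
  \<open>bd_Cons\<close> and \<open>bd_cone\<close> the two copies of \<open>bd (frag_of xs)\<close>
  cancel.\<close>

lemma bd_bd: "bd (bd u) = 0"
  using subset_UNIV[of "keys u"]
proof (induction u rule: frag_induction)
  case (one xs)
  show ?case
  proof (induction xs)
    case Nil
    show ?case by (simp add: bd_frag_of)
  next
    case (Cons x xs)
    then show ?case by (simp add: bd_Cons bd_diff bd_cone)
  qed
qed (simp_all add: bd_diff)

lemma gact_frag_of: "gact g (frag_of xs) = frag_of (gmap g xs)"
  and gact_add: "gact g (u + v) = gact g u + gact g v"
  and gact_diff: "gact g (u - v) = gact g u - gact g v"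
  and gact_0 [simp]: "gact g 0 = 0"
  by (simp_all add: gact_def frag_extend_add frag_extend_diff)

lemma bd_gact: "bd (gact g u) = gact g (bd u)"
  using subset_UNIV[of "keys u"]
proof (induction u rule: frag_induction)
  case (one xs)
  have "gact g (bd (frag_of xs)) = (\<Sum>i<length xs. frag_cmul ((- 1) ^ i) (frag_of (gmap g (take i xs @ drop (Suc i) xs))))"
    unfolding bd_frag_of gact_def by (subst frag_extend_sum) (auto simp: frag_extend_cmul)
  then show ?case
    unfolding gact_frag_of bd_frag_of map_take_drop_nth by simp
qed (simp_all add: bd_diff gact_diff)

lemma Gs_map: "g \<in> \<G> ==> xs \<in> Gs N ==> gmap g xs \<in> Gs N"
  by (auto simp: Gs_def)

lemma gact_hom: "g \<in> \<G> ==> gact g \<in> add_hom (Sg N) (Sg N)"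
  unfolding gact_def by (rule frag_extend_add_hom) (auto simp: Gs_map)

lemma cone_hom: "g \<in> \<G> ==> cone g \<in> add_hom (Sg N) (Sg (Suc N))"
  unfolding cone_def by (rule frag_extend_add_hom) (auto simp: Gs_def)

lemma bd_hom: "bd \<in> add_hom (Sg (Suc N)) (Sg N)"
  unfolding bd_def standard_differential_def
proof (rule frag_extend_add_hom)
  fix xs assume xs: "xs \<in> Gs (Suc N)"
  have "take i xs @ drop (Suc i) xs \<in> Gs N" if "i < length xs" for i
    using xs that by (auto simp: Gs_def dest: in_set_takeD in_set_dropD)
  then have "keys (frag_cmul ((- 1) ^ i) (frag_of (take i xs @ drop (Suc i) xs))) \<subseteq> Gs N" if "i < length xs" for i
    using that by (auto simp: keys_frag_of)
  then show "keys (\<Sum>i<length xs. frag_cmul ((- 1) ^ i) (frag_of (take i xs @ drop (Suc i) xs))) \<subseteq> Gs N"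
    by (intro keys_sum_subset) simp
qed

lemma gact_gact:
  assumes "g \<in> \<G>" "h \<in> \<G>" "u \<in> ch N"
  shows "gact g (gact h u) = gact (g \<otimes> h) u"
proof (rule add_hom_eqI[OF frag_group_spans frag_abelian frag_abelian add_hom_comp[OF gact_hom gact_hom] gact_hom _ assms(3)])
  fix b assume "b \<in> frag_of ` Gs N"
  then obtain xs where xs: "b = frag_of xs" "xs \<in> Gs N" by auto
  then show "gact g (gact h b) = gact (g \<otimes> h) b"
    using assms by (auto simp: gact_frag_of Gs_def G.m_assoc frag_of_eq)
qed (use assms in auto)

lemma gact_one:
  assumes "u \<in> ch N"
  shows "gact \<one> u = u"
proof (rule add_hom_eqI[OF frag_group_spans frag_abelian frag_abelian gact_hom add_hom_id _ assms])
  fix b assume "b \<in> frag_of ` Gs N"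
  then show "gact \<one> b = b"
    by (auto simp: gact_frag_of Gs_def frag_of_eq subset_iff intro!: map_idI)
qed auto

abbreviation "S n \<equiv> standard_resolution G n"

lemma S_simps [simp]:
  "carrier (S n) = {u. keys u \<subseteq> Gs (Suc n)}" "\<zero>\<^bsub>S n\<^esub> = 0" "u \<oplus>\<^bsub>S n\<^esub> v = u + v"
  "r \<odot>\<^bsub>S n\<^esub> u = (\<Sum>g | g \<in> \<G> \<and> r g \<noteq> 0. frag_cmul (r g) (gact g u))"
  by (simp_all add: standard_resolution_def Gs_def gact_def set_eq_iff)

lemma S_add_hom: "add_hom (S n) M = add_hom (Sg (Suc n)) M" "add_hom M (S n) = add_hom M (Sg (Suc n))"
  by (rule add_hom_cong; simp add: standard_resolution_def frag_group_def free_Abelian_group_def Gs_def)+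

lemma S_abelian: "abelian_group (S n)"
  by (rule abelian_group_of_comm_group[OF abelian_group.a_comm_group[OF frag_abelian[of "Gs (Suc n)"]]])
    (auto simp: standard_resolution_def frag_group_def free_Abelian_group_def Gs_def)

lemma S_spans: "spans (S n) (frag_of ` Gs (Suc n))"
proof -
  have "\<ominus>\<^bsub>S n\<^esub> x = \<ominus>\<^bsub>Sg (Suc n)\<^esub> x" for x
    by (simp add: a_inv_def m_inv_def standard_resolution_def frag_group_def free_Abelian_group_def Gs_def)
  then show ?thesis using frag_group_spans[of "Gs (Suc n)"] unfolding spans_def by simp
qed

lemma S_neg: "u \<in> carrier (S n) ==> \<ominus>\<^bsub>S n\<^esub> u = - u"
  by (rule abelian_group.minus_equality[OF S_abelian]) auto

lemma S_minus: "u \<in> carrier (S n) ==> v \<in> carrier (S n) ==> u \<ominus>\<^bsub>S n\<^esub> v = u - v"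
  by (simp add: a_minus_def S_neg)

lemma S_smult_del [simp]: "g \<in> \<G> ==> del g \<odot>\<^bsub>S n\<^esub> u = gact g u"
proof -
  assume g: "g \<in> \<G>"
  have "{h. h \<in> \<G> \<and> del g h \<noteq> 0} = {g}" using g by (auto simp: del_sing sing_def)
  then show ?thesis by (simp add: del_sing sing_def)
qed

lemma S_smult_sum:
  assumes "finite F" "F \<subseteq> \<G>" "{g. g \<in> \<G> \<and> r g \<noteq> 0} \<subseteq> F"
  shows "r \<odot>\<^bsub>S n\<^esub> u = (\<Sum>g\<in>F. frag_cmul (r g) (gact g u))"
  using assms by (auto intro!: sum.mono_neutral_left)

lemma S_left_module: "left_module R (S n)"
proof -
  have fin: "finite {g. g \<in> \<G> \<and> r g \<noteq> 0}" if "r \<in> carrier R" for r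
    using that by (auto simp: fin_supp_def)
  have cl: "r \<odot>\<^bsub>S n\<^esub> u \<in> carrier (S n)" if "r \<in> carrier R" "u \<in> carrier (S n)" for r u
  proof -
    have "frag_cmul (r g) (gact g u) \<in> carrier (S n)" if "g \<in> \<G>" for g
      using add_hom_closed[OF gact_hom[OF that], of u "Suc n"] \<open>u \<in> carrier (S n)\<close> keys_cmul[of "r g" "gact g u"] by auto
    then show ?thesis
      unfolding S_simps by (intro CollectI keys_sum_subset) auto
  qed
  have add1: "(r \<oplus>\<^bsub>R\<^esub> s) \<odot>\<^bsub>S n\<^esub> u = r \<odot>\<^bsub>S n\<^esub> u \<oplus>\<^bsub>S n\<^esub> s \<odot>\<^bsub>S n\<^esub> u" if "r \<in> carrier R" "s \<in> carrier R" for r s u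
  proof -
    let ?F = "{g. g \<in> \<G> \<and> r g \<noteq> 0} \<union> {g. g \<in> \<G> \<and> s g \<noteq> 0}"
    have F: "finite ?F" "?F \<subseteq> \<G>" using fin that by auto
    have "(r \<oplus>\<^bsub>R\<^esub> s) \<odot>\<^bsub>S n\<^esub> u = (\<Sum>g\<in>?F. frag_cmul ((r \<oplus>\<^bsub>R\<^esub> s) g) (gact g u))"
      by (rule S_smult_sum[OF F]) auto
    moreover have "r \<odot>\<^bsub>S n\<^esub> u = (\<Sum>g\<in>?F. frag_cmul (r g) (gact g u))"
      by (rule S_smult_sum[OF F]) auto
    moreover have "s \<odot>\<^bsub>S n\<^esub> u = (\<Sum>g\<in>?F. frag_cmul (s g) (gact g u))"
      by (rule S_smult_sum[OF F]) auto
    ultimately show ?thesis by (simp add: frag_cmul_distrib sum.distrib del: S_simps(4))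
  qed
  have add2: "r \<odot>\<^bsub>S n\<^esub> (u \<oplus>\<^bsub>S n\<^esub> v) = r \<odot>\<^bsub>S n\<^esub> u \<oplus>\<^bsub>S n\<^esub> r \<odot>\<^bsub>S n\<^esub> v" for r u v
    by (simp add: gact_add frag_cmul_distrib2 sum.distrib)
  have h1: "(\<lambda>r. r \<odot>\<^bsub>S n\<^esub> u) \<in> add_hom R (S n)" if "u \<in> carrier (S n)" for u
    by (rule add_homI) (use cl add1 that in blast)+
  have h2: "(\<lambda>u. r \<odot>\<^bsub>S n\<^esub> u) \<in> add_hom (S n) (S n)" if "r \<in> carrier R" for r
    by (rule add_homI) (use cl add2 that in blast)+
  show ?thesis
  proof (intro left_module.intro left_module_axioms.intro ZG.A_ring S_abelian cl add1 add2)
    fix a b x assume *: "a \<in> carrier R" "b \<in> carrier R" "x \<in> carrier (S n)"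
    show "(a \<otimes>\<^bsub>R\<^esub> b) \<odot>\<^bsub>S n\<^esub> x = a \<odot>\<^bsub>S n\<^esub> (b \<odot>\<^bsub>S n\<^esub> x)"
    proof (rule biadd_eqI[OF R_spans R_spans ZG.A_abelian ZG.A_abelian S_abelian _ _ _ _ _ *(1,2)])
      fix c d assume "c \<in> del ` \<G>" "d \<in> del ` \<G>"
      then show "(c \<otimes>\<^bsub>R\<^esub> d) \<odot>\<^bsub>S n\<^esub> x = c \<odot>\<^bsub>S n\<^esub> (d \<odot>\<^bsub>S n\<^esub> x)"
        using *(3) gact_gact[of _ _ x "Suc n"] by (auto simp del: S_simps(4))
    qed (use * cl in \<open>auto intro: add_hom_comp[OF ZG.A_mult_add_hom(1) h1] add_hom_comp[OF ZG.A_mult_add_hom(2) h1]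
        add_hom_comp[OF h1 h2] h1 simp del: S_simps(4) galg_simps(1)\<close>)
  next
    fix x assume "x \<in> carrier (S n)"
    then show "\<one>\<^bsub>R\<^esub> \<odot>\<^bsub>S n\<^esub> x = x"
      unfolding del_one using gact_one[of x "Suc n"] by (simp del: S_simps(4))
  qed auto
qed

declare S_simps(4) [simp del]

lemma S_hom_linear:
  assumes "f \<in> add_hom (S n) N" "left_module R N"
    and "\<And>g xs. g \<in> \<G> ==> xs \<in> Gs (Suc n) ==> f (frag_of (gmap g xs)) = del g \<odot>\<^bsub>N\<^esub> f (frag_of xs)"
    and "r \<in> carrier R" "x \<in> carrier (S n)"
  shows "f (r \<odot>\<^bsub>S n\<^esub> x) = r \<odot>\<^bsub>N\<^esub> f x"
  by (rule linear_on_spans[OF S_left_module assms(2,1) R_spans S_spans _ assms(4,5)])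
    (use assms(3) in \<open>auto simp: gact_frag_of\<close>)

text \<open>The module is free on the tuples with first entry 1: every tuple is the translate by its
  head of exactly one of them.\<close>

lemma S_projective: "projective_module R (S n)"
proof -
  \<comment> \<open>The basis consists of chains and not of tuples because
    \<open>projective_module\<close> takes its index set in the type of module elements.\<close>
  define I where "I = {frag_of xs | xs. xs \<in> Gs (Suc n) \<and> hd xs = \<one>}"
  define base where "base xs = gmap (inv hd xs) xs" for xs
  have hd: "hd xs \<in> \<G>" "xs \<noteq> []" if "xs \<in> Gs (Suc n)" for xs
    using that by (cases xs; auto simp: Gs_def)+
  have base: "frag_of (base xs) \<in> I" if "xs \<in> Gs (Suc n)" for xs
  proof -
    have "base xs \<in> Gs (Suc n)" unfolding base_def using that hd by (intro Gs_map) auto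
    moreover have "hd (base xs) = \<one>" using hd[OF that] by (simp add: base_def hd_map)
    ultimately show ?thesis by (auto simp: I_def)
  qed
  have base_map: "base (gmap g xs) = base xs" if "xs \<in> Gs (Suc n)" "g \<in> \<G>" for g xs
    using hd[OF that(1)] that
    by (auto simp: base_def hd_map Gs_def G.inv_mult_group G.m_assoc[symmetric] subset_iff)
      (simp add: G.m_assoc G.l_inv)
  note lF = free_module_left_module[OF ZG.A_ring]
  have i_cl: "sing R (frag_of (base xs)) (del (hd xs)) \<in> carrier (free_module R I)" if "xs \<in> Gs (Suc n)" for xs
    using that by (auto intro!: fin_supp_sing[OF ZG.A_abelian] simp: base hd)
  obtain i where i: "i \<in> add_hom (Sg (Suc n)) (free_module R I)"
    "\<And>xs. xs \<in> Gs (Suc n) ==> i (frag_of xs) = sing R (frag_of (base xs)) (del (hd xs))"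
    by (rule frag_group_universal[OF lmod_abelian[OF lF], of "Gs (Suc n)"
          "\<lambda>xs. sing R (frag_of (base xs)) (del (hd xs))"]) (rule i_cl, assumption, rule that)
  have i_lin: "i (r \<odot>\<^bsub>S n\<^esub> x) = r \<odot>\<^bsub>free_module R I\<^esub> i x" if "r \<in> carrier R" "x \<in> carrier (S n)" for r x
  proof (rule S_hom_linear[OF _ lF _ that])
    fix g xs assume "g \<in> \<G>" "xs \<in> Gs (Suc n)"
    then show "i (frag_of (gmap g xs)) = del g \<odot>\<^bsub>free_module R I\<^esub> i (frag_of xs)"
      using hd by (auto simp: i Gs_map base_map hd_map sing_def simp del: galg_simps)
  qed (use i in \<open>simp add: S_add_hom\<close>)
  obtain p where p: "p \<in> lmod_hom R (free_module R I) (S n)"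
    "\<And>j r. j \<in> I ==> r \<in> carrier R ==> p (sing R j r) = r \<odot>\<^bsub>S n\<^esub> j"
    by (rule free_module_lift[where R=R, OF S_left_module[of n], of I "\<lambda>j. j"]) (auto simp: I_def)
  have pi: "p (i x) = x" if "x \<in> carrier (S n)" for x
  proof (rule add_hom_eqI[OF S_spans S_abelian S_abelian add_hom_comp[OF _ lmod_hom_add_hom[OF p(1)]] add_hom_id _ that])
    show "i \<in> add_hom (S n) (free_module R I)" using i by (simp add: S_add_hom)
    fix b assume "b \<in> frag_of ` Gs (Suc n)"
    then obtain xs where xs: "b = frag_of xs" "xs \<in> Gs (Suc n)" by auto
    have "gmap (hd xs) (base xs) = xs"
      using hd[OF xs(2)] xs(2) by (auto simp: base_def Gs_def G.m_assoc[symmetric] subset_iff intro!: map_idI)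
    then show "p (i b) = b"
      using xs hd[OF xs(2)] base[OF xs(2)] by (simp add: i p gact_frag_of del: galg_simps)
  qed
  show ?thesis
    unfolding projective_module_def
  proof (intro conjI S_left_module exI ballI)
    show "restrict i (carrier (S n)) \<in> lmod_hom R (S n) (free_module R I)"
      by (rule lmod_homI[OF S_left_module]) (use i i_lin in \<open>simp_all add: S_add_hom\<close>)
    show "p \<in> lmod_hom R (free_module R I) (S n)" by (rule p)
    show "p (restrict i (carrier (S n)) x) = x" if "x \<in> carrier (S n)" for x
      using pi[OF that] that by simp
  qed
qed

section \<open>Augmentation and exactness of the standard resolution\<close>

abbreviation "Zt \<equiv> trivial_int_module G"

lemma Zt_simps [simp]: "carrier Zt = UNIV" "\<zero>\<^bsub>Zt\<^esub> = 0" "x \<oplus>\<^bsub>Zt\<^esub> y = x + y"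
  by (auto simp: trivial_int_module_def)

lemma Zt_smult_del: "g \<in> \<G> ==> del g \<odot>\<^bsub>Zt\<^esub> m = m"
proof -
  assume g: "g \<in> \<G>"
  have "{h. h \<in> \<G> \<and> del g h \<noteq> 0} = {g}" using g by (auto simp: del_sing sing_def)
  then show ?thesis by (simp add: trivial_int_module_def del_sing sing_def)
qed

text \<open>The sum of the coefficients. Collapsing all tuples to the empty one lets additivity be
  inherited from \<open>frag_extend\<close>.\<close>

definition aug :: "('g list \<Rightarrow>\<^sub>0 int) \<Rightarrow> int" where
  "aug u = Poly_Mapping.lookup (frag_extend (\<lambda>xs. frag_of ([]::'g list)) u) []"

lemma aug_frag_of [simp]: "aug (frag_of xs) = 1"
  by (simp add: aug_def)

lemma aug_hom: "aug \<in> add_hom (S 0) Zt"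
  by (rule add_homI) (simp_all add: aug_def frag_extend_add lookup_add)

lemma aug_diff: "aug (u - v) = aug u - aug v" and aug_0 [simp]: "aug 0 = 0"
  by (simp_all add: aug_def frag_extend_diff lookup_minus)

text \<open>Through this identification exactness at the augmentation becomes an instance of the
  cone identity.\<close>

lemma bd_length_1:
  assumes "u \<in> carrier (S 0)" shows "bd u = frag_cmul (aug u) (frag_of [])"
  using assms[simplified]
proof (induction u rule: frag_induction)
  case (one xs)
  then obtain x where "xs = [x]" by (auto simp: Gs_def length_Suc_conv)
  then show ?case by (simp add: bd_frag_of)
qed (simp_all add: bd_diff aug_diff frag_cmul_diff_distrib)

lemma S_bd_hom: "restrict bd (carrier (S (Suc n))) \<in> lmod_hom R (S (Suc n)) (S n)"
proof (rule lmod_homI[OF S_left_module])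
  show b: "bd \<in> add_hom (S (Suc n)) (S n)" using bd_hom[of "Suc n"] by (simp add: S_add_hom)
  show "bd (r \<odot>\<^bsub>S (Suc n)\<^esub> x) = r \<odot>\<^bsub>S n\<^esub> bd x" if "r \<in> carrier R" "x \<in> carrier (S (Suc n))" for r x
    by (rule S_hom_linear[OF b S_left_module _ that]) (simp add: bd_gact flip: gact_frag_of)
qed

lemma bd_closed: "u \<in> carrier (S (Suc n)) ==> bd u \<in> carrier (S n)"
  using add_hom_closed[OF bd_hom, of u "Suc n"] by simp

lemma cone_closed: "g \<in> \<G> ==> u \<in> carrier (S n) ==> cone g u \<in> carrier (S (Suc n))"
  using add_hom_closed[OF cone_hom, of g u "Suc n"] by simp

text \<open>The premise that \<open>Zt\<close> is a module is contained in the type FP hypothesis.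
  Exactness comes from the cone with vertex 1.\<close>

lemma S_resolution:
  assumes "left_module R Zt"
  shows "resolution R S (\<lambda>n. restrict bd (carrier (S (Suc n)))) (restrict aug (carrier (S 0))) Zt"
proof (intro resolution.intro augmented_complex.intro resolution_axioms.intro)
  show "restrict aug (carrier (S 0)) \<in> lmod_hom R (S 0) Zt"
  proof (rule lmod_homI[OF S_left_module aug_hom])
    show "aug (r \<odot>\<^bsub>S 0\<^esub> x) = r \<odot>\<^bsub>Zt\<^esub> aug x" if "r \<in> carrier R" "x \<in> carrier (S 0)" for r x
      by (rule S_hom_linear[OF aug_hom assms _ that]) (simp add: Zt_smult_del)
  qed
  show "restrict aug (carrier (S 0)) ` carrier (S 0) = carrier Zt"
  proof -
    have "aug (frag_cmul m (frag_of [\<one>])) = m" for m by (simp add: aug_def frag_extend_cmul)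
    moreover have "frag_cmul m (frag_of [\<one>]) \<in> carrier (S 0)" for m
      using keys_cmul[of m "frag_of [\<one>]"] by (auto simp: Gs_def)
    ultimately have "m \<in> aug ` carrier (S 0)" for m by (metis imageI)
    then show ?thesis by auto
  qed
next
  fix x assume x: "x \<in> carrier (S (Suc 0))"
  have "bd x \<in> carrier (S 0)" using x by (rule bd_closed)
  \<comment> \<open>The augmentation of a boundary is the coefficient of the empty tuple in
    \<open>bd (bd x) = 0\<close>.\<close>
  from bd_length_1[OF this, symmetric] have "frag_cmul (aug (bd x)) (frag_of ([] :: 'g list)) = 0" by (simp only: bd_bd)
  then show "restrict aug (carrier (S 0)) (restrict bd (carrier (S (Suc 0))) x) = \<zero>\<^bsub>Zt\<^esub>"
    using x \<open>bd x \<in> carrier (S 0)\<close> by simp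
next
  fix x assume x: "x \<in> carrier (S 0)" "restrict aug (carrier (S 0)) x = \<zero>\<^bsub>Zt\<^esub>"
  \<comment> \<open>Augmentation zero means \<open>bd x = 0\<close>, so the cone over
    \<open>x\<close> has boundary \<open>x\<close>.\<close>
  then have "bd (cone \<one> x) = x" using bd_length_1[OF x(1)] by (simp add: bd_cone)
  moreover have "cone \<one> x \<in> carrier (S (Suc 0))" by (rule cone_closed[OF G.one_closed x(1)])
  ultimately show "x \<in> restrict bd (carrier (S (Suc 0))) ` carrier (S (Suc 0))"
    by (intro image_eqI[where x="cone \<one> x"]) (simp_all only: restrict_apply')
next
  fix n x assume x: "x \<in> carrier (S (Suc n))" "restrict bd (carrier (S (Suc n))) x = \<zero>\<^bsub>S n\<^esub>"
  then have "bd (cone \<one> x) = x" by (simp add: bd_cone)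
  moreover have "cone \<one> x \<in> carrier (S (Suc (Suc n)))" by (rule cone_closed[OF G.one_closed x(1)])
  ultimately show "x \<in> restrict bd (carrier (S (Suc (Suc n)))) ` carrier (S (Suc (Suc n)))"
    by (intro image_eqI[where x="cone \<one> x"]) (simp_all only: restrict_apply')
next
  fix n x assume x: "x \<in> carrier (S (Suc (Suc n)))"
  then show "restrict bd (carrier (S (Suc n))) (restrict bd (carrier (S (Suc (Suc n)))) x) = \<zero>\<^bsub>S n\<^esub>"
    using bd_closed[OF x] by (simp add: bd_bd)
qed (use S_left_module assms S_bd_hom in auto)

end

section \<open>Cochains with values in an abelian group\<close>

lemma int_pow_add_hom:
  assumes "abelian_group M" "m \<in> carrier M"
  shows "(\<lambda>z::int. [z] \<cdot>\<^bsub>M\<^esub> m) \<in> add_hom \<Z> M"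
proof -
  interpret M: abelian_group M by fact
  show ?thesis using assms(2) by (intro add_homI) (auto simp: M.add.int_pow_mult)
qed

section \<open>Subgroups of a free abelian group of countable rank\<close>

abbreviation "freeN \<equiv> frag_group (UNIV :: nat set)"

text \<open>Kernels of maps out of \<open>freeN\<close> are of this form whatever the target, so the
  descending induction stays within one type of coefficients.\<close>

definition sub_freeN :: "(nat \<Rightarrow>\<^sub>0 int) set \<Rightarrow> (nat \<Rightarrow>\<^sub>0 int) ring" where
  "sub_freeN K = \<lparr>carrier = K, monoid.mult = undefined, one = undefined, ring.zero = 0, ring.add = (+)\<rparr>"

lemma sub_freeN_simps [simp]:
  "carrier (sub_freeN K) = K" "\<zero>\<^bsub>sub_freeN K\<^esub> = 0" "u \<oplus>\<^bsub>sub_freeN K\<^esub> v = u + v"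
  by (auto simp: sub_freeN_def)

definition subgrp :: "(nat \<Rightarrow>\<^sub>0 int) set \<Rightarrow> bool" where
  "subgrp K \<longleftrightarrow> 0 \<in> K \<and> (\<forall>x\<in>K. \<forall>y\<in>K. x - y \<in> K)"

lemma subgrp_add: "subgrp K ==> x \<in> K ==> y \<in> K ==> x + y \<in> K"
  unfolding subgrp_def by (metis diff_0 diff_minus_eq_add)

lemma subgrp_neg: "subgrp K ==> x \<in> K ==> - x \<in> K"
  unfolding subgrp_def by (metis diff_0)

lemma sub_freeN_abelian: "subgrp K ==> abelian_group (sub_freeN K)"
  by (rule abelian_groupI)
    (auto simp: subgrp_add add_ac subgrp_def[of K] intro!: bexI[OF _ subgrp_neg])

lemma freeN_pow [simp]: "[(z::int)] \<cdot>\<^bsub>freeN\<^esub> m = frag_cmul z m"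
proof -
  have "add_monoid freeN = free_Abelian_group UNIV"
    by (simp add: frag_group_def free_Abelian_group_def)
  then show ?thesis by (simp add: add_pow_def)
qed

lemma sub_freeN_pow:
  assumes "subgrp K" "m \<in> K" shows "[(z::int)] \<cdot>\<^bsub>sub_freeN K\<^esub> m = frag_cmul z m"
  using add_hom_int_pow[OF sub_freeN_abelian[OF assms(1)] frag_abelian[of UNIV], of "\<lambda>x. x" m z] assms(2)
  by (simp add: add_hom_def)

lemma lookup_add_hom: "(\<lambda>v. Poly_Mapping.lookup v i) \<in> add_hom (frag_group Y) \<Z>"
  by (rule add_homI) (auto simp: lookup_add)

context grp
begin

text \<open>\<open>N\<close> is the length of tuples, so the cohomological degree is
  \<open>N - 1\<close>. The last clause makes all cochains of length 0 vanish: then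
  \<open>b \<circ> bd\<close> with \<open>b\<close> in \<open>C 0 M\<close> is zero, and degree 0
  has no coboundaries although \<open>bd\<close> continues down to the empty tuple.\<close>

definition C :: "nat \<Rightarrow> ('m, 's) ring_scheme \<Rightarrow> (('g list \<Rightarrow>\<^sub>0 int) \<Rightarrow> 'm) set" where
  "C N M = {\<phi> \<in> add_hom (Sg N) M.
     (\<forall>xs\<in>Gs N. finite {g \<in> \<G>. \<phi> (frag_of (gmap g xs)) \<noteq> \<zero>\<^bsub>M\<^esub>}) \<and>
     (N = 0 \<longrightarrow> (\<forall>u\<in>ch N. \<phi> u = \<zero>\<^bsub>M\<^esub>))}"

lemma C_hom: "\<phi> \<in> C N M ==> \<phi> \<in> add_hom (Sg N) M"
  by (simp add: C_def)

lemma C_closed: "\<phi> \<in> C N M ==> u \<in> ch N ==> \<phi> u \<in> carrier M"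
  using add_hom_closed[OF C_hom] .

lemma C_finite:
  assumes "abelian_group M" "\<phi> \<in> C N M" "u \<in> ch N"
  shows "finite {g \<in> \<G>. \<phi> (gact g u) \<noteq> \<zero>\<^bsub>M\<^esub>}"
proof -
  interpret M: abelian_group M by fact
  note h = C_hom[OF assms(2)] and F = frag_abelian[of "Gs N"]
  have gcl: "gact g x \<in> ch N" if "g \<in> \<G>" "x \<in> ch N" for g x
    using add_hom_closed[OF gact_hom[OF that(1)] that(2)] .
  show ?thesis using frag_group_spans[of "Gs N"] F assms(3)
  proof (induction u rule: spans_induct)
    case zero
    have "\<phi> 0 = \<zero>\<^bsub>M\<^esub>" using add_hom_zero[OF F assms(1) h] by simp
    then show ?case by simp
  next
    case (base b)
    then show ?case using assms(2) by (auto simp: C_def gact_frag_of)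
  next
    case (neg x)
    have "\<phi> (gact g (\<ominus>\<^bsub>Sg N\<^esub> x)) = \<ominus>\<^bsub>M\<^esub> \<phi> (gact g x)" if "g \<in> \<G>" for g
      unfolding add_hom_neg[OF F F gact_hom[OF that] neg(1)] by (rule add_hom_neg[OF F assms(1) h gcl[OF that neg(1)]])
    then have "{g \<in> \<G>. \<phi> (gact g (\<ominus>\<^bsub>Sg N\<^esub> x)) \<noteq> \<zero>\<^bsub>M\<^esub>} \<subseteq> {g \<in> \<G>. \<phi> (gact g x) \<noteq> \<zero>\<^bsub>M\<^esub>}" by auto
    from finite_subset[OF this neg(2)] show ?case .
  next
    case (add x y)
    have "\<phi> (gact g (x \<oplus>\<^bsub>Sg N\<^esub> y)) = \<phi> (gact g x) \<oplus>\<^bsub>M\<^esub> \<phi> (gact g y)" if "g \<in> \<G>" for g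
      unfolding add_hom_add[OF gact_hom[OF that] add(1,2)] by (rule add_hom_add[OF h gcl[OF that add(1)] gcl[OF that add(2)]])
    then have "{g \<in> \<G>. \<phi> (gact g (x \<oplus>\<^bsub>Sg N\<^esub> y)) \<noteq> \<zero>\<^bsub>M\<^esub>} \<subseteq>
      {g \<in> \<G>. \<phi> (gact g x) \<noteq> \<zero>\<^bsub>M\<^esub>} \<union> {g \<in> \<G>. \<phi> (gact g y) \<noteq> \<zero>\<^bsub>M\<^esub>}" by auto
    from finite_subset[OF this] add(3,4) show ?case by blast
  qed
qed

text \<open>Equivariance of \<open>F\<close> makes the translates of \<open>F u\<close> the images
  of the translates of \<open>u\<close>, which preserves the finiteness condition. The last premise
  secures the vanishing at length 0.\<close>

lemma C_comp:
  assumes "abelian_group M" "\<phi> \<in> C N' M" "F \<in> add_hom (Sg N) (Sg N')"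
    and "\<And>g u. g \<in> \<G> ==> u \<in> ch N ==> F (gact g u) = gact g (F u)"
    and "\<And>u. N = 0 ==> u \<in> ch N ==> \<phi> (F u) = \<zero>\<^bsub>M\<^esub>"
  shows "(\<lambda>u. \<phi> (F u)) \<in> C N M"
  unfolding C_def
proof (intro CollectI conjI ballI impI)
  show "(\<lambda>u. \<phi> (F u)) \<in> add_hom (Sg N) M" by (rule add_hom_comp[OF assms(3) C_hom[OF assms(2)]])
  fix xs assume xs: "xs \<in> Gs N"
  then have f: "frag_of xs \<in> ch N" by simp
  have "{g \<in> \<G>. \<phi> (F (frag_of (gmap g xs))) \<noteq> \<zero>\<^bsub>M\<^esub>} = {g \<in> \<G>. \<phi> (gact g (F (frag_of xs))) \<noteq> \<zero>\<^bsub>M\<^esub>}"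
    using assms(4)[OF _ f] by (auto simp: gact_frag_of)
  with C_finite[OF assms(1,2) add_hom_closed[OF assms(3) f]]
  show "finite {g \<in> \<G>. \<phi> (F (frag_of (gmap g xs))) \<noteq> \<zero>\<^bsub>M\<^esub>}" by simp
qed (use assms(5) in auto)

lemma C_post:
  assumes "abelian_group M" "abelian_group M'" "\<phi> \<in> C N M" "p \<in> add_hom M M'"
  shows "(\<lambda>u. p (\<phi> u)) \<in> C N M'"
  unfolding C_def
proof (intro CollectI conjI ballI impI)
  have p0: "p \<zero>\<^bsub>M\<^esub> = \<zero>\<^bsub>M'\<^esub>" by (rule add_hom_zero[OF assms(1,2,4)])
  show "(\<lambda>u. p (\<phi> u)) \<in> add_hom (Sg N) M'" by (rule add_hom_comp[OF C_hom[OF assms(3)] assms(4)])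
  fix xs assume xs: "xs \<in> Gs N"
  have "{g \<in> \<G>. p (\<phi> (frag_of (gmap g xs))) \<noteq> \<zero>\<^bsub>M'\<^esub>} \<subseteq> {g \<in> \<G>. \<phi> (frag_of (gmap g xs)) \<noteq> \<zero>\<^bsub>M\<^esub>}"
    using p0 by auto
  from finite_subset[OF this] show "finite {g \<in> \<G>. p (\<phi> (frag_of (gmap g xs))) \<noteq> \<zero>\<^bsub>M'\<^esub>}"
    using assms(3) xs by (simp add: C_def)
qed (use assms(3) add_hom_zero[OF assms(1,2,4)] in \<open>auto simp: C_def\<close>)

lemma C_plus:
  assumes "abelian_group M" "\<phi> \<in> C N M" "\<psi> \<in> C N M"
  shows "(\<lambda>u. \<phi> u \<oplus>\<^bsub>M\<^esub> \<psi> u) \<in> C N M"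
  unfolding C_def
proof (intro CollectI conjI ballI impI)
  interpret M: abelian_group M by fact
  show "(\<lambda>u. \<phi> u \<oplus>\<^bsub>M\<^esub> \<psi> u) \<in> add_hom (Sg N) M" by (rule add_hom_plus[OF assms(1) C_hom[OF assms(2)] C_hom[OF assms(3)]])
  fix xs assume xs: "xs \<in> Gs N"
  let ?x = "\<lambda>g. frag_of (gmap g xs)"
  have "{g \<in> \<G>. \<phi> (?x g) \<oplus>\<^bsub>M\<^esub> \<psi> (?x g) \<noteq> \<zero>\<^bsub>M\<^esub>} \<subseteq> {g \<in> \<G>. \<phi> (?x g) \<noteq> \<zero>\<^bsub>M\<^esub>} \<union> {g \<in> \<G>. \<psi> (?x g) \<noteq> \<zero>\<^bsub>M\<^esub>}"
    by auto
  from finite_subset[OF this] show "finite {g \<in> \<G>. \<phi> (?x g) \<oplus>\<^bsub>M\<^esub> \<psi> (?x g) \<noteq> \<zero>\<^bsub>M\<^esub>}"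
    using assms(2,3) xs by (simp add: C_def)
next
  interpret M: abelian_group M by fact
  fix u assume "N = 0" "u \<in> ch N"
  then show "\<phi> u \<oplus>\<^bsub>M\<^esub> \<psi> u = \<zero>\<^bsub>M\<^esub>" using assms(2,3) by (simp add: C_def)
qed

lemma C_uminus:
  assumes "abelian_group M" "\<phi> \<in> C N M" shows "(\<lambda>u. \<ominus>\<^bsub>M\<^esub> \<phi> u) \<in> C N M"
  by (rule C_post[OF assms(1,1,2) add_hom_uminus[OF assms(1) add_hom_id]])

lemma C_freeN_minus:
  assumes "\<phi> \<in> C N freeN" "\<psi> \<in> C N freeN" shows "(\<lambda>u. \<phi> u - \<psi> u) \<in> C N freeN"
  using C_plus[OF frag_abelian assms(1) C_uminus[OF frag_abelian assms(2)]]
  by (simp add: frag_group_neg)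

lemma C_zero: "abelian_group M ==> (\<lambda>u. \<zero>\<^bsub>M\<^esub>) \<in> C N M"
  by (simp add: C_def add_hom_const_zero)

lemma C_sub: "\<phi> \<in> C N (sub_freeN K) ==> \<phi> \<in> C N freeN"
  by (auto simp: C_def add_hom_def)

lemma C_subI: "\<phi> \<in> C N freeN ==> (\<And>u. u \<in> ch N ==> \<phi> u \<in> K) ==> \<phi> \<in> C N (sub_freeN K)"
  by (auto simp: C_def add_hom_def)

lemma C_bd:
  assumes "abelian_group M" "\<phi> \<in> C N M" shows "(\<lambda>u. \<phi> (bd u)) \<in> C (Suc N) M"
  by (rule C_comp[OF assms bd_hom]) (auto simp: bd_gact)

lemma bd_cl: "u \<in> ch (Suc N) ==> bd u \<in> ch N"
  by (rule add_hom_closed[OF bd_hom])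

end

text \<open>A homotopy idempotent \<open>T\<close> of the standard resolution, factoring through a finite complex of
  finitely generated modules; the degree of a chain is shifted by one, so that it is the length of its
  tuples.\<close>

locale fp_grp = grp +
  fixes T h :: "nat \<Rightarrow> ('a list \<Rightarrow>\<^sub>0 int) \<Rightarrow> ('a list \<Rightarrow>\<^sub>0 int)" and Y :: "nat \<Rightarrow> 'a list set" and l :: nat
  assumes T_hom: "\<And>n. T (Suc n) \<in> add_hom (Sg (Suc n)) (Sg (Suc n))"
    and T_gact: "\<And>n g u. g \<in> carrier G ==> u \<in> ch (Suc n) ==> T (Suc n) (gact g u) = gact g (T (Suc n) u)"
    and T_bd: "\<And>n u. u \<in> ch (Suc (Suc n)) ==> bd (T (Suc (Suc n)) u) = T (Suc n) (bd u)"
    and h_hom: "\<And>N. h N \<in> add_hom (Sg N) (Sg (Suc N))"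
    and h_gact: "\<And>N g u. g \<in> carrier G ==> u \<in> ch N ==> h N (gact g u) = gact g (h N u)"
    and h_0: "\<And>u. h 0 u = 0"
    and h_homotopy: "\<And>n u. u \<in> ch (Suc n) ==> u = T (Suc n) u + (bd (h (Suc n) u) + h n (bd u))"
    and Y_finite: "\<And>n. finite (Y n)" and Y_sub: "\<And>n. Y n \<subseteq> Gs n"
    and T_keys: "\<And>n u. u \<in> ch (Suc n) ==>
       keys (T (Suc n) u) \<subseteq> (\<Union>g\<in>carrier G. gmap g ` Y (Suc n))"
    and T_top: "\<And>n u. n > l ==> u \<in> ch n ==> T n u = 0"
begin

text \<open>All chains \<open>T u\<close> are supported here. Since \<open>Y\<close> is finite, a
  cochain takes only finitely many values on these tuples.\<close>

definition GY :: "nat \<Rightarrow> 'a list set" where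
  "GY N = (\<Union>g\<in>\<G>. gmap g ` Y N)"

lemma GY_sub: "GY N \<subseteq> Gs N"
  using Y_sub by (auto simp: GY_def intro!: Gs_map)

lemma T_GY: "u \<in> ch (Suc n) ==> T (Suc n) u \<in> carrier (frag_group (GY (Suc n)))"
  using T_keys by (simp add: GY_def)

lemma C_T:
  assumes "abelian_group M" "\<phi> \<in> C (Suc n) M" shows "(\<lambda>u. \<phi> (T (Suc n) u)) \<in> C (Suc n) M"
  by (rule C_comp[OF assms T_hom]) (auto simp: T_gact)

lemma C_h:
  assumes "abelian_group M" "\<phi> \<in> C (Suc N) M" shows "(\<lambda>u. \<phi> (h N u)) \<in> C N M"
proof (rule C_comp[OF assms h_hom])
  fix u assume "N = 0"
  then show "\<phi> (h N u) = \<zero>\<^bsub>M\<^esub>"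
    using add_hom_zero[OF frag_abelian assms(1) C_hom[OF assms(2)]] by (simp add: h_0)
qed (auto simp: h_gact)

text \<open>On a cocycle the term \<open>bd (h u)\<close> of the homotopy disappears, so the cocycle
  differs from its composite with \<open>T\<close> by the coboundary of
  \<open>\<phi> \<circ> h\<close>.\<close>

lemma cocycle_T:
  assumes "abelian_group M" "\<phi> \<in> C (Suc n) M" "\<And>u. u \<in> ch (Suc (Suc n)) ==> \<phi> (bd u) = \<zero>\<^bsub>M\<^esub>"
    and u: "u \<in> ch (Suc n)"
  shows "\<phi> u = \<phi> (T (Suc n) u) \<oplus>\<^bsub>M\<^esub> \<phi> (h n (bd u))"
proof -
  interpret M: abelian_group M by fact
  note hom = C_hom[OF assms(2)]
  have cl: "T (Suc n) u \<in> ch (Suc n)" "h (Suc n) u \<in> ch (Suc (Suc n))" "h n (bd u) \<in> ch (Suc n)"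
    "bd (h (Suc n) u) \<in> ch (Suc n)"
    using add_hom_closed[OF T_hom u] add_hom_closed[OF h_hom u] add_hom_closed[OF h_hom bd_cl[OF u]] bd_cl by blast+
  have cl2: "bd (h (Suc n) u) + h n (bd u) \<in> ch (Suc n)"
    using abelian_monoid.a_closed[OF abelian_group.axioms(1)[OF frag_abelian] cl(4,3)] by simp
  have "\<phi> u = \<phi> (T (Suc n) u + (bd (h (Suc n) u) + h n (bd u)))" using h_homotopy[OF u] by simp
  also have "\<dots> = \<phi> (T (Suc n) u) \<oplus>\<^bsub>M\<^esub> (\<phi> (bd (h (Suc n) u)) \<oplus>\<^bsub>M\<^esub> \<phi> (h n (bd u)))"
    using add_hom_add[OF hom cl(1) cl2] add_hom_add[OF hom cl(4,3)] by simp
  finally show ?thesis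
    using assms(3)[OF cl(2)] C_closed[OF assms(2) cl(3)] by simp
qed

end

text \<open>Duality for \<int> unfolded into statements about cochains: \<open>Z_gen\<close>
  combines vanishing outside degree \<open>d\<close> with generation by \<open>c\<close>, and
  \<open>Z_inj\<close> says that the class of \<open>c\<close> has infinite order.\<close>

locale pd_grp = fp_grp +
  fixes c :: "('a list \<Rightarrow>\<^sub>0 int) \<Rightarrow> int" and d :: nat
  assumes c_C: "c \<in> C (Suc d) \<Z>"
    and c_cocycle: "\<And>u. u \<in> ch (Suc (Suc d)) ==> c (bd u) = 0"
    and Z_gen: "\<And>n \<phi>. \<phi> \<in> C (Suc n) \<Z> ==> (\<And>u. u \<in> ch (Suc (Suc n)) ==> \<phi> (bd u) = 0) ==>
      \<exists>m. \<exists>b\<in>C n \<Z>. (n \<noteq> d \<longrightarrow> m = 0) \<and> (\<forall>u\<in>ch (Suc n). \<phi> u = c u * m + b (bd u))"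
    and Z_inj: "\<And>m b. b \<in> C d \<Z> ==> (\<And>u. u \<in> ch (Suc d) ==> c u * m = b (bd u)) ==> m = 0"
begin

text \<open>One predicate for both halves of duality, vanishing for \<open>n \<noteq> d\<close> and
  surjectivity of \<open>m \<mapsto> [c m]\<close> for \<open>n = d\<close>, which keeps the
  descending induction uniform in the degree.\<close>

definition gen_by :: "nat \<Rightarrow> ('m, 's) ring_scheme \<Rightarrow> bool" where
  "gen_by n M \<longleftrightarrow> (\<forall>\<phi>\<in>C (Suc n) M. (\<forall>u\<in>ch (Suc (Suc n)). \<phi> (bd u) = \<zero>\<^bsub>M\<^esub>) \<longrightarrow>
     (\<exists>m\<in>carrier M. \<exists>b\<in>C n M. (n \<noteq> d \<longrightarrow> m = \<zero>\<^bsub>M\<^esub>) \<and>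
        (\<forall>u\<in>ch (Suc n). \<phi> u = [c u] \<cdot>\<^bsub>M\<^esub> m \<oplus>\<^bsub>M\<^esub> b (bd u))))"

lemma gen_byD:
  assumes "gen_by n M" "\<phi> \<in> C (Suc n) M" "\<And>u. u \<in> ch (Suc (Suc n)) ==> \<phi> (bd u) = \<zero>\<^bsub>M\<^esub>"
  obtains m b where "m \<in> carrier M" "b \<in> C n M" "n \<noteq> d ==> m = \<zero>\<^bsub>M\<^esub>"
    "\<And>u. u \<in> ch (Suc n) ==> \<phi> u = [c u] \<cdot>\<^bsub>M\<^esub> m \<oplus>\<^bsub>M\<^esub> b (bd u)"
  using assms unfolding gen_by_def by metis

lemma c_pow_C:
  assumes "abelian_group M" "m \<in> carrier M" shows "(\<lambda>u. [c u] \<cdot>\<^bsub>M\<^esub> m) \<in> C (Suc d) M"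
  by (rule C_post[OF ZG.k_ab assms(1) c_C int_pow_add_hom[OF assms]])

text \<open>Above the length of the finite resolution \<open>T\<close> is zero, and the homotopy
  exhibits every cocycle as a coboundary. This starts the descending induction.\<close>

lemma gen_by_top:
  assumes "abelian_group M" "Suc n > l" shows "gen_by n M"
  unfolding gen_by_def
proof (intro ballI impI)
  interpret M: abelian_group M by fact
  fix \<phi> assume \<phi>: "\<phi> \<in> C (Suc n) M" "\<forall>u\<in>ch (Suc (Suc n)). \<phi> (bd u) = \<zero>\<^bsub>M\<^esub>"
  have \<phi>0: "\<phi> 0 = \<zero>\<^bsub>M\<^esub>"
    using add_hom_zero[OF frag_abelian assms(1) C_hom[OF \<phi>(1)]] by simp
  have "\<phi> u = [c u] \<cdot>\<^bsub>M\<^esub> \<zero>\<^bsub>M\<^esub> \<oplus>\<^bsub>M\<^esub> \<phi> (h n (bd u))" if "u \<in> ch (Suc n)" for u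
    using cocycle_T[OF assms(1) \<phi>(1) _ that] \<phi>(2) T_top[OF assms(2) that] \<phi>0 by simp
  with C_h[OF assms(1) \<phi>(1)] show "\<exists>m\<in>carrier M. \<exists>b\<in>C n M. (n \<noteq> d \<longrightarrow> m = \<zero>\<^bsub>M\<^esub>) \<and>
        (\<forall>u\<in>ch (Suc n). \<phi> u = [c u] \<cdot>\<^bsub>M\<^esub> m \<oplus>\<^bsub>M\<^esub> b (bd u))"
    by (intro bexI[of _ "\<zero>\<^bsub>M\<^esub>"] bexI[of _ "\<lambda>u. \<phi> (h n u)"]) auto
qed

text \<open>Each of the finitely many tuples in \<open>Y\<close> has only finitely many translates
  on which the cochain is nonzero.\<close>

lemma finite_values:
  assumes "abelian_group M" "\<phi> \<in> C N M" shows "finite (\<phi> ` frag_of ` GY N)"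
proof -
  have "\<phi> ` frag_of ` GY N \<subseteq> insert \<zero>\<^bsub>M\<^esub> (\<Union>y\<in>Y N. (\<lambda>g. \<phi> (frag_of (gmap g y))) `
     {g \<in> \<G>. \<phi> (frag_of (gmap g y)) \<noteq> \<zero>\<^bsub>M\<^esub>})"
    by (auto simp: GY_def)
  moreover have "finite \<dots>"
    using assms(2) Y_finite[of N] Y_sub[of N] by (auto simp: C_def)
  ultimately show ?thesis by (rule finite_subset)
qed

lemma sum_cmul_lookup:
  assumes "finite I" "keys v \<subseteq> I"
  shows "(\<Sum>i\<in>I. frag_cmul (Poly_Mapping.lookup v i) (frag_of i)) = v"
proof -
  have "v = (\<Sum>i\<in>keys v. frag_cmul (Poly_Mapping.lookup v i) (frag_of i))"
    using frag_expansion[of v] by (simp add: frag_extend_def)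
  also have "\<dots> = (\<Sum>i\<in>I. frag_cmul (Poly_Mapping.lookup v i) (frag_of i))"
    using assms by (intro sum.mono_neutral_left) (auto simp: in_keys_iff)
  finally show ?thesis by simp
qed

lemma cmul_add_hom: "(\<lambda>z. frag_cmul z v) \<in> add_hom \<Z> freeN"
  by (rule add_homI) (auto simp: frag_cmul_distrib)

lemma C_sum:
  assumes "\<And>i. i \<in> I ==> b i \<in> C N freeN" "finite I"
  shows "(\<lambda>u. \<Sum>i\<in>I. b i u) \<in> C N freeN"
  using assms(2,1)
proof (induction I rule: finite_induct)
  case empty
  show ?case using C_zero[OF frag_abelian, where N=N] by simp
next
  case (insert i I)
  have "(\<lambda>u. b i u \<oplus>\<^bsub>freeN\<^esub> (\<Sum>i\<in>I. b i u)) \<in> C N freeN"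
    using insert by (intro C_plus[OF frag_abelian]) auto
  then show ?case using insert(1,2) by simp
qed


lemma add_hom_frag_mono: "\<phi> \<in> add_hom (frag_group Y1) M ==> Y2 \<subseteq> Y1 ==> \<phi> \<in> add_hom (frag_group Y2) M"
  by (auto simp: add_hom_def Pi_iff)

lemma keys_hom_subset:
  assumes "\<phi> \<in> add_hom (frag_group Y1) freeN" "\<And>x. x \<in> Y1 ==> keys (\<phi> (frag_of x)) \<subseteq> I"
    and "w \<in> carrier (frag_group Y1)"
  shows "keys (\<phi> w) \<subseteq> I"
  using frag_group_spans frag_abelian assms(3)
proof (induction w rule: spans_induct)
  case zero
  show ?case using add_hom_zero[OF frag_abelian frag_abelian assms(1)] by simp
next
  case (neg x)
  then show ?case using add_hom_neg[OF frag_abelian frag_abelian assms(1) neg(1)] by (simp add: frag_group_neg)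
next
  case (add x y)
  then show ?case using add_hom_add[OF assms(1) add(1,2)] keys_add[of "\<phi> x" "\<phi> y"] by auto
qed (use assms(2) in auto)

text \<open>Duality for \<int> is applied to each coordinate. Because
  \<open>\<phi> \<circ> T\<close> involves only the finitely many coordinates in \<open>I\<close>,
  the coordinate solutions can be summed to elements of \<open>freeN\<close>.\<close>

lemma gen_by_freeN: "gen_by n freeN"
  unfolding gen_by_def
proof (intro ballI impI)
  fix \<phi> assume \<phi>: "\<phi> \<in> C (Suc n) freeN" and cocyc: "\<forall>u\<in>ch (Suc (Suc n)). \<phi> (bd u) = \<zero>\<^bsub>freeN\<^esub>"
  note L = frag_abelian[of "UNIV :: nat set"]
  define I where "I = (\<Union>v\<in>\<phi> ` frag_of ` GY (Suc n). keys v)"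
  have I: "finite I" unfolding I_def by (rule finite_UN_I[OF finite_values[OF L \<phi>]]) simp
  have keys: "keys (\<phi> (T (Suc n) u)) \<subseteq> I" if "u \<in> ch (Suc n)" for u
    by (rule keys_hom_subset[OF add_hom_frag_mono[OF C_hom[OF \<phi>] GY_sub] _ T_GY[OF that]]) (auto simp: I_def)
  define p where "p i u = Poly_Mapping.lookup (\<phi> (T (Suc n) u)) i" for i u
  have p_C: "p i \<in> C (Suc n) \<Z>" for i
    unfolding p_def by (rule C_post[OF L ZG.k_ab C_T[OF L \<phi>] lookup_add_hom])
  have p_cocyc: "p i (bd u) = 0" if u: "u \<in> ch (Suc (Suc n))" for i u
    using cocyc add_hom_closed[OF T_hom u] by (simp add: p_def T_bd[OF u, symmetric])
  have "\<exists>m. \<exists>b\<in>C n \<Z>. (n \<noteq> d \<longrightarrow> m = 0) \<and> (\<forall>u\<in>ch (Suc n). p i u = c u * m + b (bd u))" for i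
    by (rule Z_gen[OF p_C p_cocyc])
  then obtain m b where mb: "\<And>i. b i \<in> C n \<Z>" "\<And>i. n \<noteq> d ==> m i = 0"
    "\<And>i u. u \<in> ch (Suc n) ==> p i u = c u * m i + b i (bd u)" by metis
  define m' where "m' = (\<Sum>i\<in>I. frag_cmul (m i) (frag_of i))"
  define b' where "b' u = (\<Sum>i\<in>I. frag_cmul (b i u) (frag_of i))" for u
  have b'_C: "b' \<in> C n freeN"
    unfolding b'_def by (rule C_sum[OF _ I]) (rule C_post[OF ZG.k_ab L mb(1) cmul_add_hom])
  have "\<phi> u = frag_cmul (c u) m' + (b' (bd u) + \<phi> (h n (bd u)))" if u: "u \<in> ch (Suc n)" for u
  proof -
    have "\<phi> (T (Suc n) u) = (\<Sum>i\<in>I. frag_cmul (p i u) (frag_of i))"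
      unfolding p_def using sum_cmul_lookup[OF I keys[OF u]] by simp
    also have "\<dots> = frag_cmul (c u) m' + b' (bd u)"
      by (simp add: mb(3)[OF u] m'_def b'_def frag_cmul_distrib frag_cmul_sum sum.distrib)
    finally show ?thesis using cocycle_T[OF L \<phi> _ u] cocyc by (simp add: add.assoc)
  qed
  moreover have "(\<lambda>u. b' u + \<phi> (h n u)) \<in> C n freeN"
    using C_plus[OF L b'_C C_h[OF L \<phi>]] by simp
  moreover have "n \<noteq> d \<longrightarrow> m' = 0" using mb(2) by (simp add: m'_def)
  ultimately show "\<exists>m\<in>carrier freeN. \<exists>b\<in>C n freeN. (n \<noteq> d \<longrightarrow> m = \<zero>\<^bsub>freeN\<^esub>) \<and>
        (\<forall>u\<in>ch (Suc n). \<phi> u = [c u] \<cdot>\<^bsub>freeN\<^esub> m \<oplus>\<^bsub>freeN\<^esub> b (bd u))"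
    by (intro bexI[of _ m'] bexI[of _ "\<lambda>u. b' u + \<phi> (h n u)"]) auto
qed

lemma inj_freeN:
  assumes "b \<in> C d freeN" "\<And>u. u \<in> ch (Suc d) ==> frag_cmul (c u) m = b (bd u)"
  shows "m = 0"
proof (rule poly_mapping_eqI)
  fix i
  have "(\<lambda>u. Poly_Mapping.lookup (b u) i) \<in> C d \<Z>"
    by (rule C_post[OF frag_abelian ZG.k_ab assms(1) lookup_add_hom])
  moreover have "c u * Poly_Mapping.lookup m i = Poly_Mapping.lookup (b (bd u)) i" if "u \<in> ch (Suc d)" for u
    using arg_cong[OF assms(2)[OF that], of "\<lambda>v. Poly_Mapping.lookup v i"] by simp
  ultimately show "Poly_Mapping.lookup m i = Poly_Mapping.lookup 0 i" using Z_inj by simp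
qed

text \<open>The section \<open>q\<close> is a mere function on \<open>W\<close>, sending nonzero
  elements to basis vectors. Its normalisation at zero keeps supports finite when values of a
  cochain are lifted.\<close>

lemma finite_lift:
  assumes "abelian_group M" "finite W" "W \<subseteq> carrier M"
  obtains p q where "p \<in> add_hom freeN M" "\<And>w. w \<in> W ==> p (q w) = w" "q \<zero>\<^bsub>M\<^esub> = 0"
proof -
  interpret M: abelian_group M by fact
  obtain e where e: "bij_betw e {..<card W} W" using ex_bij_betw_nat_finite[OF assms(2)] atLeast0LessThan by metis
  have ecl: "e i \<in> carrier M" if "i < card W" for i using e that assms(3) by (auto simp: bij_betw_def)
  obtain p where p: "p \<in> add_hom freeN M" "\<And>i. p (frag_of i) = (if i < card W then e i else \<zero>\<^bsub>M\<^esub>)"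
    using frag_group_universal[OF assms(1), of UNIV "\<lambda>i. if i < card W then e i else \<zero>\<^bsub>M\<^esub>"] ecl
    by (metis M.zero_closed UNIV_I)
  define q where "q w = (if w = \<zero>\<^bsub>M\<^esub> then 0 else frag_of (inv_into {..<card W} e w))" for w
  have "p (q w) = w" if w: "w \<in> W" for w
  proof (cases "w = \<zero>\<^bsub>M\<^esub>")
    case True
    then show ?thesis using add_hom_zero[OF frag_abelian assms(1) p(1)] by (simp add: q_def)
  next
    case False
    have "w \<in> e ` {..<card W}" using e w by (auto simp: bij_betw_def)
    from inv_into_into[OF this] f_inv_into_f[OF this] show ?thesis using False by (simp add: q_def p)
  qed
  then show ?thesis by (intro that[of p q]) (auto simp: p q_def)
qed

text \<open>Chains of the form \<open>T u\<close> involve only finitely many values of \<open>\<phi>\<close>, hence \<open>\<phi> \<circ> T\<close> lifts to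
  a free abelian group.\<close>

lemma lift_cochain:
  assumes "abelian_group M" "\<phi> \<in> C (Suc n) M" "m \<in> carrier M"
  obtains p \<chi> m' where "p \<in> add_hom freeN M" "\<chi> \<in> C (Suc n) freeN" "p m' = m"
    "\<And>u. u \<in> ch (Suc n) ==> p (\<chi> u) = \<phi> (T (Suc n) u)"
proof -
  define W where "W = insert m (\<phi> ` frag_of ` GY (Suc n))"
  have W: "finite W" "W \<subseteq> carrier M"
    using finite_values[OF assms(1,2)] C_closed[OF assms(2)] GY_sub[of "Suc n"] assms(3) by (auto simp: W_def)
  obtain p q where pq: "p \<in> add_hom freeN M" "\<And>w. w \<in> W ==> p (q w) = w" "q \<zero>\<^bsub>M\<^esub> = 0"
    by (rule finite_lift[OF assms(1) W]) (rule that)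
  \<comment> \<open>Off \<open>GY\<close> there is no bound on the values of \<open>\<phi>\<close>,
    so the lift is set to zero there; this is harmless since it is evaluated only on chains
    \<open>T u\<close>.\<close>
  define \<psi> where "\<psi> = frag_extend (\<lambda>xs. if xs \<in> GY (Suc n) then q (\<phi> (frag_of xs)) else 0)"
  have \<psi>_C: "\<psi> \<in> C (Suc n) freeN"
    unfolding C_def
  proof (intro CollectI conjI ballI impI)
    show "\<psi> \<in> add_hom (Sg (Suc n)) freeN" unfolding \<psi>_def by (rule frag_extend_add_hom) auto
    fix xs assume xs: "xs \<in> Gs (Suc n)"
    have "{g \<in> \<G>. \<psi> (frag_of (gmap g xs)) \<noteq> \<zero>\<^bsub>freeN\<^esub>} \<subseteq>
      {g \<in> \<G>. \<phi> (frag_of (gmap g xs)) \<noteq> \<zero>\<^bsub>M\<^esub>}"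
      using pq(3) by (auto simp: \<psi>_def split: if_splits)
    from finite_subset[OF this] show "finite {g \<in> \<G>. \<psi> (frag_of (gmap g xs)) \<noteq> \<zero>\<^bsub>freeN\<^esub>}"
      using assms(2) xs by (simp add: C_def)
  qed auto
  have "p (\<psi> w) = \<phi> w" if "w \<in> carrier (frag_group (GY (Suc n)))" for w
  proof (rule add_hom_eqI[OF frag_group_spans frag_abelian assms(1) add_hom_comp[OF add_hom_frag_mono pq(1)]
      add_hom_frag_mono[OF C_hom[OF assms(2)]] _ that])
    show "\<psi> \<in> add_hom (Sg (Suc n)) freeN" using \<psi>_C by (rule C_hom)
    fix b assume "b \<in> frag_of ` GY (Suc n)"
    then show "p (\<psi> b) = \<phi> b" using pq(2) by (auto simp: \<psi>_def W_def)
  qed (rule GY_sub)+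
  then show ?thesis
    using T_GY by (intro that[OF pq(1) C_T[OF frag_abelian \<psi>_C], of "q m"]) (auto simp: pq(2) W_def)
qed

lemma kernel_subgrp:
  assumes "abelian_group M" "p \<in> add_hom freeN M" shows "subgrp {v. p v = \<zero>\<^bsub>M\<^esub>}"
proof -
  interpret M: abelian_group M by fact
  show ?thesis
    using add_hom_zero[OF frag_abelian assms] add_hom_minus[OF frag_abelian assms]
    by (simp add: subgrp_def frag_group_minus M.minus_eq)
qed

text \<open>The long exact sequence of \<open>0 \<rightarrow> K \<rightarrow> freeN \<rightarrow> M
  \<rightarrow> 0\<close> by hand. The coboundary of a lift \<open>\<chi>\<close> has values in
  \<open>K\<close> and is a cocycle one degree higher. The induction hypothesis makes it the
  coboundary of some \<open>\<kappa>\<close> with values in \<open>K\<close>, so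
  \<open>\<chi> - \<kappa>\<close> is a cocycle over \<open>freeN\<close> and \<open>p\<close> maps
  it to \<open>\<phi> \<circ> T\<close>.\<close>

lemma gen_by_step:
  assumes K: "\<And>K. subgrp K ==> gen_by (Suc n) (sub_freeN K)" and M: "abelian_group M"
  shows "gen_by n M"
  unfolding gen_by_def
proof (intro ballI impI)
  interpret M: abelian_group M by fact
  fix \<phi> assume \<phi>: "\<phi> \<in> C (Suc n) M" and cocyc: "\<forall>u\<in>ch (Suc (Suc n)). \<phi> (bd u) = \<zero>\<^bsub>M\<^esub>"
  note L = frag_abelian[of "UNIV :: nat set"]
  obtain p \<chi> m' where p: "p \<in> add_hom freeN M" and \<chi>: "\<chi> \<in> C (Suc n) freeN"
    and p\<chi>: "\<And>u. u \<in> ch (Suc n) ==> p (\<chi> u) = \<phi> (T (Suc n) u)"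
    by (rule lift_cochain[OF M \<phi> M.zero_closed]) (rule that)
  define K where "K = {v. p v = \<zero>\<^bsub>M\<^esub>}"
  have sK: "subgrp K" unfolding K_def by (rule kernel_subgrp[OF M p])
  have "\<chi> (bd u) \<in> K" if u: "u \<in> ch (Suc (Suc n))" for u
    using cocyc add_hom_closed[OF T_hom u] by (simp add: K_def p\<chi>[OF bd_cl[OF u]] T_bd[OF u, symmetric])
  then have \<zeta>: "(\<lambda>u. \<chi> (bd u)) \<in> C (Suc (Suc n)) (sub_freeN K)"
    by (intro C_subI C_bd[OF L \<chi>])
  have \<zeta>0: "\<chi> (bd (bd u)) = \<zero>\<^bsub>sub_freeN K\<^esub>" for u
    using add_hom_zero[OF frag_abelian L C_hom[OF \<chi>]] by (simp add: bd_bd)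
  obtain k' \<kappa> where k': "k' \<in> carrier (sub_freeN K)" "Suc n \<noteq> d ==> k' = \<zero>\<^bsub>sub_freeN K\<^esub>"
    and \<kappa>: "\<kappa> \<in> C (Suc n) (sub_freeN K)"
    and eq0: "\<And>u. u \<in> ch (Suc (Suc n)) ==> \<chi> (bd u) = [c u] \<cdot>\<^bsub>sub_freeN K\<^esub> k' \<oplus>\<^bsub>sub_freeN K\<^esub> \<kappa> (bd u)"
    by (rule gen_byD[OF K[OF sK] \<zeta> \<zeta>0]) (rule that)
  have eq: "\<chi> (bd u) = frag_cmul (c u) k' + \<kappa> (bd u)" if "u \<in> ch (Suc (Suc n))" for u
    using eq0[OF that] sub_freeN_pow[OF sK] k'(1) by simp
  note \<kappa>L = C_sub[OF \<kappa>]
  have \<chi>\<kappa>: "(\<lambda>u. \<chi> u - \<kappa> u) \<in> C (Suc n) freeN" by (rule C_freeN_minus[OF \<chi> \<kappa>L])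
  \<comment> \<open>In degree \<open>d\<close> the cochain \<open>c k'\<close> is the coboundary of
    \<open>\<chi> - \<kappa>\<close> over \<open>freeN\<close>, where \<open>c\<close> is injective
    on coefficients.\<close>
  have "k' = 0"
  proof (cases "Suc n = d")
    case True
    show ?thesis
      by (rule inj_freeN[of "\<lambda>u. \<chi> u - \<kappa> u"]) (use \<chi>\<kappa> eq True in auto)
  next
    case False
    then show ?thesis using k'(2) by simp
  qed
  with eq have eq': "\<chi> (bd u) - \<kappa> (bd u) = 0" if "u \<in> ch (Suc (Suc n))" for u using that by simp
  obtain m b where m: "n \<noteq> d ==> m = \<zero>\<^bsub>freeN\<^esub>" and b: "b \<in> C n freeN"
    and eq2: "\<And>u. u \<in> ch (Suc n) ==> \<chi> u - \<kappa> u = [c u] \<cdot>\<^bsub>freeN\<^esub> m \<oplus>\<^bsub>freeN\<^esub> b (bd u)"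
    by (rule gen_byD[OF gen_by_freeN \<chi>\<kappa>]) (simp only: eq' frag_group_simps, rule that)
  note pL = add_hom_add[OF p] and p0 = add_hom_zero[OF L M p]
  have pm: "p m \<in> carrier M" using add_hom_closed[OF p, of m] by simp
  have "\<phi> u = [c u] \<cdot>\<^bsub>M\<^esub> p m \<oplus>\<^bsub>M\<^esub> (p (b (bd u)) \<oplus>\<^bsub>M\<^esub> \<phi> (h n (bd u)))" if u: "u \<in> ch (Suc n)" for u
  proof -
    have "p (\<kappa> u) = \<zero>\<^bsub>M\<^esub>" using C_closed[OF \<kappa> u] by (simp add: K_def)
    moreover have "\<chi> u = frag_cmul (c u) m + (b (bd u) + \<kappa> u)" using eq2[OF u] by (simp add: algebra_simps)
    moreover have "p (frag_cmul (c u) m) = [c u] \<cdot>\<^bsub>M\<^esub> p m"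
      using add_hom_int_pow[OF L M p, of m "c u"] by simp
    ultimately have "\<phi> (T (Suc n) u) = [c u] \<cdot>\<^bsub>M\<^esub> p m \<oplus>\<^bsub>M\<^esub> p (b (bd u))"
      unfolding p\<chi>[OF u, symmetric] using pL add_hom_closed[OF p] by simp
    moreover have "h n (bd u) \<in> ch (Suc n)" by (rule add_hom_closed[OF h_hom bd_cl[OF u]])
    ultimately show ?thesis
      using cocycle_T[OF M \<phi> _ u] cocyc pm C_closed[OF \<phi>] add_hom_closed[OF p]
      by (simp add: M.a_assoc)
  qed
  moreover have "(\<lambda>u. p (b u) \<oplus>\<^bsub>M\<^esub> \<phi> (h n u)) \<in> C n M"
    by (rule C_plus[OF M C_post[OF L M b p] C_h[OF M \<phi>]])
  moreover have "n \<noteq> d \<longrightarrow> p m = \<zero>\<^bsub>M\<^esub>" using m p0 by auto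
  ultimately show "\<exists>m\<in>carrier M. \<exists>b\<in>C n M. (n \<noteq> d \<longrightarrow> m = \<zero>\<^bsub>M\<^esub>) \<and>
        (\<forall>u\<in>ch (Suc n). \<phi> u = [c u] \<cdot>\<^bsub>M\<^esub> m \<oplus>\<^bsub>M\<^esub> b (bd u))"
    using pm by (intro bexI[of _ "p m"] bexI[of _ "\<lambda>u. p (b u) \<oplus>\<^bsub>M\<^esub> \<phi> (h n u)"]) auto
qed

text \<open>The statement is proved for all subgroups at once, because the step passes from
  \<open>K\<close> to the kernel of a different map.\<close>

lemma gen_by_sub_freeN: "subgrp K ==> gen_by n (sub_freeN K)"
proof (induction "l - n" arbitrary: n K)
  case 0
  then show ?case by (intro gen_by_top sub_freeN_abelian) auto
next
  case (Suc j)
  show ?case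
  proof (rule gen_by_step[OF _ sub_freeN_abelian[OF Suc.prems]])
    fix K assume "subgrp K"
    with Suc.hyps show "gen_by (Suc n) (sub_freeN K)" by auto
  qed
qed

lemma gen_by_all: "abelian_group M ==> gen_by n M"
  by (rule gen_by_step[OF gen_by_sub_freeN])

text \<open>If \<open>c m\<close> is a coboundary, lift \<open>m\<close> to \<open>m'\<close> and
  the bounding cochain to \<open>freeN\<close>. The defect is a cocycle with values in the kernel
  \<open>K\<close>, hence cohomologous to \<open>c k'\<close> with \<open>k'\<close> in
  \<open>K\<close>. Then \<open>c (m' + k')\<close> is a coboundary over \<open>freeN\<close>, so
  \<open>m' = - k'\<close> lies in \<open>K\<close> and \<open>m = p m'\<close> vanishes.\<close>

lemma c_pow_inj:
  assumes M: "abelian_group M" and m: "m \<in> carrier M" and b: "b \<in> C d M"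
    and eq: "\<And>u. u \<in> ch (Suc d) ==> [c u] \<cdot>\<^bsub>M\<^esub> m = b (bd u)"
  shows "m = \<zero>\<^bsub>M\<^esub>"
proof -
  interpret M: abelian_group M by fact
  note L = frag_abelian[of "UNIV :: nat set"]
  have Tcl: "T (Suc d) u \<in> ch (Suc d)" if "u \<in> ch (Suc d)" for u
    using add_hom_closed[OF T_hom that] .
  obtain p \<chi> m' where p: "p \<in> add_hom freeN M" and pm: "p m' = m" and \<chi>: "\<chi> \<in> C d freeN"
    and p\<chi>: "\<And>u. u \<in> ch (Suc d) ==> p (\<chi> (bd u)) = [c (T (Suc d) u)] \<cdot>\<^bsub>M\<^esub> m"
  proof (cases d)
    \<comment> \<open>Here \<open>b\<close> is defined on tuples of length 0, where it vanishes, so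
      the zero cochain is its lift; \<open>lift_cochain\<close> speaks of positive lengths.\<close>
    case 0
    obtain p q where pq: "p \<in> add_hom freeN M" "\<And>w. w \<in> {m} ==> p (q w) = w" "q \<zero>\<^bsub>M\<^esub> = 0"
      by (rule finite_lift[OF M, of "{m}"]) (simp, simp add: m, rule that)
    have "p 0 = [c (T (Suc d) u)] \<cdot>\<^bsub>M\<^esub> m" if u: "u \<in> ch (Suc d)" for u
      using add_hom_zero[OF L M pq(1)] eq[OF Tcl[OF u]] b bd_cl[OF Tcl[OF u]] 0 by (simp add: C_def)
    then show ?thesis
      using that[of p "q m" "\<lambda>u. 0"] pq C_zero[OF L, of d] by auto
  next
    case (Suc n)
    obtain p \<chi> m' where *: "p \<in> add_hom freeN M" "\<chi> \<in> C (Suc n) freeN" "p m' = m"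
      "\<And>u. u \<in> ch (Suc n) ==> p (\<chi> u) = b (T (Suc n) u)"
      by (rule lift_cochain[OF M b[unfolded Suc] m]) (rule that)
    have "p (\<chi> (bd u)) = [c (T (Suc d) u)] \<cdot>\<^bsub>M\<^esub> m" if u: "u \<in> ch (Suc d)" for u
      using *(4)[OF bd_cl] u eq[OF Tcl[OF u]] T_bd[of u n] Suc by simp
    then show ?thesis using that[of p m' \<chi>] * Suc by auto
  qed
  define K where "K = {v. p v = \<zero>\<^bsub>M\<^esub>}"
  have sK: "subgrp K" unfolding K_def by (rule kernel_subgrp[OF M p])
  have c_hom: "c \<in> add_hom (Sg (Suc d)) \<Z>" by (rule C_hom[OF c_C])
  \<comment> \<open>The defect of the lifted equation. It contains \<open>c \<circ> T\<close>
    instead of \<open>c\<close> because the lift of \<open>b\<close> is compatible with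
    \<open>b\<close> only after composition with \<open>T\<close>.\<close>
  define \<omega> where "\<omega> u = \<chi> (bd u) - frag_cmul (c (T (Suc d) u)) m'" for u
  have cT: "(\<lambda>u. frag_cmul (c (T (Suc d) u)) m') \<in> C (Suc d) freeN"
    by (rule C_post[OF ZG.k_ab L C_T[OF ZG.k_ab c_C] cmul_add_hom])
  have "\<omega> \<in> C (Suc d) freeN"
    unfolding \<omega>_def by (rule C_freeN_minus[OF C_bd[OF L \<chi>] cT])
  moreover have "\<omega> u \<in> K" if u: "u \<in> ch (Suc d)" for u
    using add_hom_minus[OF L M p, of "\<chi> (bd u)" "frag_cmul (c (T (Suc d) u)) m'"] p\<chi>[OF u]
      add_hom_int_pow[OF L M p, of m' "c (T (Suc d) u)"] m
    by (simp add: K_def \<omega>_def frag_group_minus pm M.minus_eq M.r_neg)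
  ultimately have \<omega>: "\<omega> \<in> C (Suc d) (sub_freeN K)" by (intro C_subI)
  have \<omega>0: "\<omega> (bd u) = \<zero>\<^bsub>sub_freeN K\<^esub>" if u: "u \<in> ch (Suc (Suc d))" for u
    using add_hom_zero[OF frag_abelian L C_hom[OF \<chi>]] c_cocycle[OF add_hom_closed[OF T_hom u]]
    by (simp add: \<omega>_def bd_bd T_bd[OF u, symmetric])
  obtain k' \<kappa> where k': "k' \<in> carrier (sub_freeN K)" and \<kappa>: "\<kappa> \<in> C d (sub_freeN K)"
    and eqK0: "\<And>u. u \<in> ch (Suc d) ==> \<omega> u = [c u] \<cdot>\<^bsub>sub_freeN K\<^esub> k' \<oplus>\<^bsub>sub_freeN K\<^esub> \<kappa> (bd u)"
    by (rule gen_byD[OF gen_by_sub_freeN[OF sK] \<omega> \<omega>0]) (assumption, rule that)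
  have eqK: "\<omega> u = frag_cmul (c u) k' + \<kappa> (bd u)" if "u \<in> ch (Suc d)" for u
    using eqK0[OF that] sub_freeN_pow[OF sK] k' by simp
  \<comment> \<open>The last summand pays for replacing \<open>c \<circ> T\<close> by
    \<open>c\<close>: the two differ by the coboundary of \<open>c \<circ> h\<close>.\<close>
  define e where "e u = \<chi> u - \<kappa> u + frag_cmul (c (h d u)) m'" for u
  have "m' + k' = 0"
  proof (rule inj_freeN)
    have "(\<lambda>u. frag_cmul (c (h d u)) m') \<in> C d freeN"
      by (rule C_post[OF ZG.k_ab L C_h[OF ZG.k_ab c_C] cmul_add_hom])
    then show "e \<in> C d freeN"
      using C_plus[OF L C_freeN_minus[OF \<chi> C_sub[OF \<kappa>]]] by (simp add: e_def[abs_def])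
    fix u assume u: "u \<in> ch (Suc d)"
    have "c u = c (T (Suc d) u) + c (h d (bd u))"
      using cocycle_T[OF ZG.k_ab c_C _ u] c_cocycle by simp
    then have "frag_cmul (c u) m' = frag_cmul (c (T (Suc d) u)) m' + frag_cmul (c (h d (bd u))) m'"
      by (simp add: frag_cmul_distrib)
    moreover have "frag_cmul (c u) k' = \<chi> (bd u) - frag_cmul (c (T (Suc d) u)) m' - \<kappa> (bd u)"
      using eqK[OF u] by (simp add: \<omega>_def algebra_simps)
    ultimately show "frag_cmul (c u) (m' + k') = e (bd u)"
      by (simp add: e_def frag_cmul_distrib2)
  qed
  then have "m' = 0 - k'" by (simp add: eq_neg_iff_add_eq_0)
  then have "m' \<in> K" using sK k' by (auto simp: subgrp_def)
  then show ?thesis using pm by (simp add: K_def)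
qed

end

section \<open>Cohomology of cochain complexes of homomorphisms\<close>

text \<open>The condition is on the restricted differential because \<open>lmod_hom\<close> consists
  of extensional functions, while the standard and bar differentials are not extensional.\<close>

locale hom_complex =
  fixes R :: "('r, 's) ring_scheme" and C :: "nat \<Rightarrow> ('r, 'c) module" and d :: "nat \<Rightarrow> 'c \<Rightarrow> 'c"
    and N :: "('r, 'n) module"
  assumes lC: "\<And>n. left_module R (C n)" and lN: "left_module R N"
    and d_hom: "\<And>n. restrict (d n) (carrier (C (Suc n))) \<in> lmod_hom R (C (Suc n)) (C n)"
    and d_d: "\<And>n x. x \<in> carrier (C (Suc (Suc n))) ==> d n (d (Suc n) x) = \<zero>\<^bsub>C n\<^esub>"
begin

abbreviation "Zc n \<equiv> cocycles R C d N n"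
abbreviation "Bc n \<equiv> coboundaries R C d N n"

lemmas ab_C = lmod_abelian[OF lC] and ab_N = lmod_abelian[OF lN]

sublocale N_ab: abelian_group N by (rule ab_N)

lemma d_closed: "x \<in> carrier (C (Suc n)) ==> d n x \<in> carrier (C n)"
  using lmod_hom_closed[OF d_hom, of x n] by simp

lemma cocycles_iff:
  "f \<in> carrier (Zc n) \<longleftrightarrow> f \<in> lmod_hom R (C n) N \<and> (\<forall>x\<in>carrier (C (Suc n)). f (d n x) = \<zero>\<^bsub>N\<^esub>)"
  by (simp add: cocycles_def)

lemma cocycles_mult: "f \<otimes>\<^bsub>Zc n\<^esub> g = (\<lambda>x\<in>carrier (C n). f x \<oplus>\<^bsub>N\<^esub> g x)"
  and cocycles_one: "\<one>\<^bsub>Zc n\<^esub> = (\<lambda>x\<in>carrier (C n). \<zero>\<^bsub>N\<^esub>)"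
  by (simp_all add: cocycles_def)

lemma hom_plus:
  assumes "f \<in> lmod_hom R (C n) N" "g \<in> lmod_hom R (C n) N"
  shows "(\<lambda>x\<in>carrier (C n). f x \<oplus>\<^bsub>N\<^esub> g x) \<in> lmod_hom R (C n) N"
  using assms
  by (intro lmod_homI[OF lC] add_hom_plus[OF ab_N] lmod_hom_add_hom)
    (auto simp: lmod_hom_smult lmod_hom_closed left_module.smult_r_distr[OF lN])

lemma hom_zero: "(\<lambda>x\<in>carrier (C n). \<zero>\<^bsub>N\<^esub>) \<in> lmod_hom R (C n) N"
  by (intro lmod_homI[OF lC] add_hom_const_zero[OF ab_N])
    (use add_hom_zero[OF ab_N ab_N left_module_smult_add_hom[OF lN]] in auto)

lemma hom_uminus:
  assumes "f \<in> lmod_hom R (C n) N"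
  shows "(\<lambda>x\<in>carrier (C n). \<ominus>\<^bsub>N\<^esub> f x) \<in> lmod_hom R (C n) N"
  using assms
  by (intro lmod_homI[OF lC] add_hom_uminus[OF ab_N] lmod_hom_add_hom)
    (auto simp: lmod_hom_smult lmod_hom_closed left_module_smult_neg[OF lN])

lemma cocycles_comm_group: "comm_group (Zc n)"
proof (rule comm_groupI)
  fix f g assume "f \<in> carrier (Zc n)" "g \<in> carrier (Zc n)"
  then show "f \<otimes>\<^bsub>Zc n\<^esub> g \<in> carrier (Zc n)"
    by (auto simp: cocycles_iff cocycles_mult hom_plus d_closed)
  show "f \<otimes>\<^bsub>Zc n\<^esub> g = g \<otimes>\<^bsub>Zc n\<^esub> f"
    using \<open>f \<in> carrier (Zc n)\<close> \<open>g \<in> carrier (Zc n)\<close>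
    by (auto simp: cocycles_iff cocycles_mult lmod_hom_closed N_ab.a_comm intro!: restrict_ext)
next
  show "\<one>\<^bsub>Zc n\<^esub> \<in> carrier (Zc n)"
    by (auto simp: cocycles_iff cocycles_one hom_zero d_closed)
next
  fix f g h assume "f \<in> carrier (Zc n)" "g \<in> carrier (Zc n)" "h \<in> carrier (Zc n)"
  then show "f \<otimes>\<^bsub>Zc n\<^esub> g \<otimes>\<^bsub>Zc n\<^esub> h = f \<otimes>\<^bsub>Zc n\<^esub> (g \<otimes>\<^bsub>Zc n\<^esub> h)"
    by (auto simp: cocycles_iff cocycles_mult lmod_hom_closed N_ab.a_assoc intro!: restrict_ext)
next
  fix f assume f: "f \<in> carrier (Zc n)"
  then have "f \<in> lmod_hom R (C n) N" by (simp add: cocycles_iff)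
  then have "\<one>\<^bsub>Zc n\<^esub> \<otimes>\<^bsub>Zc n\<^esub> f = restrict f (carrier (C n))"
    by (auto simp: cocycles_one cocycles_mult lmod_hom_closed intro!: restrict_ext)
  also have "\<dots> = f" using f by (auto simp: cocycles_iff lmod_hom_def PiE_def intro: extensional_restrict)
  finally show "\<one>\<^bsub>Zc n\<^esub> \<otimes>\<^bsub>Zc n\<^esub> f = f" .
  show "\<exists>g\<in>carrier (Zc n). g \<otimes>\<^bsub>Zc n\<^esub> f = \<one>\<^bsub>Zc n\<^esub>"
  proof (rule bexI)
    show "(\<lambda>x\<in>carrier (C n). \<ominus>\<^bsub>N\<^esub> f x) \<in> carrier (Zc n)"
      using f by (auto simp: cocycles_iff hom_uminus d_closed)
    show "(\<lambda>x\<in>carrier (C n). \<ominus>\<^bsub>N\<^esub> f x) \<otimes>\<^bsub>Zc n\<^esub> f = \<one>\<^bsub>Zc n\<^esub>"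
      using f by (auto simp: cocycles_iff cocycles_mult cocycles_one lmod_hom_closed N_ab.l_neg intro!: restrict_ext)
  qed
qed

sublocale Z: comm_group "Zc n" for n by (rule cocycles_comm_group)

lemma coboundaries_Suc:
  "f \<in> Bc (Suc m) \<longleftrightarrow> (\<exists>g\<in>lmod_hom R (C m) N. f = (\<lambda>x\<in>carrier (C (Suc m)). g (d m x)))"
  by (auto simp: coboundaries_def compose_def)

lemma coboundaries_0: "Bc 0 = {\<one>\<^bsub>Zc 0\<^esub>}"
  by (simp add: coboundaries_def cocycles_def)

lemma coboundaries_subgroup: "subgroup (Bc n) (Zc n)"
proof (cases n)
  case 0
  then show ?thesis using Z.triv_subgroup by (simp add: coboundaries_0)
next
  case (Suc m)
  have sub: "Bc (Suc m) \<subseteq> carrier (Zc (Suc m))"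
  proof
    fix f assume "f \<in> Bc (Suc m)"
    then obtain g where g: "g \<in> lmod_hom R (C m) N" "f = (\<lambda>x\<in>carrier (C (Suc m)). g (d m x))"
      by (auto simp: coboundaries_Suc)
    have "f \<in> lmod_hom R (C (Suc m)) N"
      using lmod_hom_comp[OF lC d_hom g(1)] unfolding g(2) by (simp cong: restrict_cong)
    moreover have "f (d (Suc m) x) = \<zero>\<^bsub>N\<^esub>" if x: "x \<in> carrier (C (Suc (Suc m)))" for x
      using add_hom_zero[OF ab_C ab_N lmod_hom_add_hom[OF g(1)]] by (simp add: g(2) d_closed[OF x] d_d[OF x])
    ultimately show "f \<in> carrier (Zc (Suc m))" by (simp add: cocycles_iff)
  qed
  have "subgroup (Bc (Suc m)) (Zc (Suc m))"
  proof (rule Z.subgroupI[OF sub])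
    have "\<one>\<^bsub>Zc (Suc m)\<^esub> = (\<lambda>x\<in>carrier (C (Suc m)). (\<lambda>x\<in>carrier (C m). \<zero>\<^bsub>N\<^esub>) (d m x))"
      by (auto simp: cocycles_one d_closed intro!: restrict_ext)
    then show "Bc (Suc m) \<noteq> {}" using hom_zero[of m] coboundaries_Suc by blast
  next
    fix f assume f: "f \<in> Bc (Suc m)"
    then obtain g where g: "g \<in> lmod_hom R (C m) N" "f = (\<lambda>x\<in>carrier (C (Suc m)). g (d m x))"
      by (auto simp: coboundaries_Suc)
    have "inv\<^bsub>Zc (Suc m)\<^esub> f = (\<lambda>x\<in>carrier (C (Suc m)). (\<lambda>x\<in>carrier (C m). \<ominus>\<^bsub>N\<^esub> g x) (d m x))"
    proof (rule Z.inv_equality)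
      have "(\<lambda>x\<in>carrier (C (Suc m)). (\<lambda>x\<in>carrier (C m). \<ominus>\<^bsub>N\<^esub> g x) (d m x)) \<in> Bc (Suc m)"
        unfolding coboundaries_Suc by (rule bexI[OF refl hom_uminus[OF g(1)]])
      then show "(\<lambda>x\<in>carrier (C (Suc m)). (\<lambda>x\<in>carrier (C m). \<ominus>\<^bsub>N\<^esub> g x) (d m x)) \<in> carrier (Zc (Suc m))"
        using sub by blast
    qed (use f sub g in \<open>auto simp: cocycles_mult cocycles_one d_closed lmod_hom_closed N_ab.l_neg intro!: restrict_ext\<close>)
    then show "inv\<^bsub>Zc (Suc m)\<^esub> f \<in> Bc (Suc m)"
      unfolding coboundaries_Suc by (rule bexI[OF _ hom_uminus[OF g(1)]])
  next
    fix f f' assume "f \<in> Bc (Suc m)" "f' \<in> Bc (Suc m)"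
    then obtain g g' where g: "g \<in> lmod_hom R (C m) N" "f = (\<lambda>x\<in>carrier (C (Suc m)). g (d m x))"
       "g' \<in> lmod_hom R (C m) N" "f' = (\<lambda>x\<in>carrier (C (Suc m)). g' (d m x))"
      by (auto simp: coboundaries_Suc)
    have "f \<otimes>\<^bsub>Zc (Suc m)\<^esub> f' = (\<lambda>x\<in>carrier (C (Suc m)). (\<lambda>x\<in>carrier (C m). g x \<oplus>\<^bsub>N\<^esub> g' x) (d m x))"
      by (auto simp: g cocycles_mult d_closed intro!: restrict_ext)
    then show "f \<otimes>\<^bsub>Zc (Suc m)\<^esub> f' \<in> Bc (Suc m)"
      unfolding coboundaries_Suc by (rule bexI[OF _ hom_plus[OF g(1,3)]])
  qed
  then show ?thesis by (simp add: Suc)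
qed

lemma coboundaries_normal: "Bc n \<lhd> Zc n"
  using coboundaries_subgroup Z.normal_iff_subgroup by blast

abbreviation "H n \<equiv> hom_cohomology R C d N n"

lemma H_carrier: "carrier (H n) = (\<lambda>f. Bc n #>\<^bsub>Zc n\<^esub> f) ` carrier (Zc n)"
  by (simp add: hom_cohomology_def carrier_FactGroup)

lemma H_group: "comm_group (H n)"
  unfolding hom_cohomology_def by (rule Z.abelian_FactGroup[OF coboundaries_subgroup])

lemma class_hom: "(\<lambda>f. Bc n #>\<^bsub>Zc n\<^esub> f) \<in> hom (Zc n) (H n)"
  unfolding hom_cohomology_def by (rule normal.r_coset_hom_Mod[OF coboundaries_normal])

lemma class_eq_one_iff:
  assumes "f \<in> carrier (Zc n)"
  shows "Bc n #>\<^bsub>Zc n\<^esub> f = \<one>\<^bsub>H n\<^esub> \<longleftrightarrow> f \<in> Bc n"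
  using assms Z.coset_join1[OF _ assms coboundaries_subgroup] Z.coset_join2[OF assms coboundaries_subgroup]
  by (auto simp: hom_cohomology_def)

lemma trivial_iff: "trivial_group (H n) \<longleftrightarrow> carrier (Zc n) \<subseteq> Bc n"
proof -
  interpret H: comm_group "H n" by (rule H_group)
  have "trivial_group (H n) \<longleftrightarrow> (\<forall>f\<in>carrier (Zc n). Bc n #>\<^bsub>Zc n\<^esub> f = \<one>\<^bsub>H n\<^esub>)"
    unfolding H.trivial_group_subset H_carrier by auto
  then show ?thesis using class_eq_one_iff by auto
qed

text \<open>An isomorphism on cohomology is traded for a surjection on cocycles with kernel the
  coboundaries, so later arguments do not handle cosets. \<open>iso_from_hom\<close> goes
  back.\<close>

lemma iso_to_hom:
  assumes "i \<in> iso (H n) K" "group K"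
  obtains q where "q \<in> hom (Zc n) K" "q ` carrier (Zc n) = carrier K"
    "\<And>f. f \<in> carrier (Zc n) ==> q f = \<one>\<^bsub>K\<^esub> \<longleftrightarrow> f \<in> Bc n"
proof -
  interpret H: comm_group "H n" by (rule H_group)
  interpret K: group K by fact
  have i: "i \<in> hom (H n) K" "bij_betw i (carrier (H n)) (carrier K)" using assms(1) by (auto simp: iso_def)
  have i1: "i \<one>\<^bsub>H n\<^esub> = \<one>\<^bsub>K\<^esub>" by (rule hom_one[OF i(1) H.is_group assms(2)])
  have cl: "Bc n #>\<^bsub>Zc n\<^esub> f \<in> carrier (H n)" if "f \<in> carrier (Zc n)" for f using that by (auto simp: H_carrier)
  show ?thesis
  proof (rule that[of "i \<circ> (\<lambda>f. Bc n #>\<^bsub>Zc n\<^esub> f)"])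
    show "i \<circ> (\<lambda>f. Bc n #>\<^bsub>Zc n\<^esub> f) \<in> hom (Zc n) K" by (rule hom_compose[OF class_hom i(1)])
    show "(i \<circ> (\<lambda>f. Bc n #>\<^bsub>Zc n\<^esub> f)) ` carrier (Zc n) = carrier K"
      using i(2) by (simp add: image_image H_carrier bij_betw_def)
    fix f assume f: "f \<in> carrier (Zc n)"
    have "(i \<circ> (\<lambda>f. Bc n #>\<^bsub>Zc n\<^esub> f)) f = \<one>\<^bsub>K\<^esub> \<longleftrightarrow> Bc n #>\<^bsub>Zc n\<^esub> f = \<one>\<^bsub>H n\<^esub>"
      using i(2) i1 inj_onD[of i "carrier (H n)" "Bc n #>\<^bsub>Zc n\<^esub> f" "\<one>\<^bsub>H n\<^esub>"] cl[OF f] by (auto simp: bij_betw_def)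
    then show "(i \<circ> (\<lambda>f. Bc n #>\<^bsub>Zc n\<^esub> f)) f = \<one>\<^bsub>K\<^esub> \<longleftrightarrow> f \<in> Bc n"
      using class_eq_one_iff[OF f] by simp
  qed
qed

lemma iso_from_hom:
  assumes "group K" "q \<in> hom (Zc n) K" "q ` carrier (Zc n) = carrier K"
    "\<And>f. f \<in> carrier (Zc n) ==> q f = \<one>\<^bsub>K\<^esub> \<longleftrightarrow> f \<in> Bc n"
  obtains i where "i \<in> iso (H n) K" "\<And>f. f \<in> carrier (Zc n) ==> i (Bc n #>\<^bsub>Zc n\<^esub> f) = q f"
proof -
  interpret q: group_hom "Zc n" K q
    using assms(1,2) by (intro group_hom.intro group_hom_axioms.intro Z.is_group)
  have ker: "kernel (Zc n) K q = Bc n"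
    using assms(4) subgroup.subset[OF coboundaries_subgroup] by (auto simp: kernel_def)
  show ?thesis
  proof (rule that)
    show "(\<lambda>U. the_elem (q ` U)) \<in> iso (H n) K"
      using q.FactGroup_iso_set[OF assms(3)] by (simp add: ker hom_cohomology_def)
    fix f assume f: "f \<in> carrier (Zc n)"
    have "q ` (Bc n #>\<^bsub>Zc n\<^esub> f) = {q f}"
    proof -
      have "q (b \<otimes>\<^bsub>Zc n\<^esub> f) = q f" if "b \<in> Bc n" for b
        using that f subgroup.mem_carrier[OF coboundaries_subgroup that] assms(4)[of b] by simp
      moreover have "Bc n \<noteq> {}" using subgroup.one_closed[OF coboundaries_subgroup] by blast
      moreover have "Bc n #>\<^bsub>Zc n\<^esub> f = (\<lambda>b. b \<otimes>\<^bsub>Zc n\<^esub> f) ` Bc n" by (auto simp: r_coset_def)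
      ultimately show ?thesis by (simp add: image_image image_constant_conv)
    qed
    then show "the_elem (q ` (Bc n #>\<^bsub>Zc n\<^esub> f)) = q f" by simp
  qed
qed

lemma compose_cocycle:
  assumes "\<phi> \<in> add_hom N N" "\<And>r x. r \<in> carrier R ==> x \<in> carrier N ==> \<phi> (r \<odot>\<^bsub>N\<^esub> x) = r \<odot>\<^bsub>N\<^esub> \<phi> x"
    and "f \<in> carrier (Zc n)"
  shows "compose (carrier (C n)) \<phi> f \<in> carrier (Zc n)"
proof -
  have f: "f \<in> lmod_hom R (C n) N" using assms(3) by (simp add: cocycles_iff)
  have "compose (carrier (C n)) \<phi> f \<in> lmod_hom R (C n) N"
    unfolding compose_def using f assms(2)
    by (intro lmod_homI[OF lC] add_hom_comp[OF lmod_hom_add_hom[OF f] assms(1)])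
      (auto simp: lmod_hom_smult lmod_hom_closed)
  then show ?thesis
    using assms(3) add_hom_zero[OF ab_N ab_N assms(1)] by (auto simp: cocycles_iff compose_def d_closed)
qed

lemma compose_coboundary:
  assumes "\<phi> \<in> add_hom N N" "\<And>r x. r \<in> carrier R ==> x \<in> carrier N ==> \<phi> (r \<odot>\<^bsub>N\<^esub> x) = r \<odot>\<^bsub>N\<^esub> \<phi> x"
    and "f \<in> Bc n"
  shows "compose (carrier (C n)) \<phi> f \<in> Bc n"
proof (cases n)
  case 0
  then show ?thesis
    using assms(3) add_hom_zero[OF ab_N ab_N assms(1)] by (auto simp: coboundaries_0 cocycles_one compose_def intro!: restrict_ext)
next
  case (Suc m)
  then obtain g where g: "g \<in> lmod_hom R (C m) N" "f = (\<lambda>x\<in>carrier (C (Suc m)). g (d m x))"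
    using assms(3) by (auto simp: coboundaries_Suc)
  have "restrict (\<lambda>x. \<phi> (g x)) (carrier (C m)) \<in> lmod_hom R (C m) N"
    using g(1) assms(2)
    by (intro lmod_homI[OF lC] add_hom_comp[OF lmod_hom_add_hom[OF g(1)] assms(1)])
      (auto simp: lmod_hom_smult lmod_hom_closed)
  moreover have "compose (carrier (C n)) \<phi> f = (\<lambda>x\<in>carrier (C (Suc m)). restrict (\<lambda>x. \<phi> (g x)) (carrier (C m)) (d m x))"
    by (auto simp: compose_def g(2) Suc d_closed intro!: restrict_ext)
  ultimately show ?thesis using coboundaries_Suc Suc by blast
qed

text \<open>The induced map is a union over all representatives. Since composition with
  \<open>\<phi>\<close> preserves coboundaries, all members of the union coincide.\<close>

lemma hom_cohomology_map_class:
  assumes "\<phi> \<in> add_hom N N" "\<And>r x. r \<in> carrier R ==> x \<in> carrier N ==> \<phi> (r \<odot>\<^bsub>N\<^esub> x) = r \<odot>\<^bsub>N\<^esub> \<phi> x"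
    and f: "f \<in> carrier (Zc n)"
  shows "hom_cohomology_map R C d N n \<phi> (Bc n #>\<^bsub>Zc n\<^esub> f) = Bc n #>\<^bsub>Zc n\<^esub> compose (carrier (C n)) \<phi> f"
proof -
  have "Bc n #>\<^bsub>Zc n\<^esub> compose (carrier (C n)) \<phi> f' = Bc n #>\<^bsub>Zc n\<^esub> compose (carrier (C n)) \<phi> f"
    if f': "f' \<in> Bc n #>\<^bsub>Zc n\<^esub> f" for f'
  proof -
    obtain b where b: "b \<in> Bc n" "f' = b \<otimes>\<^bsub>Zc n\<^esub> f" using f' by (auto simp: r_coset_def)
    have bZ: "b \<in> carrier (Zc n)" by (rule subgroup.mem_carrier[OF coboundaries_subgroup b(1)])
    have "compose (carrier (C n)) \<phi> f' = compose (carrier (C n)) \<phi> b \<otimes>\<^bsub>Zc n\<^esub> compose (carrier (C n)) \<phi> f"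
      using bZ f by (auto simp: b(2) cocycles_mult compose_def cocycles_iff lmod_hom_closed add_hom_add[OF assms(1)] intro!: restrict_ext)
    then have "compose (carrier (C n)) \<phi> f' \<in> Bc n #>\<^bsub>Zc n\<^esub> compose (carrier (C n)) \<phi> f"
      using compose_coboundary[OF assms(1,2) b(1)] by (auto simp: r_coset_def)
    from Z.repr_independence[OF this compose_cocycle[OF assms(1,2) f] coboundaries_subgroup] show ?thesis by simp
  qed
  moreover have "f \<in> Bc n #>\<^bsub>Zc n\<^esub> f" by (rule Z.rcos_self[OF f coboundaries_subgroup])
  ultimately show ?thesis unfolding hom_cohomology_map_def by blast
qed

end

section \<open>Groups of type FP\<close>

lemma module_type_FPE:
  fixes R :: "('r, 's) ring_scheme" and M :: "('r, 'm) module"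
  assumes "module_type_FP R M"
  obtains P :: "nat \<Rightarrow> ('r, nat \<Rightarrow> 'r) module" and \<delta> \<epsilon> l where "resolution R P \<delta> \<epsilon> M"
    "\<And>n. finitely_generated_module R (P n)" "\<And>n. projective_module R (P n)"
    "\<And>n. n > l ==> carrier (P n) = {\<zero>\<^bsub>P n\<^esub>}"
proof -
  obtain P :: "nat \<Rightarrow> ('r, nat \<Rightarrow> 'r) module" and \<delta> \<epsilon> l where P: "\<forall>n. finitely_generated_module R (P n) \<and> projective_module R (P n)"
    "\<forall>n>l. carrier (P n) = {\<zero>\<^bsub>P n\<^esub>}" "\<forall>n. \<delta> n \<in> lmod_hom R (P (Suc n)) (P n)"
    "\<epsilon> \<in> lmod_hom R (P 0) M" "\<epsilon> ` carrier (P 0) = carrier M"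
    "{x \<in> carrier (P 0). \<epsilon> x = \<zero>\<^bsub>M\<^esub>} = \<delta> 0 ` carrier (P (Suc 0))"
    "\<forall>n. {x \<in> carrier (P (Suc n)). \<delta> n x = \<zero>\<^bsub>P n\<^esub>} = \<delta> (Suc n) ` carrier (P (Suc (Suc n)))"
    using assms unfolding module_type_FP_def by (elim conjE exE) (rule that)
  have "resolution R P \<delta> \<epsilon> M"
  proof (intro resolution.intro augmented_complex.intro resolution_axioms.intro)
    show "left_module R (P n)" for n using P(1) by (simp add: projective_module_def)
    show "left_module R M" using assms by (simp add: module_type_FP_def)
    show "\<delta> n \<in> lmod_hom R (P (Suc n)) (P n)" for n using P(3) by simp
    show "\<delta> n (\<delta> (Suc n) x) = \<zero>\<^bsub>P n\<^esub>" if "x \<in> carrier (P (Suc (Suc n)))" for n x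
      using P(7) that by blast
    show "\<epsilon> (\<delta> 0 x) = \<zero>\<^bsub>M\<^esub>" if "x \<in> carrier (P (Suc 0))" for x
      using P(6) that by blast
    show "x \<in> \<delta> 0 ` carrier (P (Suc 0))" if "x \<in> carrier (P 0)" "\<epsilon> x = \<zero>\<^bsub>M\<^esub>" for x
      using P(6) that by blast
    show "x \<in> \<delta> (Suc n) ` carrier (P (Suc (Suc n)))" if "x \<in> carrier (P (Suc n))" "\<delta> n x = \<zero>\<^bsub>P n\<^esub>" for n x
      using P(7) that by blast
  qed (use P in auto)
  with P(1,2) show ?thesis by (intro that) auto
qed

text \<open>The identity minus \<open>g \<circ> f\<close> covers the zero map of \<open>M\<close>
  and is therefore null-homotopic.\<close>

lemma homotopy_inverse_exists:
  assumes "resolution R C dC eC M" "resolution R D dD eD M" "\<And>n. projective_module R (C n)"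
    and f: "\<And>n. f n \<in> lmod_hom R (C n) (D n)" "\<And>x. x \<in> carrier (C 0) ==> eD (f 0 x) = eC x"
      "\<And>n x. x \<in> carrier (C (Suc n)) ==> dD n (f (Suc n) x) = f n (dC n x)"
    and g: "\<And>n. g n \<in> lmod_hom R (D n) (C n)" "\<And>x. x \<in> carrier (D 0) ==> eC (g 0 x) = eD x"
      "\<And>n x. x \<in> carrier (D (Suc n)) ==> dC n (g (Suc n) x) = g n (dD n x)"
  obtains h where "\<And>n. h n \<in> lmod_hom R (C n) (C (Suc n))"
    "\<And>x. x \<in> carrier (C 0) ==> dC 0 (h 0 x) = x \<ominus>\<^bsub>C 0\<^esub> g 0 (f 0 x)"
    "\<And>n x. x \<in> carrier (C (Suc n)) ==>
       dC (Suc n) (h (Suc n) x) = (x \<ominus>\<^bsub>C (Suc n)\<^esub> g (Suc n) (f (Suc n) x)) \<ominus>\<^bsub>C (Suc n)\<^esub> h n (dC n x)"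
proof -
  interpret C: resolution R C dC eC M by fact
  interpret D: resolution R D dD eD M by fact
  note abC = lmod_abelian[OF C.lmod] and abM = lmod_abelian[OF C.lmod_aug]
  interpret M: abelian_group M by (rule abM)
  \<comment> \<open>The nested restrictions reproduce the form in which \<open>lmod_hom_diff\<close>
    delivers a difference.\<close>
  define F where "F n = restrict (\<lambda>x. restrict (\<lambda>x. x) (carrier (C n)) x \<ominus>\<^bsub>C n\<^esub> restrict (\<lambda>x. g n (f n x)) (carrier (C n)) x) (carrier (C n))" for n
  have F_hom: "F n \<in> lmod_hom R (C n) (C n)" for n
    unfolding F_def by (intro lmod_hom_diff C.lmod lmod_hom_id lmod_hom_comp[OF C.lmod f(1) g(1)])
  have F: "F n x = x \<ominus>\<^bsub>C n\<^esub> g n (f n x)" if "x \<in> carrier (C n)" for n x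
    using that by (simp add: F_def)
  have gf: "g n (f n x) \<in> carrier (C n)" if "x \<in> carrier (C n)" for n x
    by (rule lmod_hom_closed[OF g(1) lmod_hom_closed[OF f(1) that]])
  have F_e: "eC (F 0 x) = \<zero>\<^bsub>M\<^esub>" if x: "x \<in> carrier (C 0)" for x
    unfolding F[OF x] add_hom_minus[OF abC abM lmod_hom_add_hom[OF C.e_hom] x gf[OF x]]
    using lmod_hom_closed[OF f(1) x] lmod_hom_closed[OF C.e_hom x] by (simp add: f(2)[OF x] g(2) M.minus_eq M.r_neg)
  have F_d: "dC n (F (Suc n) x) = F n (dC n x)" if x: "x \<in> carrier (C (Suc n))" for n x
    unfolding F[OF x] add_hom_minus[OF abC abC lmod_hom_add_hom[OF C.d_hom] x gf[OF x]]
    using lmod_hom_closed[OF C.d_hom x] lmod_hom_closed[OF f(1) x] by (simp add: F f(3)[OF x] g(3))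
  obtain h where "\<And>n. h n \<in> lmod_hom R (C n) (C (Suc n))"
    "\<And>x. x \<in> carrier (C 0) ==> dC 0 (h 0 x) = F 0 x"
    "\<And>n x. x \<in> carrier (C (Suc n)) ==> dC (Suc n) (h (Suc n) x) = F (Suc n) x \<ominus>\<^bsub>C (Suc n)\<^esub> h n (dC n x)"
    by (rule null_homotopy_exists[OF C.augmented_complex_axioms C.resolution_axioms assms(3) F_hom F_e F_d]) (assumption+, rule that)
  then show ?thesis by (intro that[of h]) (simp_all add: F)
qed

lemma finsum_in_subset:
  assumes "abelian_group M" "\<zero>\<^bsub>M\<^esub> \<in> H" "H \<subseteq> carrier M"
    "\<And>x y. x \<in> H ==> y \<in> H ==> x \<oplus>\<^bsub>M\<^esub> y \<in> H" "\<And>i. i \<in> I ==> v i \<in> H"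
  shows "(\<Oplus>\<^bsub>M\<^esub>i\<in>I. v i) \<in> H"
proof -
  interpret M: abelian_group M by fact
  show ?thesis
    using assms(5)
  proof (induction I rule: infinite_finite_induct)
    case (insert i F)
    then have "v \<in> F \<rightarrow> carrier M" "v i \<in> carrier M" using assms(3) by auto
    then show ?case using insert assms(4) by simp
  qed (use assms(2) in auto)
qed

context grp
begin

abbreviation "dS n \<equiv> restrict bd (carrier (S (Suc n)))"
abbreviation "eS \<equiv> restrict aug (carrier (S 0))"

lemma keys_smult:
  assumes "r \<in> carrier R"
  shows "keys (r \<odot>\<^bsub>S n\<^esub> u) \<subseteq> (\<Union>g\<in>\<G>. gmap g ` keys u)"
  unfolding S_simps(4)
proof (rule keys_sum_subset)
  fix g assume g: "g \<in> {g. g \<in> \<G> \<and> r g \<noteq> 0}"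
  have "keys (gact g u) \<subseteq> gmap g ` keys u"
    unfolding gact_def using keys_frag_extend[of "\<lambda>xs. frag_of (gmap g xs)" u] by auto
  then show "keys (frag_cmul (r g) (gact g u)) \<subseteq> (\<Union>g\<in>\<G>. gmap g ` keys u)"
    using g by auto
qed

end

text \<open>Both homotopies are recorded because each has its use: \<open>h\<close> controls the
  operator \<open>T\<close> on the standard resolution, and \<open>k\<close> enters the additive
  contraction of \<open>P\<close>.\<close>

locale fp_comparison = grp +
  fixes P :: "nat \<Rightarrow> ('a \<Rightarrow> int, nat \<Rightarrow> 'a \<Rightarrow> int) module" and \<delta> \<epsilon> l f g h k
  assumes P: "resolution R P \<delta> \<epsilon> Zt"
    and P_fg: "\<And>n. finitely_generated_module R (P n)" and P_proj: "\<And>n. projective_module R (P n)"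
    and P_top: "\<And>n. n > l ==> carrier (P n) = {\<zero>\<^bsub>P n\<^esub>}"
    and f: "\<And>n. f n \<in> lmod_hom R (P n) (S n)" "\<And>x. x \<in> carrier (P 0) ==> eS (f 0 x) = \<epsilon> x"
      "\<And>n x. x \<in> carrier (P (Suc n)) ==> dS n (f (Suc n) x) = f n (\<delta> n x)"
    and g: "\<And>n. g n \<in> lmod_hom R (S n) (P n)" "\<And>x. x \<in> carrier (S 0) ==> \<epsilon> (g 0 x) = eS x"
      "\<And>n x. x \<in> carrier (S (Suc n)) ==> \<delta> n (g (Suc n) x) = g n (dS n x)"
    and h: "\<And>n. h n \<in> lmod_hom R (S n) (S (Suc n))"
      "\<And>x. x \<in> carrier (S 0) ==> dS 0 (h 0 x) = x \<ominus>\<^bsub>S 0\<^esub> f 0 (g 0 x)"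
      "\<And>n x. x \<in> carrier (S (Suc n)) ==>
         dS (Suc n) (h (Suc n) x) = (x \<ominus>\<^bsub>S (Suc n)\<^esub> f (Suc n) (g (Suc n) x)) \<ominus>\<^bsub>S (Suc n)\<^esub> h n (dS n x)"
    and k: "\<And>n. k n \<in> lmod_hom R (P n) (P (Suc n))"
      "\<And>x. x \<in> carrier (P 0) ==> \<delta> 0 (k 0 x) = x \<ominus>\<^bsub>P 0\<^esub> g 0 (f 0 x)"
      "\<And>n x. x \<in> carrier (P (Suc n)) ==>
         \<delta> (Suc n) (k (Suc n) x) = (x \<ominus>\<^bsub>P (Suc n)\<^esub> g (Suc n) (f (Suc n) x)) \<ominus>\<^bsub>P (Suc n)\<^esub> k n (\<delta> n x)"

lemma (in grp) fp_comparison_exists: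
  assumes "group_type_FP G"
  obtains P \<delta> \<epsilon> l f g h k where "fp_comparison G P \<delta> \<epsilon> l f g h k"
proof -
  have lZ: "left_module R Zt" using assms by (simp add: group_type_FP_def module_type_FP_def)
  obtain P :: "nat \<Rightarrow> ('g \<Rightarrow> int, nat \<Rightarrow> 'g \<Rightarrow> int) module" and \<delta> \<epsilon> l where P: "resolution R P \<delta> \<epsilon> Zt"
    "\<And>n. finitely_generated_module R (P n)" "\<And>n. projective_module R (P n)"
    "\<And>n. n > l ==> carrier (P n) = {\<zero>\<^bsub>P n\<^esub>}"
    by (rule module_type_FPE[OF assms[unfolded group_type_FP_def]]) (rule that)
  note S = S_resolution[OF lZ]
  interpret P: resolution R P \<delta> \<epsilon> Zt by (rule P(1))
  interpret S: resolution R S dS eS Zt by (rule S)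
  obtain f where f: "\<And>n. f n \<in> lmod_hom R (P n) (S n)" "\<And>x. x \<in> carrier (P 0) ==> eS (f 0 x) = \<epsilon> x"
    "\<And>n x. x \<in> carrier (P (Suc n)) ==> dS n (f (Suc n) x) = f n (\<delta> n x)"
    by (rule chain_map_exists[OF P.augmented_complex_axioms S P(3)]) (rule that)
  obtain g where g: "\<And>n. g n \<in> lmod_hom R (S n) (P n)" "\<And>x. x \<in> carrier (S 0) ==> \<epsilon> (g 0 x) = eS x"
    "\<And>n x. x \<in> carrier (S (Suc n)) ==> \<delta> n (g (Suc n) x) = g n (dS n x)"
    by (rule chain_map_exists[OF S.augmented_complex_axioms P(1) S_projective]) (rule that)
  obtain h where h: "\<And>n. h n \<in> lmod_hom R (S n) (S (Suc n))"
    "\<And>x. x \<in> carrier (S 0) ==> dS 0 (h 0 x) = x \<ominus>\<^bsub>S 0\<^esub> f 0 (g 0 x)"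
    "\<And>n x. x \<in> carrier (S (Suc n)) ==>
       dS (Suc n) (h (Suc n) x) = (x \<ominus>\<^bsub>S (Suc n)\<^esub> f (Suc n) (g (Suc n) x)) \<ominus>\<^bsub>S (Suc n)\<^esub> h n (dS n x)"
  proof (rule homotopy_inverse_exists[where f=g and g=f, OF S P(1) S_projective])
  qed (rule g f that; assumption)+
  obtain k where k: "\<And>n. k n \<in> lmod_hom R (P n) (P (Suc n))"
    "\<And>x. x \<in> carrier (P 0) ==> \<delta> 0 (k 0 x) = x \<ominus>\<^bsub>P 0\<^esub> g 0 (f 0 x)"
    "\<And>n x. x \<in> carrier (P (Suc n)) ==>
       \<delta> (Suc n) (k (Suc n) x) = (x \<ominus>\<^bsub>P (Suc n)\<^esub> g (Suc n) (f (Suc n) x)) \<ominus>\<^bsub>P (Suc n)\<^esub> k n (\<delta> n x)"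
  proof (rule homotopy_inverse_exists[where f=f and g=g, OF P(1) S P(3)])
  qed (rule g f that; assumption)+
  have "fp_comparison G P \<delta> \<epsilon> l f g h k"
    by (rule fp_comparison.intro[OF grp_axioms], rule fp_comparison_axioms.intro)
      (fact P f g h k)+
  then show ?thesis by (rule that)
qed

context fp_comparison
begin

sublocale P: resolution R P \<delta> \<epsilon> Zt by (rule P)

text \<open>Tuples of length \<open>n\<close> sit in degree \<open>n - 1\<close>, hence the shift;
  at length 0 the operator is zero.\<close>

definition T :: "nat \<Rightarrow> ('a list \<Rightarrow>\<^sub>0 int) \<Rightarrow> 'a list \<Rightarrow>\<^sub>0 int" where
  "T n u = (case n of 0 \<Rightarrow> 0 | Suc m \<Rightarrow> f m (g m u))"

definition h' :: "nat \<Rightarrow> ('a list \<Rightarrow>\<^sub>0 int) \<Rightarrow> 'a list \<Rightarrow>\<^sub>0 int" where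
  "h' n u = (case n of 0 \<Rightarrow> 0 | Suc m \<Rightarrow> h m u)"

lemma fp_grp_exists: "\<exists>T h Y l. fp_grp G T h Y l"
proof -
  have car: "ch (Suc n) = carrier (S n)" for n by simp
  have T_hom: "T (Suc n) \<in> add_hom (S n) (S n)" for n
    using add_hom_comp[OF lmod_hom_add_hom[OF g(1)] lmod_hom_add_hom[OF f(1)]] by (simp add: T_def[abs_def])
  have Tcl: "T (Suc n) u \<in> carrier (S n)" if "u \<in> carrier (S n)" for n u by (rule add_hom_closed[OF T_hom that])
  have hcl: "h n u \<in> carrier (S (Suc n))" if "u \<in> carrier (S n)" for n u by (rule lmod_hom_closed[OF h(1) that])
  have fin0: "\<exists>B. finite B \<and> B \<subseteq> carrier (P n) \<and> (\<forall>x\<in>carrier (P n). \<exists>c\<in>B \<rightarrow> carrier R. x = (\<Oplus>\<^bsub>P n\<^esub>s\<in>B. c s \<odot>\<^bsub>P n\<^esub> s))" for n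
  proof -
    have "\<exists>B\<subseteq>carrier (P n). finite B \<and> (\<forall>x\<in>carrier (P n). \<exists>c\<in>B \<rightarrow> carrier R. x = (\<Oplus>\<^bsub>P n\<^esub>s\<in>B. c s \<odot>\<^bsub>P n\<^esub> s))"
      using P_fg[of n] unfolding finitely_generated_module_def by (rule conjunct2)
    then show ?thesis by (elim exE conjE) (intro exI conjI; assumption)
  qed
  obtain B where B': "\<forall>n. finite (B n) \<and> B n \<subseteq> carrier (P n) \<and>
      (\<forall>x\<in>carrier (P n). \<exists>c\<in>B n \<rightarrow> carrier R. x = (\<Oplus>\<^bsub>P n\<^esub>s\<in>B n. c s \<odot>\<^bsub>P n\<^esub> s))"
    using choice[OF allI[of "\<lambda>n. \<exists>B. finite B \<and> B \<subseteq> carrier (P n) \<and>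
      (\<forall>x\<in>carrier (P n). \<exists>c\<in>B \<rightarrow> carrier R. x = (\<Oplus>\<^bsub>P n\<^esub>s\<in>B. c s \<odot>\<^bsub>P n\<^esub> s))", OF fin0]] by (rule exE)
  note B = B'[THEN spec, THEN conjunct1] B'[THEN spec, THEN conjunct2, THEN conjunct1]
    B'[THEN spec, THEN conjunct2, THEN conjunct2, THEN bspec]
  \<comment> \<open>\<open>T\<close> factors through \<open>P\<close>, so every \<open>T u\<close>
    is a combination of the elements \<open>f m s\<close> for generators \<open>s\<close>, and its
    tuples are translates of theirs.\<close>
  define Y where "Y n = (case n of 0 \<Rightarrow> {} | Suc m \<Rightarrow> \<Union>s\<in>B m. keys (f m s))" for n
  \<comment> \<open>The bound is raised by one because it refers to the length of tuples.\<close>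
  have "fp_grp G T h' Y (Suc l)"
  proof (intro fp_grp.intro fp_grp_axioms.intro grp_axioms)
    show "T (Suc n) \<in> add_hom (Sg (Suc n)) (Sg (Suc n))" for n using T_hom by (simp add: S_add_hom)
    show "T (Suc n) (gact a u) = gact a (T (Suc n) u)" if a: "a \<in> \<G>" and u: "u \<in> ch (Suc n)" for n a u
      using lmod_hom_smult[OF g(1) del_closed[OF a], of u n] lmod_hom_smult[OF f(1) del_closed[OF a], of "g n u" n]
        u lmod_hom_closed[OF g(1), of u n] a by (simp add: T_def)
    show "bd (T (Suc (Suc n)) u) = T (Suc n) (bd u)" if u: "u \<in> ch (Suc (Suc n))" for n u
      using f(3)[of "g (Suc n) u" n] g(3)[of u n] u[unfolded car] lmod_hom_closed[OF g(1), of u "Suc n"]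
        lmod_hom_closed[OF f(1), of "g (Suc n) u" "Suc n"] by (simp add: T_def)
    show "h' N \<in> add_hom (Sg N) (Sg (Suc N))" for N
    proof (cases N)
      case 0
      then show ?thesis by (intro add_homI) (auto simp: h'_def)
    next
      case (Suc m)
      then show ?thesis using lmod_hom_add_hom[OF h(1)[of m]] by (simp add: h'_def[abs_def] S_add_hom)
    qed
    show "h' N (gact a u) = gact a (h' N u)" if a: "a \<in> \<G>" and u: "u \<in> ch N" for N a u
      using lmod_hom_smult[OF h(1) del_closed[OF a], of u "N - 1"] a u by (cases N) (auto simp: h'_def)
    show "h' 0 u = 0" for u by (simp add: h'_def)
    show "u = T (Suc n) u + (bd (h' (Suc n) u) + h' n (bd u))" if u: "u \<in> ch (Suc n)" for n u
    proof (cases n)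
      case 0
      then show ?thesis using h(2)[of u] u[unfolded car] hcl[of u 0] S_minus[of u 0 "T (Suc 0) u"] Tcl[of u 0]
        by (simp add: h'_def T_def)
    next
      case (Suc m)
      have u': "u \<in> carrier (S (Suc m))" using u Suc by simp
      have du: "dS m u = bd u" "bd u \<in> carrier (S m)" using u' bd_closed[OF u'] by auto
      have *: "u - T (Suc (Suc m)) u \<in> carrier (S (Suc m))"
        using abelian_group.minus_closed[OF S_abelian u' Tcl[OF u']] S_minus[OF u' Tcl[OF u']] by simp
      have "bd (h (Suc m) u) = (u - T (Suc (Suc m)) u) - h m (bd u)"
        using h(3)[OF u'] S_minus[OF u' Tcl[OF u']] S_minus[OF * hcl[OF du(2)]] du hcl[OF u'] by (simp add: T_def)
      then show ?thesis by (simp add: h'_def Suc)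
    qed
    show "finite (Y n)" for n using B(1) by (auto simp: Y_def split: nat.split)
    show "Y n \<subseteq> Gs n" for n
    proof (cases n)
      case (Suc m)
      have "keys (f m s) \<subseteq> Gs (Suc m)" if "s \<in> B m" for s
        using lmod_hom_closed[OF f(1), of s m] B(2)[of m] that by auto
      then show ?thesis by (auto simp: Y_def Suc)
    qed (simp add: Y_def)
    show "T n u = 0" if "n > Suc l" "u \<in> ch n" for n u
    proof -
      obtain m where m: "n = Suc m" "m > l" using \<open>n > Suc l\<close> by (cases n) auto
      have "g m u = \<zero>\<^bsub>P m\<^esub>" using lmod_hom_closed[OF g(1), of u m] that(2) P_top[OF m(2)] m by simp
      then show ?thesis
        using add_hom_zero[OF lmod_abelian[OF P.lmod] S_abelian lmod_hom_add_hom[OF f(1)]] m by (simp add: T_def)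
    qed
    show "keys (T (Suc n) u) \<subseteq> (\<Union>a\<in>\<G>. gmap a ` Y (Suc n))" if "u \<in> ch (Suc n)" for n u
    proof -
      let ?GY = "\<Union>a\<in>\<G>. gmap a ` Y (Suc n)"
      have gu: "g n u \<in> carrier (P n)" using lmod_hom_closed[OF g(1), of u n] that by simp
      obtain c where c: "c \<in> B n \<rightarrow> carrier R" "g n u = (\<Oplus>\<^bsub>P n\<^esub>s\<in>B n. c s \<odot>\<^bsub>P n\<^esub> s)"
        using B(3)[OF gu] by blast
      have s: "s \<in> carrier (P n)" "c s \<in> carrier R" if "s \<in> B n" for s
        using that c(1) B(2)[of n] by auto
      have Yn: "Y (Suc n) \<subseteq> Gs (Suc n)"
        using lmod_hom_closed[OF f(1), of _ n] B(2)[of n] by (fastforce simp: Y_def)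
      have "T (Suc n) u = (\<Oplus>\<^bsub>S n\<^esub>s\<in>B n. f n (c s \<odot>\<^bsub>P n\<^esub> s))"
        unfolding T_def nat.case c(2)
        by (rule add_hom_finsum[OF lmod_abelian[OF P.lmod] S_abelian lmod_hom_add_hom[OF f(1)]])
          (use s in \<open>auto intro: left_module.smult_closed[OF P.lmod]\<close>)
      moreover have "(\<Oplus>\<^bsub>S n\<^esub>s\<in>B n. f n (c s \<odot>\<^bsub>P n\<^esub> s)) \<in> {w. keys w \<subseteq> ?GY}"
      proof (rule finsum_in_subset[OF S_abelian])
        have "?GY \<subseteq> Gs (Suc n)"
          by (intro UN_least image_subsetI) (use Yn in \<open>auto intro: Gs_map\<close>)
        then show "{w. keys w \<subseteq> ?GY} \<subseteq> carrier (S n)" by auto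
        show "x \<oplus>\<^bsub>S n\<^esub> y \<in> {w. keys w \<subseteq> ?GY}" if "x \<in> {w. keys w \<subseteq> ?GY}" "y \<in> {w. keys w \<subseteq> ?GY}" for x y
          using that keys_add[of x y] by auto
        fix i assume i: "i \<in> B n"
        have "keys (f n i) \<subseteq> Y (Suc n)" using i by (auto simp: Y_def)
        moreover have "f n (c i \<odot>\<^bsub>P n\<^esub> i) = c i \<odot>\<^bsub>S n\<^esub> f n i" by (rule lmod_hom_smult[OF f(1) s(2)[OF i] s(1)[OF i]])
        moreover have "(\<Union>a\<in>\<G>. gmap a ` keys (f n i)) \<subseteq> ?GY"
          using \<open>keys (f n i) \<subseteq> Y (Suc n)\<close> by (intro UN_mono image_mono) auto
        ultimately show "f n (c i \<odot>\<^bsub>P n\<^esub> i) \<in> {w. keys w \<subseteq> ?GY}"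
          using order_trans[OF keys_smult[OF s(2)[OF i], of n "f n i"]] by simp
      qed auto
      ultimately show ?thesis by simp
    qed
  qed
  then show ?thesis by blast
qed


end

text \<open>Complexes of homomorphisms that are identified, by an evaluation map, with the cochains of the
  standard resolution.\<close>

locale cochain_model = grp G + H: hom_complex Q K \<delta> N
  for G :: "('g, 't) monoid_scheme" (structure) and Q :: "('r, 's) ring_scheme"
    and K :: "nat \<Rightarrow> ('r, 'c) module" and \<delta> and N :: "('r, 'n) module" +
  fixes M :: "('m, 'u) ring_scheme" and ev :: "nat \<Rightarrow> ('c \<Rightarrow> 'n) \<Rightarrow> ('g list \<Rightarrow>\<^sub>0 int) \<Rightarrow> 'm"
  assumes abM: "abelian_group M"
    and ev_C: "\<And>n f. f \<in> lmod_hom Q (K n) N ==> ev n f \<in> C (Suc n) M"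
    and ev_eqI: "\<And>n f f'. f \<in> lmod_hom Q (K n) N ==> f' \<in> lmod_hom Q (K n) N ==>
      (\<And>u. u \<in> ch (Suc n) ==> ev n f u = ev n f' u) ==> f = f'"
    and ev_onto: "\<And>n \<phi>. \<phi> \<in> C (Suc n) M ==> \<exists>f\<in>lmod_hom Q (K n) N. \<forall>u\<in>ch (Suc n). ev n f u = \<phi> u"
    and ev_comp: "\<And>n f u. u \<in> ch (Suc (Suc n)) ==> ev (Suc n) (\<lambda>x\<in>carrier (K (Suc n)). f (\<delta> n x)) u = ev n f (bd u)"
    and ev_zero: "\<And>n u. u \<in> ch (Suc n) ==> ev n (\<lambda>x\<in>carrier (K n). \<zero>\<^bsub>N\<^esub>) u = \<zero>\<^bsub>M\<^esub>"
begin

lemma comp_hom: "f \<in> lmod_hom Q (K n) N ==> (\<lambda>x\<in>carrier (K (Suc n)). f (\<delta> n x)) \<in> lmod_hom Q (K (Suc n)) N"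
  using lmod_hom_comp[OF H.lC H.d_hom] by (simp cong: restrict_cong)

lemma cocycle_hom: "f \<in> carrier (H.Zc n) ==> f \<in> lmod_hom Q (K n) N"
  by (simp add: H.cocycles_iff)

lemma ev_eq_iff:
  assumes "f \<in> lmod_hom Q (K n) N" "f' \<in> lmod_hom Q (K n) N"
  shows "f = f' \<longleftrightarrow> (\<forall>u\<in>ch (Suc n). ev n f u = ev n f' u)"
proof
  assume "\<forall>u\<in>ch (Suc n). ev n f u = ev n f' u"
  then show "f = f'" by (intro ev_eqI[OF assms]) (rule bspec)
qed simp

lemma cocycle_iff:
  assumes f: "f \<in> lmod_hom Q (K n) N"
  shows "f \<in> carrier (H.Zc n) \<longleftrightarrow> (\<forall>u\<in>ch (Suc (Suc n)). ev n f (bd u) = \<zero>\<^bsub>M\<^esub>)"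
proof -
  let ?f = "\<lambda>x\<in>carrier (K (Suc n)). f (\<delta> n x)" and ?z = "\<lambda>x\<in>carrier (K (Suc n)). \<zero>\<^bsub>N\<^esub>"
  have "f \<in> carrier (H.Zc n) \<longleftrightarrow> (\<forall>x\<in>carrier (K (Suc n)). ?f x = ?z x)" using f by (simp add: H.cocycles_iff)
  also have "\<dots> \<longleftrightarrow> ?f = ?z" by (auto simp: fun_eq_iff restrict_def)
  also have "\<dots> \<longleftrightarrow> (\<forall>u\<in>ch (Suc (Suc n)). ev n f (bd u) = \<zero>\<^bsub>M\<^esub>)"
    unfolding ev_eq_iff[OF comp_hom[OF f] H.hom_zero] by (intro ball_cong refl) (simp only: ev_comp ev_zero)
  finally show ?thesis .
qed

lemma coboundary_iff:
  assumes f: "f \<in> lmod_hom Q (K n) N"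
  shows "f \<in> H.Bc n \<longleftrightarrow> (\<exists>b\<in>C n M. \<forall>u\<in>ch (Suc n). ev n f u = b (bd u))"
proof (cases n)
  \<comment> \<open>In degree 0 the right-hand side also says that \<open>f\<close> is zero, because
    members of \<open>C 0 M\<close> vanish on chains of length 0.\<close>
  case 0
  have "f \<in> H.Bc 0 \<longleftrightarrow> f = (\<lambda>x\<in>carrier (K 0). \<zero>\<^bsub>N\<^esub>)" by (simp add: H.coboundaries_0 H.cocycles_one)
  also have "\<dots> \<longleftrightarrow> (\<forall>u\<in>ch (Suc 0). ev 0 f u = \<zero>\<^bsub>M\<^esub>)"
    unfolding ev_eq_iff[OF f[unfolded 0] H.hom_zero] by (intro ball_cong refl) (simp only: ev_zero)
  also have "\<dots> \<longleftrightarrow> (\<exists>b\<in>C 0 M. \<forall>u\<in>ch (Suc 0). ev 0 f u = b (bd u))"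
  proof -
    have "b (bd u) = \<zero>\<^bsub>M\<^esub>" if "b \<in> C 0 M" "u \<in> ch (Suc 0)" for b u
      using that bd_cl[of u 0] by (simp add: C_def)
    then show ?thesis by (intro iffI bexI[OF _ C_zero[OF abM]]; simp) metis
  qed
  finally show ?thesis using 0 by simp
next
  case (Suc m)
  show ?thesis
  proof
    assume "f \<in> H.Bc n"
    then obtain g where "g \<in> lmod_hom Q (K m) N" "f = (\<lambda>x\<in>carrier (K (Suc m)). g (\<delta> m x))"
      unfolding Suc H.coboundaries_Suc by (elim bexE)
    then show "\<exists>b\<in>C n M. \<forall>u\<in>ch (Suc n). ev n f u = b (bd u)"
      unfolding Suc by (intro bexI[of _ "ev m g"] ballI ev_C) (simp_all only: ev_comp)
  next
    assume "\<exists>b\<in>C n M. \<forall>u\<in>ch (Suc n). ev n f u = b (bd u)"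
    then obtain b where b: "b \<in> C (Suc m) M" "\<And>u. u \<in> ch (Suc n) ==> ev n f u = b (bd u)" unfolding Suc by blast
    obtain g where g: "g \<in> lmod_hom Q (K m) N" "\<And>u. u \<in> ch (Suc m) ==> ev m g u = b u"
      using ev_onto[OF b(1)] by blast
    have "f = (\<lambda>x\<in>carrier (K (Suc m)). g (\<delta> m x))"
    proof (rule ev_eqI[OF f[unfolded Suc] comp_hom[OF g(1)]])
      fix u assume u: "u \<in> ch (Suc (Suc m))"
      show "ev (Suc m) f u = ev (Suc m) (\<lambda>x\<in>carrier (K (Suc m)). g (\<delta> m x)) u"
        unfolding ev_comp[OF u] g(2)[OF bd_cl[OF u]] using b(2) u Suc by simp
    qed
    then show "f \<in> H.Bc n" unfolding Suc H.coboundaries_Suc using g(1) by blast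
  qed
qed

end

context grp
begin

section \<open>Poincare duality in terms of cochains\<close>

lemma del_apply: "del g x = (if x = g then 1 else 0)"
  by (simp add: del_sing sing_def)

lemma del_mult_apply:
  assumes "g \<in> \<G>" "a \<in> carrier R" "x \<in> \<G>"
  shows "(del g \<otimes>\<^bsub>R\<^esub> a) x = a (inv g \<otimes> x)"
proof -
  have "(del g \<otimes>\<^bsub>R\<^esub> a) x = (\<Oplus>\<^bsub>\<Z>\<^esub>y\<in>{g}. del g y \<otimes>\<^bsub>\<Z>\<^esub> a (inv y \<otimes> x))"
    by (rule ZG.A_mult_eq[OF del_closed[OF assms(1)] assms(2,3)]) (use assms in \<open>auto simp: del_sing sing_def\<close>)
  also have "\<dots> = a (inv g \<otimes> x)"
    using ZG.k.finsum_insert[of "{}" g "\<lambda>y. del g y \<otimes>\<^bsub>\<Z>\<^esub> a (inv y \<otimes> x)"] by (simp add: del_sing sing_def)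
  finally show ?thesis .
qed

lemma mult_del_apply:
  assumes "g \<in> \<G>" "a \<in> carrier R"
  shows "(a \<otimes>\<^bsub>R\<^esub> del g) \<one> = a (inv g)"
proof -
  note ev = ZG.A_add_hom(1)[of "\<Z>", unfolded set_eq_iff, THEN spec, THEN iffD2, OF free_module_lookup_add_hom[OF ZG.k_ab]]
  show ?thesis
  proof (rule add_hom_eqI[OF R_spans ZG.A_abelian ZG.k_ab add_hom_comp[OF ZG.A_mult_add_hom(2) ev] ev _ assms(2)])
    fix b assume "b \<in> del ` \<G>"
    then obtain x where x: "x \<in> \<G>" "b = del x" by auto
    have "(x \<otimes> g = \<one>) = (x = inv g)" using x assms(1) by (metis G.inv_equality G.l_inv G.inv_closed)
    then show "(b \<otimes>\<^bsub>R\<^esub> del g) \<one> = b (inv g)"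
      unfolding x(2) del_mult[OF x(1) assms(1)] del_apply by (metis (full_types))
  qed (use assms in auto)
qed

abbreviation "RR \<equiv> regular_module R"

text \<open>\<open>ev\<close> and \<open>ind\<close> identify the cochains of the standard resolution with coefficients in the group
  ring with \<^term>\<open>C (Suc n) \<Z>\<close>.\<close>

definition ev :: "(('g list \<Rightarrow>\<^sub>0 int) \<Rightarrow> 'g \<Rightarrow> int) \<Rightarrow> ('g list \<Rightarrow>\<^sub>0 int) \<Rightarrow> int" where
  "ev F u = F u \<one>"

definition ind :: "nat \<Rightarrow> (('g list \<Rightarrow>\<^sub>0 int) \<Rightarrow> int) \<Rightarrow> ('g list \<Rightarrow>\<^sub>0 int) \<Rightarrow> 'g \<Rightarrow> int" where
  "ind n \<phi> = restrict (\<lambda>u x. if x \<in> \<G> then \<phi> (gact (inv x) u) else 0) (carrier (S n))"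

lemma RR_left_module: "left_module R RR"
  by (rule regular_module_left_module[OF ZG.A_ring])

lemma hom_apply:
  assumes "F \<in> lmod_hom R (S n) RR" "u \<in> carrier (S n)" "x \<in> \<G>"
  shows "F u x = ev F (gact (inv x) u)"
proof -
  have "F (del (inv x) \<odot>\<^bsub>S n\<^esub> u) = del (inv x) \<odot>\<^bsub>RR\<^esub> F u"
    by (rule lmod_hom_smult[OF assms(1) del_closed assms(2)]) (use assms(3) in simp)
  then show ?thesis
    using del_mult_apply[of "inv x" "F u" "\<one>"] assms(3) lmod_hom_closed[OF assms(1,2)] by (simp add: ev_def)
qed

lemma ev_C:
  assumes "F \<in> lmod_hom R (S n) RR" shows "ev F \<in> C (Suc n) \<Z>"
  unfolding C_def
proof (intro CollectI conjI ballI impI)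
  have cl: "F u \<in> carrier R" if "u \<in> carrier (S n)" for u using lmod_hom_closed[OF assms that] by simp
  show "ev F \<in> add_hom (Sg (Suc n)) \<Z>"
    using add_hom_add[OF lmod_hom_add_hom[OF assms]] by (intro add_homI) (auto simp: ev_def)
  fix xs assume xs: "xs \<in> Gs (Suc n)"
  have "{g \<in> \<G>. ev F (frag_of (gmap g xs)) \<noteq> \<zero>\<^bsub>\<Z>\<^esub>} \<subseteq> m_inv G ` {x \<in> \<G>. F (frag_of xs) x \<noteq> 0}"
  proof
    fix g assume g: "g \<in> {g \<in> \<G>. ev F (frag_of (gmap g xs)) \<noteq> \<zero>\<^bsub>\<Z>\<^esub>}"
    then have "F (frag_of xs) (inv g) \<noteq> 0" using hom_apply[OF assms, of "frag_of xs" "inv g"] xs by (simp add: gact_frag_of)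
    then show "g \<in> m_inv G ` {x \<in> \<G>. F (frag_of xs) x \<noteq> 0}" using g by (intro image_eqI[of _ _ "inv g"]) auto
  qed
  moreover have "finite {x \<in> \<G>. F (frag_of xs) x \<noteq> 0}" using cl[of "frag_of xs"] xs by (simp add: fin_supp_def)
  ultimately show "finite {g \<in> \<G>. ev F (frag_of (gmap g xs)) \<noteq> \<zero>\<^bsub>\<Z>\<^esub>}" by (meson finite_imageI finite_subset)
qed auto

lemma ind_hom:
  assumes "\<phi> \<in> C (Suc n) \<Z>" shows "ind n \<phi> \<in> lmod_hom R (S n) RR"
  unfolding ind_def
proof (rule lmod_homI[OF S_left_module])
  let ?F = "\<lambda>u x. if x \<in> \<G> then \<phi> (gact (inv x) u) else 0"
  have gcl: "gact g u \<in> ch (Suc n)" if "g \<in> \<G>" "u \<in> carrier (S n)" for g u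
    using add_hom_closed[OF gact_hom[OF that(1)], of u "Suc n"] that(2) by simp
  show F: "?F \<in> add_hom (S n) RR"
  proof (rule add_homI)
    fix u assume u: "u \<in> carrier (S n)"
    have "{x \<in> \<G>. \<phi> (gact (inv x) u) \<noteq> 0} \<subseteq> m_inv G ` {g \<in> \<G>. \<phi> (gact g u) \<noteq> \<zero>\<^bsub>\<Z>\<^esub>}"
    proof
      fix x assume "x \<in> {x \<in> \<G>. \<phi> (gact (inv x) u) \<noteq> 0}"
      then show "x \<in> m_inv G ` {g \<in> \<G>. \<phi> (gact g u) \<noteq> \<zero>\<^bsub>\<Z>\<^esub>}" by (intro image_eqI[of _ _ "inv x"]) auto
    qed
    from finite_subset[OF this finite_imageI[OF C_finite[OF ZG.k_ab assms]]]
    have "finite {x \<in> \<G>. \<phi> (gact (inv x) u) \<noteq> 0}" using u by simp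
    then show "?F u \<in> carrier RR" by (auto simp: fin_supp_def cong: conj_cong)
  next
    fix u v assume "u \<in> carrier (S n)" "v \<in> carrier (S n)"
    then show "?F (u \<oplus>\<^bsub>S n\<^esub> v) = ?F u \<oplus>\<^bsub>RR\<^esub> ?F v"
      using add_hom_add[OF C_hom[OF assms] gcl gcl, of _ u _ v] by (auto simp: gact_add)
  qed
  show "?F (r \<odot>\<^bsub>S n\<^esub> u) = r \<odot>\<^bsub>RR\<^esub> ?F u" if "r \<in> carrier R" "u \<in> carrier (S n)" for r u
  proof (rule S_hom_linear[OF F RR_left_module _ that])
    fix g xs assume g: "g \<in> \<G>" and xs: "xs \<in> Gs (Suc n)"
    have xsS: "frag_of xs \<in> carrier (S n)" using xs by simp
    show "?F (frag_of (gmap g xs)) = del g \<odot>\<^bsub>RR\<^esub> ?F (frag_of xs)"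
    proof
      fix x
      show "?F (frag_of (gmap g xs)) x = (del g \<odot>\<^bsub>RR\<^esub> ?F (frag_of xs)) x"
      proof (cases "x \<in> \<G>")
        case True
        have "(del g \<odot>\<^bsub>RR\<^esub> ?F (frag_of xs)) x = ?F (frag_of xs) (inv g \<otimes> x)"
          using del_mult_apply[OF g _ True, of "?F (frag_of xs)"] add_hom_closed[OF F xsS] by simp
        also have "\<dots> = \<phi> (gact (inv x) (gact g (frag_of xs)))"
          using g True gact_gact[of "inv x" g "frag_of xs" "Suc n"] xs by (simp add: G.inv_mult_group)
        finally show ?thesis using True by (simp add: gact_frag_of)
      qed (simp add: ZG.A_mult_outside)
    qed
  qed
qed

lemma ev_ind: "u \<in> carrier (S n) ==> ev (ind n \<phi>) u = \<phi> u"
  using gact_one[of u "Suc n"] by (simp add: ev_def ind_def)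

sublocale H: hom_complex R S standard_differential RR
proof (rule hom_complex.intro)
  show "restrict (standard_differential n) (carrier (S (Suc n))) \<in> lmod_hom R (S (Suc n)) (S n)" for n
    unfolding standard_differential_bd by (rule S_bd_hom)
qed (auto simp: S_left_module RR_left_module standard_differential_bd bd_bd)

sublocale RM: cochain_model G R S standard_differential RR \<Z> "\<lambda>_. ev"
proof (intro cochain_model.intro cochain_model_axioms.intro grp_axioms H.hom_complex_axioms ZG.k_ab)
  show "f = f'" if f: "f \<in> lmod_hom R (S n) RR" "f' \<in> lmod_hom R (S n) RR"
    and eq: "\<And>u. u \<in> ch (Suc n) ==> ev f u = ev f' u" for n f f'
  proof (rule lmod_hom_eqI[OF f])
    fix u assume u: "u \<in> carrier (S n)"
    have "f u x = f' u x" for x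
      using hom_apply[OF f(1) u] hom_apply[OF f(2) u] eq add_hom_closed[OF gact_hom, of "inv x" u "Suc n"] u
        lmod_hom_closed[OF f(1) u] lmod_hom_closed[OF f(2) u]
      by (cases "x \<in> \<G>") (auto simp: fin_supp_def)
    then show "f u = f' u" by (rule ext)
  qed
  show "\<exists>f\<in>lmod_hom R (S n) RR. \<forall>u\<in>ch (Suc n). ev f u = \<phi> u" if "\<phi> \<in> C (Suc n) \<Z>" for n \<phi>
    using ind_hom[OF that] ev_ind[of _ n \<phi>] by (intro bexI[of _ "ind n \<phi>"]) auto
qed (auto simp: ev_C ev_def standard_differential_bd)

lemma ev_mult:
  "F \<in> carrier (H.Zc n) ==> F' \<in> carrier (H.Zc n) ==> u \<in> carrier (S n) ==>
    ev (F \<otimes>\<^bsub>H.Zc n\<^esub> F') u = ev F u + ev F' u"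
  by (simp add: ev_def H.cocycles_mult)

lemma ev_group_hom: "u \<in> carrier (S n) ==> group_hom (H.Zc n) integer_group (\<lambda>F. ev F u)"
  by (intro group_hom.intro group_hom_axioms.intro homI) (auto simp: ev_mult H.Z.is_group)

lemma ev_int_pow:
  assumes "F \<in> carrier (H.Zc n)" "u \<in> carrier (S n)"
  shows "ev (F [^]\<^bsub>H.Zc n\<^esub> (m::int)) u = m * ev F u"
  using group_hom.hom_int_pow[OF ev_group_hom[OF assms(2)] assms(1)] by simp

lemma ev_inv:
  assumes "F \<in> carrier (H.Zc n)" "u \<in> carrier (S n)"
  shows "ev (inv\<^bsub>H.Zc n\<^esub> F) u = - ev F u"
  using group_hom.hom_inv[OF ev_group_hom[OF assms(2)] assms(1)] by simp

lemma right_mult_hom: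
  assumes "a \<in> \<G>"
  shows "(\<lambda>x. x \<otimes>\<^bsub>R\<^esub> group_basis \<Z> a) \<in> add_hom RR RR"
  using ZG.A_mult_add_hom(2)[OF del_closed[OF assms]] by (simp add: add_hom_def del_def)

text \<open>The cochain \<open>c\<close> is the coefficient at 1 of a cocycle generating the top
  cohomology. The second conclusion is the trivial action of \<open>G\<close> on that class, read on
  cochains; this is how orientability enters.\<close>

lemma PD_pd_grp:
  assumes "orientable_PD_group G d"
  obtains T h Y l c where "pd_grp G T h Y l c d"
    "\<And>a. a \<in> \<G> ==> \<exists>e\<in>C d \<Z>. \<forall>u\<in>ch (Suc d). c (gact a u) = c u + e (bd u)"
proof -
  have H_eq: "group_cohomology G RR = H.H"
    by (simp add: group_cohomology_def fun_eq_iff)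
  have fp: "group_type_FP G" and triv: "\<And>i. i \<noteq> d ==> trivial_group (H.H i)"
    and iso: "H.H d \<cong> integer_group"
    and act: "\<And>g U. g \<in> \<G> ==> U \<in> carrier (H.H d) ==> group_cohomology_action G d g U = U"
    using assms unfolding orientable_PD_group_def Let_def H_eq by blast+
  obtain P \<delta> \<epsilon> l0 f g h0 k where "fp_comparison G P \<delta> \<epsilon> l0 f g h0 k"
    by (rule fp_comparison_exists[OF fp]) (rule that)
  then obtain T h Y l where "fp_grp G T h Y l"
    using fp_comparison.fp_grp_exists by blast
  then interpret F: fp_grp G T h Y l .
  obtain i where i: "i \<in> iso (H.H d) integer_group" using iso by (auto simp: is_iso_def)
  obtain q where q: "q \<in> hom (H.Zc d) integer_group" "q ` carrier (H.Zc d) = carrier integer_group"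
    "\<And>F. F \<in> carrier (H.Zc d) ==> q F = \<one>\<^bsub>integer_group\<^esub> \<longleftrightarrow> F \<in> H.Bc d"
    by (rule H.iso_to_hom[OF i group_integer_group]) (rule that)
  interpret q: group_hom "H.Zc d" integer_group q
    using q(1) by (intro group_hom.intro group_hom_axioms.intro H.Z.is_group) auto
  have "(1::int) \<in> q ` carrier (H.Zc d)" by (simp add: q(2))
  then obtain c' where "1 = q c'" and c'Z: "c' \<in> carrier (H.Zc d)" by (rule imageE)
  note c' = c'Z \<open>1 = q c'\<close>[symmetric]
  have c'_hom: "c' \<in> lmod_hom R (S d) RR" using c'(1) by (simp add: H.cocycles_iff)
  define c where "c = ev c'"
  have pow: "c' [^]\<^bsub>H.Zc d\<^esub> m \<in> carrier (H.Zc d)" "q (c' [^]\<^bsub>H.Zc d\<^esub> m) = m" for m :: int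
    using q.hom_int_pow[OF c'(1), of m] c' by simp_all
  have "pd_grp G T h Y l c d"
  proof (intro pd_grp.intro pd_grp_axioms.intro)
    show "fp_grp G T h Y l" by (rule F.fp_grp_axioms)
    show "c \<in> C (Suc d) \<Z>" unfolding c_def by (rule ev_C[OF c'_hom])
    show "c (bd u) = 0" if "u \<in> ch (Suc (Suc d))" for u
      using c'(1) that RM.cocycle_iff[OF c'_hom] by (auto simp: c_def)
  next
    fix n \<phi> assume \<phi>: "\<phi> \<in> C (Suc n) \<Z>" "\<And>u. u \<in> ch (Suc (Suc n)) ==> \<phi> (bd u) = 0"
    have \<phi>Z: "ind n \<phi> \<in> carrier (H.Zc n)"
      unfolding RM.cocycle_iff[OF ind_hom[OF \<phi>(1)]] using \<phi>(2) ev_ind[of _ n \<phi>] bd_cl by simp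
    show "\<exists>m. \<exists>b\<in>C n \<Z>. (n \<noteq> d \<longrightarrow> m = 0) \<and> (\<forall>u\<in>ch (Suc n). \<phi> u = c u * m + b (bd u))"
    proof (cases "n = d")
      case False
      have "ind n \<phi> \<in> H.Bc n" using triv[OF False] \<phi>Z by (auto simp: H.trivial_iff)
      then obtain b where b: "b \<in> C n \<Z>" "\<And>u. u \<in> carrier (S n) ==> ev (ind n \<phi>) u = b (bd u)"
        using RM.coboundary_iff[OF RM.cocycle_hom[OF \<phi>Z]] by auto
      have "\<phi> u = b (bd u)" if "u \<in> ch (Suc n)" for u
        using b(2)[of u] ev_ind[of u n \<phi>] that by simp
      with b(1) show ?thesis by (intro exI[of _ 0] bexI[of _ b]) auto
    next
      case True
      \<comment> \<open>Subtracting the \<open>m\<close>-th multiple of the generator lands in the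
        kernel of \<open>q\<close>, that is, among the coboundaries.\<close>
      define m where "m = q (ind d \<phi>)"
      let ?F = "ind d \<phi> \<otimes>\<^bsub>H.Zc d\<^esub> inv\<^bsub>H.Zc d\<^esub> (c' [^]\<^bsub>H.Zc d\<^esub> m)"
      have FZ: "?F \<in> carrier (H.Zc d)" using \<phi>Z pow(1) True by simp
      have "q ?F = \<one>\<^bsub>integer_group\<^esub>" using \<phi>Z pow True by (simp add: m_def)
      then obtain b where b: "b \<in> C d \<Z>" "\<And>u. u \<in> carrier (S d) ==> ev ?F u = b (bd u)"
        using q(3)[OF FZ] RM.coboundary_iff[OF RM.cocycle_hom[OF FZ]] by auto
      have "\<phi> u = c u * m + b (bd u)" if u: "u \<in> ch (Suc d)" for u
      proof -
        have uS: "u \<in> carrier (S d)" using u by simp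
        have "ev ?F u = \<phi> u - m * c u"
          using \<phi>Z pow(1) True ev_ind[OF uS, of \<phi>] by (simp add: ev_mult[OF _ _ uS] ev_inv[OF _ uS] ev_int_pow[OF c'(1) uS] c_def)
        then show ?thesis using b(2)[OF uS] by (simp add: algebra_simps)
      qed
      with b(1) True show ?thesis by auto
    qed
  next
    fix m b assume b: "b \<in> C d \<Z>" and eq: "\<And>u. u \<in> ch (Suc d) ==> c u * m = b (bd u)"
    have "\<forall>u\<in>carrier (S d). ev (c' [^]\<^bsub>H.Zc d\<^esub> m) u = b (bd u)"
    proof
      fix u assume u: "u \<in> carrier (S d)"
      show "ev (c' [^]\<^bsub>H.Zc d\<^esub> m) u = b (bd u)"
        using eq[of u] u by (simp add: ev_int_pow[OF c'(1) u] c_def mult.commute)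
    qed
    then have "c' [^]\<^bsub>H.Zc d\<^esub> m \<in> H.Bc d"
      unfolding RM.coboundary_iff[OF RM.cocycle_hom[OF pow(1)]] by (intro bexI[OF _ b]) simp
    then show "m = 0" using q(3)[OF pow(1), of m] pow(2)[of m] by simp
  qed
  moreover have "\<exists>e\<in>C d \<Z>. \<forall>u\<in>ch (Suc d). c (gact a u) = c u + e (bd u)" if a: "a \<in> \<G>" for a
  proof -
    let ?\<phi> = "\<lambda>x. x \<otimes>\<^bsub>R\<^esub> group_basis \<Z> a"
    let ?F = "compose (carrier (S d)) ?\<phi> c'"
    have lin: "?\<phi> (r \<odot>\<^bsub>RR\<^esub> x) = r \<odot>\<^bsub>RR\<^esub> ?\<phi> x" if "r \<in> carrier R" "x \<in> carrier RR" for r x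
      using ZG.A_mult_assoc[of r x "del a"] that del_closed[OF a] by (simp add: del_def)
    have "H.Bc d #>\<^bsub>H.Zc d\<^esub> ?F = H.Bc d #>\<^bsub>H.Zc d\<^esub> c'"
      using act[OF a, of "H.Bc d #>\<^bsub>H.Zc d\<^esub> c'"] H.hom_cohomology_map_class[OF right_mult_hom[OF a] lin c'(1)] c'(1)
      by (simp add: group_cohomology_action_def H.H_carrier)
    then have "?F \<in> H.Bc d #>\<^bsub>H.Zc d\<^esub> c'"
      using H.Z.rcos_self[OF H.compose_cocycle[OF right_mult_hom[OF a] lin c'(1)] H.coboundaries_subgroup] by simp
    then obtain \<beta> where \<beta>: "\<beta> \<in> H.Bc d" "?F = \<beta> \<otimes>\<^bsub>H.Zc d\<^esub> c'" by (auto simp: r_coset_def)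
    have \<beta>Z: "\<beta> \<in> carrier (H.Zc d)" by (rule subgroup.mem_carrier[OF H.coboundaries_subgroup \<beta>(1)])
    obtain e where e: "e \<in> C d \<Z>" "\<And>u. u \<in> carrier (S d) ==> ev \<beta> u = e (bd u)"
      using RM.coboundary_iff[OF RM.cocycle_hom[OF \<beta>Z]] \<beta>(1) by auto
    have "c (gact a u) = c u + e (bd u)" if u: "u \<in> ch (Suc d)" for u
    proof -
      have uS: "u \<in> carrier (S d)" using u by simp
      \<comment> \<open>Translating the chain by \<open>a\<close> and multiplying the value by
        \<open>a\<close> on the right have the same coefficient at 1, namely that of
        \<open>c' u\<close> at the inverse of \<open>a\<close>.\<close>
      have "c (gact a u) = c' u (inv a)"
        using hom_apply[OF c'_hom uS, of "inv a"] a by (simp add: c_def)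
      also have "\<dots> = ev ?F u"
        using mult_del_apply[OF a, of "c' u"] lmod_hom_closed[OF c'_hom uS] uS by (simp add: ev_def compose_def del_def)
      also have "\<dots> = e (bd u) + c u"
        unfolding \<beta>(2) using ev_mult[OF \<beta>Z c'(1) uS] e(2)[OF uS] by (simp add: c_def)
      finally show ?thesis by simp
    qed
    with e(1) show ?thesis by blast
  qed
  ultimately show ?thesis by (rule that)
qed

end

section \<open>Tensor powers of a group algebra\<close>

type_synonym ('g, 'k) tensors = "(('g \<Rightarrow> 'k) list \<Rightarrow>\<^sub>0 int) set"

locale galg = grp G + group_alg k G
  for k :: "('k, 's) ring_scheme" and G :: "('g, 't) monoid_scheme" (structure)
begin

abbreviation "tp N \<equiv> tuples A N"
text \<open>Tensor powers are indexed by the degree in the bar resolution, the length minus two.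
  Index 0 is \<open>A \<otimes> A\<close>, which is at once the lowest bar module, the outer
  bimodule and the additive group of the enveloping algebra.\<close>

abbreviation "tn n \<equiv> tp (Suc (Suc n))"
abbreviation "Gn n \<equiv> Gs (Suc (Suc n))"
abbreviation add_A (infixl "\<oplus>\<^sub>A" 65) where "x \<oplus>\<^sub>A y \<equiv> x \<oplus>\<^bsub>A\<^esub> y"
abbreviation mult_A (infixl "\<otimes>\<^sub>A" 70) where "x \<otimes>\<^sub>A y \<equiv> x \<otimes>\<^bsub>A\<^esub> y"
abbreviation smult_A (infixl "\<odot>\<^sub>A" 70) where "c \<odot>\<^sub>A x \<equiv> c \<odot>\<^bsub>A\<^esub> x"
abbreviation mult_k (infixl "\<otimes>\<^sub>k" 70) where "c \<otimes>\<^sub>k c' \<equiv> c \<otimes>\<^bsub>k\<^esub> c'"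
abbreviation "cls n \<equiv> tensor_class k A (Suc (Suc n))"
abbreviation "\<A> \<equiv> carrier A"
abbreviation "\<K> \<equiv> carrier k"
abbreviation zero_A ("\<zero>\<^sub>A") where "\<zero>\<^sub>A \<equiv> \<zero>\<^bsub>A\<^esub>"
abbreviation one_A ("\<one>\<^sub>A") where "\<one>\<^sub>A \<equiv> \<one>\<^bsub>A\<^esub>"
abbreviation zero_k ("\<zero>\<^sub>k") where "\<zero>\<^sub>k \<equiv> \<zero>\<^bsub>k\<^esub>"
abbreviation one_k ("\<one>\<^sub>k") where "\<one>\<^sub>k \<equiv> \<one>\<^bsub>k\<^esub>"
abbreviation add_k (infixl "\<oplus>\<^sub>k" 65) where "x \<oplus>\<^sub>k y \<equiv> x \<oplus>\<^bsub>k\<^esub> y"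
abbreviation "Bar n \<equiv> bar_resolution k A n"
abbreviation "\<B> n \<equiv> carrier (Bar n)"
abbreviation "Fr n \<equiv> frag_group (tn n)"
abbreviation "Rel n \<equiv> tensor_relations k A (Suc (Suc n))"
abbreviation "FA n \<equiv> free_Abelian_group (tn n)"

lemma Fr_FA: "carrier (Fr n) = carrier (FA n)"
  by (simp add: set_eq_iff)

lemma tp_update: "as \<in> tp N ==> a \<in> \<A> ==> as[i := a] \<in> tp N"
  by (auto simp: tuples_def dest!: subsetD[OF set_update_subset_insert])

lemma tp_nth: "as \<in> tp N ==> i < N ==> as ! i \<in> \<A>"
  by (auto simp: tuples_def)

definition rel_gens :: "nat \<Rightarrow> ('g, 'k) tensors" where
  "rel_gens N = {frag_of (xs[i := x \<oplus>\<^sub>A y]) - frag_of (xs[i := x]) - frag_of (xs[i := y]) | xs i x y.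
         xs \<in> tp N \<and> i < N \<and> x \<in> \<A> \<and> y \<in> \<A>} \<union>
      {frag_of (xs[i := c \<odot>\<^sub>A xs ! i]) - frag_of (xs[j := c \<odot>\<^sub>A xs ! j]) | xs i j c.
         xs \<in> tp N \<and> i < N \<and> j < N \<and> c \<in> \<K>}"

lemma Rel_generate: "Rel n = generate (FA n) (rel_gens (Suc (Suc n)))"
  by (simp add: tensor_relations_def rel_gens_def)

lemma rel_gens_carrier: "rel_gens (Suc (Suc n)) \<subseteq> carrier (FA n)"
proof
  fix w assume "w \<in> rel_gens (Suc (Suc n))"
  then consider xs i x y where "w = frag_of (xs[i := x \<oplus>\<^sub>A y]) - frag_of (xs[i := x]) - frag_of (xs[i := y])"
      "xs \<in> tn n" "x \<in> \<A>" "y \<in> \<A>"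
    | xs i j c where "w = frag_of (xs[i := c \<odot>\<^sub>A xs ! i]) - frag_of (xs[j := c \<odot>\<^sub>A xs ! j])"
      "xs \<in> tn n" "i < Suc (Suc n)" "j < Suc (Suc n)" "c \<in> \<K>"
    unfolding rel_gens_def by blast
  then show "w \<in> carrier (FA n)"
  proof cases
    case 1
    then have "xs[i := x \<oplus>\<^sub>A y] \<in> tn n" "xs[i := x] \<in> tn n" "xs[i := y] \<in> tn n"
      using A_ab.a_closed[OF 1(3,4)] by (auto intro!: tp_update simp del: galg_simps)
    then show ?thesis unfolding 1(1) carrier_free_Abelian_group_iff
      by (intro order_trans[OF keys_diff] Un_least) (simp_all add: keys_frag_of)
  next
    case 2
    then have "xs[i := c \<odot>\<^sub>A xs ! i] \<in> tn n" "xs[j := c \<odot>\<^sub>A xs ! j] \<in> tn n"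
      by (auto intro!: tp_update A_smult_closed tp_nth simp del: galg_simps)
    then show ?thesis unfolding 2(1) carrier_free_Abelian_group_iff
      by (intro order_trans[OF keys_diff] Un_least) (simp_all add: keys_frag_of)
  qed
qed

lemma Rel_subgroup: "subgroup (Rel n) (FA n)"
  unfolding Rel_generate by (rule group.generate_is_subgroup[OF group_free_Abelian_group rel_gens_carrier])

lemma TP_comm_group: "comm_group (tensor_power k A (Suc (Suc n)))"
  unfolding tensor_power_def
  by (rule comm_group.abelian_FactGroup[OF abelian_free_Abelian_group Rel_subgroup])

lemma Bar_abelian: "abelian_group (Bar n)"
  by (rule abelian_group_of_comm_group[OF TP_comm_group[of n]]) (auto simp: bar_resolution_def)

sublocale Bar: abelian_group "Bar n" for n by (rule Bar_abelian)

lemma Bar_carrier: "\<B> n = cls n ` carrier (Fr n)"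
  by (auto simp: bar_resolution_def tensor_power_def carrier_FactGroup tensor_class_def)

lemma cls_hom: "cls n \<in> add_hom (Fr n) (Bar n)"
proof -
  have "Rel n \<lhd> FA n"
    using comm_group.normal_iff_subgroup[OF abelian_free_Abelian_group] Rel_subgroup by blast
  from normal.r_coset_hom_Mod[OF this] have h: "cls n \<in> hom (FA n) (tensor_power k A (Suc (Suc n)))"
    by (simp add: tensor_class_def[abs_def] tensor_power_def)
  show ?thesis
    using h by (intro add_homI) (auto simp: hom_def bar_resolution_def)
qed

lemma cls_closed: "u \<in> carrier (Fr n) ==> cls n u \<in> \<B> n"
  by (rule add_hom_closed[OF cls_hom])

lemma Bar_cases:
  assumes "U \<in> \<B> n" obtains u where "u \<in> carrier (Fr n)" "U = cls n u"
  using assms unfolding Bar_carrier by (elim imageE) (rule that)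

lemma cls_frag_closed [simp]: "as \<in> tn n ==> cls n (frag_of as) \<in> \<B> n"
  by (rule cls_closed) simp

lemma cls_add: "u \<in> carrier (Fr n) ==> v \<in> carrier (Fr n) ==> cls n (u + v) = cls n u \<oplus>\<^bsub>Bar n\<^esub> cls n v"
  using add_hom_add[OF cls_hom] by simp

lemma cls_mem: "u \<in> carrier (Fr n) ==> v \<in> cls n u \<longleftrightarrow> v - u \<in> Rel n"
proof -
  assume u: "u \<in> carrier (Fr n)"
  have "v \<in> cls n u \<longleftrightarrow> (\<exists>r\<in>Rel n. v = r + u)" by (auto simp: tensor_class_def r_coset_def)
  also have "\<dots> \<longleftrightarrow> v - u \<in> Rel n" by (auto simp: algebra_simps) (metis diff_add_cancel)
  finally show ?thesis .
qed

lemma cls_self: "u \<in> carrier (Fr n) ==> u \<in> cls n u"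
  using cls_mem[of u n u] subgroup.one_closed[OF Rel_subgroup, of n] by simp

lemma cls_subset: "u \<in> carrier (Fr n) ==> v \<in> cls n u ==> v \<in> carrier (Fr n)"
proof -
  assume u: "u \<in> carrier (Fr n)" and v: "v \<in> cls n u"
  have "v - u \<in> carrier (FA n)" using v cls_mem[OF u] subgroup.subset[OF Rel_subgroup] by blast
  then show ?thesis using u keys_add[of "v - u" u] by auto
qed

lemma cls_eq: "u \<in> carrier (Fr n) ==> v \<in> cls n u ==> cls n v = cls n u"
  using group.repr_independence[OF group_free_Abelian_group, of v "tn n" "Rel n" u] Rel_subgroup
  by (simp add: tensor_class_def)

lemma Bar_spans_frag: "spans (Bar n) ((\<lambda>as. cls n (frag_of as)) ` tn n)"
  using spans_image[OF frag_group_spans frag_abelian Bar_abelian cls_hom Bar_carrier[symmetric]]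
  by (simp add: image_image)

lemma cls_rel:
  assumes "w \<in> rel_gens (Suc (Suc n))" shows "cls n w = \<zero>\<^bsub>Bar n\<^esub>"
proof -
  have "w \<in> Rel n" unfolding Rel_generate by (rule generate.incl[OF assms])
  then have "w \<in> cls n 0" using cls_mem[of 0 n w] by simp
  then have "cls n w = cls n 0" by (intro cls_eq) auto
  then show ?thesis using add_hom_zero[OF frag_abelian Bar_abelian cls_hom] by simp
qed

lemma cls_additive:
  assumes "as \<in> tn n" "i < Suc (Suc n)" "x \<in> \<A>" "y \<in> \<A>"
  shows "cls n (frag_of (as[i := x \<oplus>\<^sub>A y])) = cls n (frag_of (as[i := x])) \<oplus>\<^bsub>Bar n\<^esub> cls n (frag_of (as[i := y]))"
proof -
  have t: "as[i := x \<oplus>\<^sub>A y] \<in> tn n" "as[i := x] \<in> tn n" "as[i := y] \<in> tn n"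
    using assms A_ab.a_closed[OF assms(3,4)] by (auto intro!: tp_update simp del: galg_simps)
  let ?w = "frag_of (as[i := x \<oplus>\<^sub>A y]) - frag_of (as[i := x]) - frag_of (as[i := y])"
  have w: "?w \<in> rel_gens (Suc (Suc n))" using assms unfolding rel_gens_def by blast
  have wc: "?w \<in> carrier (Fr n)" using subsetD[OF rel_gens_carrier w] unfolding Fr_FA .
  have f: "frag_of (as[i := x]) \<in> carrier (Fr n)" "frag_of (as[i := y]) \<in> carrier (Fr n)"
    "frag_of (as[i := x]) + frag_of (as[i := y]) \<in> carrier (Fr n)"
    using t keys_add[of "frag_of (as[i := x])" "frag_of (as[i := y])"] by auto
  have "cls n (frag_of (as[i := x \<oplus>\<^sub>A y])) = cls n (?w + (frag_of (as[i := x]) + frag_of (as[i := y])))" by simp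
  also have "\<dots> = cls n ?w \<oplus>\<^bsub>Bar n\<^esub> (cls n (frag_of (as[i := x])) \<oplus>\<^bsub>Bar n\<^esub> cls n (frag_of (as[i := y])))"
    by (simp only: cls_add[OF wc f(3)] cls_add[OF f(1,2)])
  finally show ?thesis using cls_rel[OF w] t by (simp del: galg_simps)
qed

lemma cls_scalar:
  assumes "as \<in> tn n" "i < Suc (Suc n)" "j < Suc (Suc n)" "c \<in> \<K>"
  shows "cls n (frag_of (as[i := c \<odot>\<^sub>A as ! i])) = cls n (frag_of (as[j := c \<odot>\<^sub>A as ! j]))"
proof -
  have t: "as[i := c \<odot>\<^sub>A as ! i] \<in> tn n" "as[j := c \<odot>\<^sub>A as ! j] \<in> tn n"
    using assms by (auto intro!: tp_update A_smult_closed tp_nth simp del: galg_simps)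
  let ?w = "frag_of (as[i := c \<odot>\<^sub>A as ! i]) - frag_of (as[j := c \<odot>\<^sub>A as ! j])"
  have w: "?w \<in> rel_gens (Suc (Suc n))" using assms unfolding rel_gens_def by blast
  have wc: "?w \<in> carrier (Fr n)" using subsetD[OF rel_gens_carrier w] unfolding Fr_FA .
  have "cls n (frag_of (as[i := c \<odot>\<^sub>A as ! i])) = cls n (?w + frag_of (as[j := c \<odot>\<^sub>A as ! j]))" by simp
  also have "\<dots> = cls n ?w \<oplus>\<^bsub>Bar n\<^esub> cls n (frag_of (as[j := c \<odot>\<^sub>A as ! j]))"
    by (rule cls_add[OF wc]) (use t in simp)
  finally show ?thesis using cls_rel[OF w] t by (simp del: galg_simps)
qed

text \<open>The target is only an abelian group, so compatibility with \<open>k\<close> is expressed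
  by letting scalars move between slots, as in \<open>tensor_relations\<close>.\<close>

definition balanced :: "nat \<Rightarrow> ('b, 'm) ring_scheme \<Rightarrow> (('g \<Rightarrow> 'k) list \<Rightarrow> 'b) \<Rightarrow> bool" where
  "balanced N B \<Phi> \<longleftrightarrow> (\<forall>as\<in>tp N. \<Phi> as \<in> carrier B) \<and>
     (\<forall>as\<in>tp N. \<forall>i<N. \<forall>x\<in>\<A>. \<forall>y\<in>\<A>. \<Phi> (as[i := x \<oplus>\<^sub>A y]) = \<Phi> (as[i := x]) \<oplus>\<^bsub>B\<^esub> \<Phi> (as[i := y])) \<and>
     (\<forall>as\<in>tp N. \<forall>i<N. \<forall>j<N. \<forall>c\<in>\<K>. \<Phi> (as[i := c \<odot>\<^sub>A as ! i]) = \<Phi> (as[j := c \<odot>\<^sub>A as ! j]))"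

lemma balancedI:
  assumes "\<And>as. as \<in> tp N ==> \<Phi> as \<in> carrier B"
    and "\<And>as i x y. as \<in> tp N ==> i < N ==> x \<in> \<A> ==> y \<in> \<A> ==>
      \<Phi> (as[i := x \<oplus>\<^sub>A y]) = \<Phi> (as[i := x]) \<oplus>\<^bsub>B\<^esub> \<Phi> (as[i := y])"
    and "\<And>as i j c. as \<in> tp N ==> i < N ==> j < N ==> c \<in> \<K> ==>
      \<Phi> (as[i := c \<odot>\<^sub>A as ! i]) = \<Phi> (as[j := c \<odot>\<^sub>A as ! j])"
  shows "balanced N B \<Phi>"
  using assms unfolding balanced_def by blast

lemma balancedD:
  assumes "balanced N B \<Phi>"
  shows "as \<in> tp N ==> \<Phi> as \<in> carrier B"
    and "as \<in> tp N ==> i < N ==> x \<in> \<A> ==> y \<in> \<A> ==>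
      \<Phi> (as[i := x \<oplus>\<^sub>A y]) = \<Phi> (as[i := x]) \<oplus>\<^bsub>B\<^esub> \<Phi> (as[i := y])"
    and "as \<in> tp N ==> i < N ==> j < N ==> c \<in> \<K> ==>
      \<Phi> (as[i := c \<odot>\<^sub>A as ! i]) = \<Phi> (as[j := c \<odot>\<^sub>A as ! j])"
  using assms unfolding balanced_def by blast+

text \<open>The map kills the generators of the relation subgroup. The conclusion is about members
  of a coset because the induced maps are defined as unions over all representatives.\<close>

lemma Bar_universal_elem:
  assumes B: "abelian_group B" and bal: "balanced (Suc (Suc n)) B \<Phi>"
    and h: "h \<in> add_hom (Fr n) B" "\<And>as. as \<in> tn n ==> h (frag_of as) = \<Phi> as"
    and u: "u \<in> carrier (Fr n)" "v \<in> cls n u"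
  shows "h v = h u"
proof -
  interpret B: abelian_group B by fact
  have gen: "h w = \<zero>\<^bsub>B\<^esub>" if w: "w \<in> rel_gens (Suc (Suc n))" for w
  proof -
    consider xs i x y where "w = frag_of (xs[i := x \<oplus>\<^sub>A y]) - frag_of (xs[i := x]) - frag_of (xs[i := y])"
        "xs \<in> tn n" "i < Suc (Suc n)" "x \<in> \<A>" "y \<in> \<A>"
      | xs i j c where "w = frag_of (xs[i := c \<odot>\<^sub>A xs ! i]) - frag_of (xs[j := c \<odot>\<^sub>A xs ! j])"
        "xs \<in> tn n" "i < Suc (Suc n)" "j < Suc (Suc n)" "c \<in> \<K>"
      using w unfolding rel_gens_def by blast
    then show ?thesis
    proof cases
      case 1
      have t: "xs[i := x \<oplus>\<^sub>A y] \<in> tn n" "xs[i := x] \<in> tn n" "xs[i := y] \<in> tn n"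
        using 1 A_ab.a_closed[OF 1(4,5)] by (auto intro!: tp_update simp del: galg_simps)
      have f: "frag_of (xs[i := x]) + frag_of (xs[i := y]) \<in> carrier (Fr n)"
        using t keys_add[of "frag_of (xs[i := x])" "frag_of (xs[i := y])"] by auto
      have "h (frag_of (xs[i := x]) + frag_of (xs[i := y])) = h (frag_of (xs[i := x])) \<oplus>\<^bsub>B\<^esub> h (frag_of (xs[i := y]))"
        using add_hom_add[OF h(1), of "frag_of (xs[i := x])" "frag_of (xs[i := y])"] t by simp
      then have "h (frag_of (xs[i := x]) + frag_of (xs[i := y])) = h (frag_of (xs[i := x \<oplus>\<^sub>A y]))"
        using balancedD(2)[OF bal 1(2-5)] t h(2) by (simp del: galg_simps)
      moreover have "w = frag_of (xs[i := x \<oplus>\<^sub>A y]) \<ominus>\<^bsub>Fr n\<^esub> (frag_of (xs[i := x]) + frag_of (xs[i := y]))"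
        using t f by (simp add: 1(1) frag_group_minus del: galg_simps)
      ultimately show ?thesis
        using add_hom_minus[OF frag_abelian B h(1) _ f, of "frag_of (xs[i := x \<oplus>\<^sub>A y])"] t
          balancedD(1)[OF bal t(1)] h(2)[OF t(1)]
        by (simp add: B.minus_eq B.r_neg del: galg_simps)
    next
      case 2
      have t: "xs[i := c \<odot>\<^sub>A xs ! i] \<in> tn n" "xs[j := c \<odot>\<^sub>A xs ! j] \<in> tn n"
        using 2 by (auto intro!: tp_update A_smult_closed tp_nth simp del: galg_simps)
      have "w = frag_of (xs[i := c \<odot>\<^sub>A xs ! i]) \<ominus>\<^bsub>Fr n\<^esub> frag_of (xs[j := c \<odot>\<^sub>A xs ! j])"
        using t by (simp add: 2(1) frag_group_minus del: galg_simps)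
      then show ?thesis
        using add_hom_minus[OF frag_abelian B h(1), of "frag_of (xs[i := c \<odot>\<^sub>A xs ! i])" "frag_of (xs[j := c \<odot>\<^sub>A xs ! j])"]
          t balancedD(1)[OF bal t(2)] h(2) balancedD(3)[OF bal 2(2-5)]
        by (simp add: B.minus_eq B.r_neg del: galg_simps)
    qed
  qed
  have "h w = \<zero>\<^bsub>B\<^esub>" if "w \<in> Rel n" for w
    using that unfolding Rel_generate
  proof (induction w rule: generate.induct)
    case one
    then show ?case using add_hom_zero[OF frag_abelian B h(1)] by simp
  next
    case (incl w)
    then show ?case by (rule gen)
  next
    case (inv w)
    have w: "w \<in> carrier (Fr n)" using subsetD[OF rel_gens_carrier inv] unfolding Fr_FA .
    then have "inv\<^bsub>FA n\<^esub> w = \<ominus>\<^bsub>Fr n\<^esub> w" by (simp add: frag_group_neg)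
    then show ?case using add_hom_neg[OF frag_abelian B h(1) w] gen[OF inv] by simp
  next
    case (eng w w')
    have "w \<in> carrier (Fr n)" "w' \<in> carrier (Fr n)"
      using eng(1,2) subsetD[OF subgroup.subset[OF Rel_subgroup, of n]] unfolding Rel_generate Fr_FA by blast+
    then show ?case using add_hom_add[OF h(1), of w w'] eng by simp
  qed
  then have 0: "h (v - u) = \<zero>\<^bsub>B\<^esub>" using cls_mem[OF u(1)] u(2) by blast
  have v: "v \<in> carrier (Fr n)" by (rule cls_subset[OF u])
  have "v - u = v \<ominus>\<^bsub>Fr n\<^esub> u" using u v by (simp add: frag_group_minus)
  with 0 have "h v \<ominus>\<^bsub>B\<^esub> h u = \<zero>\<^bsub>B\<^esub>" using add_hom_minus[OF frag_abelian B h(1) v u(1)] by simp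
  then have "\<ominus>\<^bsub>B\<^esub> (\<ominus>\<^bsub>B\<^esub> h u) = h v"
    using add_hom_closed[OF h(1) u(1)] add_hom_closed[OF h(1) v]
    by (intro B.minus_equality) (simp_all add: B.minus_eq)
  then show ?thesis using add_hom_closed[OF h(1) u(1)] by simp
qed

lemma Bar_hom:
  assumes h: "h \<in> add_hom (Fr n) B" and H: "\<And>u. u \<in> carrier (Fr n) ==> H (cls n u) = h u"
  shows "H \<in> add_hom (Bar n) B"
proof (rule add_homI)
  fix U assume "U \<in> \<B> n"
  then obtain u where u: "u \<in> carrier (Fr n)" "U = cls n u" by (rule Bar_cases)
  then show "H U \<in> carrier B" using H add_hom_closed[OF h] by simp
  fix V assume "V \<in> \<B> n"
  then obtain v where v: "v \<in> carrier (Fr n)" "V = cls n v" by (rule Bar_cases)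
  have "u + v \<in> carrier (Fr n)" using u v keys_add[of u v] by auto
  from H[OF this] show "H (U \<oplus>\<^bsub>Bar n\<^esub> V) = H U \<oplus>\<^bsub>B\<^esub> H V"
    using cls_add[OF u(1) v(1)] add_hom_add[OF h u(1) v(1)] H u v by simp
qed

lemma Bar_universal:
  assumes B: "abelian_group B" and bal: "balanced (Suc (Suc n)) B \<Phi>"
  obtains H where "H \<in> add_hom (Bar n) B" "\<And>as. as \<in> tn n ==> H (cls n (frag_of as)) = \<Phi> as"
proof -
  obtain h where h: "h \<in> add_hom (Fr n) B" "\<And>as. as \<in> tn n ==> h (frag_of as) = \<Phi> as"
    by (rule frag_group_universal[OF B, of "tn n" \<Phi>]) (rule balancedD(1)[OF bal], assumption, rule that)
  \<comment> \<open>The choice of representative is immaterial by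
    \<open>Bar_universal_elem\<close>.\<close>
  define H where "H U = h (SOME u. u \<in> U)" for U
  have H: "H (cls n u) = h u" if u: "u \<in> carrier (Fr n)" for u
    unfolding H_def by (rule Bar_universal_elem[OF B bal h u]) (assumption, rule someI[of _ u], rule cls_self[OF u])
  show ?thesis
  proof (rule that[OF Bar_hom[OF h(1) H]])
    show "H (cls n (frag_of as)) = \<Phi> as" if "as \<in> tn n" for as
      using H[of "frag_of as"] h(2)[OF that] that by simp
  qed
qed

text \<open>All sets in the union defining \<open>tensor_extend\<close> are equal, so the union is a
  single coset.\<close>

lemma tensor_extend_cls:
  assumes keys: "\<And>as. as \<in> tn n ==> keys (\<phi> as) \<subseteq> tn m"
    and bal: "balanced (Suc (Suc n)) (Bar m) (\<lambda>as. cls m (\<phi> as))"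
  shows "u \<in> carrier (Fr n) ==> tensor_extend k A (Suc (Suc m)) \<phi> (cls n u) = cls m (frag_extend \<phi> u)"
    and "tensor_extend k A (Suc (Suc m)) \<phi> \<in> add_hom (Bar n) (Bar m)"
proof -
  have h: "(\<lambda>u. cls m (frag_extend \<phi> u)) \<in> add_hom (Fr n) (Bar m)"
    by (rule add_hom_comp[OF frag_extend_add_hom cls_hom]) (rule keys)
  have eq: "tensor_extend k A (Suc (Suc m)) \<phi> (cls n u) = cls m (frag_extend \<phi> u)" if u: "u \<in> carrier (Fr n)" for u
  proof -
    have "cls m (frag_extend \<phi> v) = cls m (frag_extend \<phi> u)" if "v \<in> cls n u" for v
      by (rule Bar_universal_elem[OF Bar_abelian bal h _ u that]) simp
    then show ?thesis using cls_self[OF u] unfolding tensor_extend_def by blast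
  qed
  then show "u \<in> carrier (Fr n) ==> tensor_extend k A (Suc (Suc m)) \<phi> (cls n u) = cls m (frag_extend \<phi> u)" .
  show "tensor_extend k A (Suc (Suc m)) \<phi> \<in> add_hom (Bar n) (Bar m)" by (rule Bar_hom[OF h eq])
qed

text \<open>Independence of representatives is shown in one argument at a time: after the second
  argument is extended to a chain \<open>v\<close>, the result is still balanced in the
  first.\<close>

lemma tensor_extend2_cls:
  defines "Te l \<equiv> tensor_extend2 k A (Suc (Suc l))"
  assumes keys: "\<And>r s. r \<in> tn n ==> s \<in> tn m ==> keys (\<beta> r s) \<subseteq> tn l"
    and bal1: "\<And>s. s \<in> tn m ==> balanced (Suc (Suc n)) (Bar l) (\<lambda>r. cls l (\<beta> r s))"
    and bal2: "\<And>r. r \<in> tn n ==> balanced (Suc (Suc m)) (Bar l) (\<lambda>s. cls l (\<beta> r s))"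
  shows "r \<in> tn n ==> s \<in> tn m ==> Te l \<beta> (cls n (frag_of r)) (cls m (frag_of s)) = cls l (\<beta> r s)"
    and "V \<in> \<B> m ==> (\<lambda>U. Te l \<beta> U V) \<in> add_hom (Bar n) (Bar l)"
    and "U \<in> \<B> n ==> (\<lambda>V. Te l \<beta> U V) \<in> add_hom (Bar m) (Bar l)"
proof -
  define \<beta>' where "\<beta>' v r = frag_extend (\<beta> r) v" for v r
  have keys': "keys (\<beta>' v r) \<subseteq> tn l" if "v \<in> carrier (Fr m)" "r \<in> tn n" for v r
    unfolding \<beta>'_def using that by (intro frag_extend_frag_group[of "tn m"] keys) auto
  have h2: "(\<lambda>v. cls l (\<beta>' v r)) \<in> add_hom (Fr m) (Bar l)" if "r \<in> tn n" for r
    unfolding \<beta>'_def by (rule add_hom_comp[OF frag_extend_add_hom cls_hom]) (rule keys[OF that])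
  have indep2: "cls l (\<beta>' v' r) = cls l (\<beta>' v r)" if "r \<in> tn n" "v \<in> carrier (Fr m)" "v' \<in> cls m v" for r v v'
    by (rule Bar_universal_elem[OF Bar_abelian bal2[OF that(1)] h2[OF that(1)] _ that(2,3)]) (simp add: \<beta>'_def)
  have bal: "balanced (Suc (Suc n)) (Bar l) (\<lambda>r. cls l (\<beta>' v r))" if v: "v \<in> carrier (Fr m)" for v
  proof (rule balancedI)
    fix r assume "r \<in> tn n"
    then show "cls l (\<beta>' v r) \<in> \<B> l" by (rule add_hom_closed[OF h2 v])
  next
    fix as i x y assume a: "as \<in> tn n" "i < Suc (Suc n)" "x \<in> \<A>" "y \<in> \<A>"
    have t: "as[i := x \<oplus>\<^sub>A y] \<in> tn n" "as[i := x] \<in> tn n" "as[i := y] \<in> tn n"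
      using a A_ab.a_closed[OF a(3,4)] by (auto intro!: tp_update simp del: galg_simps)
    show "cls l (\<beta>' v (as[i := x \<oplus>\<^sub>A y])) = cls l (\<beta>' v (as[i := x])) \<oplus>\<^bsub>Bar l\<^esub> cls l (\<beta>' v (as[i := y]))"
      by (rule add_hom_eqI[OF frag_group_spans frag_abelian Bar_abelian h2[OF t(1)]
          add_hom_plus[OF Bar_abelian h2[OF t(2)] h2[OF t(3)]] _ v])
        (use balancedD(2)[OF bal1 a] in \<open>auto simp: \<beta>'_def simp del: galg_simps\<close>)
  next
    fix as i j c assume a: "as \<in> tn n" "i < Suc (Suc n)" "j < Suc (Suc n)" "c \<in> \<K>"
    have t: "as[i := c \<odot>\<^sub>A as ! i] \<in> tn n" "as[j := c \<odot>\<^sub>A as ! j] \<in> tn n"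
      using a by (auto intro!: tp_update A_smult_closed tp_nth simp del: galg_simps)
    show "cls l (\<beta>' v (as[i := c \<odot>\<^sub>A as ! i])) = cls l (\<beta>' v (as[j := c \<odot>\<^sub>A as ! j]))"
      by (rule add_hom_eqI[OF frag_group_spans frag_abelian Bar_abelian h2[OF t(1)] h2[OF t(2)] _ v])
        (use balancedD(3)[OF bal1 a] in \<open>auto simp: \<beta>'_def simp del: galg_simps\<close>)
  qed
  have h1: "(\<lambda>u. cls l (frag_extend (\<beta>' v) u)) \<in> add_hom (Fr n) (Bar l)" if "v \<in> carrier (Fr m)" for v
    by (rule add_hom_comp[OF frag_extend_add_hom cls_hom]) (rule keys'[OF that])
  have eq: "Te l \<beta> (cls n u) (cls m v) = cls l (frag_extend (\<beta>' v) u)"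
    if u: "u \<in> carrier (Fr n)" and v: "v \<in> carrier (Fr m)" for u v
  proof -
    have "cls l (frag_extend (\<beta>' v') u') = cls l (frag_extend (\<beta>' v) u)" if u': "u' \<in> cls n u" and v': "v' \<in> cls m v" for u' v'
    proof -
      have v'c: "v' \<in> carrier (Fr m)" by (rule cls_subset[OF v v'])
      have "cls l (frag_extend (\<beta>' v') u') = cls l (frag_extend (\<beta>' v') u)"
        by (rule Bar_universal_elem[OF Bar_abelian bal[OF v'c] h1[OF v'c] _ u u']) simp
      also have "\<dots> = cls l (frag_extend (\<beta>' v) u)"
        by (rule add_hom_eqI[OF frag_group_spans frag_abelian Bar_abelian h1[OF v'c] h1[OF v] _ u])
          (use indep2[OF _ v v'] in auto)
      finally show ?thesis .
    qed
    then show ?thesis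
      using cls_self[OF u] cls_self[OF v] unfolding Te_def tensor_extend2_def \<beta>'_def[symmetric] \<beta>'_def[abs_def, symmetric] by blast
  qed
  show "r \<in> tn n ==> s \<in> tn m ==> Te l \<beta> (cls n (frag_of r)) (cls m (frag_of s)) = cls l (\<beta> r s)"
    using eq[of "frag_of r" "frag_of s"] by (simp add: \<beta>'_def)
  show "(\<lambda>U. Te l \<beta> U V) \<in> add_hom (Bar n) (Bar l)" if V: "V \<in> \<B> m"
  proof -
    obtain v where v: "v \<in> carrier (Fr m)" "V = cls m v" by (rule Bar_cases[OF V])
    show ?thesis unfolding v(2) by (rule Bar_hom[OF h1[OF v(1)] eq[OF _ v(1)]])
  qed
  show "(\<lambda>V. Te l \<beta> U V) \<in> add_hom (Bar m) (Bar l)" if U: "U \<in> \<B> n"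
  proof -
    obtain u where u: "u \<in> carrier (Fr n)" "U = cls n u" by (rule Bar_cases[OF U])
    have "(\<lambda>v. cls l (frag_extend (\<beta>' v) u)) \<in> add_hom (Fr m) (Bar l)"
    proof (rule add_homI)
      fix v v' assume v: "v \<in> carrier (Fr m)" and v': "v' \<in> carrier (Fr m)"
      have vv: "v \<oplus>\<^bsub>Fr m\<^esub> v' \<in> carrier (Fr m)" using v v' keys_add[of v v'] by auto
      show "cls l (frag_extend (\<beta>' (v \<oplus>\<^bsub>Fr m\<^esub> v')) u) = cls l (frag_extend (\<beta>' v) u) \<oplus>\<^bsub>Bar l\<^esub> cls l (frag_extend (\<beta>' v') u)"
        by (rule add_hom_eqI[OF frag_group_spans frag_abelian Bar_abelian h1[OF vv] add_hom_plus[OF Bar_abelian h1[OF v] h1[OF v']] _ u(1)])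
          (use add_hom_add[OF h2 v v'] in auto)
    qed (rule add_hom_closed[OF h1 u(1)])
    then show ?thesis unfolding u(2) by (rule Bar_hom) (rule eq[OF u(1)])
  qed
qed

section \<open>Group monomials as a basis of the tensor powers\<close>

fun coef :: "('g \<Rightarrow> 'k) list \<Rightarrow> 'g list \<Rightarrow> 'k" where
  "coef (a # as) (y # ys) = a y \<otimes>\<^sub>k coef as ys"
| "coef _ _ = \<one>\<^sub>k"

lemma coef_closed: "set as \<subseteq> \<A> ==> coef as ys \<in> \<K>"
  by (induction as ys rule: coef.induct) (auto intro: cl)

text \<open>The factor of \<open>coef\<close> at position \<open>i\<close>, all the others being collected by the dummy entry
  \<open>\<lambda>_. \<one>\<close>.\<close>

lemma coef_update_closed:
  assumes "set as \<subseteq> \<A>" shows "coef (as[i := (\<lambda>_. \<one>\<^sub>k)]) ys \<in> \<K>"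
  using assms
proof (induction as ys arbitrary: i rule: coef.induct)
  case (1 a as y ys)
  then show ?case using coef_closed[of as ys] by (cases i) (auto intro: cl)
qed (auto split: nat.split)

lemma coef_update:
  assumes "set as \<subseteq> \<A>" "x \<in> \<A>" "i < length as" "length ys = length as"
  shows "coef (as[i := x]) ys = x (ys ! i) \<otimes>\<^sub>k coef (as[i := (\<lambda>_. \<one>\<^sub>k)]) ys"
  using assms
proof (induction as ys arbitrary: i rule: coef.induct)
  case (1 a as y ys)
  show ?case
  proof (cases i)
    case 0
    then show ?thesis using 1 coef_closed[of as ys] by simp
  next
    case (Suc j)
    have c: "a y \<in> \<K>" "x (ys ! j) \<in> \<K>" "coef (as[j := (\<lambda>_. \<one>\<^sub>k)]) ys \<in> \<K>"
      using 1(2,3) coef_update_closed[of as j ys] by (auto intro: cl)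
    show ?thesis using 1 Suc k.m_lcomm[OF c] by simp
  qed
qed auto

lemma coef_balanced:
  assumes "length ys = N" shows "balanced N k (\<lambda>as. coef as ys)"
proof (rule balancedI)
  fix as assume "as \<in> tp N"
  then show "coef as ys \<in> \<K>" by (intro coef_closed) (simp add: tuples_def)
next
  fix as i x y assume a: "as \<in> tp N" "i < N" "x \<in> \<A>" "y \<in> \<A>"
  then have s: "set as \<subseteq> \<A>" "i < length as" "length ys = length as" using assms by (auto simp: tuples_def)
  note u = coef_update[OF s(1) _ s(2,3)]
  have "coef (as[i := x \<oplus>\<^sub>A y]) ys = (x (ys ! i) \<oplus>\<^sub>k y (ys ! i)) \<otimes>\<^sub>k coef (as[i := (\<lambda>_. \<one>\<^sub>k)]) ys"
    using u[OF A_ab.a_closed[OF a(3,4)]] by simp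
  then show "coef (as[i := x \<oplus>\<^sub>A y]) ys = coef (as[i := x]) ys \<oplus>\<^sub>k coef (as[i := y]) ys"
    using u[OF a(3)] u[OF a(4)] a(3,4) coef_update_closed[OF s(1)] by (simp add: cl k.l_distr)
next
  fix as i j c assume a: "as \<in> tp N" "i < N" "j < N" "c \<in> \<K>"
  then have s: "set as \<subseteq> \<A>" "length ys = length as" and l: "\<And>i. i < N ==> i < length as"
    using assms by (auto simp: tuples_def)
  have "coef (as[i := c \<odot>\<^sub>A as ! i]) ys = c \<otimes>\<^sub>k coef as ys" if i: "i < N" for i
  proof -
    have ai: "as ! i \<in> \<A>" by (rule tp_nth[OF a(1) i])
    have "coef (as[i := c \<odot>\<^sub>A as ! i]) ys = (c \<otimes>\<^sub>k (as ! i) (ys ! i)) \<otimes>\<^sub>k coef (as[i := (\<lambda>_. \<one>\<^sub>k)]) ys"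
      using coef_update[OF s(1) A_smult_closed[OF a(4) ai] l[OF i] s(2)] by simp
    also have "\<dots> = c \<otimes>\<^sub>k coef (as[i := as ! i]) ys"
      using coef_update[OF s(1) ai l[OF i] s(2)] a(4) coef_update_closed[OF s(1)] ai by (simp add: cl k.m_assoc)
    finally show ?thesis by simp
  qed
  then show "coef (as[i := c \<odot>\<^sub>A as ! i]) ys = coef (as[j := c \<odot>\<^sub>A as ! j]) ys" using a by simp
qed

definition gb :: "'g \<Rightarrow> 'g \<Rightarrow> 'k" where "gb g = sing k g \<one>\<^sub>k"

text \<open>The normal form of a monomial: its scalar is stored in the first slot and all other
  slots hold group elements.\<close>

fun bt :: "'k \<Rightarrow> 'g list \<Rightarrow> ('g \<Rightarrow> 'k) list" where
  "bt c (y # ys) = sing k y c # map gb ys"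
| "bt c [] = []"

definition mono :: "nat \<Rightarrow> 'k \<Rightarrow> 'g list \<Rightarrow> ('g, 'k) tensors" where
  "mono n c ys = cls n (frag_of (bt c ys))"

abbreviation "monos n \<equiv> {mono n c ys | c ys. c \<in> \<K> \<and> ys \<in> Gn n}"

lemma gb_closed [simp]: "g \<in> \<G> ==> gb g \<in> \<A>"
  unfolding gb_def by (rule sing_A) auto

lemma gb_mult: "g \<in> \<G> ==> h \<in> \<G> ==> gb g \<otimes>\<^sub>A gb h = gb (g \<otimes> h)"
  unfolding gb_def by (simp add: A_mult_sing)

lemma gb_one: "gb \<one> = \<one>\<^sub>A"
  unfolding gb_def A_one ..

lemma smult_gb: "c \<in> \<K> ==> c \<odot>\<^sub>A gb g = sing k g c"
  unfolding gb_def by (simp only: smult_sing) simp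

lemma bt_tp: "c \<in> \<K> ==> ys \<in> Gs N ==> bt c ys \<in> tp N"
  by (cases ys) (auto simp: tuples_def Gs_def gb_closed[simplified] fin_supp_sing[OF k_ab])

lemma mono_closed: "c \<in> \<K> ==> ys \<in> Gn n ==> mono n c ys \<in> \<B> n"
  unfolding mono_def by (rule cls_frag_closed[OF bt_tp])

lemma bt_update: "ys \<in> Gs (Suc N) ==> bt c ys = (bt \<one>\<^sub>k ys)[0 := sing k (hd ys) c]"
  by (cases ys) (auto simp: Gs_def)

lemma mono_add_hom:
  assumes ys: "ys \<in> Gn n" shows "(\<lambda>c. mono n c ys) \<in> add_hom k (Bar n)"
proof (rule add_homI)
  fix c c' assume c: "c \<in> \<K>"
  show "mono n c ys \<in> \<B> n" by (rule mono_closed[OF c ys])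
  assume c': "c' \<in> \<K>"
  have y: "hd ys \<in> \<G>" using ys by (cases ys) (auto simp: Gs_def)
  have "sing k (hd ys) (c \<oplus>\<^sub>k c') = sing k (hd ys) c \<oplus>\<^sub>A sing k (hd ys) c'" by (auto simp: sing_def)
  then show "mono n (c \<oplus>\<^sub>k c') ys = mono n c ys \<oplus>\<^bsub>Bar n\<^esub> mono n c' ys"
    using cls_additive[OF bt_tp[OF k.one_closed ys], of 0 "sing k (hd ys) c" "sing k (hd ys) c'"] sing_A[OF y c] sing_A[OF y c']
    unfolding mono_def bt_update[OF ys, of c] bt_update[OF ys, of c'] bt_update[OF ys, of "c \<oplus>\<^sub>k c'"]
    by (simp del: galg_simps)
qed

lemma map_gb_bt: "ys \<noteq> [] ==> map gb ys = bt \<one>\<^sub>k ys"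
  by (cases ys) (auto simp: gb_def)

lemma list_gb_cases:
  assumes "set as \<subseteq> gb ` \<G>" obtains ys where "as = map gb ys" "set ys \<subseteq> \<G>"
proof -
  have "as \<in> map gb ` lists (\<G>)" using assms by (simp flip: lists_image add: in_lists_conv_set subset_iff)
  then show ?thesis by (elim imageE) (rule that, auto)
qed

text \<open>The slots are expanded into group elements by induction on a bound \<open>j\<close>
  below which entries are still arbitrary. At \<open>j = 0\<close> every entry is a group element;
  each step expands slot \<open>j\<close>.\<close>

lemma Bar_spans: "spans (Bar n) (monos n)"
proof (rule spans_trans[OF Bar_abelian Bar_spans_frag])
  show "monos n \<subseteq> \<B> n"
    using mono_closed by auto
  fix P b
  assume b: "b \<in> (\<lambda>as. cls n (frag_of as)) ` tn n"
    and P: "P \<zero>\<^bsub>Bar n\<^esub>" "\<And>b. b \<in> monos n ==> P b"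
    "\<And>x. x \<in> \<B> n ==> P x ==> P (\<ominus>\<^bsub>Bar n\<^esub> x)"
    "\<And>x y. x \<in> \<B> n ==> y \<in> \<B> n ==> P x ==> P y ==> P (x \<oplus>\<^bsub>Bar n\<^esub> y)"
  let ?N = "Suc (Suc n)"
  have main: "\<forall>as\<in>tp ?N. (\<forall>i<?N. j \<le> i \<longrightarrow> as ! i \<in> gb ` \<G>) \<longrightarrow> P (cls n (frag_of as))" if "j \<le> ?N" for j
    using that
  proof (induction j)
    case 0
    show ?case
    proof (intro ballI impI)
      fix as assume as: "as \<in> tp ?N" "\<forall>i<?N. 0 \<le> i \<longrightarrow> as ! i \<in> gb ` \<G>"
      have "set as \<subseteq> gb ` \<G>" using as by (auto simp: tuples_def in_set_conv_nth)
      then obtain ys where ys: "as = map gb ys" "set ys \<subseteq> \<G>"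
        by (rule list_gb_cases)
      then have "ys \<in> Gs ?N" using as(1) by (auto simp: Gs_def tuples_def)
      moreover have "as = bt \<one>\<^sub>k ys" using ys as(1) by (subst map_gb_bt[symmetric]) (auto simp: tuples_def)
      ultimately show "P (cls n (frag_of as))" using P(2) unfolding mono_def by blast
    qed
  next
    case (Suc j)
    then have IH: "P (cls n (frag_of as))" if "as \<in> tp ?N" "\<And>i. i < ?N ==> j \<le> i ==> as ! i \<in> gb ` \<G>" for as
      using that by auto
    have j: "j < ?N" using Suc.prems by simp
    show ?case
    proof (intro ballI impI)
      fix as assume as: "as \<in> tp ?N" "\<forall>i<?N. Suc j \<le> i \<longrightarrow> as ! i \<in> gb ` \<G>"
      have len: "length as = ?N" using as(1) by (simp add: tuples_def)
      have "P (cls n (frag_of (as[j := a])))" if "a \<in> fin_supp k (\<G>)" for a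
        using k_ab that
      proof (induction a rule: fin_supp_induct)
        case zero
        have z: "\<zero>\<^sub>A \<in> \<A>" by (rule A_ab.zero_closed)
        let ?z = "cls n (frag_of (as[j := \<zero>\<^sub>A]))"
        have zc: "?z \<in> \<B> n" by (rule cls_frag_closed[OF tp_update[OF as(1) z]])
        have "?z = ?z \<oplus>\<^bsub>Bar n\<^esub> ?z" using cls_additive[OF as(1) j z z] by (simp only: A_ab.l_zero[OF z])
        then have "?z = \<zero>\<^bsub>Bar n\<^esub>" using zc Bar.add.r_cancel_one' by metis
        then show ?case using P(1) by simp
      next
        case (add f g r)
        have s: "sing k g r \<in> \<A>" and f: "f \<in> \<A>" using add(1-3) sing_A by auto
        have gg: "gb g \<in> \<A>" by (rule gb_closed[OF add(2)])
        let ?as = "as[j := gb g]"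
        have as': "?as \<in> tp ?N" by (rule tp_update[OF as(1) gg])
        have bas: "?as ! i \<in> gb ` \<G>" if "i < ?N" "j \<le> i" for i
          using that as(2) add(2) len by (cases "i = j") auto
        have sm: "as[j := sing k g r] = ?as[j := r \<odot>\<^sub>A ?as ! j]" using len j by (simp add: smult_gb[OF add(3)] del: galg_simps)
        have "P (cls n (frag_of (as[j := sing k g r])))"
        proof (cases "j = 0")
          case True
          have "set ?as \<subseteq> gb ` \<G>" using bas True len by (auto simp: in_set_conv_nth)
          then obtain ys where ys: "?as = map gb ys" "set ys \<subseteq> \<G>"
            by (rule list_gb_cases)
          have "length ys = ?N" using arg_cong[OF ys(1), of length] len by simp
          then have ysG: "ys \<in> Gs ?N" using ys(2) by (simp add: Gs_def)
          obtain y ys' where y: "ys = y # ys'" using ysG by (cases ys) (auto simp: Gs_def)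
          have "as[j := sing k g r] = ?as[0 := r \<odot>\<^sub>A ?as ! 0]" using sm True by simp
          also have "\<dots> = bt r ys" unfolding ys(1) y by (simp add: smult_gb[OF add(3)] del: galg_simps)
          finally show ?thesis using P(2) ysG add(3) unfolding mono_def by auto
        next
          case False
          \<comment> \<open>The scalar produced by slot \<open>j\<close> is moved to slot 0, which
            lies below \<open>j\<close> and may still be arbitrary in the induction
            hypothesis.\<close>
          let ?as2 = "?as[0 := r \<odot>\<^sub>A ?as ! 0]"
          have "cls n (frag_of (as[j := sing k g r])) = cls n (frag_of ?as2)"
            unfolding sm by (rule cls_scalar[OF as' j _ add(3)]) simp
          moreover have "P (cls n (frag_of ?as2))"
          proof (rule IH)
            show "?as2 \<in> tp ?N" by (rule tp_update[OF as' A_smult_closed[OF add(3) tp_nth[OF as']]]) simp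
            show "?as2 ! i \<in> gb ` \<G>" if "i < ?N" "j \<le> i" for i using bas[OF that] that False by simp
          qed
          ultimately show ?thesis by simp
        qed
        then have "P (cls n (frag_of (as[j := sing k g r \<oplus>\<^sub>A f])))"
          unfolding cls_additive[OF as(1) j s f] using add(5)
          by (intro P(4) cls_frag_closed tp_update[OF as(1)] s f)
        then show ?case by simp
      qed
      from this[of "as ! j"] show "P (cls n (frag_of as))" using tp_nth[OF as(1) j] by simp
    qed
  qed
  from b obtain as where as: "as \<in> tp ?N" "b = cls n (frag_of as)" by (elim imageE)
  show "P b" using main[of ?N] as by auto
qed

text \<open>The functionals \<open>coef _ xs\<close> are dual to the monomials; this is their linear
  independence.\<close>

lemma coef_bt:
  assumes "ys \<in> Gs (Suc N)" "xs \<in> Gs (Suc N)" "c \<in> \<K>"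
  shows "coef (bt c ys) xs = (if xs = ys then c else \<zero>\<^sub>k)"
proof -
  have gbs: "coef (map gb us) vs = (if vs = us then \<one>\<^sub>k else \<zero>\<^sub>k)" if "length vs = length us" for us vs
    using that by (induction vs us rule: list_induct2) (auto simp: gb_def sing_def)
  obtain y ys' x xs' where "ys = y # ys'" "xs = x # xs'" "length xs' = length ys'"
    using assms by (cases ys; cases xs) (auto simp: Gs_def)
  then show ?thesis using assms(3) gbs by (auto simp: sing_def)
qed

text \<open>Each coordinate is a balanced functional. Collected together they define a priori only a
  map into all functions on tuples.\<close>

lemma Bar_coordinates:
  obtains \<Theta> where "\<Theta> \<in> add_hom (Bar n) (free_module k (Gn n))"
    "\<And>c ys. c \<in> \<K> ==> ys \<in> Gn n ==> \<Theta> (mono n c ys) = sing k ys c"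
proof -
  let ?G = "Gn n"
  note F = free_module_abelian_group[OF k_ab]
  have "\<forall>xs. \<exists>H. xs \<in> ?G \<longrightarrow> H \<in> add_hom (Bar n) k \<and> (\<forall>as\<in>tn n. H (cls n (frag_of as)) = coef as xs)"
  proof
    fix xs
    show "\<exists>H. xs \<in> ?G \<longrightarrow> H \<in> add_hom (Bar n) k \<and> (\<forall>as\<in>tn n. H (cls n (frag_of as)) = coef as xs)"
    proof (cases "xs \<in> ?G")
      case True
      then have "balanced (Suc (Suc n)) k (\<lambda>as. coef as xs)" by (intro coef_balanced) (simp add: Gs_def)
      from Bar_universal[OF k_ab this] show ?thesis by metis
    qed simp
  qed
  from choice[OF this] obtain H where H: "\<forall>xs. xs \<in> ?G \<longrightarrow> H xs \<in> add_hom (Bar n) k \<and> (\<forall>as\<in>tn n. H xs (cls n (frag_of as)) = coef as xs)"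
    by (rule exE)
  have Hh: "H xs \<in> add_hom (Bar n) k" if "xs \<in> ?G" for xs using H that by blast
  have Hm: "H xs (mono n c ys) = (if xs = ys then c else \<zero>\<^sub>k)" if "c \<in> \<K>" "ys \<in> ?G" "xs \<in> ?G" for c xs ys
    using H that bt_tp[OF that(1,2)] coef_bt[OF that(2,3,1)] unfolding mono_def by simp
  define \<Theta> where "\<Theta> U = (\<lambda>xs. if xs \<in> ?G then H xs U else \<zero>\<^sub>k)" for U
  have \<Theta>m: "\<Theta> (mono n c ys) = sing k ys c" if "c \<in> \<K>" "ys \<in> ?G" for c ys
    using Hm[OF that] that(2) by (auto simp: \<Theta>_def sing_def)
  have \<Theta>_add: "\<Theta> (U \<oplus>\<^bsub>Bar n\<^esub> V) = \<Theta> U \<oplus>\<^bsub>free_module k ?G\<^esub> \<Theta> V" if "U \<in> \<B> n" "V \<in> \<B> n" for U V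
    using add_hom_add[OF Hh that] by (auto simp: \<Theta>_def)
  have \<Theta>_0: "\<Theta> \<zero>\<^bsub>Bar n\<^esub> = \<zero>\<^bsub>free_module k ?G\<^esub>" using add_hom_zero[OF Bar_abelian k_ab Hh] by (auto simp: \<Theta>_def)
  have \<Theta>_neg: "\<Theta> (\<ominus>\<^bsub>Bar n\<^esub> U) = (\<lambda>xs. \<ominus>\<^bsub>k\<^esub> \<Theta> U xs)" if "U \<in> \<B> n" for U
    using add_hom_neg[OF Bar_abelian k_ab Hh that] by (auto simp: \<Theta>_def)
  \<comment> \<open>Finite support holds on monomials and passes to everything they
    generate.\<close>
  have "\<Theta> U \<in> carrier (free_module k ?G)" if "U \<in> \<B> n" for U
    using Bar_spans Bar_abelian that
  proof (induction U rule: spans_induct)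
    case zero
    show ?case unfolding \<Theta>_0 by (simp add: fin_supp_zero[OF k_ab])
  next
    case (base b)
    then show ?case using \<Theta>m fin_supp_sing[OF k_ab] by auto
  next
    case (neg x)
    then show ?case unfolding \<Theta>_neg[OF neg(1)] by (simp add: fin_supp_uminus[OF k_ab])
  next
    case (add x y)
    then show ?case unfolding \<Theta>_add[OF add(1,2)] by (simp add: fin_supp_add[OF k_ab])
  qed
  then have "\<Theta> \<in> add_hom (Bar n) (free_module k ?G)" using \<Theta>_add by (intro add_homI)
  then show ?thesis by (rule that) (rule \<Theta>m)
qed

text \<open>Since a tensor power is free over \<open>k\<close> on tuples of group elements, an
  additive map out of it may be prescribed by an additive function of the scalar for each
  tuple.\<close>

lemma Bar_lift:
  assumes B: "abelian_group B" and b: "\<And>ys. ys \<in> Gn n ==> b ys \<in> add_hom k B"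
  obtains H where "H \<in> add_hom (Bar n) B"
    "\<And>c ys. c \<in> \<K> ==> ys \<in> Gn n ==> H (mono n c ys) = b ys c"
proof -
  obtain \<Theta> where \<Theta>: "\<Theta> \<in> add_hom (Bar n) (free_module k (Gn n))"
    "\<And>c ys. c \<in> \<K> ==> ys \<in> Gn n ==> \<Theta> (mono n c ys) = sing k ys c"
    by (rule Bar_coordinates) (rule that)
  obtain h where h: "h \<in> add_hom (free_module k (Gn n)) B"
    "\<And>ys c. ys \<in> Gn n ==> c \<in> \<K> ==> h (sing k ys c) = b ys c"
    by (rule free_module_universal[OF k_ab B, of "Gn n" b]) (rule b, assumption, rule that)
  show ?thesis
    by (rule that[OF add_hom_comp[OF \<Theta>(1) h(1)]]) (simp add: \<Theta>(2) h(2))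
qed

end

context galg
begin

section \<open>The enveloping algebra and the bar resolution\<close>

definition lin :: "(('g \<Rightarrow> 'k) \<Rightarrow> 'g \<Rightarrow> 'k) \<Rightarrow> bool" where
  "lin \<psi> \<longleftrightarrow> \<psi> \<in> add_hom A A \<and> (\<forall>c\<in>\<K>. \<forall>x\<in>\<A>. \<psi> (c \<odot>\<^sub>A x) = c \<odot>\<^sub>A \<psi> x)"

lemma lin_id: "lin (\<lambda>x. x)"
  by (simp add: lin_def add_hom_id)

lemma lin_mult_left: "a \<in> \<A> ==> lin (\<lambda>x. a \<otimes>\<^sub>A x)"
  unfolding lin_def
  by (intro conjI ballI A_mult_add_hom assoc_algebra.smult_mult_right[OF A_algebra])

lemma lin_mult_right: "a \<in> \<A> ==> lin (\<lambda>x. x \<otimes>\<^sub>A a)"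
  unfolding lin_def
  by (intro conjI ballI A_mult_add_hom assoc_algebra.smult_mult_left[OF A_algebra])

text \<open>One criterion for the outer action, the inner action and all faces of the bar
  differential: changing one entry of the input changes one entry of the output by a
  \<open>k\<close>-linear map.\<close>

lemma balanced_slots:
  assumes tp: "\<And>as. as \<in> tp N ==> F as \<in> tn m"
    and slot: "\<And>as j. as \<in> tp N ==> j < N ==> \<exists>j' \<psi>. j' < Suc (Suc m) \<and> lin \<psi> \<and>
      (\<forall>x\<in>\<A>. F (as[j := x]) = (F as)[j' := \<psi> x])"
  shows "balanced N (Bar m) (\<lambda>as. cls m (frag_of (F as)))"
proof (rule balancedI)
  fix as assume "as \<in> tp N"
  then show "cls m (frag_of (F as)) \<in> \<B> m" by (intro cls_frag_closed tp)
next
  fix as i x y assume a: "as \<in> tp N" "i < N" "x \<in> \<A>" "y \<in> \<A>"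
  obtain j' \<psi> where j: "j' < Suc (Suc m)" "lin \<psi>" "\<And>x. x \<in> \<A> ==> F (as[i := x]) = (F as)[j' := \<psi> x]"
    using slot[OF a(1,2)] by blast
  have \<psi>: "\<psi> \<in> add_hom A A" using j(2) by (simp add: lin_def)
  show "cls m (frag_of (F (as[i := x \<oplus>\<^sub>A y]))) = cls m (frag_of (F (as[i := x]))) \<oplus>\<^bsub>Bar m\<^esub> cls m (frag_of (F (as[i := y])))"
    unfolding j(3)[OF A_ab.a_closed[OF a(3,4)]] j(3)[OF a(3)] j(3)[OF a(4)] add_hom_add[OF \<psi> a(3,4)]
    by (rule cls_additive[OF tp[OF a(1)] j(1) add_hom_closed[OF \<psi> a(3)] add_hom_closed[OF \<psi> a(4)]])
next
  fix as i j c assume a: "as \<in> tp N" "i < N" "j < N" "c \<in> \<K>"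
  have *: "\<exists>j'<Suc (Suc m). F (as[i := c \<odot>\<^sub>A as ! i]) = (F as)[j' := c \<odot>\<^sub>A F as ! j']" if i: "i < N" for i
  proof -
    obtain j' \<psi> where j: "j' < Suc (Suc m)" "lin \<psi>" "\<And>x. x \<in> \<A> ==> F (as[i := x]) = (F as)[j' := \<psi> x]"
      using slot[OF a(1) i] by blast
    have ai: "as ! i \<in> \<A>" by (rule tp_nth[OF a(1) i])
    have "F as = (F as)[j' := \<psi> (as ! i)]" using j(3)[OF ai] by simp
    moreover have "j' < length (F as)" using tp[OF a(1)] j(1) by (simp add: tuples_def)
    ultimately have "F as ! j' = \<psi> (as ! i)" by (metis nth_list_update_eq)
    then have "F (as[i := c \<odot>\<^sub>A as ! i]) = (F as)[j' := c \<odot>\<^sub>A F as ! j']"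
      using j(3)[OF A_smult_closed[OF a(4) ai]] j(2) a(4) ai unfolding lin_def by metis
    with j(1) show ?thesis by blast
  qed
  show "cls m (frag_of (F (as[i := c \<odot>\<^sub>A as ! i]))) = cls m (frag_of (F (as[j := c \<odot>\<^sub>A as ! j])))"
    using *[OF a(2)] *[OF a(3)] cls_scalar[OF tp[OF a(1)] _ _ a(4)] by metis
qed

lemma tp_2_cases:
  assumes "r \<in> tn 0" obtains a b where "r = [a, b]" "a \<in> \<A>" "b \<in> \<A>"
  using assms by (auto simp: tuples_def length_Suc_conv simp del: galg_simps)

lemma balanced_2I:
  assumes hom: "\<And>a. a \<in> \<A> ==> F a \<in> add_hom A B" "\<And>b. b \<in> \<A> ==> (\<lambda>a. F a b) \<in> add_hom A B"
    and sc: "\<And>a b c. a \<in> \<A> ==> b \<in> \<A> ==> c \<in> \<K> ==> F (c \<odot>\<^sub>A a) b = F a (c \<odot>\<^sub>A b)"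
  shows "balanced (Suc (Suc 0)) B (\<lambda>as. F (as ! 0) (as ! Suc 0))"
proof (rule balancedI)
  fix as assume "as \<in> tn 0"
  then show "F (as ! 0) (as ! Suc 0) \<in> carrier B" using add_hom_closed[OF hom(1)] tp_nth[of as "Suc (Suc 0)"] by simp
next
  fix as i x y assume a: "as \<in> tn 0" "i < Suc (Suc 0)" "x \<in> \<A>" "y \<in> \<A>"
  obtain p q where "as = [p, q]" "p \<in> \<A>" "q \<in> \<A>" by (rule tp_2_cases[OF a(1)])
  then show "F (as[i := x \<oplus>\<^sub>A y] ! 0) (as[i := x \<oplus>\<^sub>A y] ! Suc 0) =
      F (as[i := x] ! 0) (as[i := x] ! Suc 0) \<oplus>\<^bsub>B\<^esub> F (as[i := y] ! 0) (as[i := y] ! Suc 0)"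
    using a add_hom_add[OF hom(1), of p x y] add_hom_add[OF hom(2), of q x y] by (cases i) (simp_all del: galg_simps)
next
  fix as i j c assume a: "as \<in> tn 0" "i < Suc (Suc 0)" "j < Suc (Suc 0)" "c \<in> \<K>"
  obtain p q where "as = [p, q]" "p \<in> \<A>" "q \<in> \<A>" by (rule tp_2_cases[OF a(1)])
  then show "F (as[i := c \<odot>\<^sub>A as ! i] ! 0) (as[i := c \<odot>\<^sub>A as ! i] ! Suc 0) = F (as[j := c \<odot>\<^sub>A as ! j] ! 0) (as[j := c \<odot>\<^sub>A as ! j] ! Suc 0)"
    using a sc[of p q c] by (cases i; cases j) (simp_all del: galg_simps)
qed

section \<open>The action of the enveloping algebra on the bar modules\<close>

definition actl :: "nat \<Rightarrow> ('g \<Rightarrow> 'k) list \<Rightarrow> ('g \<Rightarrow> 'k) list \<Rightarrow> ('g \<Rightarrow> 'k) list" where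
  "actl n r xs = xs[0 := r ! 0 \<otimes>\<^sub>A xs ! 0, Suc n := xs ! Suc n \<otimes>\<^sub>A r ! Suc 0]"

lemma actl_tp: "r \<in> tn 0 ==> xs \<in> tn n ==> actl n r xs \<in> tn n"
  unfolding actl_def by (intro tp_update A_mult_closed; (rule tp_nth, assumption)?) auto

lemma actl_balanced1:
  assumes xs: "xs \<in> tn n"
  shows "balanced (Suc (Suc 0)) (Bar n) (\<lambda>r. cls n (frag_of (actl n r xs)))"
proof (rule balanced_slots)
  show "actl n r xs \<in> tn n" if "r \<in> tn 0" for r by (rule actl_tp[OF that xs])
  fix r and j :: nat assume r: "r \<in> tn 0" and j: "j < Suc (Suc 0)"
  obtain a b where ab: "r = [a, b]" by (rule tp_2_cases[OF r])
  have len: "length xs = Suc (Suc n)" using xs by (simp add: tuples_def)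
  have x0: "xs ! 0 \<in> \<A>" "xs ! Suc n \<in> \<A>" using tp_nth[OF xs] by auto
  from j consider "j = 0" | "j = Suc 0" by linarith
  then show "\<exists>j' \<psi>. j' < Suc (Suc n) \<and> lin \<psi> \<and> (\<forall>x\<in>\<A>. actl n (r[j := x]) xs = (actl n r xs)[j' := \<psi> x])"
  proof cases
    case 1
    then show ?thesis using lin_mult_right[OF x0(1)] len
      by (intro exI[of _ 0] exI[of _ "\<lambda>x. x \<otimes>\<^sub>A xs ! 0"]) (auto simp: actl_def ab list_update_swap)
  next
    case 2
    then show ?thesis using lin_mult_left[OF x0(2)] len
      by (intro exI[of _ "Suc n"] exI[of _ "\<lambda>x. xs ! Suc n \<otimes>\<^sub>A x"]) (auto simp: actl_def ab)
  qed
qed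

lemma actl_balanced2:
  assumes r: "r \<in> tn 0"
  shows "balanced (Suc (Suc n)) (Bar n) (\<lambda>xs. cls n (frag_of (actl n r xs)))"
proof (rule balanced_slots)
  show "actl n r xs \<in> tn n" if "xs \<in> tn n" for xs by (rule actl_tp[OF r that])
  fix xs j assume xs: "xs \<in> tn n" and j: "j < Suc (Suc n)"
  obtain a b where ab: "r = [a, b]" "a \<in> \<A>" "b \<in> \<A>" by (rule tp_2_cases[OF r])
  have len: "length xs = Suc (Suc n)" using xs by (simp add: tuples_def)
  consider "j = 0" | "j = Suc n" | "j \<noteq> 0" "j \<noteq> Suc n" by blast
  then show "\<exists>j' \<psi>. j' < Suc (Suc n) \<and> lin \<psi> \<and> (\<forall>x\<in>\<A>. actl n r (xs[j := x]) = (actl n r xs)[j' := \<psi> x])"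
  proof cases
    case 1
    then show ?thesis using lin_mult_left[OF ab(2)] len
      by (intro exI[of _ 0] exI[of _ "\<lambda>x. a \<otimes>\<^sub>A x"]) (auto simp: actl_def ab list_update_swap)
  next
    case 2
    then show ?thesis using lin_mult_right[OF ab(3)] len
      by (intro exI[of _ "Suc n"] exI[of _ "\<lambda>x. x \<otimes>\<^sub>A b"]) (auto simp: actl_def ab list_update_swap)
  next
    case 3
    then show ?thesis using lin_id len j
      by (intro exI[of _ j] exI[of _ "\<lambda>x. x"]) (auto simp: actl_def ab list_update_swap)
  qed
qed

lemma Bar_smult: "U \<odot>\<^bsub>Bar n\<^esub> V = tensor_extend2 k A (Suc (Suc n)) (\<lambda>r xs. frag_of (actl n r xs)) U V"
  by (simp add: bar_resolution_def actl_def)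

lemma keys_actl:
  "r \<in> tn 0 ==> xs \<in> tn n ==> keys (frag_of (actl n r xs)) \<subseteq> tn n"
  using actl_tp by simp

lemma act_frag:
  assumes "r \<in> tn 0" "xs \<in> tn n"
  shows "cls 0 (frag_of r) \<odot>\<^bsub>Bar n\<^esub> cls n (frag_of xs) = cls n (frag_of (actl n r xs))"
  unfolding Bar_smult
  by (rule tensor_extend2_cls(1)[where n = 0 and m = n and l = n and \<beta> = "\<lambda>r xs. frag_of (actl n r xs)"])
    (rule keys_actl actl_balanced1 actl_balanced2 assms; assumption)+

lemma act_hom1: "V \<in> \<B> n ==> (\<lambda>U. U \<odot>\<^bsub>Bar n\<^esub> V) \<in> add_hom (Bar 0) (Bar n)"
  unfolding Bar_smult
  by (rule tensor_extend2_cls(2)[where n = 0 and m = n and l = n and \<beta> = "\<lambda>r xs. frag_of (actl n r xs)"])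
    ((rule keys_actl actl_balanced1 actl_balanced2; assumption)+, assumption)

lemma act_hom2: "U \<in> \<B> 0 ==> (\<lambda>V. U \<odot>\<^bsub>Bar n\<^esub> V) \<in> add_hom (Bar n) (Bar n)"
  unfolding Bar_smult
  by (rule tensor_extend2_cls(3)[where n = 0 and m = n and l = n and \<beta> = "\<lambda>r xs. frag_of (actl n r xs)"])
    ((rule keys_actl actl_balanced1 actl_balanced2; assumption)+, assumption)

lemma act_closed: "U \<in> \<B> 0 ==> V \<in> \<B> n ==> U \<odot>\<^bsub>Bar n\<^esub> V \<in> \<B> n"
  by (rule add_hom_closed[OF act_hom2])

definition actg :: "nat \<Rightarrow> 'g \<Rightarrow> 'g \<Rightarrow> 'g list \<Rightarrow> 'g list" where
  "actg n g h ys = ys[0 := g \<otimes> ys ! 0, Suc n := ys ! Suc n \<otimes> h]"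

lemma Gs_nth: "ys \<in> Gs N ==> i < N ==> ys ! i \<in> \<G>"
  by (auto simp: Gs_def)

lemma Gs_update: "ys \<in> Gs N ==> a \<in> \<G> ==> ys[i := a] \<in> Gs N"
  by (auto simp: Gs_def dest!: subsetD[OF set_update_subset_insert])

lemma Gs_length: "ys \<in> Gs N ==> length ys = N"
  by (simp add: Gs_def)

lemma actg_Gs: "g \<in> \<G> ==> h \<in> \<G> ==> ys \<in> Gn n ==> actg n g h ys \<in> Gn n"
  unfolding actg_def by (intro Gs_update G.m_closed; (rule Gs_nth, assumption)?) auto

lemma Gs_2: "g \<in> \<G> ==> h \<in> \<G> ==> [g, h] \<in> Gn 0"
  by (simp add: Gs_def)

lemma Gs_2_cases:
  assumes "ys \<in> Gn 0" obtains g h where "ys = [g, h]" "g \<in> \<G>" "h \<in> \<G>"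
  using assms by (auto simp: Gs_def length_Suc_conv)

lemma bt_length [simp]: "length (bt c ys) = length ys"
  by (cases ys) auto

lemma bt_nth: "i < length ys ==> bt c ys ! i = (if i = 0 then sing k (ys ! 0) c else gb (ys ! i))"
  by (cases ys; cases i) auto

lemma sing_mult_gb: "g \<in> \<G> ==> h \<in> \<G> ==> c \<in> \<K> ==> sing k g c \<otimes>\<^sub>A gb h = sing k (g \<otimes> h) c"
  unfolding gb_def by (simp add: A_mult_sing)

lemma act_mono:
  assumes "c \<in> \<K>" "c' \<in> \<K>" "g \<in> \<G>" "h \<in> \<G>" "ys \<in> Gn n"
  shows "mono 0 c [g, h] \<odot>\<^bsub>Bar n\<^esub> mono n c' ys = mono n (c \<otimes>\<^sub>k c') (actg n g h ys)"
proof -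
  have len: "length ys = Suc (Suc n)" by (rule Gs_length[OF assms(5)])
  have y: "ys ! 0 \<in> \<G>" "ys ! Suc n \<in> \<G>" using Gs_nth[OF assms(5)] by auto
  have "actl n (bt c [g, h]) (bt c' ys) = bt (c \<otimes>\<^sub>k c') (actg n g h ys)"
  proof (rule nth_equalityI)
    fix i assume "i < length (actl n (bt c [g, h]) (bt c' ys))"
    then have i: "i < Suc (Suc n)" by (simp add: actl_def len)
    show "actl n (bt c [g, h]) (bt c' ys) ! i = bt (c \<otimes>\<^sub>k c') (actg n g h ys) ! i"
      using i len assms(1-4) y by (auto simp: actl_def actg_def bt_nth nth_list_update A_mult_sing gb_mult)
  qed (simp add: actl_def actg_def)
  then show ?thesis
    using act_frag[OF bt_tp[OF assms(1) Gs_2[OF assms(3,4)]] bt_tp[OF assms(2,5)]] by (simp add: mono_def)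
qed

lemma mono_spans_cases:
  assumes "b \<in> monos n"
  obtains c ys where "b = mono n c ys" "c \<in> \<K>" "ys \<in> Gn n"
  using assms by blast

lemma mono0_spans_cases:
  assumes "b \<in> monos 0"
  obtains c g h where "b = mono 0 c [g, h]" "c \<in> \<K>" "g \<in> \<G>" "h \<in> \<G>"
  using assms by (auto elim!: Gs_2_cases)

lemma act_assoc:
  assumes "U \<in> \<B> 0" "V \<in> \<B> 0" "W \<in> \<B> n"
  shows "(U \<odot>\<^bsub>Bar 0\<^esub> V) \<odot>\<^bsub>Bar n\<^esub> W = U \<odot>\<^bsub>Bar n\<^esub> (V \<odot>\<^bsub>Bar n\<^esub> W)"
proof (rule add_hom_eqI[OF Bar_spans Bar_abelian Bar_abelian act_hom2[OF act_closed[OF assms(1,2)]]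
      add_hom_comp[OF act_hom2[OF assms(2)] act_hom2[OF assms(1)]] _ assms(3)])
  fix W assume W: "W \<in> monos n"
  then have Wc: "W \<in> \<B> n" by (rule spans_subset[OF Bar_spans])
  obtain c ys where W': "W = mono n c ys" "c \<in> \<K>" "ys \<in> Gn n" by (rule mono_spans_cases[OF W])
  show "(U \<odot>\<^bsub>Bar 0\<^esub> V) \<odot>\<^bsub>Bar n\<^esub> W = U \<odot>\<^bsub>Bar n\<^esub> (V \<odot>\<^bsub>Bar n\<^esub> W)"
  proof (rule biadd_eqI[OF Bar_spans Bar_spans Bar_abelian Bar_abelian Bar_abelian _ _ _ _ _ assms(1,2)])
    fix b d assume b: "b \<in> monos 0"
      and d: "d \<in> monos 0"
    obtain c1 g1 h1 where 1: "b = mono 0 c1 [g1, h1]" "c1 \<in> \<K>" "g1 \<in> \<G>" "h1 \<in> \<G>"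
      by (rule mono0_spans_cases[OF b])
    obtain c2 g2 h2 where 2: "d = mono 0 c2 [g2, h2]" "c2 \<in> \<K>" "g2 \<in> \<G>" "h2 \<in> \<G>"
      by (rule mono0_spans_cases[OF d])
    have y: "ys ! 0 \<in> \<G>" "ys ! Suc n \<in> \<G>" "length ys = Suc (Suc n)" using Gs_nth[OF W'(3)] Gs_length[OF W'(3)] by auto
    have "actg n g1 h1 (actg n g2 h2 ys) = actg n (g1 \<otimes> g2) (h2 \<otimes> h1) ys"
      using 1 2 y by (intro nth_equalityI) (auto simp: actg_def nth_list_update G.m_assoc)
    then show "(b \<odot>\<^bsub>Bar 0\<^esub> d) \<odot>\<^bsub>Bar n\<^esub> W = b \<odot>\<^bsub>Bar n\<^esub> (d \<odot>\<^bsub>Bar n\<^esub> W)"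
      using 1 2 W' by (simp add: act_mono Gs_2 actg_Gs k.m_assoc) (simp add: actg_def act_mono k.m_assoc)
  qed (use Wc in \<open>auto intro: add_hom_comp[OF act_hom1 act_hom1] add_hom_comp[OF act_hom2 act_hom1]
      add_hom_comp[OF act_hom1 act_hom2] act_hom1 act_closed\<close>)
qed

abbreviation "E \<equiv> enveloping_algebra k A"

lemma E_simps [simp]: "carrier E = \<B> 0" "\<zero>\<^bsub>E\<^esub> = \<zero>\<^bsub>Bar 0\<^esub>" "U \<oplus>\<^bsub>E\<^esub> V = U \<oplus>\<^bsub>Bar 0\<^esub> V"
  by (simp_all add: enveloping_algebra_def bar_resolution_def numeral_2_eq_2)

lemma E_add_hom: "add_hom E M = add_hom (Bar 0) M" "add_hom M E = add_hom M (Bar 0)"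
  by (rule add_hom_cong; simp add: enveloping_algebra_def bar_resolution_def numeral_2_eq_2)+

lemma E_abelian: "abelian_group E"
  by (rule abelian_group_of_comm_group[OF abelian_group.a_comm_group[OF Bar_abelian[of 0]]])
    (simp_all add: enveloping_algebra_def bar_resolution_def numeral_2_eq_2)

lemma E_neg: "U \<in> \<B> 0 ==> \<ominus>\<^bsub>E\<^esub> U = \<ominus>\<^bsub>Bar 0\<^esub> U"
  by (rule abelian_group.minus_equality[OF E_abelian]) (auto simp: Bar.l_neg)

lemma E_spans: "spans E (monos 0)"
  proof -
  have "(\<forall>x\<in>H. \<ominus>\<^bsub>E\<^esub> x \<in> H) \<longleftrightarrow> (\<forall>x\<in>H. \<ominus>\<^bsub>Bar 0\<^esub> x \<in> H)" if "H \<subseteq> \<B> 0" for H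
    using that E_neg by (intro ball_cong) auto
  then show ?thesis using Bar_spans[of 0] unfolding spans_def E_simps by simp
qed

lemma E_one: "\<one>\<^bsub>E\<^esub> = mono 0 \<one>\<^sub>k [\<one>, \<one>]"
  by (simp add: enveloping_algebra_def mono_def numeral_2_eq_2 gb_def group_basis_sing)

text \<open>Multiplication in the enveloping algebra is its outer action on degree 0 of the bar
  resolution, so the ring laws are instances of the laws of the action.\<close>

lemma E_mult:
  assumes "U \<in> \<B> 0" "V \<in> \<B> 0"
  shows "U \<otimes>\<^bsub>E\<^esub> V = U \<odot>\<^bsub>Bar 0\<^esub> V"
proof -
  obtain v where v: "v \<in> carrier (Fr 0)" "V = cls 0 v" by (rule Bar_cases[OF assms(2)])
  obtain u where u: "u \<in> carrier (Fr 0)" "U = cls 0 u" by (rule Bar_cases[OF assms(1)])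
  have "frag_extend (\<lambda>r. frag_extend (\<lambda>s. frag_of [r ! 0 \<otimes>\<^sub>A s ! 0, s ! 1 \<otimes>\<^sub>A r ! 1]) v') u' =
      frag_extend (\<lambda>r. frag_extend (\<lambda>s. frag_of (actl 0 r s)) v') u'" if "u' \<in> U" "v' \<in> V" for u' v'
  proof (intro frag_extend_eq)
    fix r s assume "r \<in> keys u'" "s \<in> keys v'"
    then have "s \<in> tn 0"
      using that cls_subset[OF v(1)] v(2) by auto
    then obtain a b where "s = [a, b]" by (rule tp_2_cases)
    then show "frag_of [r ! 0 \<otimes>\<^sub>A s ! 0, s ! 1 \<otimes>\<^sub>A r ! 1] = frag_of (actl 0 r s)" by (simp add: actl_def)
  qed
  then show ?thesis
    unfolding Bar_smult by (simp add: enveloping_algebra_def tensor_extend2_def numeral_2_eq_2)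
qed

lemma act_one:
  assumes "V \<in> \<B> n" shows "\<one>\<^bsub>E\<^esub> \<odot>\<^bsub>Bar n\<^esub> V = V"
proof (rule add_hom_eqI[OF Bar_spans Bar_abelian Bar_abelian act_hom2 add_hom_id _ assms])
  show "\<one>\<^bsub>E\<^esub> \<in> \<B> 0" unfolding E_one by (intro mono_closed Gs_2) auto
  fix b assume "b \<in> monos n"
  then obtain c ys where b: "b = mono n c ys" "c \<in> \<K>" "ys \<in> Gn n" by (rule mono_spans_cases)
  have "actg n \<one> \<one> ys = ys" using Gs_nth[OF b(3)] by (simp add: actg_def)
  then show "\<one>\<^bsub>E\<^esub> \<odot>\<^bsub>Bar n\<^esub> b = b" using b by (simp add: E_one act_mono)
qed

lemma E_ring: "ring E"
proof (rule ringI)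
  have one: "\<one>\<^bsub>E\<^esub> \<in> \<B> 0" unfolding E_one by (intro mono_closed Gs_2) auto
  show "monoid E"
  proof (rule monoidI)
    fix U assume U: "U \<in> carrier E"
    then show "\<one>\<^bsub>E\<^esub> \<otimes>\<^bsub>E\<^esub> U = U" using E_mult[OF one] act_one by simp
    have "U \<odot>\<^bsub>Bar 0\<^esub> \<one>\<^bsub>E\<^esub> = U"
    proof (rule add_hom_eqI[OF Bar_spans[of 0] Bar_abelian Bar_abelian act_hom1[OF one] add_hom_id])
      fix b assume "b \<in> monos 0"
      then obtain c g h where b: "b = mono 0 c [g, h]" "c \<in> \<K>" "g \<in> \<G>" "h \<in> \<G>" by (rule mono0_spans_cases)
      then show "b \<odot>\<^bsub>Bar 0\<^esub> \<one>\<^bsub>E\<^esub> = b" unfolding E_one by (simp add: act_mono Gs_2) (simp add: actg_def)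
    qed (use U in simp)
    then show "U \<otimes>\<^bsub>E\<^esub> \<one>\<^bsub>E\<^esub> = U" using E_mult[OF _ one] U by simp
  next
    fix U V W assume "U \<in> carrier E" "V \<in> carrier E" "W \<in> carrier E"
    then show "U \<otimes>\<^bsub>E\<^esub> V \<otimes>\<^bsub>E\<^esub> W = U \<otimes>\<^bsub>E\<^esub> (V \<otimes>\<^bsub>E\<^esub> W)" by (simp add: E_mult act_closed act_assoc)
  qed (use one E_mult act_closed in auto)
next
  fix U V W assume UVW: "U \<in> carrier E" "V \<in> carrier E" "W \<in> carrier E"
  then show "(U \<oplus>\<^bsub>E\<^esub> V) \<otimes>\<^bsub>E\<^esub> W = U \<otimes>\<^bsub>E\<^esub> W \<oplus>\<^bsub>E\<^esub> V \<otimes>\<^bsub>E\<^esub> W"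
    using add_hom_add[OF act_hom1[of W 0], of U V] by (simp add: E_mult)
  show "W \<otimes>\<^bsub>E\<^esub> (U \<oplus>\<^bsub>E\<^esub> V) = W \<otimes>\<^bsub>E\<^esub> U \<oplus>\<^bsub>E\<^esub> W \<otimes>\<^bsub>E\<^esub> V"
    using UVW add_hom_add[OF act_hom2[of W 0], of U V] by (simp add: E_mult)
qed (rule E_abelian)

lemma Bar_left_module: "left_module E (Bar n)"
proof (intro left_module.intro left_module_axioms.intro E_ring Bar_abelian)
  fix a b x assume "a \<in> carrier E" "b \<in> carrier E" "x \<in> \<B> n"
  then show "(a \<oplus>\<^bsub>E\<^esub> b) \<odot>\<^bsub>Bar n\<^esub> x = a \<odot>\<^bsub>Bar n\<^esub> x \<oplus>\<^bsub>Bar n\<^esub> b \<odot>\<^bsub>Bar n\<^esub> x"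
    using add_hom_add[OF act_hom1[of x n], of a b] by simp
  show "(a \<otimes>\<^bsub>E\<^esub> b) \<odot>\<^bsub>Bar n\<^esub> x = a \<odot>\<^bsub>Bar n\<^esub> (b \<odot>\<^bsub>Bar n\<^esub> x)"
    using \<open>a \<in> carrier E\<close> \<open>b \<in> carrier E\<close> \<open>x \<in> \<B> n\<close> by (simp add: E_mult act_assoc)
next
  fix a x y assume "a \<in> carrier E" "x \<in> \<B> n" "y \<in> \<B> n"
  then show "a \<odot>\<^bsub>Bar n\<^esub> (x \<oplus>\<^bsub>Bar n\<^esub> y) = a \<odot>\<^bsub>Bar n\<^esub> x \<oplus>\<^bsub>Bar n\<^esub> a \<odot>\<^bsub>Bar n\<^esub> y"
    using add_hom_add[OF act_hom2[of a n], of x y] by simp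
qed (use act_closed act_one in auto)

section \<open>The algebra as a module over its enveloping algebra\<close>

abbreviation "AB \<equiv> algebra_bimodule k A"

lemma frag_group_finsum: "(\<And>i. i \<in> F ==> keys (f i) \<subseteq> Y) ==> (\<Oplus>\<^bsub>frag_group Y\<^esub>i\<in>F. f i) = (\<Sum>i\<in>F. f i)"
proof (induction F rule: infinite_finite_induct)
  case (infinite F)
  then show ?case by (simp add: abelian_monoid.finsum_infinite[OF abelian_group.axioms(1)[OF frag_abelian]])
next
  case empty
  then show ?case by (simp add: abelian_monoid.finsum_empty[OF abelian_group.axioms(1)[OF frag_abelian]])
next
  case (insert x F)
  then show ?case
    using abelian_monoid.finsum_insert[OF abelian_group.axioms(1)[OF frag_abelian[of Y]], of F x f] by simp
qed

lemma frag_group_pow: "keys u \<subseteq> Y ==> [(z::int)] \<cdot>\<^bsub>frag_group Y\<^esub> u = frag_cmul z u"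
proof -
  assume "keys u \<subseteq> Y"
  moreover have "add_monoid (frag_group Y) = free_Abelian_group Y"
    by (simp add: frag_group_def free_Abelian_group_def)
  ultimately show ?thesis by (simp add: add_pow_def)
qed

text \<open>The action in \<open>algebra_bimodule\<close> is an explicit sum over the keys of a
  representative; this formula recognises such a sum as an additive extension.\<close>

lemma frag_hom_expansion:
  assumes "abelian_group B" "h \<in> add_hom (frag_group Y) B" "u \<in> carrier (frag_group Y)"
  shows "h u = (\<Oplus>\<^bsub>B\<^esub>r\<in>keys u. [Poly_Mapping.lookup u r] \<cdot>\<^bsub>B\<^esub> h (frag_of r))"
proof -
  interpret B: abelian_group B by fact
  let ?t = "\<lambda>r. frag_cmul (Poly_Mapping.lookup u r) (frag_of r)"
  have keys: "keys (?t r) \<subseteq> Y" if "r \<in> keys u" for r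
    using assms(3) that by auto
  have "u = (\<Sum>r\<in>keys u. ?t r)" using frag_expansion[of u] by (simp add: frag_extend_def)
  then have "h u = h (\<Oplus>\<^bsub>frag_group Y\<^esub>r\<in>keys u. ?t r)" using frag_group_finsum[of "keys u" ?t Y] keys by simp
  also have "\<dots> = (\<Oplus>\<^bsub>B\<^esub>r\<in>keys u. h (?t r))"
    by (rule add_hom_finsum[OF frag_abelian assms(1,2)]) (use keys in simp)
  also have "\<dots> = (\<Oplus>\<^bsub>B\<^esub>r\<in>keys u. [Poly_Mapping.lookup u r] \<cdot>\<^bsub>B\<^esub> h (frag_of r))"
  proof (rule B.finsum_cong'[OF refl])
    fix r assume r: "r \<in> keys u"
    then have rY: "r \<in> Y" using assms(3) by auto
    show "h (?t r) = [Poly_Mapping.lookup u r] \<cdot>\<^bsub>B\<^esub> h (frag_of r)"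
      using add_hom_int_pow[OF frag_abelian assms(1,2), of "frag_of r" "Poly_Mapping.lookup u r"] rY
      by (simp add: frag_group_pow)
  qed (use assms(3) add_hom_closed[OF assms(2)] in \<open>auto intro!: B.add.int_pow_closed\<close>)
  finally show ?thesis .
qed

lemma AB_simps [simp]: "carrier AB = \<A>" "\<zero>\<^bsub>AB\<^esub> = \<zero>\<^sub>A" "x \<oplus>\<^bsub>AB\<^esub> y = x \<oplus>\<^sub>A y"
  by (simp_all add: algebra_bimodule_def)

lemma AB_add_hom: "add_hom AB M = add_hom A M" "add_hom M AB = add_hom M A"
  by (rule add_hom_cong; simp add: algebra_bimodule_def group_algebra_def)+

lemma AB_abelian: "abelian_group AB"
  by (rule abelian_group_of_comm_group[OF abelian_group.a_comm_group[OF A_abelian]])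
    (simp_all add: algebra_bimodule_def group_algebra_def)

lemma AB_balanced:
  assumes m: "m \<in> \<A>" shows "balanced (Suc (Suc 0)) A (\<lambda>r. r ! 0 \<otimes>\<^sub>A m \<otimes>\<^sub>A r ! Suc 0)"
proof (rule balanced_2I)
  fix a b c assume "a \<in> \<A>" "b \<in> \<A>" "c \<in> \<K>"
  then show "c \<odot>\<^sub>A a \<otimes>\<^sub>A m \<otimes>\<^sub>A b = a \<otimes>\<^sub>A m \<otimes>\<^sub>A (c \<odot>\<^sub>A b)"
    using m by (simp add: assoc_algebra.smult_mult_left[OF A_algebra] assoc_algebra.smult_mult_right[OF A_algebra] A.m_closed del: galg_simps)
qed (intro A_mult_add_hom A_mult_closed m add_hom_comp[OF A_mult_add_hom(2)[OF m]]; assumption)+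

text \<open>The sum over a representative is the value of the extension of a balanced map, hence
  constant on the coset. This is what gives \<open>the_elem\<close> its meaning.\<close>

lemma AB_smult_hom:
  assumes m: "m \<in> \<A>"
  shows "(\<lambda>U. U \<odot>\<^bsub>AB\<^esub> m) \<in> add_hom (Bar 0) A"
    and "a \<in> \<A> ==> b \<in> \<A> ==> cls 0 (frag_of [a, b]) \<odot>\<^bsub>AB\<^esub> m = a \<otimes>\<^sub>A m \<otimes>\<^sub>A b"
proof -
  let ?\<Phi> = "\<lambda>r. r ! 0 \<otimes>\<^sub>A m \<otimes>\<^sub>A r ! Suc 0"
  note bal = AB_balanced[OF m]
  obtain h where h: "h \<in> add_hom (Fr 0) A" "\<And>r. r \<in> tn 0 ==> h (frag_of r) = ?\<Phi> r"
    by (rule frag_group_universal[OF A_abelian, of "tn 0" ?\<Phi>]) (rule balancedD(1)[OF bal], assumption, rule that)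
  have sm: "cls 0 u \<odot>\<^bsub>AB\<^esub> m = h u" if u: "u \<in> carrier (Fr 0)" for u
  proof -
    have e: "(\<Oplus>\<^bsub>A\<^esub>r\<in>keys v. [Poly_Mapping.lookup v r] \<cdot>\<^bsub>A\<^esub> ?\<Phi> r) = h u" if v: "v \<in> cls 0 u" for v
    proof -
      have vc: "v \<in> carrier (Fr 0)" by (rule cls_subset[OF u v])
      have "h v = (\<Oplus>\<^bsub>A\<^esub>r\<in>keys v. [Poly_Mapping.lookup v r] \<cdot>\<^bsub>A\<^esub> h (frag_of r))"
        by (rule frag_hom_expansion[OF A_abelian h(1) vc])
      also have "\<dots> = (\<Oplus>\<^bsub>A\<^esub>r\<in>keys v. [Poly_Mapping.lookup v r] \<cdot>\<^bsub>A\<^esub> ?\<Phi> r)"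
      proof (rule A_ab.finsum_cong'[OF refl])
        show "(\<lambda>r. [Poly_Mapping.lookup v r] \<cdot>\<^bsub>A\<^esub> ?\<Phi> r) \<in> keys v \<rightarrow> \<A>"
          using vc balancedD(1)[OF bal] by (intro funcsetI A_ab.add.int_pow_closed) auto
      qed (use vc h(2) in auto)
      finally show ?thesis using Bar_universal_elem[OF A_abelian bal h u v] by simp
    qed
    have "(\<lambda>v. \<Oplus>\<^bsub>A\<^esub>r\<in>keys v. [Poly_Mapping.lookup v r] \<cdot>\<^bsub>A\<^esub> ?\<Phi> r) ` cls 0 u = {h u}"
      using e cls_self[OF u] by (auto simp: image_iff) 
    then show ?thesis by (simp add: algebra_bimodule_def)
  qed
  show "(\<lambda>U. U \<odot>\<^bsub>AB\<^esub> m) \<in> add_hom (Bar 0) A"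
  proof (rule add_homI)
    fix U assume U: "U \<in> \<B> 0"
    obtain u where u: "u \<in> carrier (Fr 0)" "U = cls 0 u" by (rule Bar_cases[OF U])
    show "U \<odot>\<^bsub>AB\<^esub> m \<in> \<A>" unfolding u(2) sm[OF u(1)] by (rule add_hom_closed[OF h(1) u(1)])
    fix V assume V: "V \<in> \<B> 0"
    obtain v where v: "v \<in> carrier (Fr 0)" "V = cls 0 v" by (rule Bar_cases[OF V])
    have uv: "u + v \<in> carrier (Fr 0)" using u v keys_add[of u v] by auto
    show "(U \<oplus>\<^bsub>Bar 0\<^esub> V) \<odot>\<^bsub>AB\<^esub> m = U \<odot>\<^bsub>AB\<^esub> m \<oplus>\<^sub>A V \<odot>\<^bsub>AB\<^esub> m"
      unfolding u(2) v(2) cls_add[OF u(1) v(1), symmetric] sm[OF uv] sm[OF u(1)] sm[OF v(1)]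
      using add_hom_add[OF h(1) u(1) v(1)] by simp
  qed
  show "a \<in> \<A> ==> b \<in> \<A> ==> cls 0 (frag_of [a, b]) \<odot>\<^bsub>AB\<^esub> m = a \<otimes>\<^sub>A m \<otimes>\<^sub>A b"
    using sm[of "frag_of [a, b]"] h(2)[of "[a, b]"] by (simp add: tuples_def del: galg_simps)
qed

lemma AB_smult_mono:
  assumes "c \<in> \<K>" "g \<in> \<G>" "h \<in> \<G>" "m \<in> \<A>"
  shows "mono 0 c [g, h] \<odot>\<^bsub>AB\<^esub> m = sing k g c \<otimes>\<^sub>A m \<otimes>\<^sub>A gb h"
  using AB_smult_hom(2)[OF assms(4) sing_A[OF assms(2,1)] gb_closed[OF assms(3)]] by (simp add: mono_def)

lemma AB_smult_hom2:
  assumes "U \<in> \<B> 0" shows "(\<lambda>m. U \<odot>\<^bsub>AB\<^esub> m) \<in> add_hom A A"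
proof (rule add_homI)
  fix m m' assume m: "m \<in> \<A>"
  show "U \<odot>\<^bsub>AB\<^esub> m \<in> \<A>" by (rule add_hom_closed[OF AB_smult_hom(1)[OF m] assms])
  assume m': "m' \<in> \<A>"
  show "U \<odot>\<^bsub>AB\<^esub> (m \<oplus>\<^sub>A m') = U \<odot>\<^bsub>AB\<^esub> m \<oplus>\<^sub>A U \<odot>\<^bsub>AB\<^esub> m'"
  proof (rule add_hom_eqI[OF Bar_spans[of 0] Bar_abelian A_abelian AB_smult_hom(1)[OF A_ab.a_closed[OF m m']]
        add_hom_plus[OF A_abelian AB_smult_hom(1)[OF m] AB_smult_hom(1)[OF m']] _ assms])
    fix b assume "b \<in> monos 0"
    then obtain c g h where b: "b = mono 0 c [g, h]" "c \<in> \<K>" "g \<in> \<G>" "h \<in> \<G>" by (rule mono0_spans_cases)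
    show "b \<odot>\<^bsub>AB\<^esub> (m \<oplus>\<^sub>A m') = b \<odot>\<^bsub>AB\<^esub> m \<oplus>\<^sub>A b \<odot>\<^bsub>AB\<^esub> m'"
      using b m m' sing_A[OF b(3,2)] gb_closed[OF b(4)]
      by (simp add: AB_smult_mono A.r_distr A.l_distr A.m_closed del: galg_simps)
  qed
qed

lemma AB_left_module: "left_module E AB"
proof (intro left_module.intro left_module_axioms.intro E_ring AB_abelian)
  fix a x assume "a \<in> carrier E" "x \<in> carrier AB"
  then show "a \<odot>\<^bsub>AB\<^esub> x \<in> carrier AB" using add_hom_closed[OF AB_smult_hom2, of a x] by simp
next
  fix a b x assume "a \<in> carrier E" "b \<in> carrier E" "x \<in> carrier AB"
  then show "(a \<oplus>\<^bsub>E\<^esub> b) \<odot>\<^bsub>AB\<^esub> x = a \<odot>\<^bsub>AB\<^esub> x \<oplus>\<^bsub>AB\<^esub> b \<odot>\<^bsub>AB\<^esub> x"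
    using add_hom_add[OF AB_smult_hom(1), of x a b] by simp
next
  fix a x y assume "a \<in> carrier E" "x \<in> carrier AB" "y \<in> carrier AB"
  then show "a \<odot>\<^bsub>AB\<^esub> (x \<oplus>\<^bsub>AB\<^esub> y) = a \<odot>\<^bsub>AB\<^esub> x \<oplus>\<^bsub>AB\<^esub> a \<odot>\<^bsub>AB\<^esub> y"
    using add_hom_add[OF AB_smult_hom2, of a x y] by simp
next
  fix x assume "x \<in> carrier AB"
  then have x: "x \<in> \<A>" by simp
  show "\<one>\<^bsub>E\<^esub> \<odot>\<^bsub>AB\<^esub> x = x"
    unfolding E_one AB_smult_mono[OF k.one_closed G.one_closed G.one_closed x] gb_def[symmetric] gb_one
    using x by (simp del: galg_simps)
next
  fix U V x assume "U \<in> carrier E" "V \<in> carrier E" "x \<in> carrier AB"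
  then have UV: "U \<in> \<B> 0" "V \<in> \<B> 0" and x: "x \<in> \<A>" by simp_all
  have "(U \<odot>\<^bsub>Bar 0\<^esub> V) \<odot>\<^bsub>AB\<^esub> x = U \<odot>\<^bsub>AB\<^esub> (V \<odot>\<^bsub>AB\<^esub> x)"
  proof (rule biadd_eqI[OF Bar_spans Bar_spans Bar_abelian Bar_abelian A_abelian _ _ _ _ _ UV])
    fix b d assume b: "b \<in> monos 0"
      and d: "d \<in> monos 0"
    obtain c1 g1 h1 where 1: "b = mono 0 c1 [g1, h1]" "c1 \<in> \<K>" "g1 \<in> \<G>" "h1 \<in> \<G>"
      by (rule mono0_spans_cases[OF b])
    obtain c2 g2 h2 where 2: "d = mono 0 c2 [g2, h2]" "c2 \<in> \<K>" "g2 \<in> \<G>" "h2 \<in> \<G>"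
      by (rule mono0_spans_cases[OF d])
    have "actg 0 g1 h1 [g2, h2] = [g1 \<otimes> g2, h2 \<otimes> h1]" by (simp add: actg_def)
    then have "b \<odot>\<^bsub>Bar 0\<^esub> d = mono 0 (c1 \<otimes>\<^sub>k c2) [g1 \<otimes> g2, h2 \<otimes> h1]" using 1 2 by (simp add: act_mono Gs_2)
    then have "(b \<odot>\<^bsub>Bar 0\<^esub> d) \<odot>\<^bsub>AB\<^esub> x = (sing k g1 c1 \<otimes>\<^sub>A sing k g2 c2) \<otimes>\<^sub>A x \<otimes>\<^sub>A (gb h2 \<otimes>\<^sub>A gb h1)"
      using 1 2 x by (simp add: AB_smult_mono A_mult_sing gb_mult)
    also have "\<dots> = b \<odot>\<^bsub>AB\<^esub> (d \<odot>\<^bsub>AB\<^esub> x)"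
    proof -
      have s: "sing k g1 c1 \<in> \<A>" "sing k g2 c2 \<in> \<A>" "gb h2 \<in> \<A>" "gb h1 \<in> \<A>"
        using 1 2 by (intro sing_A gb_closed; simp)+
      have dx: "d \<odot>\<^bsub>AB\<^esub> x = sing k g2 c2 \<otimes>\<^sub>A x \<otimes>\<^sub>A gb h2"
        unfolding 2(1) by (rule AB_smult_mono[OF 2(2-4) x])
      have "b \<odot>\<^bsub>AB\<^esub> (d \<odot>\<^bsub>AB\<^esub> x) = sing k g1 c1 \<otimes>\<^sub>A (sing k g2 c2 \<otimes>\<^sub>A x \<otimes>\<^sub>A gb h2) \<otimes>\<^sub>A gb h1"
        unfolding dx 1(1) by (rule AB_smult_mono[OF 1(2-4)]) (intro A.m_closed s x)
      then show ?thesis using s x by (simp add: A.m_assoc A.m_closed del: galg_simps)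
    qed
    finally show "(b \<odot>\<^bsub>Bar 0\<^esub> d) \<odot>\<^bsub>AB\<^esub> x = b \<odot>\<^bsub>AB\<^esub> (d \<odot>\<^bsub>AB\<^esub> x)" .
  next
    fix y assume y: "y \<in> \<B> 0"
    show "(\<lambda>U. (U \<odot>\<^bsub>Bar 0\<^esub> y) \<odot>\<^bsub>AB\<^esub> x) \<in> add_hom (Bar 0) A" by (rule add_hom_comp[OF act_hom1[OF y] AB_smult_hom(1)[OF x]])
    show "(\<lambda>V. (y \<odot>\<^bsub>Bar 0\<^esub> V) \<odot>\<^bsub>AB\<^esub> x) \<in> add_hom (Bar 0) A" by (rule add_hom_comp[OF act_hom2[OF y] AB_smult_hom(1)[OF x]])
    show "(\<lambda>U. U \<odot>\<^bsub>AB\<^esub> (y \<odot>\<^bsub>AB\<^esub> x)) \<in> add_hom (Bar 0) A" by (rule AB_smult_hom(1)[OF add_hom_closed[OF AB_smult_hom2[OF y] x]])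
    show "(\<lambda>V. y \<odot>\<^bsub>AB\<^esub> (V \<odot>\<^bsub>AB\<^esub> x)) \<in> add_hom (Bar 0) A" by (rule add_hom_comp[OF AB_smult_hom(1)[OF x] AB_smult_hom2[OF y]])
  qed
  then show "(U \<otimes>\<^bsub>E\<^esub> V) \<odot>\<^bsub>AB\<^esub> x = U \<odot>\<^bsub>AB\<^esub> (V \<odot>\<^bsub>AB\<^esub> x)" using E_mult[OF UV] by simp
qed

end

section \<open>The bar differential\<close>

text \<open>The operation is a parameter so that the same faces can be formed on lists over
  \<open>A\<close> and on lists over \<open>G\<close> and compared.\<close>

definition fold_at :: "('a \<Rightarrow> 'a \<Rightarrow> 'a) \<Rightarrow> nat \<Rightarrow> 'a list \<Rightarrow> 'a list" where
  "fold_at f i xs = take i xs @ f (xs ! i) (xs ! Suc i) # drop (Suc (Suc i)) xs"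

definition fold_sum :: "('a \<Rightarrow> 'a \<Rightarrow> 'a) \<Rightarrow> nat \<Rightarrow> 'a list \<Rightarrow> 'a list \<Rightarrow>\<^sub>0 int" where
  "fold_sum f m xs = (\<Sum>i<m. frag_cmul ((- 1) ^ i) (frag_of (fold_at f i xs)))"

lemma fold_at_length: "Suc i < length xs ==> length (fold_at f i xs) = length xs - 1"
  by (simp add: fold_at_def)

lemma fold_at_nth:
  assumes "Suc i < length xs" "p < length xs - 1"
  shows "fold_at f i xs ! p = (if p < i then xs ! p else if p = i then f (xs ! i) (xs ! Suc i) else xs ! Suc p)"
proof (cases "p \<le> i")
  case False
  then obtain q where "p = Suc (i + q)" using less_imp_Suc_add[of i p] by auto
  then show ?thesis using assms by (simp add: fold_at_def nth_append min_def)
qed (use assms in \<open>auto simp: fold_at_def nth_append min_def\<close>)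

context galg
begin

lemma balanced_plus:
  assumes "abelian_group B" "balanced N B \<Phi>" "balanced N B \<Psi>"
  shows "balanced N B (\<lambda>as. \<Phi> as \<oplus>\<^bsub>B\<^esub> \<Psi> as)"
proof -
  interpret B: abelian_group B by fact
  note D = balancedD[OF assms(2)] balancedD[OF assms(3)]
  show ?thesis
  proof (rule balancedI)
    fix as i x y assume a: "as \<in> tp N" "i < N" "x \<in> \<A>" "y \<in> \<A>"
    have t: "as[i := x] \<in> tp N" "as[i := y] \<in> tp N" using a by (auto intro!: tp_update simp del: galg_simps)
    show "\<Phi> (as[i := x \<oplus>\<^sub>A y]) \<oplus>\<^bsub>B\<^esub> \<Psi> (as[i := x \<oplus>\<^sub>A y]) =
        \<Phi> (as[i := x]) \<oplus>\<^bsub>B\<^esub> \<Psi> (as[i := x]) \<oplus>\<^bsub>B\<^esub> (\<Phi> (as[i := y]) \<oplus>\<^bsub>B\<^esub> \<Psi> (as[i := y]))"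
      unfolding D(2)[OF a] D(5)[OF a] using D(1)[OF t(1)] D(1)[OF t(2)] D(4)[OF t(1)] D(4)[OF t(2)]
      by (simp add: B.a_ac)
  next
    fix as i j c assume a: "as \<in> tp N" "i < N" "j < N" "c \<in> \<K>"
    show "\<Phi> (as[i := c \<odot>\<^sub>A as ! i]) \<oplus>\<^bsub>B\<^esub> \<Psi> (as[i := c \<odot>\<^sub>A as ! i]) =
      \<Phi> (as[j := c \<odot>\<^sub>A as ! j]) \<oplus>\<^bsub>B\<^esub> \<Psi> (as[j := c \<odot>\<^sub>A as ! j])"
      unfolding D(3)[OF a] D(6)[OF a] ..
  qed (use D in auto)
qed

lemma balanced_hom:
  assumes "balanced N B \<Phi>" "p \<in> add_hom B B'"
  shows "balanced N B' (\<lambda>as. p (\<Phi> as))"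
proof -
  note D = balancedD[OF assms(1)]
  show ?thesis
  proof (rule balancedI)
    fix as assume "as \<in> tp N"
    then show "p (\<Phi> as) \<in> carrier B'" by (rule add_hom_closed[OF assms(2) D(1)])
  next
    fix as i x y assume a: "as \<in> tp N" "i < N" "x \<in> \<A>" "y \<in> \<A>"
    have t: "as[i := x] \<in> tp N" "as[i := y] \<in> tp N" using a by (auto intro!: tp_update simp del: galg_simps)
    show "p (\<Phi> (as[i := x \<oplus>\<^sub>A y])) = p (\<Phi> (as[i := x])) \<oplus>\<^bsub>B'\<^esub> p (\<Phi> (as[i := y]))"
      unfolding D(2)[OF a] by (rule add_hom_add[OF assms(2) D(1)[OF t(1)] D(1)[OF t(2)]])
  next
    fix as i j c assume a: "as \<in> tp N" "i < N" "j < N" "c \<in> \<K>"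
    show "p (\<Phi> (as[i := c \<odot>\<^sub>A as ! i])) = p (\<Phi> (as[j := c \<odot>\<^sub>A as ! j]))" unfolding D(3)[OF a] ..
  qed
qed

lemma int_pow_endo:
  assumes "abelian_group B" shows "(\<lambda>x. [(z::int)] \<cdot>\<^bsub>B\<^esub> x) \<in> add_hom B B"
proof -
  interpret B: abelian_group B by fact
  show ?thesis by (intro add_homI) (auto simp: B.add.int_pow_distrib)
qed

abbreviation "merge \<equiv> fold_at (monoid.mult A)"
abbreviation "mergeG \<equiv> fold_at (monoid.mult G)"
abbreviation "bsum \<equiv> fold_sum (monoid.mult A)"
abbreviation "bsumG \<equiv> fold_sum (monoid.mult G)"

lemma merge_tp: "as \<in> tp (Suc N) ==> i < N ==> merge i as \<in> tp N"
  using tp_nth[of as "Suc N" i] tp_nth[of as "Suc N" "Suc i"] A_mult_closed[of "as ! i" "as ! Suc i"]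
  by (auto simp: tuples_def fold_at_def simp del: galg_simps dest: in_set_takeD in_set_dropD)

text \<open>An entry that is merged acts on the product by one-sided multiplication; an entry behind
  the product moves one place to the left.\<close>

lemma merge_slot:
  assumes as: "as \<in> tp (Suc N)" and i: "i < N" and j: "j < Suc N"
  shows "\<exists>j' \<psi>. j' < N \<and> lin \<psi> \<and> (\<forall>x\<in>\<A>. merge i (as[j := x]) = (merge i as)[j' := \<psi> x])"
proof -
  have len: "length as = Suc N" using as by (simp add: tuples_def)
  have il: "as ! i \<in> \<A>" "as ! Suc i \<in> \<A>" using tp_nth[OF as] i by auto
  have eq: "merge i (as[j := x]) = (merge i as)[j' := y]"
    if "\<And>p. p < N ==> merge i (as[j := x]) ! p = (merge i as)[j' := y] ! p" for x j' y
    by (rule nth_equalityI) (use that len i in \<open>auto simp: fold_at_length\<close>)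
  consider "j < i" | "j = i" | "j = Suc i" | "j > Suc i" by linarith
  then show ?thesis
  proof cases
    case 1
    then show ?thesis using lin_id i len
      by (intro exI[of _ j] exI[of _ "\<lambda>x. x"] conjI ballI eq) (auto simp: fold_at_nth fold_at_length nth_list_update)
  next
    case 2
    then show ?thesis using lin_mult_right[OF il(2)] i len
      by (intro exI[of _ i] exI[of _ "\<lambda>x. x \<otimes>\<^sub>A as ! Suc i"] conjI ballI eq) (auto simp: fold_at_nth fold_at_length nth_list_update)
  next
    case 3
    then show ?thesis using lin_mult_left[OF il(1)] i len
      by (intro exI[of _ i] exI[of _ "\<lambda>x. as ! i \<otimes>\<^sub>A x"] conjI ballI eq) (auto simp: fold_at_nth fold_at_length nth_list_update)
  next
    case 4
    then show ?thesis using lin_id i j len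
      by (intro exI[of _ "j - 1"] exI[of _ "\<lambda>x. x"] conjI ballI eq) (auto simp: fold_at_nth fold_at_length nth_list_update)
  qed
qed

lemma keys_bsum:
  assumes "as \<in> tp (Suc N)" "m \<le> N" shows "keys (bsum m as) \<subseteq> tp N"
  unfolding fold_sum_def
proof (rule keys_sum_subset)
  fix i assume "i \<in> {..<m}"
  then show "keys (frag_cmul ((- 1) ^ i) (frag_of (merge i as))) \<subseteq> tp N"
    using merge_tp[OF assms(1), of i] assms(2) by auto
qed

lemma cls_cmul:
  assumes "u \<in> carrier (Fr n)" shows "cls n (frag_cmul z u) = [z] \<cdot>\<^bsub>Bar n\<^esub> cls n u"
  using add_hom_int_pow[OF frag_abelian Bar_abelian cls_hom assms, of z] assms by (simp add: frag_group_pow)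

text \<open>Induction on the number of faces: each face is balanced, and so are integer multiples
  and sums of balanced maps.\<close>

lemma bsum_balanced: "m \<le> Suc (Suc n) ==> balanced (Suc (Suc (Suc n))) (Bar n) (\<lambda>as. cls n (bsum m as))"
proof (induction m)
  case 0
  have "cls n 0 = \<zero>\<^bsub>Bar n\<^esub>" using add_hom_zero[OF frag_abelian Bar_abelian cls_hom] by simp
  then show ?case by (intro balancedI) (auto simp: fold_sum_def)
next
  case (Suc m)
  let ?\<Phi> = "\<lambda>as. cls n (bsum m as) \<oplus>\<^bsub>Bar n\<^esub> [((- 1) ^ m :: int)] \<cdot>\<^bsub>Bar n\<^esub> cls n (frag_of (merge m as))"
  have bal: "balanced (Suc (Suc (Suc n))) (Bar n) ?\<Phi>"
  proof (intro balanced_plus[OF Bar_abelian] Suc.IH balanced_hom[OF balanced_slots int_pow_endo[OF Bar_abelian]])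
    show "m \<le> Suc (Suc n)" using Suc.prems by simp
    show "merge m as \<in> tn n" if "as \<in> tn (Suc n)" for as
      using merge_tp[OF that] Suc.prems by simp
    show "\<exists>j' \<psi>. j' < Suc (Suc n) \<and> lin \<psi> \<and> (\<forall>x\<in>\<A>. merge m (as[j := x]) = (merge m as)[j' := \<psi> x])"
      if "as \<in> tn (Suc n)" "j < Suc (Suc (Suc n))" for as j
      using merge_slot[OF that(1) _ that(2)] Suc.prems by simp
  qed
  have eq: "cls n (bsum (Suc m) as) = ?\<Phi> as" if "as \<in> tn (Suc n)" for as
  proof -
    have m: "frag_of (merge m as) \<in> carrier (Fr n)" using merge_tp[OF that, of m] Suc.prems by simp
    have b: "bsum m as \<in> carrier (Fr n)" using keys_bsum[OF that, of m] Suc.prems by simp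
    have c: "frag_cmul ((- 1) ^ m) (frag_of (merge m as)) \<in> carrier (Fr n)" using m by auto
    have "bsum (Suc m) as = bsum m as + frag_cmul ((- 1) ^ m) (frag_of (merge m as))" by (simp add: fold_sum_def)
    then show ?thesis using cls_add[OF b c] cls_cmul[OF m] by simp
  qed
  show ?case
  proof (rule balancedI)
    fix as assume as: "as \<in> tn (Suc n)"
    show "cls n (bsum (Suc m) as) \<in> \<B> n" unfolding eq[OF as] by (rule balancedD(1)[OF bal as])
  next
    fix as i x y assume a: "as \<in> tn (Suc n)" "i < Suc (Suc (Suc n))" "x \<in> \<A>" "y \<in> \<A>"
    note t = tp_update[OF a(1) A_ab.a_closed[OF a(3,4)], of i] tp_update[OF a(1,3), of i] tp_update[OF a(1,4), of i]
    show "cls n (bsum (Suc m) (as[i := x \<oplus>\<^sub>A y])) =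
       cls n (bsum (Suc m) (as[i := x])) \<oplus>\<^bsub>Bar n\<^esub> cls n (bsum (Suc m) (as[i := y]))"
      unfolding eq[OF t(1)] eq[OF t(2)] eq[OF t(3)] by (rule balancedD(2)[OF bal a])
  next
    fix as i j c assume a: "as \<in> tn (Suc n)" "i < Suc (Suc (Suc n))" "j < Suc (Suc (Suc n))" "c \<in> \<K>"
    note t = tp_update[OF a(1) A_smult_closed[OF a(4) tp_nth[OF a(1,2)]], of i] tp_update[OF a(1) A_smult_closed[OF a(4) tp_nth[OF a(1,3)]], of j]
    show "cls n (bsum (Suc m) (as[i := c \<odot>\<^sub>A as ! i])) = cls n (bsum (Suc m) (as[j := c \<odot>\<^sub>A as ! j]))"
      unfolding eq[OF t(1)] eq[OF t(2)] by (rule balancedD(3)[OF bal a])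
  qed
qed

abbreviation "dB n \<equiv> bar_differential k A n"

lemma dB_eq: "dB n = tensor_extend k A (Suc (Suc n)) (bsum (Suc (Suc n)))"
  by (simp add: bar_differential_def fold_sum_def[abs_def] fold_at_def)

lemma dB_hom: "dB n \<in> add_hom (Bar (Suc n)) (Bar n)"
  unfolding dB_eq by (rule tensor_extend_cls(2)[OF keys_bsum bsum_balanced]) auto

lemma dB_cls: "u \<in> carrier (Fr (Suc n)) ==> dB n (cls (Suc n) u) = cls n (frag_extend (bsum (Suc (Suc n))) u)"
  unfolding dB_eq by (rule tensor_extend_cls(1)[OF keys_bsum bsum_balanced]) auto

lemma mergeG_Gs: "ys \<in> Gs (Suc N) ==> i < N ==> mergeG i ys \<in> Gs N"
  using Gs_nth[of ys "Suc N" i] Gs_nth[of ys "Suc N" "Suc i"]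
  by (auto simp: Gs_def fold_at_def dest: in_set_takeD in_set_dropD)

lemma merge_bt:
  assumes "ys \<in> Gs (Suc N)" "i < N" "c \<in> \<K>"
  shows "merge i (bt c ys) = bt c (mergeG i ys)"
proof (rule nth_equalityI)
  have len: "length ys = Suc N" by (rule Gs_length[OF assms(1)])
  show "length (merge i (bt c ys)) = length (bt c (mergeG i ys))" using len assms(2) by (simp add: fold_at_length)
  fix p assume "p < length (merge i (bt c ys))"
  then have p: "p < N" using len assms(2) by (simp add: fold_at_length)
  have g: "ys ! q \<in> \<G>" if "q < Suc N" for q by (rule Gs_nth[OF assms(1) that])
  show "merge i (bt c ys) ! p = bt c (mergeG i ys) ! p"
    using p len assms(2,3) g[of i] g[of "Suc i"]
    by (auto simp: fold_at_nth fold_at_length bt_nth sing_mult_gb gb_mult)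
qed

lemma mergeG_actg:
  assumes "ys \<in> Gn (Suc n)" "i < Suc (Suc n)" "g \<in> \<G>" "h \<in> \<G>"
  shows "mergeG i (actg (Suc n) g h ys) = actg n g h (mergeG i ys)"
proof (rule nth_equalityI)
  have len: "length ys = Suc (Suc (Suc n))" by (rule Gs_length[OF assms(1)])
  show "length (mergeG i (actg (Suc n) g h ys)) = length (actg n g h (mergeG i ys))"
    using len assms(2) by (simp add: fold_at_length actg_def)
  fix p assume "p < length (mergeG i (actg (Suc n) g h ys))"
  then have p: "p < Suc (Suc n)" using len assms(2) by (simp add: fold_at_length actg_def)
  have gg: "ys ! q \<in> \<G>" if "q < Suc (Suc (Suc n))" for q by (rule Gs_nth[OF assms(1) that])
  show "mergeG i (actg (Suc n) g h ys) ! p = actg n g h (mergeG i ys) ! p"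
  proof -
    have l: "Suc i < length ys" "Suc i < length (actg (Suc n) g h ys)" "p < length ys - 1" "p < length (actg (Suc n) g h ys) - 1"
      "p < length (mergeG i ys)" "0 < length (mergeG i ys)" "Suc n < length (mergeG i ys)"
      using p len assms(2) by (simp_all add: actg_def fold_at_length)
    have m: "mergeG i ys ! 0 = (if i = 0 then ys ! 0 \<otimes> ys ! Suc 0 else ys ! 0)"
      "mergeG i ys ! Suc n = (if i = Suc n then ys ! i \<otimes> ys ! Suc i else ys ! Suc (Suc n))"
      using fold_at_nth[OF l(1), of 0] fold_at_nth[OF l(1), of "Suc n"] len assms(2) by auto
    have L: "actg (Suc n) g h ys ! q = (if q = Suc (Suc n) then ys ! q \<otimes> h else if q = 0 then g \<otimes> ys ! q else ys ! q)"
      if "q < Suc (Suc (Suc n))" for q using that len by (auto simp: actg_def nth_list_update)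
    have Rr: "actg n g h (mergeG i ys) ! p = (if p = Suc n then mergeG i ys ! p \<otimes> h else if p = 0 then g \<otimes> mergeG i ys ! p else mergeG i ys ! p)"
      using l by (auto simp: actg_def nth_list_update)
    show ?thesis
      unfolding fold_at_nth[OF l(2,4)] Rr fold_at_nth[OF l(1,3)]
      using p assms(2-4) gg[of i] gg[of "Suc i"] gg[of p] gg[of "Suc p"] by (auto simp: L G.m_assoc)
  qed
qed

text \<open>The additive extension of \<open>mono n c\<close> to integral combinations of tuples; it
  carries signed sums of faces from the group to the tensor powers.\<close>

definition monoZ :: "nat \<Rightarrow> 'k \<Rightarrow> ('g list \<Rightarrow>\<^sub>0 int) \<Rightarrow> ('g, 'k) tensors" where
  "monoZ n c u = cls n (frag_extend (\<lambda>ys. frag_of (bt c ys)) u)"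

lemma monoZ_hom:
  assumes "c \<in> \<K>" shows "monoZ n c \<in> add_hom (frag_group (Gn n)) (Bar n)"
  unfolding monoZ_def[abs_def]
  by (rule add_hom_comp[OF frag_extend_add_hom cls_hom]) (simp add: bt_tp[OF assms])

lemma monoZ_frag_of: "monoZ n c (frag_of ys) = mono n c ys"
  by (simp add: monoZ_def mono_def)

lemma keys_bsumG:
  assumes "ys \<in> Gs (Suc N)" "m \<le> N" shows "keys (bsumG m ys) \<subseteq> Gs N"
  unfolding fold_sum_def
proof (rule keys_sum_subset)
  fix i assume "i \<in> {..<m}"
  then show "keys (frag_cmul ((- 1) ^ i) (frag_of (mergeG i ys))) \<subseteq> Gs N"
    using mergeG_Gs[OF assms(1), of i] assms(2) by auto
qed

lemma dB_mono:
  assumes "c \<in> \<K>" "ys \<in> Gn (Suc n)"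
  shows "dB n (mono (Suc n) c ys) = monoZ n c (bsumG (Suc (Suc n)) ys)"
proof -
  have "dB n (mono (Suc n) c ys) = cls n (bsum (Suc (Suc n)) (bt c ys))"
    unfolding mono_def using dB_cls[of "frag_of (bt c ys)" n] bt_tp[OF assms] by simp
  also have "bsum (Suc (Suc n)) (bt c ys) = frag_extend (\<lambda>ys. frag_of (bt c ys)) (bsumG (Suc (Suc n)) ys)"
    unfolding fold_sum_def fold_sum_def using merge_bt[OF assms(2) _ assms(1)]
    by (subst frag_extend_sum) (auto simp: frag_extend_cmul intro!: sum.cong)
  finally show ?thesis by (simp add: monoZ_def)
qed

lemma act_monoZ:
  assumes "c \<in> \<K>" "c' \<in> \<K>" "g \<in> \<G>" "h \<in> \<G>" "u \<in> carrier (frag_group (Gn n))"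
  shows "mono 0 c [g, h] \<odot>\<^bsub>Bar n\<^esub> monoZ n c' u = monoZ n (c \<otimes>\<^sub>k c') (frag_extend (\<lambda>ys. frag_of (actg n g h ys)) u)"
proof (rule add_hom_eqI[OF frag_group_spans frag_abelian Bar_abelian add_hom_comp[OF monoZ_hom[OF assms(2)] act_hom2]
      add_hom_comp[OF frag_extend_add_hom monoZ_hom] _ assms(5)])
  fix b assume "b \<in> frag_of ` Gn n"
  then obtain ys where "b = frag_of ys" "ys \<in> Gn n" by (elim imageE)
  then show "mono 0 c [g, h] \<odot>\<^bsub>Bar n\<^esub> monoZ n c' b = monoZ n (c \<otimes>\<^sub>k c') (frag_extend (\<lambda>ys. frag_of (actg n g h ys)) b)"
    using act_mono[OF assms(1-4)] by (simp add: monoZ_frag_of)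
qed (use assms actg_Gs mono_closed Gs_2 in auto)

lemma dB_linear:
  assumes "r \<in> carrier E" "x \<in> \<B> (Suc n)"
  shows "dB n (r \<odot>\<^bsub>Bar (Suc n)\<^esub> x) = r \<odot>\<^bsub>Bar n\<^esub> dB n x"
proof (rule linear_on_spans[OF Bar_left_module Bar_left_module dB_hom E_spans Bar_spans _ assms])
  fix b x assume b: "b \<in> monos 0"
    and x: "x \<in> monos (Suc n)"
  obtain c g h where 1: "b = mono 0 c [g, h]" "c \<in> \<K>" "g \<in> \<G>" "h \<in> \<G>"
    by (rule mono0_spans_cases[OF b])
  obtain c' ys where 2: "x = mono (Suc n) c' ys" "c' \<in> \<K>" "ys \<in> Gn (Suc n)"
    by (rule mono_spans_cases[OF x])
  have "bsumG (Suc (Suc n)) (actg (Suc n) g h ys) = frag_extend (\<lambda>ys. frag_of (actg n g h ys)) (bsumG (Suc (Suc n)) ys)"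
    unfolding fold_sum_def using mergeG_actg[OF 2(3) _ 1(3,4)]
    by (subst frag_extend_sum) (auto simp: frag_extend_cmul intro!: sum.cong)
  then show "dB n (b \<odot>\<^bsub>Bar (Suc n)\<^esub> x) = b \<odot>\<^bsub>Bar n\<^esub> dB n x"
    unfolding 1(1) 2(1) act_mono[OF 1(2) 2(2) 1(3,4) 2(3)] dB_mono[OF 2(2,3)]
      dB_mono[OF k.m_closed[OF 1(2) 2(2)] actg_Gs[OF 1(3,4) 2(3)]]
    using act_monoZ[OF 1(2) 2(2) 1(3,4), of "bsumG (Suc (Suc n)) ys" n] keys_bsumG[OF 2(3)] by simp
qed

section \<open>Comparison of the standard and the bar resolution\<close>

fun tails :: "'g \<Rightarrow> 'g list \<Rightarrow> 'g list" where
  "tails x [] = [inv x]"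
| "tails x (y # ys) = (inv x \<otimes> y) # tails y ys"

text \<open>Sends (x0, ..., xn) to (x0, inv x0 x1, ..., inv x(n-1) xn, inv xn), the passage from
  homogeneous to bar coordinates. The final inverse normalises the total product to 1.\<close>

fun tup :: "'g list \<Rightarrow> 'g list" where
  "tup [] = []"
| "tup (x # xs) = x # tails x xs"

fun pref :: "'g \<Rightarrow> 'g list \<Rightarrow> 'g list" where
  "pref p [] = []"
| "pref p (y # ys) = (p \<otimes> y) # pref (p \<otimes> y) ys"

text \<open>The total product is the coordinate of a bar tuple complementary to
  \<open>untup\<close>; it is 1 on the image of \<open>tup\<close>.\<close>

fun lprod :: "'g list \<Rightarrow> 'g" where
  "lprod [] = \<one>"
| "lprod (y # ys) = y \<otimes> lprod ys"

lemma tails_length [simp]: "length (tails x xs) = Suc (length xs)"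
  by (induction xs arbitrary: x) auto

lemma tails_closed: "x \<in> \<G> ==> set xs \<subseteq> \<G> ==> set (tails x xs) \<subseteq> \<G>"
  by (induction xs arbitrary: x) auto

lemma tup_Gs: "xs \<in> Gs (Suc n) ==> tup xs \<in> Gn n"
  using tails_closed by (cases xs) (auto simp: Gs_def)

lemma lprod_closed [simp]: "set ys \<subseteq> \<G> ==> lprod ys \<in> \<G>"
  by (induction ys) auto

lemma lprod_append: "set xs \<subseteq> \<G> ==> set ys \<subseteq> \<G> ==> lprod (xs @ ys) = lprod xs \<otimes> lprod ys"
  by (induction xs) (auto simp: G.m_assoc)

lemma pref_length [simp]: "length (pref p ys) = length ys"
  by (induction ys arbitrary: p) auto

lemma pref_closed: "p \<in> \<G> ==> set ys \<subseteq> \<G> ==> set (pref p ys) \<subseteq> \<G>"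
  by (induction ys arbitrary: p) auto

lemma tails_map:
  "g \<in> \<G> ==> x \<in> \<G> ==> set xs \<subseteq> \<G> ==>
    tails (g \<otimes> x) (gmap g xs) = (tails x xs)[length xs := tails x xs ! length xs \<otimes> inv g]"
proof (induction xs arbitrary: x)
  case (Cons y ys)
  have "inv (g \<otimes> x) \<otimes> (g \<otimes> y) = inv x \<otimes> y"
    using Cons.prems by (simp add: G.inv_mult_group G.m_assoc) (simp add: G.m_assoc[symmetric])
  then show ?case using Cons by simp
qed (simp add: G.inv_mult_group)

text \<open>A diagonal translation leaves the quotients of neighbours unchanged, so only the two
  ends feel it: the first entry is multiplied by \<open>g\<close> and the last by its
  inverse.\<close>

lemma tup_map:
  assumes "g \<in> \<G>" "xs \<in> Gs (Suc n)"
  shows "tup (gmap g xs) = actg n g (inv g) (tup xs)"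
proof -
  obtain x ys where "xs = x # ys" "x \<in> \<G>" "set ys \<subseteq> \<G>" "length ys = n"
    using assms(2) by (cases xs) (auto simp: Gs_def)
  then show ?thesis using assms(1) tails_map[of g x ys] by (simp add: actg_def)
qed

lemma mergeG_Cons: "mergeG (Suc i) (y # ys) = y # mergeG i ys"
  by (simp add: fold_at_def)

lemma mergeG_tails:
  "j < length xs ==> x \<in> \<G> ==> set xs \<subseteq> \<G> ==> mergeG j (tails x xs) = tails x (take j xs @ drop (Suc j) xs)"
proof (induction xs arbitrary: x j)
  case (Cons y ys)
  have c: "inv x \<otimes> y \<otimes> (inv y \<otimes> z) = inv x \<otimes> z" if "z \<in> \<G>" for z
    using Cons.prems that by (simp add: G.m_assoc) (simp add: G.m_assoc[symmetric])
  show ?case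
  proof (cases j)
    case 0
    show ?thesis
    proof (cases ys)
      case Nil
      then show ?thesis using 0 Cons.prems by (simp add: fold_at_def G.m_assoc)
    next
      case (Cons z zs)
      then show ?thesis using 0 Cons.prems c[of z] by (simp add: fold_at_def)
    qed
  next
    case (Suc i)
    then show ?thesis using Cons by (simp add: mergeG_Cons)
  qed
qed simp

text \<open>Products of neighbouring quotients telescope, so multiplying two bar entries amounts to
  deleting the homogeneous entry between them.\<close>

lemma mergeG_tup:
  assumes "xs \<in> Gn n" "i < length xs"
  shows "mergeG i (tup xs) = tup (take i xs @ drop (Suc i) xs)"
proof -
  obtain x y zs where xs: "xs = x # y # zs" "x \<in> \<G>" "y \<in> \<G>" "set zs \<subseteq> \<G>"
    using assms(1) by (auto simp: Gs_def length_Suc_conv)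
  show ?thesis
  proof (cases i)
    case 0
    then show ?thesis using xs by (simp add: fold_at_def G.m_assoc[symmetric])
  next
    case (Suc j)
    then show ?thesis using xs assms(2) mergeG_tails[of j "y # zs" x] by (simp add: mergeG_Cons)
  qed
qed

lemma tails_pref:
  "p \<in> \<G> ==> set zs \<subseteq> \<G> ==> tails p (pref p zs) = zs @ [inv (p \<otimes> lprod zs)]"
proof (induction zs arbitrary: p)
  case (Cons z zs)
  have "inv p \<otimes> (p \<otimes> z) = z" using Cons.prems by (simp add: G.m_assoc[symmetric])
  then show ?case using Cons by (simp add: G.m_assoc)
qed simp

lemma pref_tails:
  "p \<in> \<G> ==> set xs \<subseteq> \<G> ==> pref p (butlast (tails p xs)) = xs"
proof (induction xs arbitrary: p)
  case (Cons x xs)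
  have "p \<otimes> (inv p \<otimes> x) = x" using Cons.prems by (simp add: G.m_assoc[symmetric])
  moreover have "tails x xs \<noteq> []" using tails_length[of x xs] by (metis length_0_conv nat.distinct(1))
  ultimately show ?case using Cons by simp
qed simp

lemma lprod_tails: "p \<in> \<G> ==> set xs \<subseteq> \<G> ==> lprod (tails p xs) = inv p"
proof (induction xs arbitrary: p)
  case (Cons x xs)
  then show ?case by (simp add: G.m_assoc)
qed simp

lemma pref_map:
  "g \<in> \<G> ==> p \<in> \<G> ==> set zs \<subseteq> \<G> ==> pref (g \<otimes> p) zs = gmap g (pref p zs)"
  by (induction zs arbitrary: p) (auto simp: G.m_assoc)

text \<open>The inverse of the bijection \<open>(xs, v) \<mapsto> tup xs v\<close> between \<open>G\<^sup>n\<^sup>+\<^sup>1 \<times> G\<close> and \<open>G\<^sup>n\<^sup>+\<^sup>2\<close>.\<close>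

definition untup :: "'g list \<Rightarrow> 'g list" where "untup ys = pref \<one> (butlast ys)"

lemma Gs_ends:
  assumes "ys \<in> Gn n"
  obtains y zs w where "ys = y # zs @ [w]" "y \<in> \<G>" "set zs \<subseteq> \<G>" "w \<in> \<G>" "length zs = n"
proof -
  obtain y ys' where 1: "ys = y # ys'" "ys' \<in> Gs (Suc n)" "y \<in> \<G>" using assms by (cases ys) (auto simp: Gs_def)
  then obtain zs w where "ys' = zs @ [w]" by (cases ys' rule: rev_cases) (auto simp: Gs_def)
  then show ?thesis using 1 by (intro that[of y zs w]) (auto simp: Gs_def)
qed

lemma actg_ends: "length zs = n ==> actg n g h (y # zs @ [w]) = (g \<otimes> y) # zs @ [w \<otimes> h]"
  by (simp add: actg_def nth_append list_update_append)

lemma untup_Gs: "ys \<in> Gn n ==> untup ys \<in> Gs (Suc n)"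
  using pref_closed[OF G.one_closed, of "butlast ys"] by (auto simp: untup_def Gs_def dest!: in_set_butlastD)

lemma lprod_Gs: "ys \<in> Gs N ==> lprod ys \<in> \<G>"
  by (simp add: Gs_def)

lemma untup_tup: "xs \<in> Gs (Suc n) ==> untup (tup xs) = xs"
proof -
  assume "xs \<in> Gs (Suc n)"
  then obtain x ys where xs: "xs = x # ys" "x \<in> \<G>" "set ys \<subseteq> \<G>" by (cases xs) (auto simp: Gs_def)
  have "tails x ys \<noteq> []" using tails_length[of x ys] by (metis length_0_conv nat.distinct(1))
  then show ?thesis using xs pref_tails[of x ys] by (simp add: untup_def)
qed

lemma lprod_tup: "xs \<in> Gs (Suc n) ==> lprod (tup xs) = \<one>"
  using lprod_tails by (cases xs) (auto simp: Gs_def)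

text \<open>Rebuilding a tuple from its prefix products alters only the last entry, and multiplying
  that entry by the total product restores it.\<close>

lemma actg_tup_untup:
  assumes "ys \<in> Gn n" shows "actg n \<one> (lprod ys) (tup (untup ys)) = ys"
proof -
  obtain y zs w where ys: "ys = y # zs @ [w]" "y \<in> \<G>" "set zs \<subseteq> \<G>" "w \<in> \<G>" "length zs = n"
    by (rule Gs_ends[OF assms])
  have "tup (untup ys) = y # zs @ [inv (y \<otimes> lprod zs)]"
    using ys tails_pref[of y zs] by (simp add: untup_def butlast_append)
  moreover have "inv (y \<otimes> lprod zs) \<otimes> lprod ys = w"
  proof -
    have a: "y \<otimes> lprod zs \<in> \<G>" using ys by simp
    have "lprod ys = y \<otimes> lprod zs \<otimes> w" using ys by (simp add: lprod_append G.m_assoc)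
    then show ?thesis
      using G.m_assoc[OF G.inv_closed[OF a] a ys(4)] a ys(4) by (simp only: G.l_inv G.l_one)
  qed
  ultimately show ?thesis using ys by (simp add: actg_ends)
qed

lemma untup_actg:
  assumes "ys \<in> Gn n" "g \<in> \<G>" "h \<in> \<G>"
  shows "untup (actg n g h ys) = gmap g (untup ys)"
    and "lprod (actg n g h ys) = g \<otimes> lprod ys \<otimes> h"
proof -
  obtain y zs w where ys: "ys = y # zs @ [w]" "y \<in> \<G>" "set zs \<subseteq> \<G>" "w \<in> \<G>" "length zs = n"
    by (rule Gs_ends[OF assms(1)])
  show "untup (actg n g h ys) = gmap g (untup ys)"
    using ys assms pref_map[of g y zs] by (simp add: actg_ends untup_def butlast_append)
  show "lprod (actg n g h ys) = g \<otimes> lprod ys \<otimes> h"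
    using ys assms by (simp add: actg_ends lprod_append G.m_assoc)
qed

text \<open>The inclusion of the standard resolution into the bar resolution, equivariant when
  \<open>g\<close> acts on the latter by \<open>cj g\<close>. The bar modules are induced along
  it.\<close>

definition J :: "nat \<Rightarrow> ('g list \<Rightarrow>\<^sub>0 int) \<Rightarrow> ('g, 'k) tensors" where
  "J n u = monoZ n \<one>\<^sub>k (frag_extend (\<lambda>xs. frag_of (tup xs)) u)"

lemma J_hom: "J n \<in> add_hom (Sg (Suc n)) (Bar n)"
  unfolding J_def[abs_def]
  by (rule add_hom_comp[OF frag_extend_add_hom monoZ_hom[OF k.one_closed]]) (simp add: tup_Gs)

lemma J_frag_of: "J n (frag_of xs) = mono n \<one>\<^sub>k (tup xs)"
  by (simp add: J_def monoZ_frag_of)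

lemma J_closed: "u \<in> ch (Suc n) ==> J n u \<in> \<B> n"
  by (rule add_hom_closed[OF J_hom])

abbreviation "cj g \<equiv> mono 0 \<one>\<^sub>k [g, inv g]"

lemma cj_closed: "g \<in> \<G> ==> cj g \<in> \<B> 0"
  by (intro mono_closed Gs_2) auto

lemma J_gact:
  assumes "g \<in> \<G>" "u \<in> ch (Suc n)"
  shows "J n (gact g u) = cj g \<odot>\<^bsub>Bar n\<^esub> J n u"
proof (rule add_hom_eqI[OF frag_group_spans frag_abelian Bar_abelian add_hom_comp[OF gact_hom[OF assms(1)] J_hom]
      add_hom_comp[OF J_hom act_hom2[OF cj_closed[OF assms(1)]]] _ assms(2)])
  fix b assume "b \<in> frag_of ` Gs (Suc n)"
  then obtain xs where "b = frag_of xs" "xs \<in> Gs (Suc n)" by (elim imageE)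
  then show "J n (gact g b) = cj g \<odot>\<^bsub>Bar n\<^esub> J n b"
    using assms(1) by (simp add: gact_frag_of J_frag_of tup_map act_mono tup_Gs)
qed

lemma dB_J:
  assumes "u \<in> ch (Suc (Suc n))" shows "dB n (J (Suc n) u) = J n (bd u)"
proof (rule add_hom_eqI[OF frag_group_spans frag_abelian Bar_abelian add_hom_comp[OF J_hom dB_hom]
      add_hom_comp[OF bd_hom J_hom] _ assms])
  fix b assume "b \<in> frag_of ` Gn n"
  then obtain xs where b: "b = frag_of xs" "xs \<in> Gn n" by (elim imageE)
  have len: "length xs = Suc (Suc n)" by (rule Gs_length[OF b(2)])
  have "bsumG (Suc (Suc n)) (tup xs) = frag_extend (\<lambda>xs. frag_of (tup xs)) (bd (frag_of xs))"
    unfolding fold_sum_def bd_frag_of len using mergeG_tup[OF b(2)] len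
    by (subst frag_extend_sum) (auto simp: frag_extend_cmul intro!: sum.cong)
  then show "dB n (J (Suc n) b) = J n (bd b)"
    unfolding b(1) J_frag_of dB_mono[OF k.one_closed tup_Gs[OF b(2)]] by (simp add: J_def)
qed

text \<open>Every monomial is an explicit multiple of a chain in the image of \<open>J\<close>. This
  gives uniqueness of linear extensions from \<open>J\<close> and dictates the formula for their
  existence.\<close>

lemma mono_J:
  assumes "c \<in> \<K>" "ys \<in> Gn n"
  shows "mono n c ys = mono 0 c [\<one>, lprod ys] \<odot>\<^bsub>Bar n\<^esub> J n (frag_of (untup ys))"
  using assms act_mono[OF assms(1) k.one_closed G.one_closed lprod_Gs[OF assms(2)] tup_Gs[OF untup_Gs[OF assms(2)]]]
    actg_tup_untup[OF assms(2)] by (simp add: J_frag_of)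

lemma linear_eq_on_J:
  assumes "left_module E N" "f \<in> lmod_hom E (Bar n) N" "f' \<in> lmod_hom E (Bar n) N"
    and eq: "\<And>u. u \<in> ch (Suc n) ==> f (J n u) = f' (J n u)"
  shows "f = f'"
proof (rule lmod_hom_eqI[OF assms(2,3)])
  fix x assume x: "x \<in> \<B> n"
  show "f x = f' x"
  proof (rule add_hom_eqI[OF Bar_spans Bar_abelian lmod_abelian[OF assms(1)]
        lmod_hom_add_hom[OF assms(2)] lmod_hom_add_hom[OF assms(3)] _ x])
    fix b assume "b \<in> monos n"
    then obtain c ys where b: "b = mono n c ys" "c \<in> \<K>" "ys \<in> Gn n" by (rule mono_spans_cases)
    have u: "frag_of (untup ys) \<in> ch (Suc n)" using untup_Gs[OF b(3)] by simp
    have r: "mono 0 c [\<one>, lprod ys] \<in> carrier E" using mono_closed[OF b(2) Gs_2[OF G.one_closed lprod_Gs[OF b(3)]]] by simp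
    show "f b = f' b"
      unfolding b(1) mono_J[OF b(2,3)] lmod_hom_smult[OF assms(2) r J_closed[OF u]] lmod_hom_smult[OF assms(3) r J_closed[OF u]] eq[OF u] ..
  qed
qed

text \<open>The universal property of an induced module. The values on monomials are forced by
  \<open>mono_J\<close>; linearity holds because equivariance absorbs the factor \<open>cj g\<close>
  that appears when \<open>g \<otimes> h\<close> is split as
  \<open>(1 \<otimes> g h) (g \<otimes> inv g)\<close>.\<close>

lemma linear_from_J:
  assumes N: "left_module E N" and F: "F \<in> add_hom (Sg (Suc n)) N"
    and F_gact: "\<And>g u. g \<in> \<G> ==> u \<in> ch (Suc n) ==> F (gact g u) = cj g \<odot>\<^bsub>N\<^esub> F u"
  obtains f where "f \<in> lmod_hom E (Bar n) N" "\<And>u. u \<in> ch (Suc n) ==> f (J n u) = F u"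
proof -
  note abN = lmod_abelian[OF N]
  let ?u = "\<lambda>ys. frag_of (untup ys)"
  have Fu: "F (?u ys) \<in> carrier N" if "ys \<in> Gn n" for ys
    using add_hom_closed[OF F] untup_Gs[OF that] by simp
  have r: "mono 0 c [g, h] \<in> carrier E" if "c \<in> \<K>" "g \<in> \<G>" "h \<in> \<G>" for c g h
    using mono_closed[OF that(1) Gs_2[OF that(2,3)]] by simp
  have b_hom: "(\<lambda>c. mono 0 c [\<one>, lprod ys] \<odot>\<^bsub>N\<^esub> F (?u ys)) \<in> add_hom k N" if "ys \<in> Gn n" for ys
    using add_hom_comp[OF mono_add_hom[OF Gs_2[OF G.one_closed lprod_Gs[OF that]]]] left_module_scalar_add_hom[OF N Fu[OF that]]
    by (simp add: E_add_hom)
  obtain f where f: "f \<in> add_hom (Bar n) N"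
    "\<And>c ys. c \<in> \<K> ==> ys \<in> Gn n ==> f (mono n c ys) = mono 0 c [\<one>, lprod ys] \<odot>\<^bsub>N\<^esub> F (?u ys)"
    by (rule Bar_lift[OF abN, of n "\<lambda>ys c. mono 0 c [\<one>, lprod ys] \<odot>\<^bsub>N\<^esub> F (?u ys)"]) (rule b_hom, assumption, rule that)
  have lin: "f (s \<odot>\<^bsub>Bar n\<^esub> x) = s \<odot>\<^bsub>N\<^esub> f x" if "s \<in> carrier E" "x \<in> \<B> n" for s x
  proof (rule linear_on_spans[OF Bar_left_module N f(1) E_spans Bar_spans _ that])
    fix b x assume b: "b \<in> monos 0"
      and x: "x \<in> monos n"
    obtain c g h where 1: "b = mono 0 c [g, h]" "c \<in> \<K>" "g \<in> \<G>" "h \<in> \<G>"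
      by (rule mono0_spans_cases[OF b])
    obtain c' ys where 2: "x = mono n c' ys" "c' \<in> \<K>" "ys \<in> Gn n"
      by (rule mono_spans_cases[OF x])
    let ?v = "lprod ys"
    have v: "?v \<in> \<G>" by (rule lprod_Gs[OF 2(3)])
    have uS: "?u ys \<in> ch (Suc n)" using untup_Gs[OF 2(3)] by simp
    have m: "mono 0 a [g1, h1] \<otimes>\<^bsub>E\<^esub> mono 0 a' [g2, h2] = mono 0 (a \<otimes>\<^sub>k a') [g1 \<otimes> g2, h2 \<otimes> h1]"
      if "a \<in> \<K>" "a' \<in> \<K>" "g1 \<in> \<G>" "g2 \<in> \<G>" "h1 \<in> \<G>" "h2 \<in> \<G>" for a a' g1 g2 h1 h2
      using E_mult[of "mono 0 a [g1, h1]" "mono 0 a' [g2, h2]"] r[OF that(1,3,5)] r[OF that(2,4,6)] act_mono[OF that(1,2,3,5) Gs_2[OF that(4,6)]]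
      by (simp add: actg_def)
    have "f (b \<odot>\<^bsub>Bar n\<^esub> x) = mono 0 (c \<otimes>\<^sub>k c') [\<one>, g \<otimes> ?v \<otimes> h] \<odot>\<^bsub>N\<^esub> F (gact g (?u ys))"
      unfolding 1(1) 2(1) act_mono[OF 1(2) 2(2) 1(3,4) 2(3)] f(2)[OF k.m_closed[OF 1(2) 2(2)] actg_Gs[OF 1(3,4) 2(3)]]
      by (simp add: untup_actg[OF 2(3) 1(3,4)] gact_frag_of)
    also have "\<dots> = (mono 0 (c \<otimes>\<^sub>k c') [\<one>, g \<otimes> ?v \<otimes> h] \<otimes>\<^bsub>E\<^esub> cj g) \<odot>\<^bsub>N\<^esub> F (?u ys)"
      unfolding F_gact[OF 1(3) uS]
      by (rule left_module.smult_assoc[OF N _ _ Fu[OF 2(3)], symmetric]) (intro r; use 1 2 v in simp)+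
    also have "mono 0 (c \<otimes>\<^sub>k c') [\<one>, g \<otimes> ?v \<otimes> h] \<otimes>\<^bsub>E\<^esub> cj g = mono 0 (c \<otimes>\<^sub>k c') [g, ?v \<otimes> h]"
      using 1 2 v by (simp add: m G.m_assoc[symmetric])
    also have "\<dots> = mono 0 c [g, h] \<otimes>\<^bsub>E\<^esub> mono 0 c' [\<one>, ?v]"
      using 1 2 v by (simp add: m)
    also have "\<dots> \<odot>\<^bsub>N\<^esub> F (?u ys) = b \<odot>\<^bsub>N\<^esub> f x"
      unfolding 1(1) 2(1) f(2)[OF 2(2,3)] by (rule left_module.smult_assoc[OF N _ _ Fu[OF 2(3)]]) (intro r; use 1 2 v in simp)+
    finally show "f (b \<odot>\<^bsub>Bar n\<^esub> x) = b \<odot>\<^bsub>N\<^esub> f x" .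
  qed
  have fJ: "f (J n u) = F u" if "u \<in> ch (Suc n)" for u
  proof (rule add_hom_eqI[OF frag_group_spans frag_abelian abN add_hom_comp[OF J_hom f(1)] F _ that])
    fix b assume "b \<in> frag_of ` Gs (Suc n)"
    then obtain xs where b: "b = frag_of xs" "xs \<in> Gs (Suc n)" by (elim imageE)
    have "F b \<in> carrier N" using add_hom_closed[OF F, of b] b by simp
    then show "f (J n b) = F b"
      using b f(2)[OF k.one_closed tup_Gs[OF b(2)]] left_module.smult_one[OF N]
      by (simp add: J_frag_of untup_tup lprod_tup E_one)
  qed
  show ?thesis
    by (rule that[OF lmod_homI[OF Bar_left_module f(1) lin]]) (assumption+, use fJ J_closed in simp)
qed

lemma dB_lmod_hom: "restrict (dB n) (\<B> (Suc n)) \<in> lmod_hom E (Bar (Suc n)) (Bar n)"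
  by (rule lmod_homI[OF Bar_left_module dB_hom]) (rule dB_linear)

text \<open>By linearity it suffices to look at the image of \<open>J\<close>, where the claim is
  \<open>bd (bd u) = 0\<close>.\<close>

lemma dB_dB:
  assumes "x \<in> \<B> (Suc (Suc n))" shows "dB n (dB (Suc n) x) = \<zero>\<^bsub>Bar n\<^esub>"
proof -
  let ?f = "restrict (\<lambda>x. dB n (dB (Suc n) x)) (\<B> (Suc (Suc n)))"
  let ?z = "restrict (\<lambda>x. \<zero>\<^bsub>Bar n\<^esub>) (\<B> (Suc (Suc n)))"
  have cl: "dB n y \<in> \<B> n" if "y \<in> \<B> (Suc n)" for n y by (rule add_hom_closed[OF dB_hom that])
  have f: "?f \<in> lmod_hom E (Bar (Suc (Suc n))) (Bar n)"
  proof (rule lmod_homI[OF Bar_left_module add_hom_comp[OF dB_hom dB_hom]])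
    fix r x assume r: "r \<in> carrier E" and x: "x \<in> \<B> (Suc (Suc n))"
    show "dB n (dB (Suc n) (r \<odot>\<^bsub>Bar (Suc (Suc n))\<^esub> x)) = r \<odot>\<^bsub>Bar n\<^esub> dB n (dB (Suc n) x)"
      unfolding dB_linear[OF r x] by (rule dB_linear[OF r cl[OF x]])
  qed
  have z: "?z \<in> lmod_hom E (Bar (Suc (Suc n))) (Bar n)"
    by (rule lmod_homI[OF Bar_left_module add_hom_const_zero[OF Bar_abelian]])
      (use add_hom_zero[OF Bar_abelian Bar_abelian act_hom2] in simp)
  have "?f = ?z"
  proof (rule linear_eq_on_J[OF Bar_left_module f z])
    fix u assume u: "u \<in> ch (Suc (Suc (Suc n)))"
    have "dB n (dB (Suc n) (J (Suc (Suc n)) u)) = J n (bd (bd u))"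
      unfolding dB_J[OF u] by (rule dB_J[OF bd_cl[OF u]])
    also have "\<dots> = \<zero>\<^bsub>Bar n\<^esub>" using add_hom_zero[OF frag_abelian Bar_abelian J_hom] by (simp add: bd_bd)
    finally show "?f (J (Suc (Suc n)) u) = ?z (J (Suc (Suc n)) u)" using J_closed[OF u] by simp
  qed
  from fun_cong[OF this, of x] assms show ?thesis by simp
qed

end

context galg
begin

section \<open>Bar cochains with values in the outer bimodule\<close>

lemma kappa_balanced: "balanced (Suc (Suc 0)) A (\<lambda>as. (as ! 0) \<one> \<odot>\<^sub>A as ! Suc 0)"
proof (rule balanced_2I)
  fix a b c assume "a \<in> \<A>" "b \<in> \<A>" "c \<in> \<K>"
  then show "(c \<odot>\<^sub>A a) \<one> \<odot>\<^sub>A b = a \<one> \<odot>\<^sub>A (c \<odot>\<^sub>A b)" by (auto simp: cl k.m_ac)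
next
  show "(\<lambda>b. a \<one> \<odot>\<^sub>A b) \<in> add_hom A A" if "a \<in> \<A>" for a
    by (rule A_smult_add_hom) (use that in \<open>simp add: cl\<close>)
  show "(\<lambda>a. a \<one> \<odot>\<^sub>A b) \<in> add_hom A A" if "b \<in> \<A>" for b
    using that by (intro add_homI A_smult_closed) (auto simp: cl k.l_distr)
qed

text \<open>The coefficient \<open>\<kappa>\<close> of \<open>1 \<otimes> _\<close>. Together with the conjugates of its argument it determines
  an element of \<open>A \<otimes> A\<close>, so that \<open>A \<otimes> A\<close> is induced from the trivial subgroup for conjugation.\<close>

definition \<kappa> :: "('g, 'k) tensors \<Rightarrow> 'g \<Rightarrow> 'k" where
  "\<kappa> = (SOME K. K \<in> add_hom (Bar 0) A \<and> (\<forall>as\<in>tn 0. K (cls 0 (frag_of as)) = (as ! 0) \<one> \<odot>\<^sub>A as ! Suc 0))"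

lemma \<kappa>: "\<kappa> \<in> add_hom (Bar 0) A"
  "as \<in> tn 0 ==> \<kappa> (cls 0 (frag_of as)) = (as ! 0) \<one> \<odot>\<^sub>A as ! Suc 0"
proof -
  obtain K where "K \<in> add_hom (Bar 0) A" "\<And>as. as \<in> tn 0 ==> K (cls 0 (frag_of as)) = (as ! 0) \<one> \<odot>\<^sub>A as ! Suc 0"
    by (rule Bar_universal[OF A_abelian kappa_balanced]) (rule that)
  then have "\<exists>K. K \<in> add_hom (Bar 0) A \<and> (\<forall>as\<in>tn 0. K (cls 0 (frag_of as)) = (as ! 0) \<one> \<odot>\<^sub>A as ! Suc 0)"
    by (intro exI[of _ K]) (auto simp del: galg_simps)
  from someI_ex[OF this] show "\<kappa> \<in> add_hom (Bar 0) A"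
    "as \<in> tn 0 ==> \<kappa> (cls 0 (frag_of as)) = (as ! 0) \<one> \<odot>\<^sub>A as ! Suc 0"
    unfolding \<kappa>_def by blast+
qed

lemma \<kappa>_mono:
  assumes "c \<in> \<K>" "x \<in> \<G>" "y \<in> \<G>"
  shows "\<kappa> (mono 0 c [x, y]) = (if x = \<one> then sing k y c else \<zero>\<^sub>A)"
  using \<kappa>(2)[OF bt_tp[OF assms(1) Gs_2[OF assms(2,3)]]] assms smult_gb[OF assms(1), of y] gb_closed[OF assms(3)]
  by (auto simp: mono_def sing_def cl)

lemma cj_cj:
  assumes "g \<in> \<G>" "h \<in> \<G>" "W \<in> \<B> n"
  shows "cj g \<odot>\<^bsub>Bar n\<^esub> (cj h \<odot>\<^bsub>Bar n\<^esub> W) = cj (g \<otimes> h) \<odot>\<^bsub>Bar n\<^esub> W"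
proof -
  have "cj g \<odot>\<^bsub>Bar 0\<^esub> cj h = cj (g \<otimes> h)"
    using act_mono[of "\<one>\<^sub>k" "\<one>\<^sub>k" g "inv g" "[h, inv h]" 0] assms
    by (simp add: Gs_2) (simp add: actg_def G.inv_mult_group)
  then show ?thesis using act_assoc[OF cj_closed[OF assms(1)] cj_closed[OF assms(2)] assms(3)] by simp
qed

lemma cj_mono:
  assumes "c \<in> \<K>" "g \<in> \<G>" "x \<in> \<G>" "y \<in> \<G>"
  shows "cj g \<odot>\<^bsub>Bar 0\<^esub> mono 0 c [x, y] = mono 0 c [g \<otimes> x, y \<otimes> inv g]"
  using act_mono[of "\<one>\<^sub>k" c g "inv g" "[x, y]" 0] assms by (simp add: Gs_2) (simp add: actg_def)

abbreviation "FG \<equiv> free_module A (\<G>)"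

lemmas FG_abelian = free_module_abelian_group[OF A_abelian, of "\<G>"]

lemma FG_spans: "spans FG {sing A x a | x a. x \<in> \<G> \<and> a \<in> \<A>}"
  by (rule free_module_spans[OF A_abelian])

lemma mult_eq_one_iff: "x \<in> \<G> ==> y \<in> \<G> ==> inv x \<otimes> y = \<one> \<longleftrightarrow> y = x"
  by (metis G.inv_closed G.inv_equality G.inv_inv G.l_inv)

text \<open>\<open>A \<otimes> A\<close> is identified with finitely supported functions from
  \<open>G\<close> to \<open>A\<close>: the monomial x \<otimes> y goes to yx at the point x, and
  conversely \<open>a\<close> at the point x comes from \<open>cj x\<close> applied to 1 \<otimes>
  a.\<close>

lemma expand_coinduced:
  obtains D Hm where "D \<in> add_hom (Bar 0) FG" "Hm \<in> add_hom FG (Bar 0)"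
    "\<And>W x. W \<in> \<B> 0 ==> x \<in> \<G> ==> D W x = \<kappa> (cj (inv x) \<odot>\<^bsub>Bar 0\<^esub> W)"
    "\<And>W. W \<in> \<B> 0 ==> Hm (D W) = W"
    "\<And>v. v \<in> carrier FG ==> D (Hm v) = v"
proof -
  have sA: "(\<lambda>c. sing A x (sing k z c)) \<in> add_hom k FG" if "x \<in> \<G>" "z \<in> \<G>" for x z
    by (rule add_hom_comp[OF sing_add_hom[OF k_ab that(2), folded A_add_hom(2)] sing_add_hom[OF A_abelian that(1)]])
  have sG: "(\<lambda>c. sing A (ys ! 0) (sing k (ys ! Suc 0 \<otimes> ys ! 0) c)) \<in> add_hom k FG" if "ys \<in> Gn 0" for ys
    by (rule sA) (use Gs_nth[OF that] in auto)
  obtain D where D: "D \<in> add_hom (Bar 0) FG"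
    and D': "\<And>c ys. c \<in> \<K> ==> ys \<in> Gn 0 ==> D (mono 0 c ys) = sing A (ys ! 0) (sing k (ys ! Suc 0 \<otimes> ys ! 0) c)"
    by (rule Bar_lift[OF FG_abelian, of 0 "\<lambda>ys c. sing A (ys ! 0) (sing k (ys ! Suc 0 \<otimes> ys ! 0) c)"])
      (rule sG, assumption, rule that)
  have Dm: "D (mono 0 c [x, y]) = sing A x (sing k (y \<otimes> x) c)" if "c \<in> \<K>" "x \<in> \<G>" "y \<in> \<G>" for c x y
    using D'[OF that(1) Gs_2[OF that(2,3)]] by simp
  have mh: "(\<lambda>c. mono 0 c [\<one>, z]) \<in> add_hom k (Bar 0)" if "z \<in> \<G>" for z
    by (rule mono_add_hom[OF Gs_2]) (use that in auto)
  obtain la where "la \<in> add_hom (free_module k (\<G>)) (Bar 0)"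
    and la': "\<And>z c. z \<in> \<G> ==> c \<in> \<K> ==> la (sing k z c) = mono 0 c [\<one>, z]"
    by (rule free_module_universal[OF k_ab Bar_abelian, of "\<G>" "\<lambda>z c. mono 0 c [\<one>, z]" 0]) (rule mh, assumption, rule that)
  then have la: "la \<in> add_hom A (Bar 0)" by (simp add: A_add_hom)
  have Hx: "(\<lambda>a. cj x \<odot>\<^bsub>Bar 0\<^esub> la a) \<in> add_hom A (Bar 0)" if "x \<in> \<G>" for x
    by (rule add_hom_comp[OF la act_hom2[OF cj_closed[OF that]]])
  obtain Hm where Hm: "Hm \<in> add_hom FG (Bar 0)"
    and Hm': "\<And>x a. x \<in> \<G> ==> a \<in> \<A> ==> Hm (sing A x a) = cj x \<odot>\<^bsub>Bar 0\<^esub> la a"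
    by (rule free_module_universal[OF A_abelian Bar_abelian Hx]) (assumption, rule that)
  have Hs: "Hm (sing A x (sing k z c)) = mono 0 c [x, z \<otimes> inv x]" if "x \<in> \<G>" "z \<in> \<G>" "c \<in> \<K>" for x z c
    using that sing_A[OF that(2,3)] by (simp add: Hm' la' cj_mono del: galg_simps)
  have HD: "Hm (D W) = W" if "W \<in> \<B> 0" for W
  proof (rule add_hom_eqI[OF Bar_spans Bar_abelian Bar_abelian add_hom_comp[OF D Hm] add_hom_id _ that])
    fix b assume "b \<in> monos 0"
    then obtain c x y where "b = mono 0 c [x, y]" "c \<in> \<K>" "x \<in> \<G>" "y \<in> \<G>" by (rule mono0_spans_cases)
    then show "Hm (D b) = b" by (simp add: Dm Hs G.m_assoc)
  qed
  have DH: "D (Hm v) = v" if "v \<in> carrier FG" for v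
  proof (rule add_hom_eqI[OF FG_spans FG_abelian FG_abelian add_hom_comp[OF Hm D] add_hom_id _ that])
    fix b assume "b \<in> {sing A x a | x a. x \<in> \<G> \<and> a \<in> \<A>}"
    then obtain x a where b: "b = sing A x a" "x \<in> \<G>" "a \<in> \<A>" by blast
    have s: "sing A x \<in> add_hom A FG" by (rule sing_add_hom[OF A_abelian b(2)])
    show "D (Hm b) = b"
      unfolding b(1)
    proof (rule add_hom_eqI[OF A_spans A_abelian FG_abelian add_hom_comp[OF add_hom_comp[OF s Hm] D] s _ b(3)])
      fix a assume "a \<in> {sing k g c | g c. g \<in> \<G> \<and> c \<in> \<K>}"
      then obtain g c where "a = sing k g c" "g \<in> \<G>" "c \<in> \<K>" by blast
      then show "D (Hm (sing A x a)) = sing A x a" using b(2) by (simp add: Hs Dm G.m_assoc)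
    qed
  qed
  have D\<kappa>: "D W x = \<kappa> (cj (inv x) \<odot>\<^bsub>Bar 0\<^esub> W)" if "W \<in> \<B> 0" "x \<in> \<G>" for W x
  proof (rule add_hom_eqI[OF Bar_spans Bar_abelian A_abelian add_hom_comp[OF D free_module_lookup_add_hom[OF A_abelian]]
        add_hom_comp[OF act_hom2[OF cj_closed] \<kappa>(1)] _ that(1)])
    fix b assume "b \<in> monos 0"
    then obtain c y z where b: "b = mono 0 c [y, z]" "c \<in> \<K>" "y \<in> \<G>" "z \<in> \<G>" by (rule mono0_spans_cases)
    show "D b x = \<kappa> (cj (inv x) \<odot>\<^bsub>Bar 0\<^esub> b)"
      unfolding b(1) cj_mono[OF b(2) G.inv_closed[OF that(2)] b(3,4)] Dm[OF b(2-4)]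
      using b that(2) by (subst \<kappa>_mono) (auto simp: mult_eq_one_iff sing_def)
  qed (use that in simp)
  show ?thesis by (rule that[OF D Hm D\<kappa> HD DH])
qed

definition evB :: "nat \<Rightarrow> (('g, 'k) tensors \<Rightarrow> ('g, 'k) tensors) \<Rightarrow> ('g list \<Rightarrow>\<^sub>0 int) \<Rightarrow> 'g \<Rightarrow> 'k" where
  "evB n f u = \<kappa> (f (J n u))"

lemma gact_closed: "g \<in> \<G> ==> u \<in> ch N ==> gact g u \<in> ch N"
  using add_hom_closed[OF gact_hom] .

lemma evB_gact:
  assumes "f \<in> lmod_hom E (Bar n) (Bar 0)" "g \<in> \<G>" "u \<in> ch (Suc n)"
  shows "evB n f (gact g u) = \<kappa> (cj g \<odot>\<^bsub>Bar 0\<^esub> f (J n u))"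
  using J_gact[OF assms(2,3)] lmod_hom_smult[OF assms(1), of "cj g"] cj_closed[OF assms(2)] J_closed[OF assms(3)]
  by (simp add: evB_def)

lemma evB_hom: "f \<in> lmod_hom E (Bar n) (Bar 0) ==> evB n f \<in> add_hom (Sg (Suc n)) A"
  unfolding evB_def[abs_def] by (rule add_hom_comp[OF add_hom_comp[OF J_hom lmod_hom_add_hom] \<kappa>(1)])

section \<open>Hochschild cohomology\<close>

sublocale HB: hom_complex E Bar "bar_differential k A" "Bar 0"
  by (intro hom_complex.intro Bar_left_module dB_lmod_hom dB_dB)

text \<open>Two identifications are combined: linear maps on the bar resolution are equivariant maps
  on the standard resolution, and an element of \<open>A \<otimes> A\<close> is known once
  \<open>\<kappa>\<close> is known on all its conjugates, finitely many of which are
  nonzero.\<close>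

lemma evB_model: "cochain_model G E Bar (bar_differential k A) (Bar 0) A evB"
proof -
  obtain D Hm where D: "D \<in> add_hom (Bar 0) FG" "Hm \<in> add_hom FG (Bar 0)"
      "\<And>W x. W \<in> \<B> 0 ==> x \<in> \<G> ==> D W x = \<kappa> (cj (inv x) \<odot>\<^bsub>Bar 0\<^esub> W)"
      "\<And>W. W \<in> \<B> 0 ==> Hm (D W) = W" "\<And>v. v \<in> carrier FG ==> D (Hm v) = v"
    by (rule expand_coinduced) (rule that)
  have D_ext: "U = W" if UW: "U \<in> \<B> 0" "W \<in> \<B> 0"
    and eq: "\<And>x. x \<in> \<G> ==> \<kappa> (cj (inv x) \<odot>\<^bsub>Bar 0\<^esub> U) = \<kappa> (cj (inv x) \<odot>\<^bsub>Bar 0\<^esub> W)" for U W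
  proof -
    have "D U x = D W x" for x
      using D(3)[OF UW(1)] D(3)[OF UW(2)] eq[of x] add_hom_closed[OF D(1) UW(1)] add_hom_closed[OF D(1) UW(2)]
      by (cases "x \<in> \<G>") (simp_all add: fin_supp_def del: galg_simps)
    then have "D U = D W" by (rule ext)
    from arg_cong[OF this, of Hm] show ?thesis unfolding D(4)[OF UW(1)] D(4)[OF UW(2)] .
  qed
  show ?thesis
  proof (intro cochain_model.intro cochain_model_axioms.intro grp_axioms HB.hom_complex_axioms A_abelian)
    fix n f assume f: "f \<in> lmod_hom E (Bar n) (Bar 0)"
    show "evB n f \<in> C (Suc n) A"
      unfolding C_def
    proof (intro CollectI conjI ballI impI evB_hom[OF f])
      fix xs assume xs: "xs \<in> Gs (Suc n)"
      let ?W = "f (J n (frag_of xs))"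
      have W: "?W \<in> \<B> 0" by (rule lmod_hom_closed[OF f J_closed]) (use xs in simp)
      have "{g \<in> \<G>. evB n f (frag_of (gmap g xs)) \<noteq> \<zero>\<^sub>A} \<subseteq> m_inv G ` {x \<in> \<G>. D ?W x \<noteq> \<zero>\<^sub>A}"
      proof
        fix g assume g: "g \<in> {g \<in> \<G>. evB n f (frag_of (gmap g xs)) \<noteq> \<zero>\<^sub>A}"
        then have "D ?W (inv g) \<noteq> \<zero>\<^sub>A"
          using evB_gact[OF f, of g "frag_of xs"] D(3)[OF W, of "inv g"] xs by (simp add: gact_frag_of del: galg_simps)
        then show "g \<in> m_inv G ` {x \<in> \<G>. D ?W x \<noteq> \<zero>\<^sub>A}" using g by (intro image_eqI[of _ _ "inv g"]) auto
      qed
      moreover have "finite {x \<in> \<G>. D ?W x \<noteq> \<zero>\<^sub>A}"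
        using add_hom_closed[OF D(1) W] by (simp add: fin_supp_def del: galg_simps)
      ultimately show "finite {g \<in> \<G>. evB n f (frag_of (gmap g xs)) \<noteq> \<zero>\<^sub>A}"
        by (meson finite_imageI finite_subset)
    qed auto
  next
    fix n f f' assume f: "f \<in> lmod_hom E (Bar n) (Bar 0)" and f': "f' \<in> lmod_hom E (Bar n) (Bar 0)"
      and eq: "\<And>u. u \<in> ch (Suc n) ==> evB n f u = evB n f' u"
    show "f = f'"
    proof (rule linear_eq_on_J[OF Bar_left_module f f'], rule D_ext)
      fix u assume u: "u \<in> ch (Suc n)"
      show "f (J n u) \<in> \<B> 0" "f' (J n u) \<in> \<B> 0"
        by (rule lmod_hom_closed[OF f J_closed[OF u]], rule lmod_hom_closed[OF f' J_closed[OF u]])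
      show "\<kappa> (cj (inv x) \<odot>\<^bsub>Bar 0\<^esub> f (J n u)) = \<kappa> (cj (inv x) \<odot>\<^bsub>Bar 0\<^esub> f' (J n u))" if x: "x \<in> \<G>" for x
        using eq[OF gact_closed[OF G.inv_closed[OF x] u]]
        unfolding evB_gact[OF f G.inv_closed[OF x] u] evB_gact[OF f' G.inv_closed[OF x] u] .
    qed
  next
    fix n \<phi> assume \<phi>: "\<phi> \<in> C (Suc n) A"
    \<comment> \<open>The function on \<open>G\<close> whose value at 1 is \<open>\<phi> u\<close>
      and whose other values are forced by equivariance; \<open>Hm\<close> turns it into an element
      of \<open>A \<otimes> A\<close>.\<close>
    define V where "V u = (\<lambda>x. if x \<in> \<G> then \<phi> (gact (inv x) u) else \<zero>\<^sub>A)" for u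
    have V: "V \<in> add_hom (Sg (Suc n)) FG"
    proof (rule add_homI)
      fix u assume u: "u \<in> ch (Suc n)"
      have "{x \<in> \<G>. \<phi> (gact (inv x) u) \<noteq> \<zero>\<^sub>A} \<subseteq> m_inv G ` {g \<in> \<G>. \<phi> (gact g u) \<noteq> \<zero>\<^sub>A}"
      proof
        fix x assume "x \<in> {x \<in> \<G>. \<phi> (gact (inv x) u) \<noteq> \<zero>\<^sub>A}"
        then show "x \<in> m_inv G ` {g \<in> \<G>. \<phi> (gact g u) \<noteq> \<zero>\<^sub>A}" by (intro image_eqI[of _ _ "inv x"]) auto
      qed
      from finite_subset[OF this finite_imageI[OF C_finite[OF A_abelian \<phi> u]]]
      have "finite {x \<in> \<G>. V u x \<noteq> \<zero>\<^sub>A}" by (simp add: V_def cong: conj_cong del: galg_simps)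
      then show "V u \<in> carrier FG"
        using C_closed[OF \<phi> gact_closed[OF _ u]] by (simp add: fin_supp_def del: galg_simps) (simp add: V_def del: galg_simps)
      fix v assume v: "v \<in> ch (Suc n)"
      show "V (u \<oplus>\<^bsub>Sg (Suc n)\<^esub> v) = V u \<oplus>\<^bsub>FG\<^esub> V v"
      proof
        fix x
        show "V (u \<oplus>\<^bsub>Sg (Suc n)\<^esub> v) x = (V u \<oplus>\<^bsub>FG\<^esub> V v) x"
        proof (cases "x \<in> \<G>")
          case True
          then have "\<phi> (gact (inv x) (u \<oplus>\<^bsub>Sg (Suc n)\<^esub> v)) = \<phi> (gact (inv x) u) \<oplus>\<^sub>A \<phi> (gact (inv x) v)"
            using add_hom_add[OF add_hom_comp[OF gact_hom C_hom[OF \<phi>]] u v] by simp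
          then show ?thesis using True by (simp add: V_def del: galg_simps)
        qed (simp add: V_def A_ab.l_zero del: galg_simps)
      qed
    qed
    have HV: "Hm (V u) \<in> \<B> 0" if "u \<in> ch (Suc n)" for u
      by (rule add_hom_closed[OF D(2) add_hom_closed[OF V that]])
    have \<kappa>V: "\<kappa> (cj (inv x) \<odot>\<^bsub>Bar 0\<^esub> Hm (V u)) = \<phi> (gact (inv x) u)" if "u \<in> ch (Suc n)" "x \<in> \<G>" for u x
      using D(3)[OF HV[OF that(1)] that(2)] D(5)[OF add_hom_closed[OF V that(1)]] that(2) by (simp add: V_def)
    have eqv: "Hm (V (gact g u)) = cj g \<odot>\<^bsub>Bar 0\<^esub> Hm (V u)" if g: "g \<in> \<G>" and u: "u \<in> ch (Suc n)" for g u
    proof (rule D_ext[OF HV[OF gact_closed[OF g u]] act_closed[OF cj_closed[OF g] HV[OF u]]])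
      fix x assume x: "x \<in> \<G>"
      have "\<kappa> (cj (inv x) \<odot>\<^bsub>Bar 0\<^esub> (cj g \<odot>\<^bsub>Bar 0\<^esub> Hm (V u))) = \<kappa> (cj (inv (inv g \<otimes> x)) \<odot>\<^bsub>Bar 0\<^esub> Hm (V u))"
        using cj_cj[of "inv x" g "Hm (V u)"] g x HV[OF u] by (simp add: G.inv_mult_group)
      also have "\<dots> = \<phi> (gact (inv x) (gact g u))"
        using \<kappa>V[OF u, of "inv g \<otimes> x"] gact_gact[of "inv x" g u "Suc n"] g x u by (simp add: G.inv_mult_group)
      finally show "\<kappa> (cj (inv x) \<odot>\<^bsub>Bar 0\<^esub> Hm (V (gact g u))) = \<kappa> (cj (inv x) \<odot>\<^bsub>Bar 0\<^esub> (cj g \<odot>\<^bsub>Bar 0\<^esub> Hm (V u)))"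
        using \<kappa>V[OF gact_closed[OF g u] x] by simp
    qed
    obtain f where f: "f \<in> lmod_hom E (Bar n) (Bar 0)" "\<And>u. u \<in> ch (Suc n) ==> f (J n u) = Hm (V u)"
      by (rule linear_from_J[OF Bar_left_module add_hom_comp[OF V D(2)] eqv]) (assumption+, rule that)
    have "evB n f u = \<phi> u" if u: "u \<in> ch (Suc n)" for u
      using evB_gact[OF f(1) G.one_closed u] f(2)[OF u] \<kappa>V[OF u G.one_closed] gact_one[of u "Suc n"] u by simp
    with f(1) show "\<exists>f\<in>lmod_hom E (Bar n) (Bar 0). \<forall>u\<in>ch (Suc n). evB n f u = \<phi> u" by (intro bexI[of _ f] ballI)
  next
    show "evB (Suc n) (\<lambda>x\<in>\<B> (Suc n). f (dB n x)) u = evB n f (bd u)" if "u \<in> ch (Suc (Suc n))" for n f u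
      using dB_J[OF that] J_closed[OF that] by (simp add: evB_def)
    show "evB n (\<lambda>x\<in>\<B> n. \<zero>\<^bsub>Bar 0\<^esub>) u = \<zero>\<^sub>A" if "u \<in> ch (Suc n)" for n u
      using J_closed[OF that] add_hom_zero[OF Bar_abelian A_abelian \<kappa>(1)] by (simp add: evB_def)
  qed
qed

sublocale BM: cochain_model G E Bar "bar_differential k A" "Bar 0" A evB
  by (rule evB_model)

lemma evB_mult:
  assumes "f \<in> carrier (HB.Zc n)" "f' \<in> carrier (HB.Zc n)" "u \<in> ch (Suc n)"
  shows "evB n (f \<otimes>\<^bsub>HB.Zc n\<^esub> f') u = evB n f u \<oplus>\<^sub>A evB n f' u"
  using add_hom_add[OF \<kappa>(1) lmod_hom_closed[OF BM.cocycle_hom[OF assms(1)] J_closed[OF assms(3)]]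
      lmod_hom_closed[OF BM.cocycle_hom[OF assms(2)] J_closed[OF assms(3)]]]
  unfolding evB_def HB.cocycles_mult using J_closed[OF assms(3)] by simp

section \<open>The dualizing bimodule\<close>

text \<open>The relation that \<open>f\<close> has the class of \<open>c m\<close>. It becomes the
  graph of the isomorphism to \<open>A\<close> once existence and uniqueness of \<open>m\<close> are
  known.\<close>

definition rep :: "(('g list \<Rightarrow>\<^sub>0 int) \<Rightarrow> int) \<Rightarrow> nat \<Rightarrow> (('g, 'k) tensors \<Rightarrow> ('g, 'k) tensors) \<Rightarrow> ('g \<Rightarrow> 'k) \<Rightarrow> bool" where
  "rep c d f m \<longleftrightarrow> m \<in> \<A> \<and>
     (\<exists>b\<in>C d A. \<forall>u\<in>ch (Suc d). evB d f u = [c u] \<cdot>\<^bsub>A\<^esub> m \<oplus>\<^sub>A b (bd u))"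

lemma repI:
  assumes "m \<in> \<A>" "b \<in> C d A" "\<And>u. u \<in> ch (Suc d) ==> evB d f u = [c u] \<cdot>\<^bsub>A\<^esub> m \<oplus>\<^sub>A b (bd u)"
  shows "rep c d f m"
  unfolding rep_def using assms by (intro conjI bexI[of _ b] ballI)

lemma repD:
  assumes "rep c d f m"
  obtains b where "m \<in> \<A>" "b \<in> C d A" "\<And>u. u \<in> ch (Suc d) ==> evB d f u = [c u] \<cdot>\<^bsub>A\<^esub> m \<oplus>\<^sub>A b (bd u)"
  using assms unfolding rep_def by (elim conjE bexE) (rule that, auto simp del: galg_simps)

lemma rep_mult:
  assumes "f \<in> carrier (HB.Zc d)" "f' \<in> carrier (HB.Zc d)" "rep c d f m" "rep c d f' m'"
  shows "rep c d (f \<otimes>\<^bsub>HB.Zc d\<^esub> f') (m \<oplus>\<^sub>A m')"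
proof -
  obtain b where b: "m \<in> \<A>" "b \<in> C d A" "\<And>u. u \<in> ch (Suc d) ==> evB d f u = [c u] \<cdot>\<^bsub>A\<^esub> m \<oplus>\<^sub>A b (bd u)"
    by (rule repD[OF assms(3)]) (rule that)
  obtain b' where b': "m' \<in> \<A>" "b' \<in> C d A" "\<And>u. u \<in> ch (Suc d) ==> evB d f' u = [c u] \<cdot>\<^bsub>A\<^esub> m' \<oplus>\<^sub>A b' (bd u)"
    by (rule repD[OF assms(4)]) (rule that)
  show ?thesis
  proof (rule repI[OF A_ab.a_closed[OF b(1) b'(1)] C_plus[OF A_abelian b(2) b'(2)]])
    fix u assume u: "u \<in> ch (Suc d)"
    have cl: "b (bd u) \<in> \<A>" "b' (bd u) \<in> \<A>" "[c u] \<cdot>\<^bsub>A\<^esub> m \<in> \<A>" "[c u] \<cdot>\<^bsub>A\<^esub> m' \<in> \<A>"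
      using C_closed[OF b(2) bd_cl[OF u]] C_closed[OF b'(2) bd_cl[OF u]]
        A_ab.add.int_pow_closed[OF b(1)] A_ab.add.int_pow_closed[OF b'(1)] by (simp_all del: galg_simps)
    show "evB d (f \<otimes>\<^bsub>HB.Zc d\<^esub> f') u = [c u] \<cdot>\<^bsub>A\<^esub> (m \<oplus>\<^sub>A m') \<oplus>\<^sub>A (b (bd u) \<oplus>\<^sub>A b' (bd u))"
      unfolding evB_mult[OF assms(1,2) u] b(3)[OF u] b'(3)[OF u] A_ab.add.int_pow_distrib[OF b(1) b'(1)]
      using cl by (simp add: A_ab.a_ac del: galg_simps)
  qed
qed

text \<open>The difference of two candidates turns \<open>c\<close> into a coboundary with
  coefficients in \<open>A\<close>, so \<open>c_pow_inj\<close> applies.\<close>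

lemma rep_unique:
  assumes pd: "pd_grp G T h Y l c d" and "rep c d f m" "rep c d f m'" shows "m = m'"
proof -
  interpret pd: pd_grp G T h Y l c d by (rule pd)
  obtain b where b: "m \<in> \<A>" "b \<in> C d A" "\<And>u. u \<in> ch (Suc d) ==> evB d f u = [c u] \<cdot>\<^bsub>A\<^esub> m \<oplus>\<^sub>A b (bd u)"
    by (rule repD[OF assms(2)]) (rule that)
  obtain b' where b': "m' \<in> \<A>" "b' \<in> C d A" "\<And>u. u \<in> ch (Suc d) ==> evB d f u = [c u] \<cdot>\<^bsub>A\<^esub> m' \<oplus>\<^sub>A b' (bd u)"
    by (rule repD[OF assms(3)]) (rule that)
  have "m \<oplus>\<^sub>A \<ominus>\<^bsub>A\<^esub> m' = \<zero>\<^sub>A"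
  proof (rule pd.c_pow_inj[OF A_abelian _ C_plus[OF A_abelian b'(2) C_uminus[OF A_abelian b(2)]]])
    show "m \<oplus>\<^sub>A \<ominus>\<^bsub>A\<^esub> m' \<in> \<A>" by (rule A_ab.a_closed[OF b(1) A_ab.a_inv_closed[OF b'(1)]])
    fix u assume u: "u \<in> ch (Suc d)"
    have cl: "b (bd u) \<in> \<A>" "b' (bd u) \<in> \<A>" "[c u] \<cdot>\<^bsub>A\<^esub> m \<in> \<A>" "[c u] \<cdot>\<^bsub>A\<^esub> m' \<in> \<A>"
      using C_closed[OF b(2) bd_cl[OF u]] C_closed[OF b'(2) bd_cl[OF u]]
        A_ab.add.int_pow_closed[OF b(1)] A_ab.add.int_pow_closed[OF b'(1)] by (simp_all del: galg_simps)
    have "[c u] \<cdot>\<^bsub>A\<^esub> (\<ominus>\<^bsub>A\<^esub> m') = \<ominus>\<^bsub>A\<^esub> ([c u] \<cdot>\<^bsub>A\<^esub> m')"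
      using add_hom_neg[OF A_abelian A_abelian int_pow_endo[OF A_abelian] b'(1)] .
    then have l: "[c u] \<cdot>\<^bsub>A\<^esub> (m \<oplus>\<^sub>A \<ominus>\<^bsub>A\<^esub> m') = [c u] \<cdot>\<^bsub>A\<^esub> m \<oplus>\<^sub>A \<ominus>\<^bsub>A\<^esub> ([c u] \<cdot>\<^bsub>A\<^esub> m')"
      using A_ab.add.int_pow_distrib[OF b(1) A_ab.a_inv_closed[OF b'(1)]] by (simp del: galg_simps)
    have e: "[c u] \<cdot>\<^bsub>A\<^esub> m \<oplus>\<^sub>A b (bd u) = [c u] \<cdot>\<^bsub>A\<^esub> m' \<oplus>\<^sub>A b' (bd u)" using b(3)[OF u] b'(3)[OF u] by metis
    have "x \<oplus>\<^sub>A \<ominus>\<^bsub>A\<^esub> y = w \<oplus>\<^sub>A \<ominus>\<^bsub>A\<^esub> z" if "x \<in> \<A>" "y \<in> \<A>" "z \<in> \<A>" "w \<in> \<A>" "x \<oplus>\<^sub>A z = y \<oplus>\<^sub>A w" for x y z w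
    proof -
      have "x \<oplus>\<^sub>A \<ominus>\<^bsub>A\<^esub> y = (x \<oplus>\<^sub>A z) \<oplus>\<^sub>A (\<ominus>\<^bsub>A\<^esub> y \<oplus>\<^sub>A \<ominus>\<^bsub>A\<^esub> z)"
        using that(1-4) by (simp add: A_ab.a_ac A_ab.r_neg A_ab.r_neg1 A_ab.r_neg2 del: galg_simps)
      also have "\<dots> = w \<oplus>\<^sub>A \<ominus>\<^bsub>A\<^esub> z"
        unfolding that(5) using that(1-4) by (simp add: A_ab.a_ac A_ab.r_neg1 A_ab.r_neg2 del: galg_simps)
      finally show ?thesis .
    qed
    from this[OF cl(3,4,1,2) e] show "[c u] \<cdot>\<^bsub>A\<^esub> (m \<oplus>\<^sub>A \<ominus>\<^bsub>A\<^esub> m') = b' (bd u) \<oplus>\<^sub>A \<ominus>\<^bsub>A\<^esub> b (bd u)"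
      unfolding l .
  qed
  then show ?thesis using b(1) b'(1) A_ab.minus_equality[of m "\<ominus>\<^bsub>A\<^esub> m'"] by (simp add: A_ab.minus_minus del: galg_simps)
qed

text \<open>Duality with coefficients in the additive group of \<open>A\<close>; outside degree
  \<open>d\<close> the coefficient is zero and only the coboundary remains.\<close>

lemma rep_exists:
  assumes pd: "pd_grp G T h Y l c d" and "f \<in> carrier (HB.Zc n)"
  shows "n = d ==> \<exists>m. rep c d f m" and "n \<noteq> d ==> f \<in> HB.Bc n"
proof -
  interpret pd: pd_grp G T h Y l c d by (rule pd)
  have f: "f \<in> lmod_hom E (Bar n) (Bar 0)" using assms(2) by (simp add: HB.cocycles_iff)
  have 0: "evB n f (bd u) = \<zero>\<^sub>A" if "u \<in> ch (Suc (Suc n))" for u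
    using assms(2) that unfolding BM.cocycle_iff[OF f] by (rule bspec)
  obtain m b where m: "m \<in> \<A>" "b \<in> C n A" "n \<noteq> d ==> m = \<zero>\<^sub>A"
    "\<And>u. u \<in> ch (Suc n) ==> evB n f u = [c u] \<cdot>\<^bsub>A\<^esub> m \<oplus>\<^sub>A b (bd u)"
    by (rule pd.gen_byD[OF pd.gen_by_all[OF A_abelian] BM.ev_C[OF f] 0]) (assumption, rule that)
  show "n = d ==> \<exists>m. rep c d f m" using repI[of m b d f c] m(1,2,4) by blast
  assume n: "n \<noteq> d"
  have "evB n f u = b (bd u)" if "u \<in> ch (Suc n)" for u
    using m(4)[OF that] m(3)[OF n] C_closed[OF m(2) bd_cl[OF that]] A_ab.add.int_pow_one[of "c u"]
    by (simp del: galg_simps)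
  then show "f \<in> HB.Bc n" unfolding BM.coboundary_iff[OF f] using m(2) by blast
qed

section \<open>The inner bimodule structure\<close>

definition inn :: "('g \<Rightarrow> 'k) \<Rightarrow> ('g \<Rightarrow> 'k) \<Rightarrow> ('g, 'k) tensors \<Rightarrow> ('g, 'k) tensors" where
  "inn a b = tensor_extend k A (Suc (Suc 0)) (\<lambda>xs. frag_of [xs ! 0 \<otimes>\<^sub>A a, b \<otimes>\<^sub>A xs ! Suc 0])"

lemma inn:
  assumes a: "a \<in> \<A>" and b: "b \<in> \<A>"
  shows "inn a b \<in> add_hom (Bar 0) (Bar 0)"
    and "as \<in> tn 0 ==> inn a b (cls 0 (frag_of as)) = cls 0 (frag_of [as ! 0 \<otimes>\<^sub>A a, b \<otimes>\<^sub>A as ! Suc 0])"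
proof -
  let ?F = "\<lambda>xs. [xs ! 0 \<otimes>\<^sub>A a, b \<otimes>\<^sub>A xs ! Suc 0]"
  have tp: "?F xs \<in> tn 0" if "xs \<in> tn 0" for xs
    using A_mult_closed[OF tp_nth[OF that] a] A_mult_closed[OF b tp_nth[OF that]] by (simp add: tuples_def del: galg_simps)
  have keys: "keys (frag_of (?F xs)) \<subseteq> tn 0" if "xs \<in> tn 0" for xs
    using tp[OF that] by (simp del: galg_simps)
  have bal: "balanced (Suc (Suc 0)) (Bar 0) (\<lambda>xs. cls 0 (frag_of (?F xs)))"
  proof (rule balanced_slots[OF tp])
    fix as :: "('g \<Rightarrow> 'k) list" and j :: nat assume as: "as \<in> tn 0" and j: "j < Suc (Suc 0)"
    obtain x y where xy: "as = [x, y]" by (rule tp_2_cases[OF as])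
    from j consider "j = 0" | "j = Suc 0" by linarith
    then show "\<exists>j' \<psi>. j' < Suc (Suc 0) \<and> lin \<psi> \<and> (\<forall>x\<in>\<A>. ?F (as[j := x]) = (?F as)[j' := \<psi> x])"
    proof cases
      case 1
      then show ?thesis using lin_mult_right[OF a] xy by (intro exI[of _ 0] exI[of _ "\<lambda>x. x \<otimes>\<^sub>A a"]) auto
    next
      case 2
      then show ?thesis using lin_mult_left[OF b] xy by (intro exI[of _ "Suc 0"] exI[of _ "\<lambda>x. b \<otimes>\<^sub>A x"]) auto
    qed
  qed
  show "inn a b \<in> add_hom (Bar 0) (Bar 0)" unfolding inn_def by (rule tensor_extend_cls(2)[OF keys bal])
  show "as \<in> tn 0 ==> inn a b (cls 0 (frag_of as)) = cls 0 (frag_of (?F as))"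
    unfolding inn_def using tensor_extend_cls(1)[OF keys bal, of "frag_of as"] by (simp del: galg_simps)
qed

lemma cls_2_in: "a \<in> \<A> ==> b \<in> \<A> ==> [a, b] \<in> tn 0"
  by (simp add: tuples_def)

lemma cls_2_add1:
  "a \<in> \<A> ==> a' \<in> \<A> ==> b \<in> \<A> ==>
    cls 0 (frag_of [a \<oplus>\<^sub>A a', b]) = cls 0 (frag_of [a, b]) \<oplus>\<^bsub>Bar 0\<^esub> cls 0 (frag_of [a', b])"
  using cls_additive[OF cls_2_in[of a b], of 0 a a'] by (simp del: galg_simps)

text \<open>The outer and inner structures multiply each tensor factor on opposite sides, so they
  commute by associativity.\<close>

lemma inn_linear:
  assumes a: "a \<in> \<A>" and b: "b \<in> \<A>" and "r \<in> carrier E" "W \<in> \<B> 0"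
  shows "inn a b (r \<odot>\<^bsub>Bar 0\<^esub> W) = r \<odot>\<^bsub>Bar 0\<^esub> inn a b W"
proof (rule linear_on_spans[OF Bar_left_module Bar_left_module inn(1)[OF a b] E_spans Bar_spans_frag _ assms(3,4)])
  fix q w assume q: "q \<in> monos 0"
    and w: "w \<in> (\<lambda>as. cls 0 (frag_of as)) ` tn 0"
  obtain c g h where 1: "q = cls 0 (frag_of (bt c [g, h]))" "bt c [g, h] \<in> tn 0"
    by (rule mono0_spans_cases[OF q]) (auto simp: mono_def intro!: that bt_tp Gs_2 simp del: bt.simps)
  obtain p p' where p: "bt c [g, h] = [p, p']" "p \<in> \<A>" "p' \<in> \<A>" by (rule tp_2_cases[OF 1(2)])
  obtain as where as: "as \<in> tn 0" "w = cls 0 (frag_of as)" using w by (elim imageE)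
  obtain x y where xy: "as = [x, y]" "x \<in> \<A>" "y \<in> \<A>" by (rule tp_2_cases[OF as(1)])
  have m: "cls 0 (frag_of [p, p']) \<odot>\<^bsub>Bar 0\<^esub> cls 0 (frag_of [x, y]) = cls 0 (frag_of [p \<otimes>\<^sub>A x, y \<otimes>\<^sub>A p'])" if "x \<in> \<A>" "y \<in> \<A>" for x y
    using act_frag[OF cls_2_in[OF p(2,3)] cls_2_in[OF that]] by (simp add: actl_def del: galg_simps)
  have i: "inn a b (cls 0 (frag_of [x, y])) = cls 0 (frag_of [x \<otimes>\<^sub>A a, b \<otimes>\<^sub>A y])" if "x \<in> \<A>" "y \<in> \<A>" for x y
    using inn(2)[OF a b cls_2_in[OF that]] by simp
  show "inn a b (q \<odot>\<^bsub>Bar 0\<^esub> w) = q \<odot>\<^bsub>Bar 0\<^esub> inn a b w"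
    unfolding 1(1) p(1) as(2) xy(1) m[OF xy(2,3)] i[OF xy(2,3)] i[OF A_mult_closed[OF p(2) xy(2)] A_mult_closed[OF xy(3) p(3)]]
      m[OF A_mult_closed[OF xy(2) a] A_mult_closed[OF b xy(3)]] A_mult_assoc[OF p(2) xy(2) a] A_mult_assoc[OF b xy(3) p(3)] ..
qed

lemma inn_add:
  assumes a: "a \<in> \<A>" "a' \<in> \<A>" and b: "b \<in> \<A>" and W: "W \<in> \<B> 0"
  shows "inn (a \<oplus>\<^sub>A a') b W = inn a b W \<oplus>\<^bsub>Bar 0\<^esub> inn a' b W"
proof (rule add_hom_eqI[OF Bar_spans_frag Bar_abelian Bar_abelian inn(1)[OF A_ab.a_closed[OF a] b]
      add_hom_plus[OF Bar_abelian inn(1)[OF a(1) b] inn(1)[OF a(2) b]] _ W])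
  fix w assume w: "w \<in> (\<lambda>as. cls 0 (frag_of as)) ` tn 0"
  obtain as where as: "as \<in> tn 0" "w = cls 0 (frag_of as)" using w by (elim imageE)
  obtain x y where xy: "as = [x, y]" "x \<in> \<A>" "y \<in> \<A>" by (rule tp_2_cases[OF as(1)])
  show "inn (a \<oplus>\<^sub>A a') b w = inn a b w \<oplus>\<^bsub>Bar 0\<^esub> inn a' b w"
    unfolding as(2) inn(2)[OF A_ab.a_closed[OF a] b as(1)] inn(2)[OF a(1) b as(1)] inn(2)[OF a(2) b as(1)]
    using cls_2_add1[OF A_mult_closed[OF xy(2) a(1)] A_mult_closed[OF xy(2) a(2)] A_mult_closed[OF b xy(3)]]
      A.r_distr[OF a xy(2)] by (simp add: xy(1) del: galg_simps)
qed

text \<open>Sliding \<open>g\<close> across the tensor sign turns the inner action into conjugation.\<close>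

lemma \<kappa>_inn:
  assumes g: "g \<in> \<G>" and s: "s \<in> \<K>" and b: "b \<in> \<A>" and W: "W \<in> \<B> 0"
  shows "\<kappa> (inn (sing k g s) b W) = b \<otimes>\<^sub>A \<kappa> (cj g \<odot>\<^bsub>Bar 0\<^esub> W) \<otimes>\<^sub>A sing k g s"
proof (rule add_hom_eqI[OF Bar_spans Bar_abelian A_abelian add_hom_comp[OF inn(1)[OF sing_A[OF g s] b] \<kappa>(1)]
      add_hom_comp[OF add_hom_comp[OF add_hom_comp[OF act_hom2[OF cj_closed[OF g]] \<kappa>(1)] A_mult_add_hom(1)[OF b]] A_mult_add_hom(2)[OF sing_A[OF g s]]] _ W])
  fix w assume "w \<in> monos 0"
  then obtain c x y where w: "w = mono 0 c [x, y]" "c \<in> \<K>" "x \<in> \<G>" "y \<in> \<G>" by (rule mono0_spans_cases)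
  have cs: "c \<otimes>\<^sub>k s \<in> \<K>" using w s by simp
  \<comment> \<open>The two sides select the monomials with \<open>x g = 1\<close> and with
    \<open>g x = 1\<close>, and in a group these are the same ones.\<close>
  have xg: "x \<otimes> g = \<one> \<longleftrightarrow> g \<otimes> x = \<one>" using w(3) g by (metis G.inv_comm)
  have bt: "bt c [x, y] = [sing k x c, gb y]" by simp
  have 1: "inn (sing k g s) b w = cls 0 (frag_of [sing k (x \<otimes> g) (c \<otimes>\<^sub>k s), b \<otimes>\<^sub>A gb y])"
    using inn(2)[OF sing_A[OF g s] b bt_tp[OF w(2) Gs_2[OF w(3,4)]]] A_mult_sing[OF w(3) g w(2) s]
    unfolding w(1) mono_def by (simp del: galg_simps)
  have 2: "\<kappa> (inn (sing k g s) b w) = (if x \<otimes> g = \<one> then c \<otimes>\<^sub>k s else \<zero>\<^sub>k) \<odot>\<^sub>A (b \<otimes>\<^sub>A gb y)"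
    unfolding 1 using \<kappa>(2)[OF cls_2_in[OF sing_A[OF G.m_closed[OF w(3) g] cs] A_mult_closed[OF b gb_closed[OF w(4)]]]]
    by (auto simp: sing_def simp del: galg_simps)
  have 3: "\<kappa> (cj g \<odot>\<^bsub>Bar 0\<^esub> w) = (if g \<otimes> x = \<one> then sing k (y \<otimes> inv g) c else \<zero>\<^sub>A)"
    unfolding w(1) cj_mono[OF w(2) g w(3,4)] using w g by (intro \<kappa>_mono) auto
  note sm = assoc_algebra.smult_mult_right[OF A_algebra]
  have bg: "b \<otimes>\<^sub>A gb y \<in> \<A>" by (rule A_mult_closed[OF b gb_closed[OF w(4)]])
  show "\<kappa> (inn (sing k g s) b w) = b \<otimes>\<^sub>A \<kappa> (cj g \<odot>\<^bsub>Bar 0\<^esub> w) \<otimes>\<^sub>A sing k g s"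
  proof (cases "x \<otimes> g = \<one>")
    case True
    have ys: "sing k (y \<otimes> inv g) c \<in> \<A>" using w g by (intro sing_A) auto
    have "b \<otimes>\<^sub>A sing k (y \<otimes> inv g) c \<otimes>\<^sub>A sing k g s = b \<otimes>\<^sub>A ((c \<otimes>\<^sub>k s) \<odot>\<^sub>A gb y)"
      unfolding A_mult_assoc[OF b ys sing_A[OF g s]] smult_gb[OF cs]
      using w g s by (simp add: A_mult_sing G.m_assoc)
    then show ?thesis unfolding 2 3 xg[symmetric] using True sm[OF cs b gb_closed[OF w(4)]] by (simp del: galg_simps)
  next
    case False
    have "\<zero>\<^sub>k \<odot>\<^sub>A (b \<otimes>\<^sub>A gb y) = \<zero>\<^sub>A" using cl[OF bg[simplified]] by (simp add: fun_eq_iff)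
    then show ?thesis unfolding 2 3 xg[symmetric] using False b sing_A[OF g s] A.r_null A.l_null by (simp del: galg_simps)
  qed
qed

text \<open>Translation by a fixed \<open>g\<close> does not commute with other translations, so
  \<open>C_comp\<close> does not apply; the finite set is reindexed by left multiplication with
  \<open>g\<close> instead.\<close>

lemma C_gact:
  assumes g: "g \<in> \<G>" and M: "abelian_group M" and b: "b \<in> C N M" shows "(\<lambda>w. b (gact g w)) \<in> C N M"
  unfolding C_def
proof (intro CollectI conjI ballI impI)
  show "(\<lambda>w. b (gact g w)) \<in> add_hom (Sg N) M" by (rule add_hom_comp[OF gact_hom[OF g] C_hom[OF b]])
  show "N = 0 ==> u \<in> ch N ==> b (gact g u) = \<zero>\<^bsub>M\<^esub>" for u
    using b gact_closed[OF g] unfolding C_def by blast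
  fix xs assume xs: "xs \<in> Gs N"
  have f: "frag_of xs \<in> ch N" using xs by simp
  have "{x \<in> \<G>. b (gact g (frag_of (gmap x xs))) \<noteq> \<zero>\<^bsub>M\<^esub>} \<subseteq>
      (\<lambda>y. inv g \<otimes> y) ` {y \<in> \<G>. b (gact y (frag_of xs)) \<noteq> \<zero>\<^bsub>M\<^esub>}"
  proof
    fix x assume x: "x \<in> {x \<in> \<G>. b (gact g (frag_of (gmap x xs))) \<noteq> \<zero>\<^bsub>M\<^esub>}"
    then have "b (gact (g \<otimes> x) (frag_of xs)) \<noteq> \<zero>\<^bsub>M\<^esub>" using gact_gact[OF g _ f, of x] by (simp add: gact_frag_of)
    then show "x \<in> (\<lambda>y. inv g \<otimes> y) ` {y \<in> \<G>. b (gact y (frag_of xs)) \<noteq> \<zero>\<^bsub>M\<^esub>}"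
      using x g by (intro image_eqI[of _ _ "g \<otimes> x"]) (auto simp: G.m_assoc[symmetric])
  qed
  from finite_subset[OF this finite_imageI[OF C_finite[OF M b f]]]
  show "finite {x \<in> \<G>. b (gact g (frag_of (gmap x xs))) \<noteq> \<zero>\<^bsub>M\<^esub>}" .
qed

text \<open>By \<open>\<kappa>_inn\<close> the inner action evaluates the cocycle on the translated
  chain. There \<open>c\<close> changes only by the coboundary of \<open>e\<close>, so the
  coefficient \<open>m\<close> is merely multiplied by \<open>y\<close> and by the group
  element.\<close>

lemma rep_inn:
  assumes pd: "pd_grp G T h Y l c d" and e: "e \<in> C d \<Z>" "\<And>u. u \<in> ch (Suc d) ==> c (gact g u) = c u + e (bd u)"
    and g: "g \<in> \<G>" and s: "s \<in> \<K>" and y: "y \<in> \<A>"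
    and f: "f \<in> carrier (HB.Zc d)" and r: "rep c d f m"
  shows "rep c d (compose (\<B> d) (inn (sing k g s) y) f) (y \<otimes>\<^sub>A m \<otimes>\<^sub>A sing k g s)"
proof -
  have f': "f \<in> lmod_hom E (Bar d) (Bar 0)" using f by (simp add: HB.cocycles_iff)
  obtain b where b: "m \<in> \<A>" "b \<in> C d A" "\<And>u. u \<in> ch (Suc d) ==> evB d f u = [c u] \<cdot>\<^bsub>A\<^esub> m \<oplus>\<^sub>A b (bd u)"
    by (rule repD[OF r]) (rule that)
  let ?p = "\<lambda>x. y \<otimes>\<^sub>A x \<otimes>\<^sub>A sing k g s"
  have p: "?p \<in> add_hom A A" by (rule add_hom_comp[OF A_mult_add_hom(1)[OF y] A_mult_add_hom(2)[OF sing_A[OF g s]]])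
  \<comment> \<open>Collects the change of \<open>c\<close> under translation, paired with
    \<open>m\<close>, and the translate of the old bounding cochain.\<close>
  let ?b = "\<lambda>w. [e w] \<cdot>\<^bsub>A\<^esub> m \<oplus>\<^sub>A b (gact g w)"
  have b': "?b \<in> C d A"
    by (rule C_plus[OF A_abelian C_post[OF ZG.k_ab A_abelian e(1) int_pow_add_hom[OF A_abelian b(1)]] C_gact[OF g A_abelian b(2)]])
  show ?thesis
  proof (rule repI[OF add_hom_closed[OF p b(1)] C_post[OF A_abelian A_abelian b' p]])
    fix u assume u: "u \<in> ch (Suc d)"
    have gu: "gact g u \<in> ch (Suc d)" by (rule gact_closed[OF g u])
    have i: "[z] \<cdot>\<^bsub>A\<^esub> m \<in> \<A>" for z :: int by (rule A_ab.add.int_pow_closed[OF b(1)])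
    have bc: "b (gact g (bd u)) \<in> \<A>" by (rule C_closed[OF b(2) gact_closed[OF g bd_cl[OF u]]])
    have "evB d (compose (\<B> d) (inn (sing k g s) y) f) u = \<kappa> (inn (sing k g s) y (f (J d u)))"
      using J_closed[OF u] by (simp add: evB_def compose_def)
    also have "\<dots> = ?p (evB d f (gact g u))"
      unfolding evB_gact[OF f' g u] by (rule \<kappa>_inn[OF g s y lmod_hom_closed[OF f' J_closed[OF u]]])
    also have "evB d f (gact g u) = ([c u] \<cdot>\<^bsub>A\<^esub> m \<oplus>\<^sub>A [e (bd u)] \<cdot>\<^bsub>A\<^esub> m) \<oplus>\<^sub>A b (gact g (bd u))"
      using add_hom_add[OF int_pow_add_hom[OF A_abelian b(1)], of "c u" "e (bd u)"]
      unfolding b(3)[OF gu] e(2)[OF u] bd_gact by (simp del: galg_simps)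
    also have "\<dots> = [c u] \<cdot>\<^bsub>A\<^esub> m \<oplus>\<^sub>A ?b (bd u)" by (rule A_ab.a_assoc[OF i i bc])
    also have "?p \<dots> = ?p ([c u] \<cdot>\<^bsub>A\<^esub> m) \<oplus>\<^sub>A ?p (?b (bd u))"
      by (rule add_hom_add[OF p i A_ab.a_closed[OF i bc]])
    also have "?p ([c u] \<cdot>\<^bsub>A\<^esub> m) = [c u] \<cdot>\<^bsub>A\<^esub> ?p m" by (rule add_hom_int_pow[OF A_abelian A_abelian p b(1)])
    finally show "evB d (compose (\<B> d) (inn (sing k g s) y) f) u = [c u] \<cdot>\<^bsub>A\<^esub> ?p m \<oplus>\<^sub>A ?p (?b (bd u))" .
  qed
qed

lemma hochschild_PD:
  assumes pd: "pd_grp G T h Y l c d"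
    and act: "\<And>a. a \<in> \<G> ==> \<exists>e\<in>C d \<Z>. \<forall>u\<in>ch (Suc d). c (gact a u) = c u + e (bd u)"
  shows "n \<noteq> d ==> trivial_group (hochschild_cohomology k A (outer_bimodule k A) n)"
    and "\<exists>i\<in>iso (hochschild_cohomology k A (outer_bimodule k A) d) (add_monoid A).
      \<forall>a\<in>\<A>. \<forall>b\<in>\<A>. \<forall>U\<in>carrier (hochschild_cohomology k A (outer_bimodule k A) d).
        i (inner_action k A d a b U) = b \<otimes>\<^sub>A i U \<otimes>\<^sub>A a"
proof -
  interpret pd: pd_grp G T h Y l c d by (rule pd)
  have H: "hochschild_cohomology k A (outer_bimodule k A) n = HB.H n" for n by (simp add: hochschild_cohomology_def)
  show "n \<noteq> d ==> trivial_group (hochschild_cohomology k A (outer_bimodule k A) n)"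
    unfolding H HB.trivial_iff using rep_exists(2)[OF pd] by blast
  \<comment> \<open>\<open>rep_unique\<close> turns the chosen coefficient into a function
    compatible with all the operations below.\<close>
  define q where "q f = (SOME m. rep c d f m)" for f
  have q: "rep c d f (q f)" if "f \<in> carrier (HB.Zc d)" for f
    unfolding q_def by (rule someI_ex[OF rep_exists(1)[OF pd that refl]])
  have qA: "q f \<in> \<A>" if "f \<in> carrier (HB.Zc d)" for f using q[OF that] unfolding rep_def by (rule conjunct1)
  have q_eq: "q f = m" if "f \<in> carrier (HB.Zc d)" "rep c d f m" for f m by (rule rep_unique[OF pd q[OF that(1)] that(2)])
  have q_mult: "q (f \<otimes>\<^bsub>HB.Zc d\<^esub> f') = q f \<oplus>\<^sub>A q f'" if "f \<in> carrier (HB.Zc d)" "f' \<in> carrier (HB.Zc d)" for f f'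
    by (rule q_eq[OF HB.Z.m_closed[OF that] rep_mult[OF that q[OF that(1)] q[OF that(2)]]])
  have hom: "q \<in> hom (HB.Zc d) (add_monoid A)" using q_mult qA by (auto intro!: homI simp del: galg_simps)
  have onto: "q ` carrier (HB.Zc d) = carrier (add_monoid A)"
  proof
    show "q ` carrier (HB.Zc d) \<subseteq> carrier (add_monoid A)" using qA by auto
    show "carrier (add_monoid A) \<subseteq> q ` carrier (HB.Zc d)"
    proof
      fix m assume "m \<in> carrier (add_monoid A)"
      then have m: "m \<in> \<A>" by simp
      obtain f where f: "f \<in> lmod_hom E (Bar d) (Bar 0)" "\<And>u. u \<in> ch (Suc d) ==> evB d f u = [c u] \<cdot>\<^bsub>A\<^esub> m"
        using BM.ev_onto[OF pd.c_pow_C[OF A_abelian m]] by blast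
      have fZ: "f \<in> carrier (HB.Zc d)"
        unfolding BM.cocycle_iff[OF f(1)] using f(2)[OF bd_cl] pd.c_cocycle add_hom_zero[OF ZG.k_ab A_abelian int_pow_add_hom[OF A_abelian m]]
        by (simp del: galg_simps)
      have "rep c d f m"
        by (rule repI[OF m C_zero[OF A_abelian]]) (use f(2) A_ab.add.int_pow_closed[OF m] in \<open>simp del: galg_simps\<close>)
      from q_eq[OF fZ this] show "m \<in> q ` carrier (HB.Zc d)" using fZ by blast
    qed
  qed
  have ker: "q f = \<one>\<^bsub>add_monoid A\<^esub> \<longleftrightarrow> f \<in> HB.Bc d" if f: "f \<in> carrier (HB.Zc d)" for f
  proof -
    have f': "f \<in> lmod_hom E (Bar d) (Bar 0)" using f by (simp add: HB.cocycles_iff)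
    have "q f = \<zero>\<^sub>A \<longleftrightarrow> rep c d f \<zero>\<^sub>A" using q[OF f] q_eq[OF f] by metis
    also have "\<dots> \<longleftrightarrow> f \<in> HB.Bc d"
    proof -
      have "[c u] \<cdot>\<^bsub>A\<^esub> \<zero>\<^sub>A \<oplus>\<^sub>A b (bd u) = b (bd u)" if "b \<in> C d A" "u \<in> ch (Suc d)" for b u
        using add_hom_zero[OF A_abelian A_abelian int_pow_endo[OF A_abelian], of "c u"] A_ab.l_zero[OF C_closed[OF that(1) bd_cl[OF that(2)]]]
        by (simp only:)
      then have "(\<exists>b\<in>C d A. \<forall>u\<in>ch (Suc d). evB d f u = [c u] \<cdot>\<^bsub>A\<^esub> \<zero>\<^sub>A \<oplus>\<^sub>A b (bd u)) \<longleftrightarrow>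
          (\<exists>b\<in>C d A. \<forall>u\<in>ch (Suc d). evB d f u = b (bd u))"
        by (intro bex_cong ball_cong refl) (simp only:)
      then show ?thesis unfolding rep_def BM.coboundary_iff[OF f'] using A_ab.zero_closed by blast
    qed
    finally show ?thesis by simp
  qed
  obtain i where i: "i \<in> iso (HB.H d) (add_monoid A)" "\<And>f. f \<in> carrier (HB.Zc d) ==> i (HB.Bc d #>\<^bsub>HB.Zc d\<^esub> f) = q f"
    by (rule HB.iso_from_hom[OF A_ab.a_group hom onto ker]) (assumption, rule that)
  have cZ: "compose (\<B> d) (inn a b) f \<in> carrier (HB.Zc d)" if "a \<in> \<A>" "b \<in> \<A>" "f \<in> carrier (HB.Zc d)" for a b f
    by (rule HB.compose_cocycle[OF inn(1)[OF that(1,2)] inn_linear[OF that(1,2)] that(3)])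
  \<comment> \<open>Both sides are additive in \<open>a\<close>, so it suffices to take a scalar
    multiple of a group element, which is the case covered by \<open>rep_inn\<close>.\<close>
  have main: "q (compose (\<B> d) (inn a b) f) = b \<otimes>\<^sub>A q f \<otimes>\<^sub>A a"
    if a: "a \<in> \<A>" and b: "b \<in> \<A>" and f: "f \<in> carrier (HB.Zc d)" for a b f
  proof (rule add_hom_eqI[OF A_spans A_abelian A_abelian _ A_mult_add_hom(1)[OF A_mult_closed[OF b qA[OF f]]] _ a])
    have f': "f \<in> lmod_hom E (Bar d) (Bar 0)" using f by (simp add: HB.cocycles_iff)
    show "(\<lambda>a. q (compose (\<B> d) (inn a b) f)) \<in> add_hom A A"
    proof (rule add_homI)
      fix a a' assume a: "a \<in> \<A>" and a': "a' \<in> \<A>"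
      have "compose (\<B> d) (inn (a \<oplus>\<^sub>A a') b) f =
          compose (\<B> d) (inn a b) f \<otimes>\<^bsub>HB.Zc d\<^esub> compose (\<B> d) (inn a' b) f"
        unfolding HB.cocycles_mult compose_def
        by (rule restrict_ext) (simp add: inn_add[OF a a' b lmod_hom_closed[OF f']] del: galg_simps)
      then show "q (compose (\<B> d) (inn (a \<oplus>\<^sub>A a') b) f) =
          q (compose (\<B> d) (inn a b) f) \<oplus>\<^sub>A q (compose (\<B> d) (inn a' b) f)"
        using q_mult[OF cZ[OF a b f] cZ[OF a' b f]] by (simp del: galg_simps)
    qed (rule qA[OF cZ[OF _ b f]])
    fix x assume "x \<in> {sing k g c | g c. g \<in> \<G> \<and> c \<in> \<K>}"
    then obtain g s where x: "x = sing k g s" "g \<in> \<G>" "s \<in> \<K>" by blast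
    obtain e where e: "e \<in> C d \<Z>" "\<And>u. u \<in> ch (Suc d) ==> c (gact g u) = c u + e (bd u)"
      using act[OF x(2)] by blast
    show "q (compose (\<B> d) (inn x b) f) = b \<otimes>\<^sub>A q f \<otimes>\<^sub>A x"
      unfolding x(1) by (rule q_eq[OF cZ[OF sing_A[OF x(2,3)] b f] rep_inn[OF pd e x(2,3) b f q[OF f]]])
  qed
  have "i (inner_action k A d a b U) = b \<otimes>\<^sub>A i U \<otimes>\<^sub>A a"
    if a: "a \<in> \<A>" and b: "b \<in> \<A>" and U: "U \<in> carrier (HB.H d)" for a b U
  proof -
    obtain f where f: "f \<in> carrier (HB.Zc d)" "U = HB.Bc d #>\<^bsub>HB.Zc d\<^esub> f" using U unfolding HB.H_carrier by (elim imageE)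
    have "inner_action k A d a b U = HB.Bc d #>\<^bsub>HB.Zc d\<^esub> compose (\<B> d) (inn a b) f"
      using HB.hom_cohomology_map_class[OF inn(1)[OF a b] inn_linear[OF a b] f(1)]
      unfolding f(2) by (simp add: inner_action_def inn_def numeral_2_eq_2)
    then show ?thesis unfolding f(2) i(2)[OF f(1)] using i(2)[OF cZ[OF a b f(1)]] main[OF a b f(1)] by simp
  qed
  with i(1) show "\<exists>i\<in>iso (hochschild_cohomology k A (outer_bimodule k A) d) (add_monoid A).
      \<forall>a\<in>\<A>. \<forall>b\<in>\<A>. \<forall>U\<in>carrier (hochschild_cohomology k A (outer_bimodule k A) d).
        i (inner_action k A d a b U) = b \<otimes>\<^sub>A i U \<otimes>\<^sub>A a"
    unfolding H by (intro bexI[of _ i] ballI)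
qed

end

section \<open>Finite projective resolutions from idempotents of free modules\<close>

text \<open>Linear maps without extensionality, closed under composition of plain functions.\<close>

definition lin_maps :: "('r, 's) ring_scheme \<Rightarrow> ('r, 'm) module \<Rightarrow> ('r, 'n) module \<Rightarrow> ('m \<Rightarrow> 'n) set" where
  "lin_maps R M N = {f \<in> add_hom M N. \<forall>r\<in>carrier R. \<forall>x\<in>carrier M. f (r \<odot>\<^bsub>M\<^esub> x) = r \<odot>\<^bsub>N\<^esub> f x}"

lemma lin_mapsI:
  "f \<in> add_hom M N ==> (\<And>r x. r \<in> carrier R ==> x \<in> carrier M ==> f (r \<odot>\<^bsub>M\<^esub> x) = r \<odot>\<^bsub>N\<^esub> f x) ==> f \<in> lin_maps R M N"
  by (simp add: lin_maps_def)

lemma lin_mapsD: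
  assumes "f \<in> lin_maps R M N"
  shows "f \<in> add_hom M N" "r \<in> carrier R ==> x \<in> carrier M ==> f (r \<odot>\<^bsub>M\<^esub> x) = r \<odot>\<^bsub>N\<^esub> f x"
    "x \<in> carrier M ==> f x \<in> carrier N"
  using assms add_hom_closed[of f M N x] by (auto simp: lin_maps_def)

lemma lmod_hom_lin: "f \<in> lmod_hom R M N ==> f \<in> lin_maps R M N"
  by (rule lin_mapsI[OF lmod_hom_add_hom lmod_hom_smult])

lemma lin_restrict: "left_module R M ==> f \<in> lin_maps R M N ==> restrict f (carrier M) \<in> lmod_hom R M N"
  by (rule lmod_homI[OF _ lin_mapsD(1)]) (assumption+, rule lin_mapsD(2))

lemma lin_comp: "f \<in> lin_maps R M N ==> g \<in> lin_maps R N L ==> (\<lambda>x. g (f x)) \<in> lin_maps R M L"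
  by (rule lin_mapsI[OF add_hom_comp[OF lin_mapsD(1) lin_mapsD(1)]]) (simp_all add: lin_mapsD)

lemma lin_zero:
  assumes "left_module R M" "left_module R N" "f \<in> lin_maps R M N" shows "f \<zero>\<^bsub>M\<^esub> = \<zero>\<^bsub>N\<^esub>"
  by (rule add_hom_zero[OF lmod_abelian lmod_abelian lin_mapsD(1)]) (rule assms)+

text \<open>For an idempotent the fixed points are its image. Written as fixed points they are
  visibly closed under the module operations.\<close>

definition fixed_part :: "('r, 'm) module \<Rightarrow> ('m \<Rightarrow> 'm) \<Rightarrow> ('r, 'm) module" where
  "fixed_part M e = M\<lparr>carrier := {x \<in> carrier M. e x = x}\<rparr>"

lemma fixed_part_simps [simp]:
  "carrier (fixed_part M e) = {x \<in> carrier M. e x = x}" "\<zero>\<^bsub>fixed_part M e\<^esub> = \<zero>\<^bsub>M\<^esub>"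
  "x \<oplus>\<^bsub>fixed_part M e\<^esub> y = x \<oplus>\<^bsub>M\<^esub> y" "r \<odot>\<^bsub>fixed_part M e\<^esub> x = r \<odot>\<^bsub>M\<^esub> x"
  by (simp_all add: fixed_part_def)

lemma fixed_part_left_module:
  assumes M: "left_module R M" and e: "e \<in> lin_maps R M M"
  shows "left_module R (fixed_part M e)"
proof -
  note ab = lmod_abelian[OF M]
  interpret ab: abelian_group M by (rule ab)
  interpret M: left_module R M by (rule M)
  note e' = add_hom_add[OF lin_mapsD(1)[OF e]] add_hom_neg[OF ab ab lin_mapsD(1)[OF e]] lin_zero[OF M M e] lin_mapsD(2)[OF e]
  have "abelian_group (fixed_part M e)"
  proof (rule abelian_groupI)
    fix x assume "x \<in> carrier (fixed_part M e)"
    then show "\<exists>y\<in>carrier (fixed_part M e). y \<oplus>\<^bsub>fixed_part M e\<^esub> x = \<zero>\<^bsub>fixed_part M e\<^esub>"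
      by (intro bexI[of _ "\<ominus>\<^bsub>M\<^esub> x"]) (auto simp: e' ab.l_neg)
  qed (auto simp: e' ab.a_assoc intro: ab.a_comm)
  then show ?thesis
    by (intro left_module.intro left_module_axioms.intro left_module_ring[OF M])
      (auto simp: e' M.smult_closed M.smult_l_distr M.smult_r_distr M.smult_assoc M.smult_one)
qed

lemma fixed_part_hom:
  assumes "left_module R M" "e \<in> lin_maps R M M" "f \<in> lin_maps R M N" "\<And>x. x \<in> carrier M ==> e' (f x) = f x"
  shows "restrict f (carrier (fixed_part M e)) \<in> lmod_hom R (fixed_part M e) (fixed_part N e')"
  by (rule lmod_homI[OF fixed_part_left_module[OF assms(1,2)] add_homI])
    (use assms(4) lin_mapsD[OF assms(3)] add_hom_add[OF lin_mapsD(1)[OF assms(3)]] in auto)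

lemma fixed_part_hom':
  assumes "left_module R M" "e \<in> lin_maps R M M" "f \<in> lin_maps R M N"
  shows "restrict f (carrier (fixed_part M e)) \<in> lmod_hom R (fixed_part M e) N"
  by (rule lmod_homI[OF fixed_part_left_module[OF assms(1,2)] add_homI])
    (use lin_mapsD[OF assms(3)] add_hom_add[OF lin_mapsD(1)[OF assms(3)]] in auto)

text \<open>Finite generation is stated with a set of generators and coefficients indexed by its
  elements, while \<open>p\<close> may send several basis vectors to the same generator.\<close>

lemma fg_image:
  assumes M: "left_module R M" and p: "p \<in> lin_maps R (free_module R {..<m::nat}) M"
    and onto: "carrier M \<subseteq> p ` carrier (free_module R {..<m})"
  shows "finitely_generated_module R M"
proof -
  interpret R: ring R by (rule left_module_ring[OF M])
  interpret ab: abelian_group M by (rule lmod_abelian[OF M])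
  interpret M: left_module R M by (rule M)
  note F = free_module_left_module[OF R.ring_axioms, of "{..<m}"]
  note abF = lmod_abelian[OF F]
  define b where "b i = p (sing R i \<one>\<^bsub>R\<^esub>)" for i
  let ?S = "b ` {..<m}"
  have sF: "sing R i r \<in> carrier (free_module R {..<m})" if "i < m" "r \<in> carrier R" for i r
    using fin_supp_sing[OF R.is_abelian_group _ that(2), of i "{..<m}"] that(1) by simp
  have S: "?S \<subseteq> carrier M" using lin_mapsD(3)[OF p sF] by (auto simp: b_def)
  note lS = free_module_left_module[OF R.ring_axioms, of ?S]
  have s1: "sing R (b i) \<one>\<^bsub>R\<^esub> \<in> carrier (free_module R ?S)" if "i \<in> {..<m}" for i
    using fin_supp_sing[OF R.is_abelian_group _ R.one_closed, of "b i" ?S] that by simp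
  \<comment> \<open>This map adds up the coefficients of all basis vectors with the same
    image.\<close>
  obtain u where u: "u \<in> lmod_hom R (free_module R {..<m}) (free_module R ?S)"
    "\<And>i r. i \<in> {..<m} ==> r \<in> carrier R ==> u (sing R i r) = r \<odot>\<^bsub>free_module R ?S\<^esub> sing R (b i) \<one>\<^bsub>R\<^esub>"
    by (rule free_module_lift[OF lS s1]) (assumption, rule that)
  have g: "(\<lambda>w. \<Oplus>\<^bsub>M\<^esub>s\<in>?S. w s \<odot>\<^bsub>M\<^esub> s) \<in> add_hom (free_module R ?S) M"
    by (rule add_hom_sum[OF lmod_abelian[OF lS] lmod_abelian[OF M] add_hom_comp[OF free_module_lookup_add_hom[OF R.is_abelian_group] left_module_scalar_add_hom[OF M]]])
      (use S in blast)
  have pu: "p v = (\<Oplus>\<^bsub>M\<^esub>s\<in>?S. u v s \<odot>\<^bsub>M\<^esub> s)" if v: "v \<in> carrier (free_module R {..<m})" for v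
  proof (rule add_hom_eqI[OF free_module_spans[OF R.is_abelian_group] abF lmod_abelian[OF M] lin_mapsD(1)[OF p] add_hom_comp[OF lmod_hom_add_hom[OF u(1)] g] _ v])
    fix v assume "v \<in> {sing R i r | i r. i \<in> {..<m} \<and> r \<in> carrier R}"
    then obtain i r where v: "v = sing R i r" "i \<in> {..<m}" "r \<in> carrier R" by blast
    have "v = r \<odot>\<^bsub>free_module R {..<m}\<^esub> sing R i \<one>\<^bsub>R\<^esub>" using v(1,3) by (auto simp: sing_def)
    then have "p v = r \<odot>\<^bsub>M\<^esub> b i" using lin_mapsD(2)[OF p v(3) sF[OF _ R.one_closed]] v(2) by (simp add: b_def del: free_module_simps)
    also have "\<dots> = (\<Oplus>\<^bsub>M\<^esub>s\<in>?S. if b i = s then r \<odot>\<^bsub>M\<^esub> s else \<zero>\<^bsub>M\<^esub>)"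
      by (rule ab.finsum_singleton[symmetric]) (use v S in \<open>auto intro!: M.smult_closed\<close>)
    also have "\<dots> = (\<Oplus>\<^bsub>M\<^esub>s\<in>?S. sing R (b i) r s \<odot>\<^bsub>M\<^esub> s)"
      using S v add_hom_zero[OF R.is_abelian_group lmod_abelian[OF M] left_module_scalar_add_hom[OF M]]
      by (intro ab.finsum_cong'[OF refl]) (auto simp: sing_def intro!: M.smult_closed)
    also have "sing R (b i) r = u v" using v by (auto simp: u(2)[OF v(2,3)] sing_def[of R "b i"])
    finally show "p v = (\<Oplus>\<^bsub>M\<^esub>s\<in>?S. u v s \<odot>\<^bsub>M\<^esub> s)" .
  qed
  have "\<exists>c\<in>?S \<rightarrow> carrier R. x = (\<Oplus>\<^bsub>M\<^esub>s\<in>?S. c s \<odot>\<^bsub>M\<^esub> s)" if x: "x \<in> carrier M" for x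
  proof -
    obtain v where v: "v \<in> carrier (free_module R {..<m})" "x = p v" using x onto by blast
    have "u v \<in> ?S \<rightarrow> carrier R" using lmod_hom_closed[OF u(1) v(1)] by (auto dest: fin_suppD(1))
    then show ?thesis using pu[OF v(1)] v(2) by blast
  qed
  then show ?thesis unfolding finitely_generated_module_def using M S by (intro conjI exI[of _ ?S]) auto
qed

text \<open>The index set \<open>{..<m}\<close> has to be transported into the type of the elements of \<open>M\<close>.\<close>

lemma projective_retract:
  fixes R :: "('r, 's) ring_scheme" and M :: "('r, nat \<Rightarrow> 'r) module"
  assumes M: "left_module R M" and ab: "(a::'r) \<noteq> b"
    and i: "i \<in> lin_maps R M (free_module R {..<m::nat})" and p: "p \<in> lin_maps R (free_module R {..<m}) M"
    and pi: "\<And>x. x \<in> carrier M ==> p (i x) = x"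
  shows "projective_module R M"
proof -
  interpret R: ring R by (rule left_module_ring[OF M])
  \<comment> \<open>Two distinct values in the type of ring elements give pairwise distinct
    functions, even if the ring itself is zero.\<close>
  define j :: "nat \<Rightarrow> nat \<Rightarrow> 'r" where "j n = (\<lambda>x. if x = n then a else b)" for n
  have inj: "j n = j n' \<longleftrightarrow> n = n'" for n n' using ab by (metis j_def)
  let ?I = "j ` {..<m}"
  note lF = free_module_left_module[OF R.ring_axioms, of "{..<m}"] and lI = free_module_left_module[OF R.ring_axioms, of ?I]
  have s1: "sing R (j n) \<one>\<^bsub>R\<^esub> \<in> carrier (free_module R ?I)" if "n \<in> {..<m}" for n
    using fin_supp_sing[OF R.is_abelian_group _ R.one_closed, of "j n" ?I] that by simp
  have s2: "sing R (THE n. x = j n) \<one>\<^bsub>R\<^esub> \<in> carrier (free_module R {..<m})" if "x \<in> ?I" for x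
    using that fin_supp_sing[OF R.is_abelian_group _ R.one_closed, of _ "{..<m}"] by (auto simp: inj)
  obtain u where u: "u \<in> lmod_hom R (free_module R {..<m}) (free_module R ?I)"
    "\<And>n r. n \<in> {..<m} ==> r \<in> carrier R ==> u (sing R n r) = r \<odot>\<^bsub>free_module R ?I\<^esub> sing R (j n) \<one>\<^bsub>R\<^esub>"
    by (rule free_module_lift[OF lI s1]) (assumption, rule that)
  obtain w where w: "w \<in> lmod_hom R (free_module R ?I) (free_module R {..<m})"
    "\<And>x r. x \<in> ?I ==> r \<in> carrier R ==> w (sing R x r) = r \<odot>\<^bsub>free_module R {..<m}\<^esub> sing R (THE n. x = j n) \<one>\<^bsub>R\<^esub>"
    by (rule free_module_lift[OF lF s2]) (assumption, rule that)
  have one: "r \<odot>\<^bsub>free_module R I\<^esub> sing R x \<one>\<^bsub>R\<^esub> = sing R x r" if "r \<in> carrier R" for I x r using that by (auto simp: sing_def)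
  have wu: "w (u v) = v" if "v \<in> carrier (free_module R {..<m})" for v
  proof (rule add_hom_eqI[OF free_module_spans[OF R.is_abelian_group] lmod_abelian[OF lF] lmod_abelian[OF lF]
        add_hom_comp[OF lmod_hom_add_hom[OF u(1)] lmod_hom_add_hom[OF w(1)]] add_hom_id _ that])
    fix v assume "v \<in> {sing R i r | i r. i \<in> {..<m} \<and> r \<in> carrier R}"
    then obtain n r where "v = sing R n r" "n \<in> {..<m}" "r \<in> carrier R" by blast
    then show "w (u v) = v" using u(2)[of n r] w(2)[of "j n" r] by (simp only: one) (simp add: inj one del: free_module_simps)
  qed
  note ui = lin_comp[OF i lmod_hom_lin[OF u(1)]] and pw = lin_comp[OF lmod_hom_lin[OF w(1)] p]
  show ?thesis
    unfolding projective_module_def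
  proof (intro conjI M exI ballI)
    show "restrict (\<lambda>x. u (i x)) (carrier M) \<in> lmod_hom R M (free_module R ?I)" by (rule lin_restrict[OF M ui])
    show "restrict (\<lambda>x. p (w x)) (carrier (free_module R ?I)) \<in> lmod_hom R (free_module R ?I) M"
      by (rule lin_restrict[OF lI pw])
    fix x assume x: "x \<in> carrier M"
    have "u (i x) \<in> carrier (free_module R ?I)" by (rule lin_mapsD(3)[OF ui x])
    then show "restrict (\<lambda>x. p (w x)) (carrier (free_module R ?I)) (restrict (\<lambda>x. u (i x)) (carrier M) x) = x"
      using x wu[OF lin_mapsD(3)[OF i x]] pi[OF x] by (simp del: free_module_simps)
  qed
qed

text \<open>A resolution of \<open>M\<close> by the images of the idempotents \<open>e n\<close> on free modules of rank \<open>m n\<close>,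
  together with an additive contraction given by \<open>s\<close> and \<open>t\<close>.\<close>

locale split_resolution =
  fixes R :: "('r, 's) ring_scheme" and M :: "('r, 'm) module" and m :: "nat \<Rightarrow> nat"
    and e d s :: "nat \<Rightarrow> (nat \<Rightarrow> 'r) \<Rightarrow> nat \<Rightarrow> 'r" and \<epsilon> t l
  assumes lM: "left_module R M"
    and e: "\<And>n. e n \<in> lin_maps R (free_module R {..<m n}) (free_module R {..<m n})"
    and d: "\<And>n. d n \<in> lin_maps R (free_module R {..<m (Suc n)}) (free_module R {..<m n})"
    and \<epsilon>: "\<epsilon> \<in> lin_maps R (free_module R {..<m 0}) M"
    and s: "\<And>n. s n \<in> add_hom (free_module R {..<m n}) (free_module R {..<m (Suc n)})"
    and t: "t \<in> add_hom M (free_module R {..<m 0})"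
    and e_e: "\<And>n x. x \<in> carrier (free_module R {..<m n}) ==> e n (e n x) = e n x"
    and e_d: "\<And>n x. x \<in> carrier (free_module R {..<m (Suc n)}) ==> e n (d n x) = d n x"
    and d_e: "\<And>n x. x \<in> carrier (free_module R {..<m (Suc n)}) ==> d n (e (Suc n) x) = d n x"
    and d_d: "\<And>n x. x \<in> carrier (free_module R {..<m (Suc (Suc n))}) ==> d n (d (Suc n) x) = \<zero>\<^bsub>free_module R {..<m n}\<^esub>"
    and \<epsilon>_e: "\<And>x. x \<in> carrier (free_module R {..<m 0}) ==> \<epsilon> (e 0 x) = \<epsilon> x"
    and \<epsilon>_d: "\<And>x. x \<in> carrier (free_module R {..<m (Suc 0)}) ==> \<epsilon> (d 0 x) = \<zero>\<^bsub>M\<^esub>"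
    and \<epsilon>_t: "\<And>y. y \<in> carrier M ==> \<epsilon> (t y) = y"
    and e_0: "\<And>x. x \<in> carrier (free_module R {..<m 0}) ==> e 0 x = d 0 (s 0 x) \<oplus>\<^bsub>free_module R {..<m 0}\<^esub> t (\<epsilon> x)"
    and e_Suc: "\<And>n x. x \<in> carrier (free_module R {..<m (Suc n)}) ==>
      e (Suc n) x = d (Suc n) (s (Suc n) x) \<oplus>\<^bsub>free_module R {..<m (Suc n)}\<^esub> s n (d n x)"
    and e_top: "\<And>n x. n > l ==> x \<in> carrier (free_module R {..<m n}) ==> e n x = \<zero>\<^bsub>free_module R {..<m n}\<^esub>"
begin

abbreviation "F n \<equiv> free_module R {..<m n}"

text \<open>The modules are the images of the idempotents. Exactness concerns only the underlying
  abelian groups, so an additive contraction is enough.\<close>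

theorem type_FP:
  assumes "(a::'r) \<noteq> b" shows "module_type_FP R M"
proof -
  note lF = free_module_left_module[OF left_module_ring[OF lM]]
  interpret F: abelian_group "F n" for n by (rule lmod_abelian[OF lF])
  define Q where "Q n = fixed_part (F n) (e n)" for n
  define \<delta> where "\<delta> n = restrict (d n) (carrier (Q (Suc n)))" for n
  define \<eta> where "\<eta> = restrict \<epsilon> (carrier (Q 0))"
  have Q: "x \<in> carrier (Q n) \<longleftrightarrow> x \<in> carrier (F n) \<and> e n x = x" and Q0: "\<zero>\<^bsub>Q n\<^esub> = \<zero>\<^bsub>F n\<^esub>" for n x by (simp_all add: Q_def)
  have lQ: "left_module R (Q n)" for n unfolding Q_def by (rule fixed_part_left_module[OF lF e])
  have eQ: "e n x \<in> carrier (Q n)" if "x \<in> carrier (F n)" for n x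
    unfolding Q using e_e[OF that] lin_mapsD(3)[OF e that] by (intro conjI)
  have e_lin: "e n \<in> lin_maps R (F n) (Q n)" for n
    by (rule lin_mapsI[OF add_homI[OF eQ]])
      (use add_hom_add[OF lin_mapsD(1)[OF e], of _ n] lin_mapsD(2)[OF e, of _ _ n] in \<open>simp_all add: Q_def del: free_module_simps\<close>)
  have i_lin: "(\<lambda>x. x) \<in> lin_maps R (Q n) (F n)" for n
    by (rule lin_mapsI[OF add_homI]) (simp_all add: Q_def del: free_module_simps)
  have \<delta>_hom: "\<delta> n \<in> lmod_hom R (Q (Suc n)) (Q n)" for n
    unfolding \<delta>_def Q_def by (rule fixed_part_hom[OF lF e d e_d])
  have \<eta>_hom: "\<eta> \<in> lmod_hom R (Q 0) M"
    unfolding \<eta>_def Q_def by (rule fixed_part_hom'[OF lF e \<epsilon>])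
  have d0: "d n \<zero>\<^bsub>F (Suc n)\<^esub> = \<zero>\<^bsub>F n\<^esub>" for n by (rule lin_zero[OF lF lF d])
  have s0: "s n \<zero>\<^bsub>F n\<^esub> = \<zero>\<^bsub>F (Suc n)\<^esub>" for n by (rule add_hom_zero[OF F.abelian_group_axioms F.abelian_group_axioms s])
  have t0: "t \<zero>\<^bsub>M\<^esub> = \<zero>\<^bsub>F 0\<^esub>" by (rule add_hom_zero[OF lmod_abelian[OF lM] F.abelian_group_axioms t])
  \<comment> \<open>The contraction need not take values in the fixed part; since \<open>d\<close>
    absorbs the idempotent, \<open>x\<close> may be replaced by its projection.\<close>
  have im: "d n x \<in> \<delta> n ` carrier (Q (Suc n))" if x: "x \<in> carrier (F (Suc n))" for n x
  proof (rule image_eqI[OF _ eQ[OF x]])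
    show "d n x = \<delta> n (e (Suc n) x)" unfolding \<delta>_def using d_e[OF x] eQ[OF x] by simp
  qed
  have top: "carrier (Q n) = {\<zero>\<^bsub>Q n\<^esub>}" if "n > l" for n
  proof
    show "carrier (Q n) \<subseteq> {\<zero>\<^bsub>Q n\<^esub>}"
    proof
      fix x assume "x \<in> carrier (Q n)"
      then show "x \<in> {\<zero>\<^bsub>Q n\<^esub>}" using e_top[OF that, of x] unfolding Q Q0 by auto
    qed
    show "{\<zero>\<^bsub>Q n\<^esub>} \<subseteq> carrier (Q n)" unfolding Q0 using Q lin_zero[OF lF lF e] by blast
  qed
  have fg: "finitely_generated_module R (Q n)" for n
  proof (rule fg_image[OF lQ e_lin])
    show "carrier (Q n) \<subseteq> e n ` carrier (F n)"
    proof
      fix x assume "x \<in> carrier (Q n)"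
      then show "x \<in> e n ` carrier (F n)" unfolding Q by (intro image_eqI[of _ _ x]) auto
    qed
  qed
  have pr: "projective_module R (Q n)" for n
    by (rule projective_retract[OF lQ assms i_lin e_lin]) (simp only: Q)
  have onto: "\<eta> ` carrier (Q 0) = carrier M"
  proof
    show "\<eta> ` carrier (Q 0) \<subseteq> carrier M" using lmod_hom_closed[OF \<eta>_hom] by blast
    show "carrier M \<subseteq> \<eta> ` carrier (Q 0)"
    proof
      fix y assume y: "y \<in> carrier M"
      have ty: "t y \<in> carrier (F 0)" by (rule add_hom_closed[OF t y])
      show "y \<in> \<eta> ` carrier (Q 0)"
        by (rule image_eqI[OF _ eQ[OF ty]]) (simp only: \<eta>_def restrict_apply' eQ[OF ty] \<epsilon>_e[OF ty] \<epsilon>_t[OF y])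
    qed
  qed
  have ex0: "{x \<in> carrier (Q 0). \<eta> x = \<zero>\<^bsub>M\<^esub>} = \<delta> 0 ` carrier (Q (Suc 0))"
  proof (intro equalityI subsetI)
    fix x assume "x \<in> {x \<in> carrier (Q 0). \<eta> x = \<zero>\<^bsub>M\<^esub>}"
    then have x: "x \<in> carrier (F 0)" "e 0 x = x" "\<epsilon> x = \<zero>\<^bsub>M\<^esub>" unfolding \<eta>_def using Q by auto
    have sx: "s 0 x \<in> carrier (F (Suc 0))" by (rule add_hom_closed[OF s x(1)])
    \<comment> \<open>On a fixed point in the kernel of the augmentation the contraction identity
      loses its second term.\<close>
    have "x = d 0 (s 0 x)" using e_0[OF x(1)] x(2) F.r_zero[OF lin_mapsD(3)[OF d sx]] unfolding x(3) t0 by simp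
    then show "x \<in> \<delta> 0 ` carrier (Q (Suc 0))" using im[OF sx] by simp
  next
    fix x assume "x \<in> \<delta> 0 ` carrier (Q (Suc 0))"
    then obtain y where y: "y \<in> carrier (Q (Suc 0))" "x = \<delta> 0 y" by blast
    have "x = d 0 y" "y \<in> carrier (F (Suc 0))" using y Q by (simp_all add: \<delta>_def)
    moreover have "x \<in> carrier (Q 0)" unfolding y(2) by (rule lmod_hom_closed[OF \<delta>_hom y(1)])
    ultimately show "x \<in> {x \<in> carrier (Q 0). \<eta> x = \<zero>\<^bsub>M\<^esub>}" using \<epsilon>_d by (simp add: \<eta>_def)
  qed
  have ex: "{x \<in> carrier (Q (Suc n)). \<delta> n x = \<zero>\<^bsub>Q n\<^esub>} = \<delta> (Suc n) ` carrier (Q (Suc (Suc n)))" for n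
  proof (intro equalityI subsetI)
    fix x assume "x \<in> {x \<in> carrier (Q (Suc n)). \<delta> n x = \<zero>\<^bsub>Q n\<^esub>}"
    then have x: "x \<in> carrier (F (Suc n))" "e (Suc n) x = x" "d n x = \<zero>\<^bsub>F n\<^esub>" unfolding \<delta>_def using Q Q0 by auto
    have sx: "s (Suc n) x \<in> carrier (F (Suc (Suc n)))" by (rule add_hom_closed[OF s x(1)])
    have "x = d (Suc n) (s (Suc n) x)" using e_Suc[OF x(1)] x(2) F.r_zero[OF lin_mapsD(3)[OF d sx]] unfolding x(3) s0 by simp
    then show "x \<in> \<delta> (Suc n) ` carrier (Q (Suc (Suc n)))" using im[OF sx] by simp
  next
    fix x assume "x \<in> \<delta> (Suc n) ` carrier (Q (Suc (Suc n)))"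
    then obtain y where y: "y \<in> carrier (Q (Suc (Suc n)))" "x = \<delta> (Suc n) y" by blast
    have "x = d (Suc n) y" "y \<in> carrier (F (Suc (Suc n)))" using y Q by (simp_all add: \<delta>_def)
    moreover have "x \<in> carrier (Q (Suc n))" unfolding y(2) by (rule lmod_hom_closed[OF \<delta>_hom y(1)])
    ultimately show "x \<in> {x \<in> carrier (Q (Suc n)). \<delta> n x = \<zero>\<^bsub>Q n\<^esub>}" using d_d[of y n] Q0 by (simp add: \<delta>_def del: free_module_simps)
  qed
  show ?thesis
    unfolding module_type_FP_def
    by (intro conjI exI[of _ Q] exI[of _ \<delta>] exI[of _ \<eta>] exI[of _ l] lM allI impI fg pr top \<delta>_hom \<eta>_hom onto ex0 ex)
qed

end

text \<open>The cancellation behind the contraction of \<open>P\<close>: the error of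
  \<open>g \<circ> f\<close> from the identity, the cone term and the homotopy term each occur twice
  with opposite signs.\<close>

lemma (in abelian_group) telescope:
  assumes "x \<in> carrier G" "y \<in> carrier G" "z \<in> carrier G" "w \<in> carrier G"
  shows "((y \<ominus> z) \<oplus> ((x \<ominus> y) \<ominus> w)) \<oplus> (z \<oplus> w) = x" and "((y \<ominus> z) \<oplus> (x \<ominus> y)) \<oplus> z = x"
  using assms by (simp_all add: minus_eq a_ac r_neg r_neg1 r_neg2 l_neg)

text \<open>Finitely many generators give a surjection from a free module of finite rank, and
  projectivity splits it. The free module in the definition of projectivity itself may have infinite
  rank.\<close>

lemma fg_projective_retract:
  assumes fg: "finitely_generated_module R M" and pr: "projective_module R M"
  obtains m i p where "i \<in> lin_maps R M (free_module R {..<m::nat})" "p \<in> lin_maps R (free_module R {..<m}) M"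
    "\<And>x. x \<in> carrier M ==> p (i x) = x"
proof -
  have M: "left_module R M" using fg by (simp add: finitely_generated_module_def)
  interpret R: ring R by (rule left_module_ring[OF M])
  note abM = lmod_abelian[OF M]
  interpret ab: abelian_group M by (rule abM)
  obtain B where B: "B \<subseteq> carrier M" "finite B" "\<And>x. x \<in> carrier M ==> \<exists>c\<in>B \<rightarrow> carrier R. x = (\<Oplus>\<^bsub>M\<^esub>s\<in>B. c s \<odot>\<^bsub>M\<^esub> s)"
    using fg unfolding finitely_generated_module_def by (elim conjE exE) (rule that; blast)
  obtain b where b: "bij_betw b {0..<card B} B" using ex_bij_betw_nat_finite[OF B(2)] by blast
  define m where "m = card B"
  have b': "b n \<in> carrier M" if "n \<in> {..<m}" for n using b B(1) that by (auto simp: m_def bij_betw_def)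
  note lF = free_module_left_module[OF R.ring_axioms, of "{..<m}"]
  obtain p where p: "p \<in> lmod_hom R (free_module R {..<m}) M"
    "\<And>n r. n \<in> {..<m} ==> r \<in> carrier R ==> p (sing R n r) = r \<odot>\<^bsub>M\<^esub> b n"
    by (rule free_module_lift[OF M b']) (assumption, rule that)
  have onto: "x \<in> p ` carrier (free_module R {..<m})" if x: "x \<in> carrier M" for x
  proof -
    obtain c where c: "c \<in> B \<rightarrow> carrier R" "x = (\<Oplus>\<^bsub>M\<^esub>s\<in>B. c s \<odot>\<^bsub>M\<^esub> s)" using B(3)[OF x] by blast
    let ?n = "inv_into {0..<card B} b"
    let ?v = "\<lambda>s. sing R (?n s) (c s)"
    have n: "?n s \<in> {..<m}" "b (?n s) = s" if "s \<in> B" for s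
      using b that inv_into_into[of s b "{0..<card B}"] f_inv_into_f[of s b "{0..<card B}"] by (auto simp: m_def bij_betw_def)
    have v: "?v s \<in> carrier (free_module R {..<m})" if "s \<in> B" for s
      using fin_supp_sing[OF R.is_abelian_group n(1)[OF that], of "c s"] c(1) that by auto
    have "p (\<Oplus>\<^bsub>free_module R {..<m}\<^esub>s\<in>B. ?v s) = (\<Oplus>\<^bsub>M\<^esub>s\<in>B. p (?v s))"
      by (rule add_hom_finsum[OF lmod_abelian[OF lF] abM lmod_hom_add_hom[OF p(1)] v])
    also have "\<dots> = x"
      unfolding c(2) by (rule ab.finsum_cong'[OF refl])
        (use c(1) n p(2) B(1) in \<open>auto simp: Pi_iff intro!: left_module.smult_closed[OF M]\<close>)
    finally have "x = p (\<Oplus>\<^bsub>free_module R {..<m}\<^esub>s\<in>B. ?v s)" ..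
    moreover have "(\<Oplus>\<^bsub>free_module R {..<m}\<^esub>s\<in>B. ?v s) \<in> carrier (free_module R {..<m})"
      by (rule abelian_monoid.finsum_closed[OF abelian_group.axioms(1)[OF lmod_abelian[OF lF]]]) (use v in auto)
    ultimately show ?thesis by (rule image_eqI)
  qed
  obtain i where i: "i \<in> lmod_hom R M (free_module R {..<m})" "\<And>x. x \<in> carrier M ==> p (i x) = restrict (\<lambda>x. x) (carrier M) x"
    by (rule projective_lift[OF pr M lF p(1) lmod_hom_id[OF M]]) (use onto in auto)
  show ?thesis by (rule that[OF lmod_hom_lin[OF i(1)] lmod_hom_lin[OF p(1)]]) (simp add: i(2))
qed

context fp_comparison
begin

text \<open>The cone contraction of the standard resolution is carried over to \<open>P\<close>
  through the comparison maps and then to free modules through the retractions \<open>i\<close> and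
  \<open>p\<close>.\<close>

lemma split_resolution_exists:
  obtains m e d s \<epsilon>' t where "split_resolution R Zt m e d s \<epsilon>' t l"
proof -
  have "\<exists>m i p. i \<in> lin_maps R (P n) (free_module R {..<m::nat}) \<and> p \<in> lin_maps R (free_module R {..<m}) (P n) \<and>
      (\<forall>x\<in>carrier (P n). p (i x) = x)" for n
    by (rule fg_projective_retract[OF P_fg P_proj]) blast
  then obtain m i p where ip: "\<And>n. i n \<in> lin_maps R (P n) (free_module R {..<m n :: nat})"
      "\<And>n. p n \<in> lin_maps R (free_module R {..<m n}) (P n)" "\<And>n x. x \<in> carrier (P n) ==> p n (i n x) = x"
    by metis
  note i = ip(1) and p = ip(2) and pi = ip(3) and lP = P.lmod
  interpret ab: abelian_group "P n" for n by (rule lmod_abelian[OF lP])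
  note abP = ab.abelian_group_axioms
  have fl: "f n x \<in> carrier (S n)" if "x \<in> carrier (P n)" for n x by (rule lmod_hom_closed[OF f(1) that])
  have gl: "g n u \<in> carrier (P n)" if "u \<in> carrier (S n)" for n u by (rule lmod_hom_closed[OF g(1) that])
  have kl: "k n x \<in> carrier (P (Suc n))" if "x \<in> carrier (P n)" for n x by (rule lmod_hom_closed[OF k(1) that])
  have dl: "\<delta> n x \<in> carrier (P n)" if "x \<in> carrier (P (Suc n))" for n x by (rule lmod_hom_closed[OF P.d_hom that])
  note g_add = lmod_hom_add_hom[OF g(1)]
  \<comment> \<open>The transported cone contracts \<open>P\<close> only up to the difference of
    \<open>g \<circ> f\<close> from the identity, and the homotopy \<open>k\<close> supplies this
    correction.\<close>
  define s' where "s' n x = g (Suc n) (cone \<one> (f n x)) \<oplus>\<^bsub>P (Suc n)\<^esub> k n x" for n x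
  \<comment> \<open>The additive section of the augmentation comes from \<open>z\<close> times the
    tuple with the single entry 1.\<close>
  define t' where "t' z = g 0 (frag_cmul z (frag_of [\<one>]))" for z
  have cn: "cone \<one> \<in> add_hom (S n) (S (Suc n))" for n using cone_hom[of "\<one>" "Suc n"] by (simp add: S_add_hom)
  have s'_hom: "s' n \<in> add_hom (P n) (P (Suc n))" for n
    unfolding s'_def[abs_def]
    by (rule add_hom_plus[OF abP add_hom_comp[OF add_hom_comp[OF lmod_hom_add_hom[OF f(1)] cn] g_add] lmod_hom_add_hom[OF k(1)]])
  have w: "frag_cmul z (frag_of [\<one>]) \<in> carrier (S 0)" for z by (auto simp: Gs_def)
  have t'_hom: "t' \<in> add_hom Zt (P 0)"
    unfolding t'_def[abs_def] by (rule add_hom_comp[OF add_homI[OF w] g_add]) (simp add: trivial_int_module_def frag_cmul_distrib)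
  have bdg: "\<delta> n (g (Suc n) (cone \<one> u)) = g n u \<ominus>\<^bsub>P n\<^esub> g n (cone \<one> (bd u))" if u: "u \<in> carrier (S n)" "cone \<one> (bd u) \<in> carrier (S n)" for n u
  proof -
    have c: "cone \<one> u \<in> carrier (S (Suc n))" by (rule cone_closed[OF G.one_closed u(1)])
    have "\<delta> n (g (Suc n) (cone \<one> u)) = g n (u \<ominus>\<^bsub>S n\<^esub> cone \<one> (bd u))"
      unfolding g(3)[OF c] S_minus[OF u] using c by (simp add: bd_cone del: S_simps)
    then show ?thesis using add_hom_minus[OF S_abelian abP g_add u] by simp
  qed
  have con: "\<delta> (Suc n) (s' (Suc n) x) \<oplus>\<^bsub>P (Suc n)\<^esub> s' n (\<delta> n x) = x" if x: "x \<in> carrier (P (Suc n))" for n x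
  proof -
    have bu: "bd (f (Suc n) x) = f n (\<delta> n x)" using f(3)[OF x] fl[OF x] by (simp del: S_simps)
    have c: "cone \<one> (f n (\<delta> n x)) \<in> carrier (S (Suc n))" by (rule cone_closed[OF G.one_closed fl[OF dl[OF x]]])
    have "\<delta> (Suc n) (s' (Suc n) x) = \<delta> (Suc n) (g (Suc (Suc n)) (cone \<one> (f (Suc n) x))) \<oplus>\<^bsub>P (Suc n)\<^esub> \<delta> (Suc n) (k (Suc n) x)"
      unfolding s'_def by (rule add_hom_add[OF lmod_hom_add_hom[OF P.d_hom] gl[OF cone_closed[OF G.one_closed fl[OF x]]] kl[OF x]])
    also have "\<dots> = (g (Suc n) (f (Suc n) x) \<ominus>\<^bsub>P (Suc n)\<^esub> g (Suc n) (cone \<one> (f n (\<delta> n x)))) \<oplus>\<^bsub>P (Suc n)\<^esub>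
        ((x \<ominus>\<^bsub>P (Suc n)\<^esub> g (Suc n) (f (Suc n) x)) \<ominus>\<^bsub>P (Suc n)\<^esub> k n (\<delta> n x))"
      using bdg[OF fl[OF x]] c k(3)[OF x] by (simp only: bu)
    finally show ?thesis using ab.telescope(1)[OF x gl[OF fl[OF x]] gl[OF c] kl[OF dl[OF x]]] by (simp only: s'_def)
  qed
  have con0: "\<delta> 0 (s' 0 x) \<oplus>\<^bsub>P 0\<^esub> t' (\<epsilon> x) = x" if x: "x \<in> carrier (P 0)" for x
  proof -
    have "bd (f 0 x) = frag_cmul (\<epsilon> x) (frag_of [])"
      using bd_length_1[OF fl[OF x]] f(2)[OF x] fl[OF x] by (simp del: S_simps)
    then have bu: "cone \<one> (bd (f 0 x)) = frag_cmul (\<epsilon> x) (frag_of [\<one>])" by (simp add: cone_def frag_extend_cmul)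
    have "\<delta> 0 (s' 0 x) = \<delta> 0 (g (Suc 0) (cone \<one> (f 0 x))) \<oplus>\<^bsub>P 0\<^esub> \<delta> 0 (k 0 x)"
      unfolding s'_def by (rule add_hom_add[OF lmod_hom_add_hom[OF P.d_hom] gl[OF cone_closed[OF G.one_closed fl[OF x]]] kl[OF x]])
    also have "\<dots> = (g 0 (f 0 x) \<ominus>\<^bsub>P 0\<^esub> t' (\<epsilon> x)) \<oplus>\<^bsub>P 0\<^esub> (x \<ominus>\<^bsub>P 0\<^esub> g 0 (f 0 x))"
      using bdg[OF fl[OF x], unfolded bu, OF w] k(2)[OF x] by (simp only: t'_def)
    finally show ?thesis using ab.telescope(2)[OF x gl[OF fl[OF x]] gl[OF w[of "\<epsilon> x"]] x] by (simp only: t'_def)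
  qed
  note dlin = lmod_hom_lin[OF P.d_hom] and \<epsilon>lin = lmod_hom_lin[OF P.e_hom]
  note lF = free_module_left_module[OF left_module_ring[OF P.lmod_aug]]
  have pc: "p n x \<in> carrier (P n)" if "x \<in> carrier (free_module R {..<m n})" for n x by (rule lin_mapsD(3)[OF p that])
  have i0: "i n \<zero>\<^bsub>P n\<^esub> = \<zero>\<^bsub>free_module R {..<m n}\<^esub>" for n by (rule lin_zero[OF lP lF i])
  have sc: "s' n x \<in> carrier (P (Suc n))" if "x \<in> carrier (P n)" for n x by (rule add_hom_closed[OF s'_hom that])
  have tc: "t' z \<in> carrier (P 0)" for z unfolding t'_def by (rule gl[OF w])
  \<comment> \<open>Every map of \<open>P\<close> is sandwiched between a projection and an
    inclusion; the identity of \<open>P n\<close> becomes the idempotent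
    \<open>i n \<circ> p n\<close>.\<close>
  have "split_resolution R Zt m (\<lambda>n x. i n (p n x)) (\<lambda>n x. i n (\<delta> n (p (Suc n) x))) (\<lambda>n x. i (Suc n) (s' n (p n x)))
      (\<lambda>x. \<epsilon> (p 0 x)) (\<lambda>z. i 0 (t' z)) l"
  proof (rule split_resolution.intro)
    show "left_module R Zt" by (rule P.lmod_aug)
    show "(\<lambda>x. i n (p n x)) \<in> lin_maps R (free_module R {..<m n}) (free_module R {..<m n})" for n by (rule lin_comp[OF p i])
    show "(\<lambda>x. i n (\<delta> n (p (Suc n) x))) \<in> lin_maps R (free_module R {..<m (Suc n)}) (free_module R {..<m n})" for n
      by (rule lin_comp[OF lin_comp[OF p dlin] i])
    show "(\<lambda>x. \<epsilon> (p 0 x)) \<in> lin_maps R (free_module R {..<m 0}) Zt" by (rule lin_comp[OF p \<epsilon>lin])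
    show "(\<lambda>x. i (Suc n) (s' n (p n x))) \<in> add_hom (free_module R {..<m n}) (free_module R {..<m (Suc n)})" for n
      by (rule add_hom_comp[OF add_hom_comp[OF lin_mapsD(1)[OF p] s'_hom] lin_mapsD(1)[OF i]])
    show "(\<lambda>z. i 0 (t' z)) \<in> add_hom Zt (free_module R {..<m 0})" by (rule add_hom_comp[OF t'_hom lin_mapsD(1)[OF i]])
    show "i n (p n x) = \<zero>\<^bsub>free_module R {..<m n}\<^esub>" if "l < n" "x \<in> carrier (free_module R {..<m n})" for n x
      using pc[OF that(2)] P_top[OF that(1)] i0[of n] by auto
    show "\<epsilon> (p 0 (i 0 (t' y))) = y" for y unfolding pi[OF tc] unfolding t'_def g(2)[OF w] using w[of y] by (simp add: aug_def frag_extend_cmul del: S_simps)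
    show "i (Suc n) (p (Suc n) x) = i (Suc n) (\<delta> (Suc n) (p (Suc (Suc n)) (i (Suc (Suc n)) (s' (Suc n) (p (Suc n) x)))))
        \<oplus>\<^bsub>free_module R {..<m (Suc n)}\<^esub> i (Suc n) (s' n (p n (i n (\<delta> n (p (Suc n) x)))))"
      if x: "x \<in> carrier (free_module R {..<m (Suc n)})" for n x
      unfolding pi[OF sc[OF pc[OF x]]] pi[OF dl[OF pc[OF x]]]
      using add_hom_add[OF lin_mapsD(1)[OF i] dl[OF sc[OF pc[OF x]]] sc[OF dl[OF pc[OF x]]]] con[OF pc[OF x]] by (simp only:)
    show "i 0 (p 0 x) = i 0 (\<delta> 0 (p (Suc 0) (i (Suc 0) (s' 0 (p 0 x))))) \<oplus>\<^bsub>free_module R {..<m 0}\<^esub> i 0 (t' (\<epsilon> (p 0 x)))"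
      if x: "x \<in> carrier (free_module R {..<m 0})" for x
      unfolding pi[OF sc[OF pc[OF x]]]
      using add_hom_add[OF lin_mapsD(1)[OF i] dl[OF sc[OF pc[OF x]]] tc[of "\<epsilon> (p 0 x)"]] con0[OF pc[OF x]] by (simp only:)
    show "\<epsilon> (p 0 (i 0 (\<delta> 0 (p (Suc 0) x)))) = \<zero>\<^bsub>Zt\<^esub>" if x: "x \<in> carrier (free_module R {..<m (Suc 0)})" for x
      unfolding pi[OF dl[OF pc[OF x]]] by (rule P.e_d[OF pc[OF x]])
    show "i n (\<delta> n (p (Suc n) (i (Suc n) (\<delta> (Suc n) (p (Suc (Suc n)) x))))) = \<zero>\<^bsub>free_module R {..<m n}\<^esub>"
      if x: "x \<in> carrier (free_module R {..<m (Suc (Suc n))})" for n x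
      unfolding pi[OF dl[OF pc[OF x]]] P.d_d[OF pc[OF x]] by (rule i0)
    show "i n (p n (i n (p n x))) = i n (p n x)" if "x \<in> carrier (free_module R {..<m n})" for n x
      unfolding pi[OF pc[OF that]] ..
    show "i n (p n (i n (\<delta> n (p (Suc n) x)))) = i n (\<delta> n (p (Suc n) x))" if "x \<in> carrier (free_module R {..<m (Suc n)})" for n x
      unfolding pi[OF dl[OF pc[OF that]]] ..
    show "i n (\<delta> n (p (Suc n) (i (Suc n) (p (Suc n) x)))) = i n (\<delta> n (p (Suc n) x))" if "x \<in> carrier (free_module R {..<m (Suc n)})" for n x
      unfolding pi[OF pc[OF that]] ..
    show "\<epsilon> (p 0 (i 0 (p 0 x))) = \<epsilon> (p 0 x)" if "x \<in> carrier (free_module R {..<m 0})" for x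
      unfolding pi[OF pc[OF that]] ..
  qed
  then show ?thesis by (rule that)
qed

end

lemma spans_mono:
  assumes "spans M B" "B \<subseteq> B'" "B' \<subseteq> carrier M" shows "spans M B'"
  unfolding spans_def
proof (intro conjI allI impI assms(3))
  fix H assume "H \<subseteq> carrier M" "\<zero>\<^bsub>M\<^esub> \<in> H" "B' \<subseteq> H" "\<forall>x\<in>H. \<ominus>\<^bsub>M\<^esub> x \<in> H" "\<forall>x\<in>H. \<forall>y\<in>H. x \<oplus>\<^bsub>M\<^esub> y \<in> H"
  then show "carrier M \<subseteq> H"
    using assms(1)[unfolded spans_def, THEN conjunct2, THEN spec, of H] subset_trans[OF assms(2)] by simp
qed

lemma spans_sing:
  assumes R: "abelian_group R" and B: "spans R B"
  shows "spans (free_module R I) {sing R i b | i b. i \<in> I \<and> b \<in> B}"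
proof (rule spans_trans[OF free_module_abelian_group[OF R] free_module_spans[OF R]])
  have B': "B \<subseteq> carrier R" using spans_subset[OF B] by blast
  show "{sing R i b | i b. i \<in> I \<and> b \<in> B} \<subseteq> carrier (free_module R I)"
    using B' by (auto intro: fin_supp_sing[OF R])
  fix Q v
  assume v: "v \<in> {sing R i r | i r. i \<in> I \<and> r \<in> carrier R}"
    and Q: "Q \<zero>\<^bsub>free_module R I\<^esub>" "\<And>b. b \<in> {sing R i b | i b. i \<in> I \<and> b \<in> B} ==> Q b"
    "\<And>x. x \<in> carrier (free_module R I) ==> Q x ==> Q (\<ominus>\<^bsub>free_module R I\<^esub> x)"
    "\<And>x y. x \<in> carrier (free_module R I) ==> y \<in> carrier (free_module R I) ==> Q x ==> Q y ==> Q (x \<oplus>\<^bsub>free_module R I\<^esub> y)"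
  obtain i r where i: "v = sing R i r" "i \<in> I" "r \<in> carrier R" using v by blast
  note s = sing_add_hom[OF R i(2)]
  show "Q v"
    unfolding i(1) using B R i(3)
  proof (induction r rule: spans_induct)
    case zero
    then show ?case using Q(1) add_hom_zero[OF R free_module_abelian_group[OF R] s] by simp
  next
    case (base b)
    then show ?case using i(2) Q(2) by blast
  next
    case (neg x)
    show ?case unfolding add_hom_neg[OF R free_module_abelian_group[OF R] s neg(1)] by (rule Q(3)[OF add_hom_closed[OF s neg(1)] neg(2)])
  next
    case (add x y)
    show ?case unfolding add_hom_add[OF s add(1,2)]
      by (rule Q(4)[OF add_hom_closed[OF s add(1)] add_hom_closed[OF s add(2)] add(3,4)])
  qed
qed

context galg
begin

section \<open>Induction from the group ring to the enveloping algebra\<close>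

text \<open>The ring homomorphism from the integral group ring to the enveloping algebra given by
  \<open>g \<mapsto> g \<otimes> inv g\<close>; its multiplicativity is used in the form
  \<open>\<omega>_del_mult\<close>.\<close>

definition \<omega> :: "('g \<Rightarrow> int) \<Rightarrow> ('g, 'k) tensors" where
  "\<omega> = (SOME h. h \<in> add_hom R (Bar 0) \<and> (\<forall>g\<in>\<G>. h (del g) = cj g))"

lemma \<omega>: "\<omega> \<in> add_hom R (Bar 0)" "g \<in> \<G> ==> \<omega> (del g) = cj g"
proof -
  have pw: "(\<lambda>z::int. [z] \<cdot>\<^bsub>Bar 0\<^esub> cj g) \<in> add_hom \<Z> (Bar 0)" if "g \<in> \<G>" for g
    by (rule int_pow_add_hom[OF Bar_abelian cj_closed[OF that]])
  obtain h where h: "h \<in> add_hom (free_module \<Z> (\<G>)) (Bar 0)"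
    "\<And>g z. g \<in> \<G> ==> z \<in> carrier \<Z> ==> h (sing \<Z> g z) = [z] \<cdot>\<^bsub>Bar 0\<^esub> cj g"
    by (rule free_module_universal[OF ZG.k_ab Bar_abelian pw]) (assumption, rule that)
  have "h \<in> add_hom R (Bar 0)" using h(1) by (simp add: ZG.A_add_hom)
  moreover have "h (del g) = cj g" if "g \<in> \<G>" for g
    using h(2)[OF that, of 1] cj_closed[OF that] Bar.add.int_pow_1[of "cj g" 0] by (simp add: del_sing)
  ultimately have "\<exists>h. h \<in> add_hom R (Bar 0) \<and> (\<forall>g\<in>\<G>. h (del g) = cj g)" by blast
  from someI_ex[OF this] show "\<omega> \<in> add_hom R (Bar 0)" "g \<in> \<G> ==> \<omega> (del g) = cj g"
    unfolding \<omega>_def by blast+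
qed

lemma \<omega>_del_mult:
  assumes x: "x \<in> \<G>" and r: "r \<in> carrier R" shows "\<omega> (del x \<otimes>\<^bsub>R\<^esub> r) = cj x \<odot>\<^bsub>Bar 0\<^esub> \<omega> r"
proof (rule add_hom_eqI[OF R_spans ZG.A_abelian Bar_abelian add_hom_comp[OF ZG.A_mult_add_hom(1)[OF del_closed[OF x]] \<omega>(1)]
      add_hom_comp[OF \<omega>(1) act_hom2[OF cj_closed[OF x]]] _ r])
  fix b assume "b \<in> del ` \<G>"
  then obtain g where g: "b = del g" "g \<in> \<G>" by blast
  show "\<omega> (del x \<otimes>\<^bsub>R\<^esub> b) = cj x \<odot>\<^bsub>Bar 0\<^esub> \<omega> b"
    using x g by (simp add: \<omega>(2) cj_mono G.inv_mult_group)
qed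

abbreviation "FR m \<equiv> free_module R {..<m::nat}"
abbreviation "FE m \<equiv> free_module E {..<m::nat}"

lemmas FR_abelian = free_module_abelian_group[OF ZG.A_abelian]
lemmas FE_abelian = free_module_abelian_group[OF E_abelian]
lemmas FE_left_module = free_module_left_module[OF E_ring]

lemma FR_nth: "w \<in> carrier (FR m) ==> w i \<in> carrier R"
  using fin_supp_closed[OF ZG.A_abelian] by simp

lemma FR_spans: "spans (FR m) {sing R i b | i b. i \<in> {..<m} \<and> b \<in> del ` \<G>}"
  by (rule spans_sing[OF ZG.A_abelian R_spans])

text \<open>\<open>\<gamma> c z w\<close> stands for \<open>(c \<otimes> z) \<otimes> w\<close> in \<open>A\<^sup>e \<otimes> \<int>G\<^sup>m\<close>, formed along \<open>g \<mapsto> g \<otimes> g\<^sup>-\<^sup>1\<close>.\<close>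

definition \<gamma> :: "'k \<Rightarrow> 'g \<Rightarrow> (nat \<Rightarrow> 'g \<Rightarrow> int) \<Rightarrow> nat \<Rightarrow> ('g, 'k) tensors" where
  "\<gamma> c z w = (\<lambda>i. mono 0 c [\<one>, z] \<odot>\<^bsub>Bar 0\<^esub> \<omega> (w i))"

lemma mono_1: "c \<in> \<K> ==> z \<in> \<G> ==> mono 0 c [\<one>, z] \<in> \<B> 0"
  by (intro mono_closed Gs_2) auto

lemma \<omega>_closed: "r \<in> carrier R ==> \<omega> r \<in> \<B> 0"
  by (rule add_hom_closed[OF \<omega>(1)])

lemma \<gamma>_closed:
  assumes "c \<in> \<K>" "z \<in> \<G>" "w \<in> carrier (FR m)" shows "\<gamma> c z w \<in> carrier (FE m)"
proof -
  have "\<gamma> c z w i = \<zero>\<^bsub>E\<^esub>" if "i \<notin> {..<m}" for i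
    using assms(3) that add_hom_zero[OF ZG.A_abelian Bar_abelian \<omega>(1)] add_hom_zero[OF Bar_abelian Bar_abelian act_hom2[OF mono_1[OF assms(1,2)], of 0]]
    by (simp add: \<gamma>_def fin_supp_def)
  moreover have "\<gamma> c z w i \<in> carrier E" for i
    using act_closed[OF mono_1[OF assms(1,2)] \<omega>_closed[OF FR_nth[OF assms(3)]]] by (simp add: \<gamma>_def)
  ultimately show ?thesis by (simp add: fin_supp_def)
qed

lemma \<gamma>_hom:
  assumes c: "c \<in> \<K>" and z: "z \<in> \<G>" shows "\<gamma> c z \<in> add_hom (FR m) (FE m)"
proof (rule add_homI[OF \<gamma>_closed[OF c z]])
  fix v w assume v: "v \<in> carrier (FR m)" and w: "w \<in> carrier (FR m)"
  show "\<gamma> c z (v \<oplus>\<^bsub>FR m\<^esub> w) = \<gamma> c z v \<oplus>\<^bsub>FE m\<^esub> \<gamma> c z w"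
  proof
    fix i
    show "\<gamma> c z (v \<oplus>\<^bsub>FR m\<^esub> w) i = (\<gamma> c z v \<oplus>\<^bsub>FE m\<^esub> \<gamma> c z w) i"
      using add_hom_add[OF add_hom_comp[OF \<omega>(1) act_hom2[OF mono_1[OF c z]]] FR_nth[OF v] FR_nth[OF w], of i i] by (simp add: \<gamma>_def)
  qed
qed

lemma \<gamma>_hom_coeff:
  assumes z: "z \<in> \<G>" and w: "w \<in> carrier (FR m)" shows "(\<lambda>c. \<gamma> c z w) \<in> add_hom k (FE m)"
proof (rule add_homI)
  fix c c' assume c: "c \<in> \<K>" and c': "c' \<in> \<K>"
  have m: "(\<lambda>c. mono 0 c [\<one>, z]) \<in> add_hom k (Bar 0)" by (rule mono_add_hom[OF Gs_2[OF G.one_closed z]])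
  show "\<gamma> (c \<oplus>\<^sub>k c') z w = \<gamma> c z w \<oplus>\<^bsub>FE m\<^esub> \<gamma> c' z w"
  proof
    fix i
    show "\<gamma> (c \<oplus>\<^sub>k c') z w i = (\<gamma> c z w \<oplus>\<^bsub>FE m\<^esub> \<gamma> c' z w) i"
      using add_hom_add[OF add_hom_comp[OF m act_hom1[OF \<omega>_closed[OF FR_nth[OF w]]]] c c', of i] by (simp add: \<gamma>_def)
  qed
qed (rule \<gamma>_closed[OF _ z w])

lemma \<gamma>_sing:
  assumes "c \<in> \<K>" "z \<in> \<G>" "g \<in> \<G>"
  shows "\<gamma> c z (sing R i (del g)) = sing E i (mono 0 c [g, inv g \<otimes> z])"
proof
  fix i'
  have "mono 0 c [\<one>, z] \<odot>\<^bsub>Bar 0\<^esub> cj g = mono 0 c [g, inv g \<otimes> z]"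
    using act_mono[of c "\<one>\<^sub>k" "\<one>" z "[g, inv g]" 0] assms by (simp add: Gs_2) (simp add: actg_def)
  then show "\<gamma> c z (sing R i (del g)) i' = sing E i (mono 0 c [g, inv g \<otimes> z]) i'"
    using \<omega>(2)[OF assms(3)] add_hom_zero[OF ZG.A_abelian Bar_abelian \<omega>(1)] add_hom_zero[OF Bar_abelian Bar_abelian act_hom2[OF mono_1[OF assms(1,2)], of 0]]
    by (simp add: \<gamma>_def sing_def[of R] sing_def[of E])
qed

lemma sing_del_closed: "i < m ==> g \<in> \<G> ==> sing R i (del g) \<in> carrier (FR m)"
  using fin_supp_sing[OF ZG.A_abelian _ del_closed, of i "{..<m}" g] by simp

abbreviation "\<gamma>s m \<equiv> {\<gamma> c z w | c z w. c \<in> \<K> \<and> z \<in> \<G> \<and> w \<in> carrier (FR m)}"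

text \<open>A monomial x \<otimes> y factors as (1 \<otimes> xy)(x \<otimes> inv x), and the second
  factor comes from the group ring.\<close>

lemma FE_spans: "spans (FE m) (\<gamma>s m)"
proof (rule spans_mono[OF spans_sing[OF E_abelian E_spans]])
  show "\<gamma>s m \<subseteq> carrier (FE m)" using \<gamma>_closed by blast
  show "{sing E i b | i b. i \<in> {..<m} \<and> b \<in> monos 0} \<subseteq> \<gamma>s m"
  proof
    fix v assume "v \<in> {sing E i b | i b. i \<in> {..<m} \<and> b \<in> monos 0}"
    then obtain i b where i: "v = sing E i b" "i < m" and b: "b \<in> monos 0" by auto
    obtain c x y where x: "b = mono 0 c [x, y]" "c \<in> \<K>" "x \<in> \<G>" "y \<in> \<G>" by (rule mono0_spans_cases[OF b])
    have "v = \<gamma> c (x \<otimes> y) (sing R i (del x))" using x by (simp add: i(1) \<gamma>_sing G.m_assoc[symmetric])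
    then show "v \<in> \<gamma>s m" using x i sing_del_closed[OF i(2) x(3)] by blast
  qed
qed

lemma FE_eqI:
  assumes "abelian_group B" "\<phi> \<in> add_hom (FE m) B" "\<psi> \<in> add_hom (FE m) B" "v \<in> carrier (FE m)"
    and "\<And>c z w. c \<in> \<K> ==> z \<in> \<G> ==> w \<in> carrier (FR m) ==> \<phi> (\<gamma> c z w) = \<psi> (\<gamma> c z w)"
  shows "\<phi> v = \<psi> v"
  by (rule add_hom_eqI[OF FE_spans FE_abelian assms(1-3) _ assms(4)]) (use assms(5) in blast)

text \<open>Additively \<open>FE m\<close> is the tensor product of \<open>A\<close> with
  \<open>FR m\<close> over \<int>, so maps out of it are prescribed by functions additive in the
  scalar \<open>c\<close> and in \<open>w\<close>. Linearity of \<open>\<Gamma>\<close> in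
  \<open>w\<close> over the group ring is not asked for, which is what admits the
  contraction.\<close>

lemma FE_lift:
  assumes B: "abelian_group B"
    and \<Gamma>1: "\<And>z w. z \<in> \<G> ==> w \<in> carrier (FR m) ==> (\<lambda>c. \<Gamma> c z w) \<in> add_hom k B"
    and \<Gamma>2: "\<And>c z. c \<in> \<K> ==> z \<in> \<G> ==> \<Gamma> c z \<in> add_hom (FR m) B"
  obtains \<phi> where "\<phi> \<in> add_hom (FE m) B"
    "\<And>c z w. c \<in> \<K> ==> z \<in> \<G> ==> w \<in> carrier (FR m) ==> \<phi> (\<gamma> c z w) = \<Gamma> c z w"
proof -
  have ex: "\<exists>b\<in>add_hom (Bar 0) B. \<forall>c\<in>\<K>. \<forall>ys\<in>Gn 0. b (mono 0 c ys) = \<Gamma> c (ys ! 0 \<otimes> ys ! Suc 0) (sing R i (del (ys ! 0)))"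
    if i: "i \<in> {..<m}" for i
  proof -
    have h: "(\<lambda>c. \<Gamma> c (ys ! 0 \<otimes> ys ! Suc 0) (sing R i (del (ys ! 0)))) \<in> add_hom k B" if "ys \<in> Gn 0" for ys
      using Gs_nth[OF that, of 0] Gs_nth[OF that, of "Suc 0"] i by (intro \<Gamma>1 sing_del_closed) auto
    obtain b where "b \<in> add_hom (Bar 0) B" "\<And>c ys. c \<in> \<K> ==> ys \<in> Gn 0 ==>
        b (mono 0 c ys) = \<Gamma> c (ys ! 0 \<otimes> ys ! Suc 0) (sing R i (del (ys ! 0)))"
      by (rule Bar_lift[OF B h]) (assumption, rule that)
    then show ?thesis by (intro bexI[of _ b] ballI)
  qed
  obtain b where b: "\<forall>i\<in>{..<m}. b i \<in> add_hom (Bar 0) B \<and> (\<forall>c\<in>\<K>. \<forall>ys\<in>Gn 0.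
      b i (mono 0 c ys) = \<Gamma> c (ys ! 0 \<otimes> ys ! Suc 0) (sing R i (del (ys ! 0))))"
    using bchoice[OF ballI[OF ex[unfolded Bex_def]]] by (rule exE)
  have bE: "b i \<in> add_hom E B" if "i \<in> {..<m}" for i using b that unfolding E_add_hom by blast
  obtain \<phi> where \<phi>: "\<phi> \<in> add_hom (FE m) B" "\<And>i r. i \<in> {..<m} ==> r \<in> carrier E ==> \<phi> (sing E i r) = b i r"
    by (rule free_module_universal[OF E_abelian B bE]) (assumption, rule that)
  have "\<phi> (\<gamma> c z w) = \<Gamma> c z w" if c: "c \<in> \<K>" and z: "z \<in> \<G>" and w: "w \<in> carrier (FR m)" for c z w
  proof (rule add_hom_eqI[OF FR_spans FR_abelian B add_hom_comp[OF \<gamma>_hom[OF c z] \<phi>(1)] \<Gamma>2[OF c z] _ w])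
    fix v assume "v \<in> {sing R i b | i b. i \<in> {..<m} \<and> b \<in> del ` \<G>}"
    then obtain i g where v: "v = sing R i (del g)" "i \<in> {..<m}" "g \<in> \<G>" by blast
    have Gs: "[g, inv g \<otimes> z] \<in> Gn 0" using v(3) z by (intro Gs_2) auto
    have "\<phi> (\<gamma> c z v) = b i (mono 0 c [g, inv g \<otimes> z])"
      unfolding v(1) \<gamma>_sing[OF c z v(3)] by (rule \<phi>(2)[OF v(2)]) (use mono_closed[OF c Gs] in simp)
    also have "\<dots> = \<Gamma> c (g \<otimes> (inv g \<otimes> z)) (sing R i (del g))"
      using b[rule_format, OF v(2), THEN conjunct2, rule_format, OF c Gs] by simp
    finally show "\<phi> (\<gamma> c z v) = \<Gamma> c z v" using v z by (simp add: G.m_assoc[symmetric])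
  qed
  with \<phi>(1) show ?thesis by (rule that)
qed

text \<open>Rests on (x \<otimes> y)(1 \<otimes> z) = (1 \<otimes> xzy)(x \<otimes> inv x); the last
  factor is then absorbed into \<open>w\<close>.\<close>

lemma act_\<gamma>:
  assumes c: "c \<in> \<K>" and c': "c' \<in> \<K>" and x: "x \<in> \<G>" and y: "y \<in> \<G>" and z: "z \<in> \<G>"
    and w: "w \<in> carrier (FR m)"
  shows "mono 0 c' [x, y] \<odot>\<^bsub>FE m\<^esub> \<gamma> c z w = \<gamma> (c' \<otimes>\<^sub>k c) (x \<otimes> z \<otimes> y) (del x \<odot>\<^bsub>FR m\<^esub> w)"
proof
  fix i
  have wi: "\<omega> (w i) \<in> \<B> 0" by (rule \<omega>_closed[OF FR_nth[OF w]])
  have mxy: "mono 0 c' [x, y] \<in> \<B> 0" by (rule mono_closed[OF c' Gs_2[OF x y]])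
  have u: "x \<otimes> z \<otimes> y \<in> \<G>" "c' \<otimes>\<^sub>k c \<in> \<K>" using c c' x y z by auto
  have 1: "mono 0 c' [x, y] \<odot>\<^bsub>Bar 0\<^esub> mono 0 c [\<one>, z] = mono 0 (c' \<otimes>\<^sub>k c) [x, z \<otimes> y]"
    using act_mono[OF c' c x y Gs_2[OF G.one_closed z]] x by (simp add: actg_def)
  have 2: "mono 0 (c' \<otimes>\<^sub>k c) [\<one>, x \<otimes> z \<otimes> y] \<odot>\<^bsub>Bar 0\<^esub> cj x = mono 0 (c' \<otimes>\<^sub>k c) [x, z \<otimes> y]"
    using act_mono[OF u(2) k.one_closed G.one_closed u(1) Gs_2[OF x G.inv_closed[OF x]], of] x y z u(2)
    by (simp add: actg_def G.m_assoc[symmetric])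
  have "(mono 0 c' [x, y] \<odot>\<^bsub>FE m\<^esub> \<gamma> c z w) i = mono 0 c' [x, y] \<odot>\<^bsub>Bar 0\<^esub> (mono 0 c [\<one>, z] \<odot>\<^bsub>Bar 0\<^esub> \<omega> (w i))"
    using E_mult[OF mxy act_closed[OF mono_1[OF c z] wi]] by (simp add: \<gamma>_def)
  also have "\<dots> = mono 0 (c' \<otimes>\<^sub>k c) [x, z \<otimes> y] \<odot>\<^bsub>Bar 0\<^esub> \<omega> (w i)"
    using act_assoc[OF mxy mono_1[OF c z] wi] 1 by simp
  also have "\<dots> = mono 0 (c' \<otimes>\<^sub>k c) [\<one>, x \<otimes> z \<otimes> y] \<odot>\<^bsub>Bar 0\<^esub> (cj x \<odot>\<^bsub>Bar 0\<^esub> \<omega> (w i))"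
    using act_assoc[OF mono_1[OF u(2,1)] cj_closed[OF x] wi] 2 by simp
  also have "\<dots> = \<gamma> (c' \<otimes>\<^sub>k c) (x \<otimes> z \<otimes> y) (del x \<odot>\<^bsub>FR m\<^esub> w) i"
    using \<omega>_del_mult[OF x FR_nth[OF w], of i] by (simp add: \<gamma>_def)
  finally show "(mono 0 c' [x, y] \<odot>\<^bsub>FE m\<^esub> \<gamma> c z w) i = \<gamma> (c' \<otimes>\<^sub>k c) (x \<otimes> z \<otimes> y) (del x \<odot>\<^bsub>FR m\<^esub> w) i" .
qed

lemma FE_linear:
  assumes B: "left_module E B" and \<phi>: "\<phi> \<in> add_hom (FE m) B"
    and eq: "\<And>c' x y c z w. c' \<in> \<K> ==> x \<in> \<G> ==> y \<in> \<G> ==> c \<in> \<K> ==> z \<in> \<G> ==> w \<in> carrier (FR m) ==>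
      \<phi> (\<gamma> (c' \<otimes>\<^sub>k c) (x \<otimes> z \<otimes> y) (del x \<odot>\<^bsub>FR m\<^esub> w)) = mono 0 c' [x, y] \<odot>\<^bsub>B\<^esub> \<phi> (\<gamma> c z w)"
  shows "\<phi> \<in> lin_maps E (FE m) B"
proof (rule lin_mapsI[OF \<phi>], rule linear_on_spans[OF FE_left_module B \<phi> E_spans FE_spans])
  fix b v assume b: "b \<in> monos 0" and v: "v \<in> \<gamma>s m"
  obtain c' x y where x: "b = mono 0 c' [x, y]" "c' \<in> \<K>" "x \<in> \<G>" "y \<in> \<G>" by (rule mono0_spans_cases[OF b])
  obtain c z w where w: "v = \<gamma> c z w" "c \<in> \<K>" "z \<in> \<G>" "w \<in> carrier (FR m)" using v by blast
  show "\<phi> (b \<odot>\<^bsub>FE m\<^esub> v) = b \<odot>\<^bsub>B\<^esub> \<phi> v"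
    unfolding x(1) w(1) act_\<gamma>[OF w(2) x(2-4) w(3,4)] by (rule eq[OF x(2-4) w(2-4)])
qed

text \<open>Base change of a map of free modules that acts on the \<open>w\<close> factor only. It
  is available for every additive \<open>\<rho>\<close> and is linear over \<open>E\<close> when
  \<open>\<rho>\<close> is linear over the group ring.\<close>

definition ind_map :: "nat \<Rightarrow> nat \<Rightarrow> ((nat \<Rightarrow> 'g \<Rightarrow> int) \<Rightarrow> nat \<Rightarrow> 'g \<Rightarrow> int) \<Rightarrow>
    (nat \<Rightarrow> ('g, 'k) tensors) \<Rightarrow> nat \<Rightarrow> ('g, 'k) tensors" where
  "ind_map m m' \<rho> = (SOME \<phi>. \<phi> \<in> add_hom (FE m) (FE m') \<and>
     (\<forall>c\<in>\<K>. \<forall>z\<in>\<G>. \<forall>w\<in>carrier (FR m). \<phi> (\<gamma> c z w) = \<gamma> c z (\<rho> w)))"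

lemma ind_map:
  assumes \<rho>: "\<rho> \<in> add_hom (FR m) (FR m')"
  shows "ind_map m m' \<rho> \<in> add_hom (FE m) (FE m')"
    and "c \<in> \<K> ==> z \<in> \<G> ==> w \<in> carrier (FR m) ==> ind_map m m' \<rho> (\<gamma> c z w) = \<gamma> c z (\<rho> w)"
proof -
  obtain \<phi> where "\<phi> \<in> add_hom (FE m) (FE m')"
    "\<And>c z w. c \<in> \<K> ==> z \<in> \<G> ==> w \<in> carrier (FR m) ==> \<phi> (\<gamma> c z w) = \<gamma> c z (\<rho> w)"
    by (rule FE_lift[OF FE_abelian \<gamma>_hom_coeff[OF _ add_hom_closed[OF \<rho>]] add_hom_comp[OF \<rho> \<gamma>_hom]]) (assumption+, rule that)
  then have "\<exists>\<phi>. \<phi> \<in> add_hom (FE m) (FE m') \<and> (\<forall>c\<in>\<K>. \<forall>z\<in>\<G>. \<forall>w\<in>carrier (FR m). \<phi> (\<gamma> c z w) = \<gamma> c z (\<rho> w))"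
    by (intro exI[of _ \<phi>] conjI ballI)
  from someI_ex[OF this] show "ind_map m m' \<rho> \<in> add_hom (FE m) (FE m')"
    "c \<in> \<K> ==> z \<in> \<G> ==> w \<in> carrier (FR m) ==> ind_map m m' \<rho> (\<gamma> c z w) = \<gamma> c z (\<rho> w)"
    unfolding ind_map_def by (simp_all del: free_module_simps)
qed

lemma del_smult_FR:
  assumes "x \<in> \<G>" "w \<in> carrier (FR m)" shows "del x \<odot>\<^bsub>FR m\<^esub> w \<in> carrier (FR m)"
  by (rule left_module.smult_closed[OF free_module_left_module[OF ZG.A_ring] del_closed[OF assms(1)] assms(2)])

lemma ind_map_lin:
  assumes \<rho>: "\<rho> \<in> lin_maps R (FR m) (FR m')" shows "ind_map m m' \<rho> \<in> lin_maps E (FE m) (FE m')"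
proof (rule FE_linear[OF FE_left_module ind_map(1)[OF lin_mapsD(1)[OF \<rho>]]])
  fix c' x y c z w assume a: "c' \<in> \<K>" "x \<in> \<G>" "y \<in> \<G>" "c \<in> \<K>" "z \<in> \<G>" "w \<in> carrier (FR m)"
  have u: "c' \<otimes>\<^sub>k c \<in> \<K>" "x \<otimes> z \<otimes> y \<in> \<G>" using a by auto
  note \<rho>' = lin_mapsD(1)[OF \<rho>]
  show "ind_map m m' \<rho> (\<gamma> (c' \<otimes>\<^sub>k c) (x \<otimes> z \<otimes> y) (del x \<odot>\<^bsub>FR m\<^esub> w)) = mono 0 c' [x, y] \<odot>\<^bsub>FE m'\<^esub> ind_map m m' \<rho> (\<gamma> c z w)"
    unfolding ind_map(2)[OF \<rho>' u del_smult_FR[OF a(2,6)]] ind_map(2)[OF \<rho>' a(4-6)] lin_mapsD(2)[OF \<rho> del_closed[OF a(2)] a(6)]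
    by (rule act_\<gamma>[OF a(4,1,2,3,5) lin_mapsD(3)[OF \<rho> a(6)], symmetric])
qed

lemma sing_pow_hom: "z \<in> \<G> ==> (\<lambda>c. [(n::int)] \<cdot>\<^bsub>A\<^esub> sing k z c) \<in> add_hom k A"
  by (rule add_hom_comp[OF sing_add_hom[OF k_ab, of z "\<G>", folded A_add_hom(2)] int_pow_endo[OF A_abelian]])

text \<open>Inducing the trivial module \<int> gives back the bimodule \<open>A\<close>: the element
  (c \<otimes> z) \<otimes> n corresponds to n times c z.\<close>

lemma ind_augmentation:
  assumes \<epsilon>: "\<epsilon> \<in> lin_maps R (FR m) Zt"
  obtains \<phi> where "\<phi> \<in> lin_maps E (FE m) AB"
    "\<And>c z w. c \<in> \<K> ==> z \<in> \<G> ==> w \<in> carrier (FR m) ==> \<phi> (\<gamma> c z w) = [\<epsilon> w] \<cdot>\<^bsub>A\<^esub> sing k z c"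
proof -
  have \<epsilon>Z: "\<epsilon> \<in> add_hom (FR m) \<Z>" using lin_mapsD(1)[OF \<epsilon>] by (simp add: add_hom_def trivial_int_module_def)
  obtain \<phi> where \<phi>: "\<phi> \<in> add_hom (FE m) A"
    "\<And>c z w. c \<in> \<K> ==> z \<in> \<G> ==> w \<in> carrier (FR m) ==> \<phi> (\<gamma> c z w) = [\<epsilon> w] \<cdot>\<^bsub>A\<^esub> sing k z c"
  proof (rule FE_lift[OF A_abelian, of m "\<lambda>c z w. [\<epsilon> w] \<cdot>\<^bsub>A\<^esub> sing k z c"])
    show "(\<lambda>c. [\<epsilon> w] \<cdot>\<^bsub>A\<^esub> sing k z c) \<in> add_hom k A" if "z \<in> \<G>" for z w by (rule sing_pow_hom[OF that])
    show "(\<lambda>w. [\<epsilon> w] \<cdot>\<^bsub>A\<^esub> sing k z c) \<in> add_hom (FR m) A" if "c \<in> \<K>" "z \<in> \<G>" for c z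
      by (rule add_hom_comp[OF \<epsilon>Z int_pow_add_hom[OF A_abelian sing_A[OF that(2,1)]]])
  qed (rule that)
  have \<phi>AB: "\<phi> \<in> add_hom (FE m) AB" using \<phi>(1) by (simp only: AB_add_hom)
  have "\<phi> \<in> lin_maps E (FE m) AB"
  proof (rule FE_linear[OF AB_left_module \<phi>AB])
    fix c' x y c z w assume a: "c' \<in> \<K>" "x \<in> \<G>" "y \<in> \<G>" "c \<in> \<K>" "z \<in> \<G>" "w \<in> carrier (FR m)"
    have u: "c' \<otimes>\<^sub>k c \<in> \<K>" "x \<otimes> z \<otimes> y \<in> \<G>" using a by auto
    have s: "sing k z c \<in> \<A>" by (rule sing_A[OF a(5,4)])
    have mxy: "mono 0 c' [x, y] \<in> \<B> 0" by (rule mono_closed[OF a(1) Gs_2[OF a(2,3)]])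
    \<comment> \<open>The action on \<int> is trivial, so the translation of \<open>w\<close> is
      invisible and only the bimodule action on \<open>z\<close> remains.\<close>
    have "\<epsilon> (del x \<odot>\<^bsub>FR m\<^esub> w) = \<epsilon> w"
      using lin_mapsD(2)[OF \<epsilon> del_closed[OF a(2)] a(6)] a(2) by (simp add: Zt_smult_del)
    then have "\<phi> (\<gamma> (c' \<otimes>\<^sub>k c) (x \<otimes> z \<otimes> y) (del x \<odot>\<^bsub>FR m\<^esub> w)) = [\<epsilon> w] \<cdot>\<^bsub>A\<^esub> sing k (x \<otimes> z \<otimes> y) (c' \<otimes>\<^sub>k c)"
      using \<phi>(2)[OF u del_smult_FR[OF a(2,6)]] by (simp only:)
    also have "sing k (x \<otimes> z \<otimes> y) (c' \<otimes>\<^sub>k c) = mono 0 c' [x, y] \<odot>\<^bsub>AB\<^esub> sing k z c"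
      unfolding AB_smult_mono[OF a(1-3) s] using a by (simp add: A_mult_sing sing_mult_gb)
    also have "[\<epsilon> w] \<cdot>\<^bsub>A\<^esub> \<dots> = mono 0 c' [x, y] \<odot>\<^bsub>AB\<^esub> ([\<epsilon> w] \<cdot>\<^bsub>A\<^esub> sing k z c)"
      by (rule add_hom_int_pow[OF A_abelian A_abelian AB_smult_hom2[OF mxy] s, symmetric])
    finally show "\<phi> (\<gamma> (c' \<otimes>\<^sub>k c) (x \<otimes> z \<otimes> y) (del x \<odot>\<^bsub>FR m\<^esub> w)) = mono 0 c' [x, y] \<odot>\<^bsub>AB\<^esub> \<phi> (\<gamma> c z w)"
      using \<phi>(2)[OF a(4-6)] by (simp only:)
  qed
  then show ?thesis using \<phi>(2) by (rule that)
qed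

text \<open>Each axiom of \<open>split_resolution\<close> is an identity between additive maps. On
  an element \<open>\<gamma> c z w\<close> it becomes the image under \<open>\<gamma> c z\<close> of
  the same identity over the group ring.\<close>

lemma enveloping_type_FP:
  assumes "split_resolution R Zt m e d s \<epsilon> t l" shows "module_type_FP E AB"
proof -
  interpret r: split_resolution R Zt m e d s \<epsilon> t l by fact
  let ?e = "\<lambda>n. ind_map (m n) (m n) (e n)"
  let ?d = "\<lambda>n. ind_map (m (Suc n)) (m n) (d n)"
  let ?s = "\<lambda>n. ind_map (m n) (m (Suc n)) (s n)"
  note e' = lin_mapsD(1)[OF r.e] and d' = lin_mapsD(1)[OF r.d]
  note ie = ind_map[OF e'] and id = ind_map[OF d'] and si = ind_map[OF r.s]
  have c: "e n w \<in> carrier (FR (m n))" if "w \<in> carrier (FR (m n))" for n w by (rule add_hom_closed[OF e' that])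
  have dc: "d n w \<in> carrier (FR (m n))" if "w \<in> carrier (FR (m (Suc n)))" for n w by (rule add_hom_closed[OF d' that])
  have sc: "s n w \<in> carrier (FR (m (Suc n)))" if "w \<in> carrier (FR (m n))" for n w by (rule add_hom_closed[OF r.s that])
  have tc: "t y \<in> carrier (FR (m 0))" for y by (rule add_hom_closed[OF r.t]) (simp add: trivial_int_module_def)
  have \<gamma>0: "\<gamma> c z \<zero>\<^bsub>FR n\<^esub> = \<zero>\<^bsub>FE n\<^esub>" if "c \<in> \<K>" "z \<in> \<G>" for c z n
    by (rule add_hom_zero[OF FR_abelian FE_abelian \<gamma>_hom[OF that]])
  obtain \<eta> where \<eta>: "\<eta> \<in> lin_maps E (FE (m 0)) AB"
    "\<And>c z w. c \<in> \<K> ==> z \<in> \<G> ==> w \<in> carrier (FR (m 0)) ==> \<eta> (\<gamma> c z w) = [\<epsilon> w] \<cdot>\<^bsub>A\<^esub> sing k z c"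
    by (rule ind_augmentation[OF r.\<epsilon>]) (rule that)
  note \<eta>h = lin_mapsD(1)[OF \<eta>(1)]
  \<comment> \<open>The induced section sends the group element \<open>z\<close> with scalar
    \<open>c\<close> to the vector \<open>t 1\<close> placed in the component of \<open>c\<close>
    and \<open>z\<close>.\<close>
  obtain \<tau> where "\<tau> \<in> add_hom (free_module k (\<G>)) (FE (m 0))"
    and \<tau>': "\<And>z c. z \<in> \<G> ==> c \<in> \<K> ==> \<tau> (sing k z c) = \<gamma> c z (t 1)"
    by (rule free_module_universal[OF k_ab FE_abelian \<gamma>_hom_coeff[OF _ tc]]) (assumption, rule that)
  then have \<tau>: "\<tau> \<in> add_hom A (FE (m 0))" and \<tau>B: "\<tau> \<in> add_hom AB (FE (m 0))" by (simp_all only: A_add_hom AB_add_hom)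
  \<comment> \<open>An additive map on \<int> is determined by its value at 1, so
    \<open>\<tau>\<close> agrees with \<open>t\<close> on all multiples.\<close>
  have t_pow: "t z = [z] \<cdot>\<^bsub>FR (m 0)\<^esub> t 1" for z
  proof -
    have tZ: "t \<in> add_hom \<Z> (FR (m 0))" using r.t by (simp add: add_hom_def trivial_int_module_def)
    have "[z] \<cdot>\<^bsub>\<Z>\<^esub> (1::int) = z"
      using group_int_pow_integer_group[of 1 z] by (simp add: add_pow_def integer_group_def)
    then show ?thesis using add_hom_int_pow[OF ZG.k_ab FR_abelian tZ, of 1 z] by simp
  qed
  have "split_resolution E AB m ?e ?d ?s \<eta> \<tau> l"
  proof (rule split_resolution.intro)
    show "?e n (?e n v) = ?e n v" if "v \<in> carrier (FE (m n))" for n v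
      by (rule FE_eqI[OF FE_abelian add_hom_comp[OF ie(1) ie(1)] ie(1) that]) (simp only: ie(2) c r.e_e)
    show "?e n (?d n v) = ?d n v" if "v \<in> carrier (FE (m (Suc n)))" for n v
      by (rule FE_eqI[OF FE_abelian add_hom_comp[OF id(1) ie(1)] id(1) that]) (simp only: ie(2) id(2) dc r.e_d)
    show "?d n (?e (Suc n) v) = ?d n v" if "v \<in> carrier (FE (m (Suc n)))" for n v
      by (rule FE_eqI[OF FE_abelian add_hom_comp[OF ie(1) id(1)] id(1) that]) (simp only: ie(2) id(2) c r.d_e)
    show "?d n (?d (Suc n) v) = \<zero>\<^bsub>FE (m n)\<^esub>" if "v \<in> carrier (FE (m (Suc (Suc n))))" for n v
      by (rule FE_eqI[OF FE_abelian add_hom_comp[OF id(1) id(1)] add_hom_const_zero[OF FE_abelian] that]) (simp only: id(2) dc r.d_d \<gamma>0)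
    show "?e n v = \<zero>\<^bsub>FE (m n)\<^esub>" if "l < n" "v \<in> carrier (FE (m n))" for n v
      by (rule FE_eqI[OF FE_abelian ie(1) add_hom_const_zero[OF FE_abelian] that(2)]) (simp only: ie(2) r.e_top[OF that(1)] \<gamma>0)
    show "\<eta> (?e 0 v) = \<eta> v" if "v \<in> carrier (FE (m 0))" for v
      by (rule FE_eqI[OF AB_abelian add_hom_comp[OF ie(1) \<eta>h] \<eta>h that]) (simp only: ie(2) \<eta>(2) c r.\<epsilon>_e)
    show "\<eta> (?d 0 v) = \<zero>\<^bsub>AB\<^esub>" if "v \<in> carrier (FE (m (Suc 0)))" for v
    proof (rule FE_eqI[OF AB_abelian add_hom_comp[OF id(1) \<eta>h] add_hom_const_zero[OF AB_abelian] that])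
      fix c z w assume a: "c \<in> \<K>" "z \<in> \<G>" "w \<in> carrier (FR (m (Suc 0)))"
      have "\<epsilon> (d 0 w) = 0" using r.\<epsilon>_d[OF a(3)] by (simp add: trivial_int_module_def)
      then show "\<eta> (?d 0 (\<gamma> c z w)) = \<zero>\<^bsub>AB\<^esub>"
        using id(2)[OF a] \<eta>(2)[OF a(1,2) dc[OF a(3)]] add_hom_zero[OF ZG.k_ab A_abelian int_pow_add_hom[OF A_abelian sing_A[OF a(2,1)]]]
        by (simp del: galg_simps)
    qed
    show "\<eta> (\<tau> y) = y" if y: "y \<in> carrier AB" for y
    proof (rule add_hom_eqI[OF A_spans A_abelian A_abelian add_hom_comp[OF \<tau> \<eta>h[unfolded AB_add_hom]] add_hom_id])
      fix b assume "b \<in> {sing k g c | g c. g \<in> \<G> \<and> c \<in> \<K>}"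
      then obtain z c where b: "b = sing k z c" "z \<in> \<G>" "c \<in> \<K>" by blast
      have "\<epsilon> (t 1) = 1" using r.\<epsilon>_t[of 1] by (simp add: trivial_int_module_def)
      then show "\<eta> (\<tau> b) = b"
        unfolding b(1) \<tau>'[OF b(2,3)] \<eta>(2)[OF b(3,2) tc] using A_ab.add.int_pow_1[OF sing_A[OF b(2,3)]] by (simp only:)
    qed (use y in \<open>simp only: AB_simps\<close>)
    show "?e 0 v = ?d 0 (?s 0 v) \<oplus>\<^bsub>FE (m 0)\<^esub> \<tau> (\<eta> v)" if "v \<in> carrier (FE (m 0))" for v
    proof (rule FE_eqI[OF FE_abelian ie(1) add_hom_plus[OF FE_abelian add_hom_comp[OF si(1) id(1)] add_hom_comp[OF \<eta>h \<tau>B]] that])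
      fix c z w assume a: "c \<in> \<K>" "z \<in> \<G>" "w \<in> carrier (FR (m 0))"
      have "\<tau> (\<eta> (\<gamma> c z w)) = [\<epsilon> w] \<cdot>\<^bsub>FE (m 0)\<^esub> \<gamma> c z (t 1)"
        unfolding \<eta>(2)[OF a] \<tau>'[OF a(2,1), symmetric] by (rule add_hom_int_pow[OF A_abelian FE_abelian \<tau> sing_A[OF a(2,1)]])
      also have "\<dots> = \<gamma> c z (t (\<epsilon> w))"
        unfolding t_pow[of "\<epsilon> w"] by (rule add_hom_int_pow[OF FR_abelian FE_abelian \<gamma>_hom[OF a(1,2)] tc, symmetric])
      finally have 1: "\<tau> (\<eta> (\<gamma> c z w)) = \<gamma> c z (t (\<epsilon> w))" .
      show "?e 0 (\<gamma> c z w) = ?d 0 (?s 0 (\<gamma> c z w)) \<oplus>\<^bsub>FE (m 0)\<^esub> \<tau> (\<eta> (\<gamma> c z w))"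
        unfolding 1 ie(2)[OF a] si(2)[OF a] id(2)[OF a(1,2) sc[OF a(3)]] r.e_0[OF a(3)]
        by (rule add_hom_add[OF \<gamma>_hom[OF a(1,2)] dc[OF sc[OF a(3)]] tc])
    qed
    show "?e (Suc n) v = ?d (Suc n) (?s (Suc n) v) \<oplus>\<^bsub>FE (m (Suc n))\<^esub> ?s n (?d n v)" if "v \<in> carrier (FE (m (Suc n)))" for n v
    proof (rule FE_eqI[OF FE_abelian ie(1) add_hom_plus[OF FE_abelian add_hom_comp[OF si(1) id(1)] add_hom_comp[OF id(1) si(1)]] that])
      fix c z w assume a: "c \<in> \<K>" "z \<in> \<G>" "w \<in> carrier (FR (m (Suc n)))"
      show "?e (Suc n) (\<gamma> c z w) = ?d (Suc n) (?s (Suc n) (\<gamma> c z w)) \<oplus>\<^bsub>FE (m (Suc n))\<^esub> ?s n (?d n (\<gamma> c z w))"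
        unfolding ie(2)[OF a] si(2)[OF a] id(2)[OF a] id(2)[OF a(1,2) sc[OF a(3)]] si(2)[OF a(1,2) dc[OF a(3)]] r.e_Suc[OF a(3)]
        by (rule add_hom_add[OF \<gamma>_hom[OF a(1,2)] dc[OF sc[OF a(3)]] sc[OF dc[OF a(3)]]])
    qed
  qed (intro AB_left_module ind_map_lin r.e r.d \<eta>(1) si(1) \<tau>B)+
  \<comment> \<open>Elements of the enveloping algebra are sets of chains, and these two sets
    provide the distinct values asked for by \<open>type_FP\<close>.\<close>
  moreover have "({} :: ('g, 'k) tensors) \<noteq> UNIV" by simp
  ultimately show ?thesis by (rule split_resolution.type_FP)
qed

end

theorem theorem50:
  fixes k :: "('k, 's) ring_scheme" and G :: "('g, 't) monoid_scheme" and d :: nat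
  assumes "cring k" and "orientable_PD_group G d"
  shows "calabi_yau_algebra k (group_algebra k G) d"
proof -
  have G: "group G" and FP: "group_type_FP G" using assms(2) by (simp_all add: orientable_PD_group_def)
  interpret grp G by (rule grp.intro[OF G])
  interpret galg k G by (intro galg.intro group_alg.intro assms(1) G grp_axioms)
  obtain P \<delta> \<epsilon> l f g h kk where "fp_comparison G P \<delta> \<epsilon> l f g h kk"
    by (rule fp_comparison_exists[OF FP]) (rule that)
  then interpret fp: fp_comparison G P \<delta> \<epsilon> l f g h kk .
  obtain m e ds s \<epsilon>' t where sr: "split_resolution R Zt m e ds s \<epsilon>' t l"
    by (rule fp.split_resolution_exists) (rule that)
  obtain T hh Y l' c where pd: "pd_grp G T hh Y l' c d"
    and act: "\<And>a. a \<in> carrier G \<Longrightarrow> \<exists>e\<in>C d \<Z>. \<forall>u\<in>ch (Suc d). c (gact a u) = c u + e (bd u)"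
    by (rule PD_pd_grp[OF assms(2)]) (rule that)
  show ?thesis
    unfolding calabi_yau_algebra_def Let_def
    by (intro conjI allI impI A_algebra enveloping_type_FP[OF sr] hochschild_PD[OF pd act])
qed

end
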